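(* Assume (A1)–(A4) and run Algorithm SC with step sizes $\alpha_{ij,k}=\alpha_{ij,1}/k^{\gamma_{ij}}$ and $\beta_{i,k}=\beta_{i,1}/k$, where (i) $\alpha_{ij,1}=\alpha_{ji,1}>0$ for all $(i,j)\in\mathcal{E}$ and $\beta_{i,1}>0$ for all $i\in\mathcal{V}$; (ii) $1/2<\gamma_{ij}=\gamma_{ji}\le1$ and $\nu_{ij}+\gamma_{ij}\le1$ for all $(i,j)\in\mathcal{E}$. Let $h=\min_{(i,j)\in\mathcal{E}}(\nu_{ij}/2+\gamma_{ij})$, $\mathcal{E}'=\{(i,j)\in\mathcal{E}:\nu_{ij}+\gamma_{ij}=1\}$, $\underline\beta=\min_{i\in\mathcal{V}}\beta_{i,1}$, $m'=\min_{(i,j)\in\mathcal{E}'}\alpha_{ij,1}e^{-\|\theta\|_1/b_{ij}}/b_{ij}$ (when $\mathcal{E}'\neq\varnothing$), and $a=\delta\underline\beta/N$ if $\mathcal{E}'=\varnothing$, and $a=\dfrac{\delta\lambda_2(\mathcal{L})\underline\beta\, m'}{2Nn\bar H^2\underline\beta+N\lambda_2(\mathcal{L})m'}$ if $\mathcal{E}'\neq\varnothing$. Then for every $i\in\mathcal{V}$, almost surely, $\tilde\theta_{i,k}=O(k^{-a})$ if $2h-2a>1$; $\tilde\theta_{i,k}=O(\ln k/k^{h-1/2})$ if $2h-2a=1$; $\tilde\theta_{i,k}=O(\sqrt{\ln k}/k^{h-1/2})$ if $2h-2a<1$.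
   Context: Network: undirected weighted graph with sensor set $\mathcal{V}=\{1,\dots,N\}$, symmetric nonnegative weights $a_{ij}=a_{ji}$, with $a_{ij}>0$ iff $(i,j)\in\mathcal{E}$; the edge set $\mathcal{E}$ is regarded as a set of ordered pairs that is symmetric ($(i,j)\in\mathcal{E}\iff(j,i)\in\mathcal{E}$), $M=|\mathcal{E}|/2$ is the number of undirected edges, and $\mathcal{N}_i=\{j:(i,j)\in\mathcal{E}\}$. The Laplacian is $\mathcal{L}=\mathcal{D}-\mathcal{A}$ with $\mathcal{A}=(a_{ij})$, $\mathcal{D}=\mathrm{diag}(\sum_{j\in\mathcal{N}_i}a_{ij})$; $\lambda_2(\mathcal{L})$ is its second smallest eigenvalue. Observations: unknown $\theta\in\mathbb{R}^n$; sensor $i$ observes $y_{i,k}=H_{i,k}\theta+w_{i,k}$, $k\ge1$, with deterministic $H_{i,k}\in\mathbb{R}^{m_i\times n}$ and noise $w_{i,k}\in\mathbb{R}^{m_i}$. Let $d_{i,k}$ ($i\in\mathcal{V},k\ge1$) be the dithering noises used below, $\mathcal{F}_k=\sigma(w_{i,t},d_{i,t}: i\in\mathcal{V},1\le t\le k)$ and $\mathcal{F}^w_k=\sigma(w_{i,t}: i\in\mathcal{V},1\le t\le k)$. Assumptions. (A1) There is $\bar H>0$ with $\|H_{i,k}\|\le\bar H$ for all $i,k$, and there are a positive integer $p$ and $\delta>0$ with $\frac1p\sum_{t=k}^{k+p-1}\sum_{i=1}^N H_{i,t}^\top H_{i,t}\ge\delta I_n$ for all $k\ge1$. (A2) $\{w_{i,k},\mathcal{F}_k\}$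 is a martingale difference sequence and $\sup_{i,k}\mathbb{E}[\|w_{i,k}\|^\rho\mid\mathcal{F}^w_{k-1}]<\infty$ a.s. for some $\rho>2$. (A3) The graph is connected, i.e. $\mathrm{rank}(\mathcal{L})=N-1$. (A4) The $d_{i,k}$ are i.i.d. with the Laplace distribution $\mathrm{Lap}(0,1)$ (density $f(x)=\frac12e^{-|x|}$, distribution function $F$), mutually independent over all $(i,k)$, and independent of all $w_{j,t}$. Algorithm SC. Inputs: deterministic initial estimates $\hat\theta_{i,0}\in\mathbb{R}^n$; event-triggered coefficients $\nu_{ij}=\nu_{ji}\ge0$; noise coefficients $b_{ij}=b_{ji}>0$; step sizes $\alpha_{ij,k}=\alpha_{ji,k}>0$ ($(i,j)\in\mathcal{E}$) and $\beta_{i,k}>0$. For $k=1,2,\dots$: let $\varphi_k\in\mathbb{R}^n$ be the $l$-th standard basis vector, where $k=nq+l$ with $q\in\mathbb{N}\cup\{0\}$, $l\in\{1,\dots,n\}$; set $x_{i,k}=\varphi_k^\top\hat\theta_{i,k-1}$; set $C_{ij,k}=\nu_{ij}b_{ij}\ln k$; set $s_{ij,k}=1$ if $x_{i,k}+b_{ij}d_{i,k}>0$ and $s_{ij,k}=-1$ otherwise. Sensor $i$ sends the one-bit message $s_{ij,k}$ to neighbor $j$ iff $|x_{i,k}+b_{ij}d_{i,k}|>C_{ij,k}$; sensor $i$ sets $\hat s_{ji,k}=s_{ji,k}$ if it received $s_{ji,k}$ from $j$, and $\hat s_{ji,k}=0$ otherwise. With $G_{ij,k}(x)=F((x-C_{ij,k})/b_{ij})-F((-x-C_{ij,k})/b_{ij})$,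 update $\check\theta_{i,k}=\hat\theta_{i,k-1}+\varphi_k\sum_{j\in\mathcal{N}_i}\alpha_{ij,k}a_{ij}(\hat s_{ji,k}-G_{ij,k}(x_{i,k}))$, $\hat\theta_{i,k}=\check\theta_{i,k}+\beta_{i,k}H_{i,k}^\top(y_{i,k}-H_{i,k}\hat\theta_{i,k-1})$. Write $\tilde\theta_{i,k}=\hat\theta_{i,k}-\theta$. Here $\|\theta\|_1$ is the $\ell_1$ norm, and for random vectors $X_k$ and positive numbers $r_k$, "$X_k=O(r_k)$ a.s." means $\sup_k\|X_k\|/r_k<\infty$ almost surely. *)

theory Defs
  imports "HOL-Probability.Probability" "Jordan_Normal_Form.Char_Poly"
          "Jordan_Normal_Form.DL_Rank"
begin

(* Conventions: sensors are indexed 0..<N, vector components 0..<n (resp. 0..<m i);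
   vectors are functions nat => real, matrices nat => nat => real (row, column). *)

definition vnorm :: "nat \<Rightarrow> (nat \<Rightarrow> real) \<Rightarrow> real" where
  "vnorm d x = sqrt (\<Sum>c<d. (x c)\<^sup>2)"

definition l1norm :: "nat \<Rightarrow> (nat \<Rightarrow> real) \<Rightarrow> real" where
  "l1norm d x = (\<Sum>c<d. \<bar>x c\<bar>)"

definition matvec :: "nat \<Rightarrow> (nat \<Rightarrow> nat \<Rightarrow> real) \<Rightarrow> (nat \<Rightarrow> real) \<Rightarrow> nat \<Rightarrow> real" where
  "matvec nc A x = (\<lambda>r. \<Sum>c<nc. A r c * x c)"

definition opnorm :: "nat \<Rightarrow> nat \<Rightarrow> (nat \<Rightarrow> nat \<Rightarrow> real) \<Rightarrow> real" where
  "opnorm mr nc A = Sup {vnorm mr (matvec nc A x) | x. vnorm nc x \<le> 1}"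

(* distribution function of Lap(0,1) *)
definition lapF :: "real \<Rightarrow> real" where
  "lapF x = (if x < 0 then exp x / 2 else 1 - exp (- x) / 2)"

definition edges :: "nat \<Rightarrow> (nat \<Rightarrow> nat \<Rightarrow> real) \<Rightarrow> (nat \<times> nat) set" where
  "edges N aw = {(i, j). i < N \<and> j < N \<and> aw i j > 0}"

definition nbrs :: "nat \<Rightarrow> (nat \<Rightarrow> nat \<Rightarrow> real) \<Rightarrow> nat \<Rightarrow> nat set" where
  "nbrs N aw i = {j. (i, j) \<in> edges N aw}"

definition laplacian :: "nat \<Rightarrow> (nat \<Rightarrow> nat \<Rightarrow> real) \<Rightarrow> real mat" where
  "laplacian N aw = mat N N (\<lambda>(i, j). (if i = j then (\<Sum>l\<in>nbrs N aw i. aw i l) else 0) - aw i j)"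

definition lambda2 :: "real mat \<Rightarrow> real" where
  "lambda2 L = sorted_list_of_multiset (proots (char_poly L)) ! 1"

definition mat_rank :: "real mat \<Rightarrow> nat" where
  "mat_rank L = vec_space.rank (dim_row L) L"

(* Algorithm SC.  Arguments: N, n, m, weights aw, event-trigger coefficients nu,
   noise coefficients b, step sizes alpha i j k and beta i k, matrices H i k,
   observations y i k (a vector), dithers d i k, initial estimates init i.
   Result: sc_est ... k i = \<hat>\<theta>_{i,k} (a vector). *)
fun sc_est :: "nat \<Rightarrow> nat \<Rightarrow> (nat \<Rightarrow> nat) \<Rightarrow> (nat \<Rightarrow> nat \<Rightarrow> real) \<Rightarrow>
    (nat \<Rightarrow> nat \<Rightarrow> real) \<Rightarrow> (nat \<Rightarrow> nat \<Rightarrow> real) \<Rightarrow>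
    (nat \<Rightarrow> nat \<Rightarrow> nat \<Rightarrow> real) \<Rightarrow> (nat \<Rightarrow> nat \<Rightarrow> real) \<Rightarrow>
    (nat \<Rightarrow> nat \<Rightarrow> nat \<Rightarrow> nat \<Rightarrow> real) \<Rightarrow> (nat \<Rightarrow> nat \<Rightarrow> nat \<Rightarrow> real) \<Rightarrow>
    (nat \<Rightarrow> nat \<Rightarrow> real) \<Rightarrow> (nat \<Rightarrow> nat \<Rightarrow> real) \<Rightarrow>
    nat \<Rightarrow> nat \<Rightarrow> nat \<Rightarrow> real" where
  "sc_est N n m aw nu b alpha beta H y d init 0 = init"
| "sc_est N n m aw nu b alpha beta H y d init (Suc k') =
    (let k = Suc k';
         prev = sc_est N n m aw nu b alpha beta H y d init k';
         l = k' mod n;  \<comment> \<open>\<phi>_k is the basis vector with index l (0-based)\<close>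
         x = (\<lambda>i. prev i l);
         C = (\<lambda>i j. nu i j * b i j * ln (real k));
         s = (\<lambda>i j. if x i + b i j * d i k > 0 then (1::real) else -1);
         shat = (\<lambda>j i. if \<bar>x j + b j i * d j k\<bar> > C j i then s j i else 0);
         G = (\<lambda>i j z. lapF ((z - C i j) / b i j) - lapF ((- z - C i j) / b i j));
         chk = (\<lambda>i c. prev i c + (if c = l then
                  (\<Sum>j\<in>nbrs N aw i. alpha i j k * aw i j * (shat j i - G i j (x i)))
                  else 0))
     in (\<lambda>i c. chk i c + beta i k *
           (\<Sum>r<m i. H i k r c * (y i k r - matvec n (H i k) (prev i) r))))"

definition filt_wd :: "'w measure \<Rightarrow> nat \<Rightarrow> (nat \<Rightarrow> nat) \<Rightarrow> (nat \<Rightarrow> nat \<Rightarrow> 'w \<Rightarrow> nat \<Rightarrow> real)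
    \<Rightarrow> (nat \<Rightarrow> nat \<Rightarrow> 'w \<Rightarrow> real) \<Rightarrow> nat \<Rightarrow> 'w measure" where
  "filt_wd M N m w d k = sigma (space M)
     ((\<Union>i<N. \<Union>t\<in>{1..k}. \<Union>r<m i. {(\<lambda>\<omega>. w i t \<omega> r) -` A \<inter> space M | A. A \<in> sets borel})
      \<union> (\<Union>i<N. \<Union>t\<in>{1..k}. {d i t -` A \<inter> space M | A. A \<in> sets borel}))"

definition filt_w :: "'w measure \<Rightarrow> nat \<Rightarrow> (nat \<Rightarrow> nat) \<Rightarrow> (nat \<Rightarrow> nat \<Rightarrow> 'w \<Rightarrow> nat \<Rightarrow> real)
    \<Rightarrow> nat \<Rightarrow> 'w measure" where
  "filt_w M N m w k = sigma (space M)
     (\<Union>i<N. \<Union>t\<in>{1..k}. \<Union>r<m i. {(\<lambda>\<omega>. w i t \<omega> r) -` A \<inter> space M | A. A \<in> sets borel})"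

definition events_w :: "'w measure \<Rightarrow> nat \<Rightarrow> (nat \<Rightarrow> nat) \<Rightarrow> (nat \<Rightarrow> nat \<Rightarrow> 'w \<Rightarrow> nat \<Rightarrow> real)
    \<Rightarrow> 'w set set" where
  "events_w M N m w = sigma_sets (space M)
     (\<Union>i<N. \<Union>t\<in>{1..}. \<Union>r<m i. {(\<lambda>\<omega>. w i t \<omega> r) -` A \<inter> space M | A. A \<in> sets borel})"

definition events_d :: "'w measure \<Rightarrow> nat \<Rightarrow> (nat \<Rightarrow> nat \<Rightarrow> 'w \<Rightarrow> real) \<Rightarrow> 'w set set" where
  "events_d M N d = sigma_sets (space M)
     (\<Union>i<N. \<Union>t\<in>{1..}. {d i t -` A \<inter> space M | A. A \<in> sets borel})"

end

theory Submission
  imports Defs "HOL-Number_Theory.Cong"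
begin

text \<open>
  Let \<open>V\<close> be the sum over the sensors of the squared estimation errors. One step of the algorithm moves
  the error along the measurement form of the current time and the consensus form of the current
  coordinate, neither of which is definite on its own. Adding to \<open>V\<close> a small telescoping correction built
  from window averages replaces both by their averages over one period, and these together dominate
  \<open>a V / k\<close>. Raising the corrected function to a power \<open>q > 1\<close> and weighting it by the reciprocal of the
  claimed rate to the power \<open>2 q\<close> gives an almost supermartingale, whose maximal inequality yields almost
  sure boundedness. A crude constant first shows that the error tends to zero; once it is small, the
  slopes of the dithered quantiser near \<open>\<theta>\<close> are controlled by \<open>\<parallel>\<theta>\<parallel>\<^sub>1\<close>, which gives the sharp constant.
\<close>

section \<open>The spectral gap of the Laplacian\<close>


text \<open>The power q > 1 is forced by the logarithmic case: with the weight k^(2h-1) / ln k the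
  noise contributes terms of order 1/(k ln k), which diverge, whereas the q-th power leaves 1/(k (ln
  k)^q). This is where observation moments of order above 2 enter. Two obstacles shape the
  probabilistic part. The assumed moment bound is random and conditional on observation noise only,
  and the quantisation noise has the decay encoded in \<open>h\<close> only while the errors stay
  bounded. Estimates are therefore localised to events known at time k, integrals over such events
  replace conditional expectations, and countable unions over bounds give back almost every outcome.
  The constant \<open>a\<close> comes from splitting the error into network mean and deviations:
  excitation controls the mean, consensus the deviations, and Young's inequality divides the cross
  term. The eigenvalue enters only as a lower bound for the minimum of the Dirichlet form.\<close>

lemma rank_sum_rank_one_le:
  fixes g f :: "nat \<Rightarrow> nat \<Rightarrow> real"
  assumes "finite S"
  shows "vec_space.rank N (mat N N (\<lambda>(i, k). \<Sum>j\<in>S. g j i * f j k)) \<le> card S"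
  using assms
proof (induction S rule: finite_induct)
  case empty
  have "mat N N (\<lambda>(i, k). \<Sum>j\<in>{}. g j i * f j k) = 0\<^sub>m N N"
    by (rule eq_matI) auto
  then show ?case by (simp only: vec_space.rank_0I card.empty)
next
  case (insert j S)
  let ?A = "mat N N (\<lambda>(i, k). g j i * f j k)"
  let ?B = "mat N N (\<lambda>(i, k). \<Sum>j\<in>S. g j i * f j k)"
  have eq: "mat N N (\<lambda>(i, k). \<Sum>j\<in>insert j S. g j i * f j k) = ?A + ?B"
    by (rule eq_matI) (use insert in auto)
  have "vec_space.rank N ?A \<le> 1"
    by (rule vec_space.rank_le_1_product_entries[where f="g j" and g="f j"]) auto
  moreover have "vec_space.rank N (?A + ?B) \<le> vec_space.rank N ?A + vec_space.rank N ?B"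
    by (rule vec_space.rank_subadditive) auto
  ultimately show ?case using insert eq by simp
qed

text \<open>The constants and \<open>v\<close> span a plane in the kernel. Its basis
  \<open>y\<close>, \<open>z\<close>, normalised to the values (1, 0) and (0, 1) at
  \<open>s\<close>, \<open>t\<close>, expresses columns \<open>s\<close> and \<open>t\<close>
  through the other N - 2 columns, so the matrix is a sum of N - 2 outer products.\<close>

lemma corank_two_rank_le:
  fixes A :: "nat \<Rightarrow> nat \<Rightarrow> real" and v :: "nat \<Rightarrow> real"
  assumes s: "s < N" and t: "t < N" and st: "v s \<noteq> v t"
    and one: "\<And>i. i < N \<Longrightarrow> (\<Sum>j<N. A i j) = 0"
    and ker: "\<And>i. i < N \<Longrightarrow> (\<Sum>j<N. A i j * v j) = 0"
  shows "vec_space.rank N (mat N N (\<lambda>(i, j). A i j)) \<le> N - 2"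
proof -
  define z where "z j = (v j - v s) / (v t - v s)" for j
  define y where "y j = (v j - v t) / (v s - v t)" for j
  have zs: "z s = 0" "z t = 1" "y s = 1" "y t = 0" using st by (auto simp: z_def y_def)
  have Az: "(\<Sum>j<N. A i j * z j) = 0" if "i < N" for i
  proof -
    have "(\<Sum>j<N. A i j * z j) = ((\<Sum>j<N. A i j * v j) - v s * (\<Sum>j<N. A i j)) / (v t - v s)"
      by (simp add: z_def sum_divide_distrib sum_distrib_left sum_subtractf[symmetric] algebra_simps diff_divide_distrib)
    then show ?thesis using one ker that by simp
  qed
  have Ay: "(\<Sum>j<N. A i j * y j) = 0" if "i < N" for i
  proof -
    have "(\<Sum>j<N. A i j * y j) = ((\<Sum>j<N. A i j * v j) - v t * (\<Sum>j<N. A i j)) / (v s - v t)"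
      by (simp add: y_def sum_divide_distrib sum_distrib_left sum_subtractf[symmetric] algebra_simps diff_divide_distrib)
    then show ?thesis using one ker that by simp
  qed
  have ne: "s \<noteq> t" using st by auto
  define S where "S = {..<N} - {s, t}"
  have split: "(\<Sum>j<N. F j) = F s + F t + (\<Sum>j\<in>S. F j)" for F :: "nat \<Rightarrow> real"
  proof -
    have "{..<N} = insert s (insert t S)" using s t by (auto simp: S_def)
    moreover have "finite S" "s \<notin> insert t S" "t \<notin> S" using ne by (auto simp: S_def)
    ultimately show ?thesis by (simp add: add.assoc)
  qed
  \<comment> \<open>\<open>f j k\<close> is the coefficient of column \<open>j\<close> in column
    \<open>k\<close>; for the two eliminated columns it is read off from the kernel vectors.\<close>
  define f where "f j k = (if k = s then - y j else if k = t then - z j else if j = k then 1 else 0)" for j k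
  have "mat N N (\<lambda>(i, j). A i j) = mat N N (\<lambda>(i, k). \<Sum>j\<in>S. A i j * f j k)"
  proof (rule eq_matI, simp_all)
    fix i k assume i: "i < N" and k: "k < N"
    consider "k = s" | "k = t" | "k \<in> S" using k by (auto simp: S_def)
    then show "A i k = (\<Sum>j\<in>S. A i j * f j k)"
    proof cases
      case 1
      have "A i s + (\<Sum>j\<in>S. A i j * y j) = 0" using Ay[OF i] zs by (simp add: split)
      then show ?thesis using 1 by (simp add: f_def sum_negf)
    next
      case 2
      have "A i t + (\<Sum>j\<in>S. A i j * z j) = 0" using Az[OF i] zs by (simp add: split)
      then show ?thesis using 2 ne by (simp add: f_def sum_negf)
    next
      case 3
      then have "(\<Sum>j\<in>S. A i j * f j k) = (\<Sum>j\<in>S. if k = j then A i j else 0)"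
        by (intro sum.cong) (auto simp: f_def S_def)
      also have "\<dots> = A i k" using 3 by (simp add: S_def)
      finally show ?thesis by simp
    qed
  qed
  then have "vec_space.rank N (mat N N (\<lambda>(i, j). A i j)) \<le> card S"
    using rank_sum_rank_one_le[of S N "\<lambda>j i. A i j" f] by (simp add: S_def)
  also have "card S = N - 2" using s t ne by (simp add: S_def card_Diff_subset)
  finally show ?thesis .
qed

lemma nbrs_sum:
  assumes "\<And>j. j < N \<Longrightarrow> aw i j \<ge> 0" "i < N"
  shows "(\<Sum>l\<in>nbrs N aw i. aw i l * f l) = (\<Sum>l<N. aw i l * (f l :: real))"
  by (rule sum.mono_neutral_left) (use assms in \<open>auto simp: nbrs_def edges_def order.order_iff_strict\<close>)

text \<open>The smaller member stands earlier in the list, so the larger one has index at least 1.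
  It is applied to the eigenvalues 0 and \<open>\<mu>\<close>.\<close>

lemma sorted_nth_1_le:
  fixes xs :: "real list"
  assumes "sorted xs" "u \<in> set xs" "v \<in> set xs" "u < v"
  shows "1 < length xs \<and> xs ! 1 \<le> v"
proof -
  obtain i where i: "i < length xs" "xs ! i = u" using assms by (auto simp: in_set_conv_nth)
  obtain j where j: "j < length xs" "xs ! j = v" using assms by (auto simp: in_set_conv_nth)
  have "i < j"
  proof (rule ccontr)
    assume "\<not> i < j"
    then have "xs ! j \<le> xs ! i" using assms(1) i by (intro sorted_nth_mono) auto
    then show False using i j assms by simp
  qed
  then have "1 \<le> j" by simp
  then have "xs ! 1 \<le> xs ! j" using assms(1) j by (intro sorted_nth_mono) auto
  then show ?thesis using \<open>1 \<le> j\<close> j by simp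
qed

lemma eigenvalueI_sum:
  fixes A :: "nat \<Rightarrow> nat \<Rightarrow> real"
  assumes "t < N" "v t \<noteq> 0" "\<And>i. i < N \<Longrightarrow> (\<Sum>j<N. A i j * v j) = c * v i"
  shows "eigenvalue (mat N N (\<lambda>(i, j). A i j)) c"
proof -
  let ?v = "vec N v"
  have "eigenvector (mat N N (\<lambda>(i, j). A i j)) ?v c"
    unfolding eigenvector_def
  proof (intro conjI)
    show "?v \<noteq> 0\<^sub>v (dim_row (mat N N (\<lambda>(i, j). A i j)))"
      using assms(1,2) by (auto simp: vec_eq_iff)
    show "mat N N (\<lambda>(i, j). A i j) *\<^sub>v ?v = c \<cdot>\<^sub>v ?v"
      by (rule eq_vecI) (auto simp: scalar_prod_def assms(3) lessThan_atLeast0[symmetric])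
  qed auto
  then show ?thesis by (auto simp: eigenvalue_def)
qed

lemma eigenvalueE_sum:
  fixes A :: "nat \<Rightarrow> nat \<Rightarrow> real"
  assumes "eigenvalue (mat N N (\<lambda>(i, j). A i j)) c"
  obtains v t where "t < N" "v t \<noteq> 0" "\<And>i. i < N \<Longrightarrow> (\<Sum>j<N. A i j * v j) = c * v i"
proof -
  obtain v where v: "v \<in> carrier_vec N" "v \<noteq> 0\<^sub>v N" "mat N N (\<lambda>(i, j). A i j) *\<^sub>v v = c \<cdot>\<^sub>v v"
    using assms by (auto simp: eigenvalue_def eigenvector_def)
  obtain t where "t < N" "v $ t \<noteq> 0" using v(1,2) by (auto simp: vec_eq_iff)
  moreover have "(\<Sum>j<N. A i j * v $ j) = c * v $ i" if "i < N" for i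
  proof -
    have "(mat N N (\<lambda>(i, j). A i j) *\<^sub>v v) $ i = (c \<cdot>\<^sub>v v) $ i" using v by simp
    then show ?thesis using that v(1) by (simp add: scalar_prod_def lessThan_atLeast0[symmetric])
  qed
  ultimately show ?thesis using that[of t "\<lambda>j. v $ j"] by auto
qed

text \<open>The form is continuous on the compact unit sphere of mean-zero vectors, and homogeneity
  extends the minimum to all mean-zero \<open>x\<close>. The minimiser turns out to be an
  eigenvector, which takes the place of a spectral decomposition.\<close>

lemma dirichlet_min_attained:
  fixes a :: "nat \<Rightarrow> nat \<Rightarrow> real"
  assumes N: "2 \<le> N"
  obtains v \<mu> where "(\<Sum>i<N. v i) = 0" "(\<Sum>i<N. (v i)\<^sup>2) = 1"
    "(\<Sum>i<N. \<Sum>j<N. a i j * (v i - v j)\<^sup>2) = 2 * \<mu>"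
    "\<And>x. (\<Sum>i<N. x i) = 0 \<Longrightarrow> (\<Sum>i<N. \<Sum>j<N. a i j * (x i - x j)\<^sup>2) \<ge> 2 * \<mu> * (\<Sum>i<N. (x i)\<^sup>2)"
proof -
  let ?Q = "\<lambda>x::nat\<Rightarrow>real. \<Sum>i<N. \<Sum>j<N. a i j * (x i - x j)\<^sup>2"
  \<comment> \<open>Pinning the coordinates from \<open>N\<close> on to 0 makes every factor
    compact, hence the product is compact in the topology of functions on all naturals.\<close>
  let ?B = "PiE UNIV (\<lambda>i. if i < N then {-1..1} else {0::real})"
  let ?K = "?B \<inter> {x. (\<Sum>i<N. x i) = 0} \<inter> {x. (\<Sum>i<N. (x i)\<^sup>2) = 1}"
  have cB: "compact ?B"
  proof -
    have "compactin (product_topology (\<lambda>i. euclidean) UNIV) ?B"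
      by (subst compactin_PiE) auto
    then show ?thesis by (simp add: euclidean_product_topology)
  qed
  have c1: "continuous_on UNIV (\<lambda>x::nat\<Rightarrow>real. x i)" for i by (rule continuous_on_product_coordinates)
  have cl1: "closed {x::nat\<Rightarrow>real. (\<Sum>i<N. x i) = 0}"
    by (rule closed_Collect_eq) (intro continuous_intros c1)+
  have cl2: "closed {x::nat\<Rightarrow>real. (\<Sum>i<N. (x i)\<^sup>2) = 1}"
    by (rule closed_Collect_eq) (intro continuous_intros c1)+
  have cK: "compact ?K" by (intro compact_Int_closed cB cl1 cl2)
  have ne: "?K \<noteq> {}"
  proof -
    define x where "x i = (if i = 0 then 1 / sqrt 2 else if i = Suc 0 then - 1 / sqrt 2 else (0::real))" for i :: nat
    obtain N' where N': "N = Suc (Suc N')" using N by (metis add_2_eq_Suc le_Suc_ex)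
    have "(\<Sum>i<N. x i) = 0" "(\<Sum>i<N. (x i)\<^sup>2) = 1"
      unfolding N' by (simp_all add: sum.lessThan_Suc_shift x_def power_divide del: sum.lessThan_Suc)
    moreover have "0 \<le> 1 / sqrt (2::real)" by simp
    then have "- 1 \<le> 1 / sqrt (2::real)" by linarith
    then have "x \<in> ?B" using N by (auto simp: x_def)
    ultimately show ?thesis by blast
  qed
  have cQ: "continuous_on ?K ?Q"
    by (intro continuous_intros continuous_on_subset[OF c1]) auto
  obtain v where v: "v \<in> ?K" "\<And>x. x \<in> ?K \<Longrightarrow> ?Q v \<le> ?Q x"
    using continuous_attains_inf[OF cK ne cQ] by blast
  define \<mu> where "\<mu> = ?Q v / 2"
  have min: "?Q x \<ge> 2 * \<mu> * (\<Sum>i<N. (x i)\<^sup>2)" if x: "(\<Sum>i<N. x i) = 0" for x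
  proof (cases "(\<Sum>i<N. (x i)\<^sup>2) = 0")
    case True
    then have "\<And>i. i < N \<Longrightarrow> x i = 0" by (simp add: sum_nonneg_eq_0_iff)
    then have "?Q x = 0" by simp
    then show ?thesis using True by simp
  next
    case False
    define s where "s = (\<Sum>i<N. (x i)\<^sup>2)"
    have s: "s > 0" using False sum_nonneg[of "{..<N}" "\<lambda>i. (x i)\<^sup>2"] unfolding s_def by fastforce
    define y where "y i = (if i < N then x i / sqrt s else 0)" for i
    have y0: "(\<Sum>i<N. y i) = 0" using x by (simp add: y_def sum_divide_distrib[symmetric])
    have y1: "(\<Sum>i<N. (y i)\<^sup>2) = 1"
      using s by (simp add: y_def power_divide sum_divide_distrib[symmetric] s_def[symmetric])
    have "\<bar>y i\<bar> \<le> 1" if "i < N" for i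
    proof -
      have "(y i)\<^sup>2 \<le> (\<Sum>i<N. (y i)\<^sup>2)" using that by (intro member_le_sum) auto
      then show ?thesis using y1 by (simp add: abs_square_le_1)
    qed
    then have "y i \<in> (if i < N then {-1..1} else {0})" for i
      by (cases "i < N") (auto simp: abs_le_iff minus_le_iff, simp add: y_def)
    then have "y \<in> ?B" by auto
    then have "?Q v \<le> ?Q y" using v(2) y0 y1 by blast
    also have "?Q y = ?Q x / s"
      unfolding sum_divide_distrib
      by (intro sum.cong refl) (use s in \<open>auto simp: y_def diff_divide_distrib[symmetric] power_divide\<close>)
    finally have "2 * \<mu> \<le> ?Q x / s" by (simp add: \<mu>_def)
    then show ?thesis using s by (simp add: s_def[symmetric] field_simps)
  qed
  show ?thesis by (rule that[of v \<mu>]) (use v min in \<open>auto simp: \<mu>_def\<close>)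
qed


text \<open>First-order condition at a minimum: at t = -s b the value is -s (1 - s c) b^2, and a
  small s > 0 makes it negative unless b = 0.\<close>

lemma quadratic_nonneg_imp_linear_zero:
  fixes b c :: real
  assumes "\<And>t. t * b + t\<^sup>2 * c \<ge> 0"
  shows "b = 0"
proof -
  define s where "s = 1 / (\<bar>c\<bar> + 1)"
  have s: "s > 0" "s * c < 1" by (auto simp: s_def field_simps)
  have "0 \<le> (- (s * b)) * b + (- (s * b))\<^sup>2 * c" by (rule assms)
  also have "\<dots> = - (s * (1 - s * c) * b\<^sup>2)" by (simp add: power2_eq_square algebra_simps)
  finally have "s * (1 - s * c) * b\<^sup>2 \<le> 0" by simp
  moreover have "s * (1 - s * c) > 0" using s by simp
  ultimately have "b\<^sup>2 \<le> 0" by (metis mult_le_0_iff not_less)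
  then show ?thesis by simp
qed

text \<open>Summation by parts on the graph: exchanging the indices turns the \<open>y j\<close>
  half into the \<open>y i\<close> half, by symmetry of \<open>a\<close> and antisymmetry of
  \<open>F\<close>. It serves linear differences here and differences of quantiser means in
  \<open>ip_dG\<close>.\<close>

lemma sum_edge_differences:
  fixes a :: "nat \<Rightarrow> nat \<Rightarrow> real"
  assumes "\<And>i j. i < N \<Longrightarrow> j < N \<Longrightarrow> a i j = a j i"
    and "\<And>i j. i < N \<Longrightarrow> j < N \<Longrightarrow> F i j = - F j i"
  shows "(\<Sum>i<N. \<Sum>j<N. a i j * F i j * (y i - y j)) = 2 * (\<Sum>i<N. y i * (\<Sum>j<N. a i j * F i j))"
proof -
  have "(\<Sum>i<N. \<Sum>j<N. a i j * F i j * y j) = (\<Sum>i<N. \<Sum>j<N. a j i * F j i * y i)"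
    by (rule sum.swap)
  also have "\<dots> = (\<Sum>i<N. \<Sum>j<N. - (a i j * F i j * y i))"
  proof (intro sum.cong refl)
    fix i j assume "i \<in> {..<N}" "j \<in> {..<N}"
    then have "a j i = a i j" "F j i = - F i j" using assms(1)[of j i] assms(2)[of j i] by auto
    then show "a j i * F j i * y i = - (a i j * F i j * y i)" by simp
  qed
  finally have "(\<Sum>i<N. \<Sum>j<N. a i j * F i j * y j) = - (\<Sum>i<N. \<Sum>j<N. a i j * F i j * y i)"
    by (simp add: sum_negf)
  then show ?thesis
    by (simp add: right_diff_distrib sum_subtractf sum_distrib_left mult_ac)
qed

text \<open>The gap constant is the minimum \<open>\<mu>\<close> of the Dirichlet form. It is an
  eigenvalue different from the eigenvalue 0, so the second entry of the sorted root list is at most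
  \<open>\<mu>\<close>; this inequality and nonnegativity are what the rate constant requires of
  \<open>lambda2\<close>.\<close>

lemma laplacian_spectral_gap:
  assumes N: "2 \<le> N"
    and sym: "\<And>i j. i < N \<Longrightarrow> j < N \<Longrightarrow> aw i j = aw j i"
    and nonneg: "\<And>i j. i < N \<Longrightarrow> j < N \<Longrightarrow> aw i j \<ge> 0"
    and conn: "mat_rank (laplacian N aw) = N - 1"
  obtains \<mu> where "\<mu> > 0" "0 \<le> lambda2 (laplacian N aw)" "lambda2 (laplacian N aw) \<le> \<mu>"
    "\<And>x. (\<Sum>i<N. \<Sum>j<N. aw i j * (x i - x j)\<^sup>2) \<ge> 2 * \<mu> * (\<Sum>i<N. (x i - (\<Sum>j<N. x j) / N)\<^sup>2)"
proof -
  define g where "g x i = (\<Sum>j<N. aw i j * (x i - x j))" for x :: "nat \<Rightarrow> real" and i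
  define Q where "Q x = (\<Sum>i<N. \<Sum>j<N. aw i j * (x i - x j)\<^sup>2)" for x :: "nat \<Rightarrow> real"
  define A where "A i j = (if i = j then (\<Sum>l\<in>nbrs N aw i. aw i l) else 0) - aw i j" for i j
  have L: "laplacian N aw = mat N N (\<lambda>(i, j). A i j)" by (simp add: laplacian_def A_def)
  have Ax: "(\<Sum>j<N. A i j * x j) = g x i" if "i < N" for i x
  proof -
    have "(\<Sum>l\<in>nbrs N aw i. aw i l) = (\<Sum>l<N. aw i l)"
      using nbrs_sum[of N aw i "\<lambda>_. 1"] nonneg that by simp
    then have "(\<Sum>j<N. A i j * x j) = (\<Sum>j<N. (if i = j then (\<Sum>l<N. aw i l) * x j else 0)) - (\<Sum>j<N. aw i j * x j)"
      unfolding sum_subtractf[symmetric] by (intro sum.cong refl) (auto simp: A_def algebra_simps)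
    also have "\<dots> = g x i" using that
      by (simp add: g_def right_diff_distrib sum_subtractf sum_distrib_right)
    finally show ?thesis .
  qed
  have polar: "(\<Sum>i<N. \<Sum>j<N. aw i j * (x i - x j) * (y i - y j)) = 2 * (\<Sum>i<N. y i * g x i)" for x y
    unfolding g_def by (rule sum_edge_differences) (use sym in auto)
  have Qg: "Q x = 2 * (\<Sum>i<N. x i * g x i)" for x
    using polar[of x x] by (simp add: Q_def power2_eq_square mult.assoc)
  have Qpos: "0 \<le> Q x" for x unfolding Q_def using nonneg by (intro sum_nonneg) auto
  have Qadd: "Q (\<lambda>i. x i + t * y i) = Q x + 4 * t * (\<Sum>i<N. y i * g x i) + t\<^sup>2 * Q y" for x y t
  proof -
    have "Q (\<lambda>i. x i + t * y i) = Q x + 2 * t * (\<Sum>i<N. \<Sum>j<N. aw i j * (x i - x j) * (y i - y j)) + t\<^sup>2 * Q y"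
      unfolding Q_def sum_distrib_left sum.distrib[symmetric]
      by (intro sum.cong refl) (simp add: power2_eq_square algebra_simps)
    then show ?thesis by (simp add: polar)
  qed
  have g1: "(\<Sum>i<N. g x i) = 0" for x
    using polar[of x "\<lambda>_. 1"] by simp
  obtain v \<mu> where v0: "(\<Sum>i<N. v i) = 0" and v1: "(\<Sum>i<N. (v i)\<^sup>2) = 1" and vQ: "Q v = 2 * \<mu>"
    and min: "\<And>x. (\<Sum>i<N. x i) = 0 \<Longrightarrow> Q x \<ge> 2 * \<mu> * (\<Sum>i<N. (x i)\<^sup>2)"
    by (rule dirichlet_min_attained[OF N, of aw, folded Q_def]) blast
  \<comment> \<open>Minimality of \<open>v\<close> along v + t y leaves no term linear in t, so the
    residual \<open>g v - \<mu> v\<close> is orthogonal to every mean-zero \<open>y\<close>.\<close>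
  have orth: "(\<Sum>i<N. y i * (g v i - \<mu> * v i)) = 0" if y: "(\<Sum>i<N. y i) = 0" for y
  proof -
    define c where "c = Q y - 2 * \<mu> * (\<Sum>i<N. (y i)\<^sup>2)"
    have split: "(\<Sum>i<N. y i * (g v i - \<mu> * v i)) = (\<Sum>i<N. y i * g v i) - \<mu> * (\<Sum>i<N. y i * v i)"
      unfolding sum_distrib_left sum_subtractf[symmetric] by (intro sum.cong refl) (simp add: algebra_simps)
    have "4 * (\<Sum>i<N. y i * (g v i - \<mu> * v i)) = 0"
    proof (rule quadratic_nonneg_imp_linear_zero[where c = c])
      fix t :: real
      have "(\<Sum>i<N. v i + t * y i) = 0" using y v0 by (simp add: sum.distrib sum_distrib_left[symmetric])
      then have "2 * \<mu> * (\<Sum>i<N. (v i + t * y i)\<^sup>2) \<le> Q (\<lambda>i. v i + t * y i)" by (rule min)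
      moreover have "(\<Sum>i<N. (v i + t * y i)\<^sup>2) = 1 + 2 * t * (\<Sum>i<N. y i * v i) + t\<^sup>2 * (\<Sum>i<N. (y i)\<^sup>2)"
        unfolding v1[symmetric] sum_distrib_left sum.distrib[symmetric]
        by (intro sum.cong refl) (simp add: power2_eq_square algebra_simps)
      ultimately show "0 \<le> t * (4 * (\<Sum>i<N. y i * (g v i - \<mu> * v i))) + t\<^sup>2 * c"
        unfolding Qadd vQ split c_def by (simp add: algebra_simps)
    qed
    then show ?thesis by simp
  qed
  \<comment> \<open>The residual has mean zero itself, so it may serve as the direction
    \<open>y\<close>; being orthogonal to itself, it vanishes.\<close>
  have "(\<Sum>i<N. (g v i - \<mu> * v i) * (g v i - \<mu> * v i)) = 0"
    by (rule orth) (simp add: sum_subtractf g1 sum_distrib_left[symmetric] v0)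
  then have gv: "g v i = \<mu> * v i" if "i < N" for i
    using that by (subst (asm) sum_nonneg_eq_0_iff) auto
  obtain t where t: "t < N" "v t \<noteq> 0"
  proof -
    have "\<exists>t<N. v t \<noteq> 0"
    proof (rule ccontr)
      assume "\<not> ?thesis"
      then have "(\<Sum>i<N. (v i)\<^sup>2) = 0" by simp
      then show False using v1 by simp
    qed
    then show ?thesis using that by blast
  qed
  obtain s where s: "s < N" "v s \<noteq> v t"
  proof -
    have "\<exists>s<N. v s \<noteq> v t"
    proof (rule ccontr)
      assume "\<not> ?thesis"
      then have "(\<Sum>i<N. v i) = (\<Sum>i<N. v t)" by (intro sum.cong) auto
      then show False using v0 t by simp
    qed
    then show ?thesis using that by blast
  qed
  have g_one: "g (\<lambda>_. 1) i = 0" for i by (simp add: g_def)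
  have mu0: "\<mu> \<ge> 0" using Qpos[of v] vQ by simp
  \<comment> \<open>With \<open>\<mu> = 0\<close> the kernel would contain the constants and the
    nonconstant \<open>v\<close>, so the rank would be at most N - 2.\<close>
  have mupos: "\<mu> > 0"
  proof (rule ccontr)
    assume "\<not> 0 < \<mu>"
    then have "\<mu> = 0" using mu0 by simp
    have "vec_space.rank N (mat N N (\<lambda>(i, j). A i j)) \<le> N - 2"
    proof (rule corank_two_rank_le[OF s(1) t(1) s(2)])
      show "(\<Sum>j<N. A i j) = 0" if "i < N" for i using Ax[OF that, of "\<lambda>_. 1"] g_one by simp
      show "(\<Sum>j<N. A i j * v j) = 0" if "i < N" for i using Ax[OF that, of v] gv[OF that] \<open>\<mu> = 0\<close> by simp
    qed
    moreover have "mat_rank (laplacian N aw) = vec_space.rank N (mat N N (\<lambda>(i, j). A i j))"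
      by (simp add: mat_rank_def L)
    ultimately show False using conn N by simp
  qed
  have carr: "laplacian N aw \<in> carrier_mat N N" by (simp add: laplacian_def)
  let ?P = "char_poly (laplacian N aw)"
  have P0: "?P \<noteq> 0" using degree_monic_char_poly[OF carr] by auto
  have root: "c \<in># proots ?P \<longleftrightarrow> eigenvalue (laplacian N aw) c" for c
    unfolding eigenvalue_root_char_poly[OF carr] using P0 by simp
  let ?xs = "sorted_list_of_multiset (proots ?P)"
  have setxs: "set ?xs = set_mset (proots ?P)" by simp
  have e0: "eigenvalue (laplacian N aw) 0"
    unfolding L by (rule eigenvalueI_sum[of t N "\<lambda>_. 1"]) (use t g_one Ax[of _ "\<lambda>_. 1"] in simp_all)
  have e1: "eigenvalue (laplacian N aw) \<mu>"
    unfolding L by (rule eigenvalueI_sum[of t N v]) (use t in \<open>simp_all add: Ax gv\<close>)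
  have nth: "1 < length ?xs \<and> ?xs ! 1 \<le> \<mu>"
  proof (rule sorted_nth_1_le[OF _ _ _ mupos])
    show "sorted ?xs" by simp
    show "0 \<in> set ?xs" "\<mu> \<in> set ?xs" unfolding setxs root by (rule e0, rule e1)
  qed
  have le: "lambda2 (laplacian N aw) \<le> \<mu>" using nth by (simp add: lambda2_def)
  \<comment> \<open>Being an eigenvalue, \<open>lambda2\<close> is nonnegative because the Dirichlet
    form of its eigenvector is. Only nonnegativity is obtained, so the value 0 has to be allowed for
    later.\<close>
  have "eigenvalue (laplacian N aw) (?xs ! 1)"
    using nth nth_mem[of 1 ?xs] unfolding setxs root by simp
  then have "eigenvalue (mat N N (\<lambda>(i, j). A i j)) (lambda2 (laplacian N aw))"
    by (simp add: lambda2_def L)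
  then obtain y u where u: "u < N" "y u \<noteq> 0"
      "\<And>i. i < N \<Longrightarrow> (\<Sum>j<N. A i j * y j) = lambda2 (laplacian N aw) * y i"
    by (rule eigenvalueE_sum) blast
  have "Q y = 2 * (\<Sum>i<N. y i * (lambda2 (laplacian N aw) * y i))"
    unfolding Qg using u(3) Ax by simp
  also have "\<dots> = 2 * lambda2 (laplacian N aw) * (\<Sum>i<N. (y i)\<^sup>2)"
    by (simp add: sum_distrib_left power2_eq_square mult_ac)
  finally have "0 \<le> lambda2 (laplacian N aw) * (\<Sum>i<N. (y i)\<^sup>2)" using Qpos[of y] by simp
  moreover have "(\<Sum>i<N. (y i)\<^sup>2) > 0" using u by (intro sum_pos2[of _ u]) auto
  ultimately have ge: "0 \<le> lambda2 (laplacian N aw)" by (simp add: zero_le_mult_iff)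
  have "Q x \<ge> 2 * \<mu> * (\<Sum>i<N. (x i - (\<Sum>j<N. x j) / N)\<^sup>2)" for x
  proof -
    have "(\<Sum>i<N. x i - (\<Sum>j<N. x j) / N) = 0" using N by (simp add: sum_subtractf)
    from min[OF this] show ?thesis by (simp add: Q_def)
  qed
  from that[OF mupos ge le this[unfolded Q_def]] show ?thesis .
qed

section \<open>Almost supermartingales\<close>

lemma (in prob_space) integrable_indicator_prob:
  "A \<in> sets M \<Longrightarrow> integrable M (indicat_real A)"
  by (rule integrable_const_bound[where B = 1]) auto

text \<open>Maximal inequality by stopping at the first passage above a level: a path that starts
  below \<open>c\<close> and stays in the \<open>J k\<close> crosses level \<open>l\<close> with
  probability at most c / l. Since \<open>Z\<close> need not be integrable, the supermartingale
  property is asked only on events of \<open>F k\<close>, inside \<open>J k\<close>, on which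
  \<open>Z k\<close> is bounded.\<close>

lemma (in prob_space) nonneg_supermartingale_bounded:
  fixes Z :: "nat \<Rightarrow> 'a \<Rightarrow> real"
  assumes sub: "\<And>k. subalgebra M (F k)" and mono: "\<And>j k. j \<le> k \<Longrightarrow> sets (F j) \<subseteq> sets (F k)"
    and meas: "\<And>k. Z k \<in> borel_measurable (F k)"
    and nn: "\<And>k \<omega>. Z k \<omega> \<ge> 0"
    and J: "\<And>k. J k \<in> sets (F k)"
    and step: "\<And>k A R. A \<in> sets (F k) \<Longrightarrow> A \<subseteq> J k \<Longrightarrow> (\<And>\<omega>. \<omega> \<in> A \<Longrightarrow> Z k \<omega> \<le> R) \<Longrightarrow>
        integrable M (\<lambda>\<omega>. indicator A \<omega> * Z (Suc k) \<omega>) \<and>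
        (\<integral>\<omega>. indicator A \<omega> * Z (Suc k) \<omega> \<partial>M) \<le> (\<integral>\<omega>. indicator A \<omega> * Z k \<omega> \<partial>M)"
  shows "AE \<omega> in M. (\<forall>k. \<omega> \<in> J k) \<longrightarrow> (\<exists>B. \<forall>k. Z k \<omega> \<le> B)"
proof -
  have spF: "space (F k) = space M" and seF: "sets (F k) \<subseteq> sets M" for k
    using sub[of k] by (auto simp: subalgebra_def)
  have measF: "Z j \<in> borel_measurable (F k)" if "j \<le> k" for j k
    using meas[of j] mono[OF that] spF by (auto simp: measurable_def)
  have [measurable]: "Z k \<in> borel_measurable M" for k
    by (rule measurable_from_subalg[OF sub meas])
  have JF: "J j \<in> sets (F k)" if "j \<le> k" for j k using J[of j] mono[OF that] by auto
  have [measurable]: "J k \<in> sets M" for k using J seF by blast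
  \<comment> \<open>\<open>T c l k\<close> collects the paths that started below \<open>c\<close>
    and up to time k stayed in every \<open>J j\<close> and below level \<open>l\<close>;
    \<open>E c l k\<close> below is first passage at time k + 1.\<close>
  define T where "T c l k = {\<omega> \<in> space M. Z 0 \<omega> \<le> c \<and> (\<forall>j\<in>{..k}. \<omega> \<in> J j \<and> Z j \<omega> \<le> l)}" for c l :: real and k :: nat
  have TF: "T c l k \<in> sets (F k)" for c l k
  proof -
    have "T c l k = {\<omega> \<in> space (F k). Z 0 \<omega> \<le> c} \<inter> (\<Inter>j\<in>{..k}. J j \<inter> {\<omega> \<in> space (F k). Z j \<omega> \<le> l})"
      by (auto simp: T_def spF)
    moreover have "{\<omega> \<in> space (F k). Z j \<omega> \<le> x} \<in> sets (F k)" if "j \<le> k" for j x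
      using measF[OF that] by measurable
    ultimately show ?thesis using JF by (auto intro!: sets.Int sets.finite_INT)
  qed
  have [measurable]: "T c l k \<in> sets M" for c l k using TF seF by blast
  define E where "E c l k = T c l k \<inter> {\<omega> \<in> space M. Z (Suc k) \<omega> > l}" for c l k
  have [measurable]: "E c l k \<in> sets M" for c l k unfolding E_def by measurable
  have intT: "integrable M (\<lambda>\<omega>. indicator (T c l k) \<omega> * Z k \<omega>)" for c l k
  proof (rule integrable_const_bound[where B = "\<bar>l\<bar>"])
    have "norm (indicator (T c l k) \<omega> * Z k \<omega>) \<le> \<bar>l\<bar>" for \<omega>
      using nn[of k \<omega>] by (cases "\<omega> \<in> T c l k") (auto simp: T_def intro: order.trans[OF _ abs_ge_self])
    then show "AE \<omega> in M. norm (indicator (T c l k) \<omega> * Z k \<omega>) \<le> \<bar>l\<bar>" by simp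
  qed simp
  \<comment> \<open>The probability already spent on crossings, multiplied by \<open>l\<close>, plus
    the mass still below the level never exceeds \<open>c\<close>: each step can only move mass from
    the second term to the first.\<close>
  have bound: "l * (\<Sum>j<k. prob (E c l j)) + (\<integral>\<omega>. indicator (T c l k) \<omega> * Z k \<omega> \<partial>M) \<le> c"
    if "c \<ge> 0" "l \<ge> 0" for c l k
  proof (induction k)
    case 0
    have "(\<integral>\<omega>. indicator (T c l 0) \<omega> * Z 0 \<omega> \<partial>M) \<le> (\<integral>\<omega>. c \<partial>M)"
      by (rule integral_mono[OF intT]) (use \<open>c \<ge> 0\<close> in \<open>auto simp: T_def indicator_def\<close>)
    then show ?case by (simp add: prob_space)
  next
    case (Suc k)
    have st: "integrable M (\<lambda>\<omega>. indicator (T c l k) \<omega> * Z (Suc k) \<omega>)"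
      "(\<integral>\<omega>. indicator (T c l k) \<omega> * Z (Suc k) \<omega> \<partial>M) \<le> (\<integral>\<omega>. indicator (T c l k) \<omega> * Z k \<omega> \<partial>M)"
      using step[of "T c l k" k l] TF by (auto simp: T_def)
    have "l * prob (E c l k) + (\<integral>\<omega>. indicator (T c l (Suc k)) \<omega> * Z (Suc k) \<omega> \<partial>M)
        = (\<integral>\<omega>. l * indicator (E c l k) \<omega> + indicator (T c l (Suc k)) \<omega> * Z (Suc k) \<omega> \<partial>M)"
      using intT[of c l "Suc k"] integrable_indicator_prob[of "E c l k"]
      by (subst Bochner_Integration.integral_add) auto
    also have "\<dots> \<le> (\<integral>\<omega>. indicator (T c l k) \<omega> * Z (Suc k) \<omega> \<partial>M)"
    proof (rule integral_mono)
      show "integrable M (\<lambda>\<omega>. l * indicator (E c l k) \<omega> + indicator (T c l (Suc k)) \<omega> * Z (Suc k) \<omega>)"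
        using intT[of c l "Suc k"] integrable_indicator_prob[of "E c l k"] by auto
      show "integrable M (\<lambda>\<omega>. indicator (T c l k) \<omega> * Z (Suc k) \<omega>)" by (rule st(1))
      fix \<omega>
      consider "\<omega> \<in> T c l (Suc k)" | "\<omega> \<in> E c l k" | "\<omega> \<notin> T c l (Suc k)" "\<omega> \<notin> E c l k" by blast
      then show "l * indicator (E c l k) \<omega> + indicator (T c l (Suc k)) \<omega> * Z (Suc k) \<omega> \<le> indicator (T c l k) \<omega> * Z (Suc k) \<omega>"
      proof cases
        case 1
        then have "Z (Suc k) \<omega> \<le> l" unfolding T_def by blast
        then have "\<omega> \<notin> E c l k" by (simp add: E_def)
        moreover have "\<omega> \<in> T c l k" using 1 by (auto simp: T_def)
        ultimately show ?thesis using 1 by simp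
      next
        case 2
        then have l: "l < Z (Suc k) \<omega>" "\<omega> \<in> T c l k" by (auto simp: E_def)
        have "Z (Suc k) \<omega> \<le> l" if "\<omega> \<in> T c l (Suc k)" using that unfolding T_def by blast
        then have "\<omega> \<notin> T c l (Suc k)" using l by force
        then show ?thesis using 2 l by simp
      next
        case 3
        then show ?thesis using nn[of "Suc k" \<omega>] by simp
      qed
    qed
    finally show ?case using Suc st(2) by (simp add: algebra_simps)
  qed
  define Bad where "Bad c = {\<omega> \<in> space M. Z 0 \<omega> \<le> real c \<and> (\<forall>k. \<omega> \<in> J k) \<and> (\<forall>B::nat. \<exists>k. Z k \<omega> > real B)}" for c :: nat
  have [measurable]: "Bad c \<in> sets M" for c unfolding Bad_def by measurable
  have Bad0: "prob (Bad c) = 0" for c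
  proof -
    have le: "prob (Bad c) \<le> real c / real l" if l: "l \<ge> c" "l > 0" for l :: nat
    proof -
      let ?E = "E (real c) (real l)"
      have part: "(\<Sum>j<k. prob (?E j)) \<le> real c / real l" for k
      proof -
        have "0 \<le> (\<integral>\<omega>. indicator (T (real c) (real l) k) \<omega> * Z k \<omega> \<partial>M)"
          by (intro integral_nonneg_AE) (auto simp: nn)
        then show ?thesis using bound[of "real c" "real l" k] l by (simp add: field_simps)
      qed
      have sm: "summable (\<lambda>j. prob (?E j))"
        by (rule summableI_nonneg_bounded[OF _ part]) auto
      have "Bad c \<subseteq> (\<Union>j. ?E j)"
      proof
        fix \<omega> assume w: "\<omega> \<in> Bad c"
        \<comment> \<open>Time 0 is not a crossing, since \<open>Z 0\<close> is at most
          \<open>c\<close>, hence at most \<open>l\<close>. The first passage is therefore some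
          \<open>Suc k'\<close>, and the path lies in \<open>?E k'\<close>.\<close>
        define k where "k = (LEAST k. Z k \<omega> > real l)"
        have ex: "\<exists>k. Z k \<omega> > real l" using w by (auto simp: Bad_def)
        have k1: "Z k \<omega> > real l" unfolding k_def by (rule LeastI_ex[OF ex])
        have k2: "Z j \<omega> \<le> real l" if "j < k" for j using not_less_Least that unfolding k_def by force
        have "k \<noteq> 0" using k1 w l by (intro notI) (auto simp: Bad_def)
        then obtain k' where k': "k = Suc k'" by (cases k) auto
        have "\<omega> \<in> ?E k'" using w k1 k2 k' by (auto simp: E_def T_def Bad_def)
        then show "\<omega> \<in> (\<Union>j. ?E j)" by blast
      qed
      then have "prob (Bad c) \<le> prob (\<Union>j. ?E j)" by (intro finite_measure_mono) auto
      also have "\<dots> \<le> (\<Sum>j. prob (?E j))" by (rule finite_measure_subadditive_countably[OF _ sm]) auto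
      also have "\<dots> \<le> real c / real l" by (rule suminf_le_const[OF sm part])
      finally show ?thesis .
    qed
    have "prob (Bad c) \<le> 0"
    proof (rule LIMSEQ_le_const)
      show "(\<lambda>l. real c / real l) \<longlonglongrightarrow> 0" by (rule lim_const_over_n)
      show "\<exists>N. \<forall>l\<ge>N. prob (Bad c) \<le> real c / real l"
        using le by (intro exI[of _ "Suc c"]) auto
    qed
    then show ?thesis by (simp add: measure_le_0_iff)
  qed
  have "AE \<omega> in M. \<omega> \<notin> Bad c" for c
    using Bad0[of c] by (intro AE_not_in) (auto simp: null_sets_def emeasure_eq_measure)
  then have "AE \<omega> in M. \<forall>c. \<omega> \<notin> Bad c" by (simp add: AE_all_countable)
  then show ?thesis
  proof (rule AE_mp, intro AE_I2 impI)
    fix \<omega> assume w: "\<omega> \<in> space M" "\<forall>c. \<omega> \<notin> Bad c" "\<forall>k. \<omega> \<in> J k"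
    obtain c :: nat where "Z 0 \<omega> \<le> real c" using real_arch_simple by blast
    then have "\<not> (\<forall>B::nat. \<exists>k. Z k \<omega> > real B)" using w by (auto simp: Bad_def)
    then obtain B :: nat where "\<forall>k. Z k \<omega> \<le> real B" by (auto simp: not_less)
    then show "\<exists>B. \<forall>k. Z k \<omega> \<le> B" by blast
  qed
qed

text \<open>Robbins-Siegmund reduction: discount by \<open>v k\<close>, the reciprocal product of
  the factors 1 + a j, and add the discounted tail \<open>t k\<close> of the additive errors. The
  result \<open>Y\<close> is a supermartingale, and since \<open>v\<close> stays above exp (- suminf
  a), boundedness of \<open>Y\<close> gives that of \<open>Z\<close>.\<close>

lemma (in prob_space) almost_supermartingale_bounded:
  fixes Z :: "nat \<Rightarrow> 'a \<Rightarrow> real" and a b :: "nat \<Rightarrow> real"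
  assumes sub: "\<And>k. subalgebra M (F k)" and mono: "\<And>j k. j \<le> k \<Longrightarrow> sets (F j) \<subseteq> sets (F k)"
    and meas: "\<And>k. k \<ge> K \<Longrightarrow> Z k \<in> borel_measurable (F k)"
    and nn: "\<And>k \<omega>. k \<ge> K \<Longrightarrow> Z k \<omega> \<ge> 0"
    and J: "\<And>k. k \<ge> K \<Longrightarrow> J k \<in> sets (F k)"
    and a: "\<And>k. a k \<ge> 0" "summable a" and b: "\<And>k. b k \<ge> 0" "summable b"
    and step: "\<And>k A R. k \<ge> K \<Longrightarrow> A \<in> sets (F k) \<Longrightarrow> A \<subseteq> J k \<Longrightarrow> (\<And>\<omega>. \<omega> \<in> A \<Longrightarrow> Z k \<omega> \<le> R) \<Longrightarrow>
        integrable M (\<lambda>\<omega>. indicator A \<omega> * Z (Suc k) \<omega>) \<and>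
        (\<integral>\<omega>. indicator A \<omega> * Z (Suc k) \<omega> \<partial>M) \<le> (1 + a k) * (\<integral>\<omega>. indicator A \<omega> * Z k \<omega> \<partial>M) + b k * prob A"
  shows "AE \<omega> in M. (\<forall>k\<ge>K. \<omega> \<in> J k) \<longrightarrow> (\<exists>B. \<forall>k\<ge>K. Z k \<omega> \<le> B)"
proof -
  define v where "v k = inverse (\<Prod>j<k. 1 + a j)" for k
  have apos: "1 + a j > 0" for j using a(1)[of j] by linarith
  have prodpos: "(\<Prod>j<k. 1 + a j) > 0" for k by (rule prod_pos) (use apos in auto)
  have vpos: "v k > 0" for k using prodpos[of k] by (simp add: v_def)
  have vS: "v (Suc k) * (1 + a k) = v k" for k
    using apos[of k] by (simp add: v_def)
  define c where "c = exp (- suminf a)"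
  have cpos: "c > 0" by (simp add: c_def)
  have vge: "v k \<ge> c" for k
  proof -
    have "(\<Prod>j<k. 1 + a j) \<le> (\<Prod>j<k. exp (a j))"
      by (intro prod_mono) (use a(1) in \<open>auto simp: add_nonneg_nonneg exp_ge_add_one_self\<close>)
    also have "\<dots> = exp (\<Sum>j<k. a j)" by (simp add: exp_sum)
    also have "\<dots> \<le> exp (suminf a)" using sum_le_suminf[OF a(2), of "{..<k}"] a(1) by simp
    finally show ?thesis unfolding v_def c_def exp_minus
      by (intro le_imp_inverse_le) (use prodpos in auto)
  qed
  have vle: "v k \<le> 1" for k
  proof -
    have "1 \<le> (\<Prod>j<k. 1 + a j)" by (rule prod_ge_1) (use a in auto)
    then show ?thesis by (simp add: v_def inverse_le_1_iff)
  qed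
  define t where "t k = suminf (\<lambda>j. v (Suc (j + k)) * b (j + k))" for k
  have sm: "summable (\<lambda>j. v (Suc (j + k)) * b (j + k))" for k
  proof (rule summable_comparison_test')
    show "summable (\<lambda>j. b (j + k))" using b(2) by (rule summable_ignore_initial_segment)
    fix j
    have "v (Suc (j + k)) * b (j + k) \<le> 1 * b (j + k)"
      by (rule mult_right_mono) (use vle b in auto)
    moreover have "0 \<le> v (Suc (j + k)) * b (j + k)"
      using vpos[of "Suc (j + k)"] b(1)[of "j + k"] by simp
    ultimately show "norm (v (Suc (j + k)) * b (j + k)) \<le> b (j + k)" by simp
  qed
  have tS: "t k = v (Suc k) * b k + t (Suc k)" for k
    using suminf_split_head[OF sm[of k]] by (simp add: t_def)
  have tpos: "t k \<ge> 0" for k unfolding t_def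
    by (rule suminf_nonneg[OF sm]) (use vpos[THEN less_imp_le] b in auto)
  define Y where "Y k \<omega> = v (K + k) * Z (K + k) \<omega> + t (K + k)" for k \<omega>
  have "AE \<omega> in M. (\<forall>k. \<omega> \<in> J (K + k)) \<longrightarrow> (\<exists>B. \<forall>k. Y k \<omega> \<le> B)"
  proof (rule nonneg_supermartingale_bounded[where F = "\<lambda>k. F (K + k)"])
    show "subalgebra M (F (K + k))" for k by (rule sub)
    show "sets (F (K + j)) \<subseteq> sets (F (K + k))" if "j \<le> k" for j k by (rule mono) (use that in simp)
    show "Y k \<in> borel_measurable (F (K + k))" for k
      unfolding Y_def using meas[of "K + k"] by measurable
    show "0 \<le> Y k \<omega>" for k \<omega>
      using vpos[of "K + k"] nn[of "K + k" \<omega>] tpos[of "K + k"] by (simp add: Y_def)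
    show "J (K + k) \<in> sets (F (K + k))" for k by (rule J) simp
    fix k A R assume A: "A \<in> sets (F (K + k))" "A \<subseteq> J (K + k)" and R: "\<And>\<omega>. \<omega> \<in> A \<Longrightarrow> Y k \<omega> \<le> R"
    let ?k = "K + k"
    have [measurable]: "A \<in> sets M" using A sub[of ?k] by (auto simp: subalgebra_def)
    have [measurable]: "Z ?k \<in> borel_measurable M"
      by (rule measurable_from_subalg[OF sub meas]) simp
    have bnd: "Z ?k \<omega> \<le> R / v ?k" if "\<omega> \<in> A" for \<omega>
      using R[OF that] tpos[of ?k] vpos[of ?k] by (simp add: Y_def field_simps)
    have i1: "integrable M (\<lambda>\<omega>. indicator A \<omega> * Z (Suc ?k) \<omega>)"
      and i2: "(\<integral>\<omega>. indicator A \<omega> * Z (Suc ?k) \<omega> \<partial>M) \<le> (1 + a ?k) * (\<integral>\<omega>. indicator A \<omega> * Z ?k \<omega> \<partial>M) + b ?k * prob A"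
      using step[OF _ A bnd] by auto
    have i0: "integrable M (\<lambda>\<omega>. indicator A \<omega> * Z ?k \<omega>)"
    proof (rule integrable_const_bound[where B = "\<bar>R / v ?k\<bar>"])
      have "norm (indicator A \<omega> * Z ?k \<omega>) \<le> \<bar>R / v ?k\<bar>" for \<omega>
      proof (cases "\<omega> \<in> A")
        case True
        have "Z ?k \<omega> \<le> \<bar>R / v ?k\<bar>" using bnd[OF True] abs_ge_self order.trans by blast
        then show ?thesis using True nn[of ?k \<omega>] by simp
      qed simp
      then show "AE \<omega> in M. norm (indicator A \<omega> * Z ?k \<omega>) \<le> \<bar>R / v ?k\<bar>" by simp
    qed simp
    have eqS: "indicator A \<omega> * Y (Suc k) \<omega> = v (Suc ?k) * (indicator A \<omega> * Z (Suc ?k) \<omega>) + t (Suc ?k) * indicator A \<omega>" for \<omega>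
      by (simp add: Y_def algebra_simps)
    have eq0: "indicator A \<omega> * Y k \<omega> = v ?k * (indicator A \<omega> * Z ?k \<omega>) + t ?k * indicator A \<omega>" for \<omega>
      by (simp add: Y_def algebra_simps)
    have "(\<integral>\<omega>. indicator A \<omega> * Y (Suc k) \<omega> \<partial>M) = v (Suc ?k) * (\<integral>\<omega>. indicator A \<omega> * Z (Suc ?k) \<omega> \<partial>M) + t (Suc ?k) * prob A"
      unfolding eqS using i1 integrable_indicator_prob[of A] by (subst Bochner_Integration.integral_add) auto
    also have "\<dots> \<le> v (Suc ?k) * ((1 + a ?k) * (\<integral>\<omega>. indicator A \<omega> * Z ?k \<omega> \<partial>M) + b ?k * prob A) + t (Suc ?k) * prob A"
      using i2 vpos[of "Suc ?k"] by (intro add_right_mono mult_left_mono) auto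
    also have "\<dots> = v ?k * (\<integral>\<omega>. indicator A \<omega> * Z ?k \<omega> \<partial>M) + t ?k * prob A"
      unfolding vS[of ?k, symmetric] tS[of ?k] by (simp add: algebra_simps)
    also have "\<dots> = (\<integral>\<omega>. indicator A \<omega> * Y k \<omega> \<partial>M)"
      unfolding eq0 using i0 integrable_indicator_prob[of A] by (subst Bochner_Integration.integral_add) auto
    finally show "integrable M (\<lambda>\<omega>. indicator A \<omega> * Y (Suc k) \<omega>) \<and>
        (\<integral>\<omega>. indicator A \<omega> * Y (Suc k) \<omega> \<partial>M) \<le> (\<integral>\<omega>. indicator A \<omega> * Y k \<omega> \<partial>M)"
      unfolding eqS using i1 integrable_indicator_prob[of A] by auto
  qed
  then show ?thesis
  proof (rule AE_mp, intro AE_I2 impI)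
    fix \<omega> assume *: "(\<forall>k. \<omega> \<in> J (K + k)) \<longrightarrow> (\<exists>B. \<forall>k. Y k \<omega> \<le> B)" "\<forall>k\<ge>K. \<omega> \<in> J k"
    then obtain B where B: "\<And>k. Y k \<omega> \<le> B" by auto
    have "Z k \<omega> \<le> B / c" if "k \<ge> K" for k
    proof -
      have "c * Z k \<omega> \<le> v k * Z k \<omega>" by (rule mult_right_mono) (use vge nn that in auto)
      also have "\<dots> \<le> B" using B[of "k - K"] tpos[of k] that by (simp add: Y_def)
      finally show ?thesis using cpos by (simp add: field_simps)
    qed
    then show "\<exists>B. \<forall>k\<ge>K. Z k \<omega> \<le> B" by blast
  qed
qed

text \<open>Because q = (2 - q) * 1 + (q - 1) * 2, the left side is a weighted geometric mean of s
  and s^2, and convexity of exp puts it below the arithmetic mean. This yields a second-order bound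
  for powers without differentiating them.\<close>

lemma powr_le_interpolation:
  fixes s q :: real
  assumes "1 \<le> q" "q \<le> 2" "s \<ge> 0"
  shows "s powr q \<le> (q - 1) * s\<^sup>2 + (2 - q) * s"
proof (cases "s = 0")
  case False
  have "convex_on UNIV (\<lambda>x::real. exp x)" by (rule exp_convex)
  from convex_onD[OF this, of "q - 1" "ln s" "2 * ln s"]
  have "exp ((2 - q) * ln s + (q - 1) * (2 * ln s)) \<le> (2 - q) * exp (ln s) + (q - 1) * exp (2 * ln s)"
    using assms by simp
  also have "(2 - q) * ln s + (q - 1) * (2 * ln s) = q * ln s" by (simp add: algebra_simps)
  also have "exp (2 * ln s) = s\<^sup>2" using False assms(3) by (simp add: exp_double)
  finally show ?thesis using False assms(3) by (simp add: powr_def)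
qed simp

text \<open>The first-order term in D + m is kept exactly, because \<open>m\<close> will integrate
  to zero against \<open>A powr (q - 1)\<close>; everything else goes into the three error terms.
  For \<open>\<eta> \<le> A\<close> the relative increment is expanded to second order; for
  \<open>\<eta> > A\<close> all quantities are bounded by multiples of
  \<open>\<eta>\<close>.\<close>

lemma power_step:
  fixes A D m s \<eta> e q :: real
  assumes q: "1 < q" "q \<le> 2" and A: "0 \<le> A" and nn: "0 \<le> A + D + m + s"
    and D: "D\<^sup>2 \<le> e * A\<^sup>2" and m: "m\<^sup>2 \<le> 8 * A * \<eta>" and s: "0 \<le> s" "s \<le> e * A + 2 * \<eta>"
    and e: "0 \<le> e" "e \<le> 1" and \<eta>: "0 \<le> \<eta>"
  shows "(A + D + m + s) powr q \<le> A powr q + q * A powr (q - 1) * (D + m)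
    + 72 * (e * A powr q + A powr (q - 1) * \<eta> + \<eta> powr q)"
proof -
  have absD: "\<bar>D\<bar> \<le> A"
  proof -
    have "D\<^sup>2 \<le> 1 * A\<^sup>2" using D e mult_right_mono[of e 1 "A\<^sup>2"] by simp
    then show ?thesis using A by (simp add: abs_le_square_iff[symmetric])
  qed
  consider "A = 0" | "A > 0" "\<eta> \<le> A" | "A > 0" "\<eta> > A" using A by linarith
  then show ?thesis
  proof cases
    case 1
    then have "D = 0" "m = 0" using D m by auto
    then have "(A + D + m + s) powr q \<le> (2 * \<eta>) powr q" using 1 s q by (intro powr_mono2) auto
    also have "\<dots> = 2 powr q * \<eta> powr q" using \<eta> by (simp add: powr_mult)
    also have "\<dots> \<le> 72 * \<eta> powr q"
    proof (rule mult_right_mono)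
      have "(2::real) powr q \<le> 2 powr 2" using q by (intro powr_mono) auto
      then show "(2::real) powr q \<le> 72" by simp
    qed simp
    finally show ?thesis using 1 q by simp
  next
    case 2
    \<comment> \<open>Relative increment: the q-th power of 1 + t is at most 1 + q t + t^2, and the
      squares of \<open>D\<close>, \<open>m\<close>, \<open>s\<close> control the last term.\<close>
    define t where "t = (D + m + s) / A"
    define P where "P = A powr (q - 1)"
    have P: "P \<ge> 0" by (simp add: P_def)
    have PA: "A powr q = P * A" using 2 powr_add[of A "q - 1" 1] by (simp add: P_def)
    have eq: "A + D + m + s = A * (1 + t)" using 2 by (simp add: t_def field_simps)
    have t: "0 \<le> 1 + t" using nn 2 by (simp add: eq zero_le_mult_iff)
    have "(A + D + m + s) powr q = A powr q * (1 + t) powr q"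
      unfolding eq using 2 t by (simp add: powr_mult)
    also have "(1 + t) powr q \<le> (q - 1) * (1 + t)\<^sup>2 + (2 - q) * (1 + t)"
      using q t by (intro powr_le_interpolation) auto
    also have "\<dots> = 1 + q * t + (q - 1) * t\<^sup>2" by (simp add: power2_eq_square algebra_simps)
    also have "\<dots> \<le> 1 + q * t + 1 * t\<^sup>2" using q by (intro add_left_mono mult_right_mono) auto
    finally have "(A + D + m + s) powr q \<le> A powr q * (1 + q * t + t\<^sup>2)"
      by (simp add: mult_left_mono)
    also have "\<dots> = A powr q + q * P * (D + m) + q * P * s + P * ((D + m + s)\<^sup>2 / A)"
      unfolding PA t_def using 2 by (simp add: field_simps power2_eq_square)
    also have "q * P * s \<le> P * (2 * e * A + 4 * \<eta>)"
    proof -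
      have "q * s \<le> 2 * (e * A + 2 * \<eta>)" using q s by (intro mult_mono) auto
      then have "P * (q * s) \<le> P * (2 * e * A + 4 * \<eta>)" using P by (intro mult_left_mono) (auto simp: algebra_simps)
      then show ?thesis by (simp add: mult_ac)
    qed
    also have "P * ((D + m + s)\<^sup>2 / A) \<le> P * (9 * e * A + 48 * \<eta>)"
    proof (rule mult_left_mono[OF _ P])
      have "(D + m + s)\<^sup>2 \<le> 3 * (D\<^sup>2 + m\<^sup>2 + s\<^sup>2)"
        using zero_le_power2[of "D - m"] zero_le_power2[of "D - s"] zero_le_power2[of "m - s"]
        by (simp add: power2_eq_square algebra_simps)
      also have "s\<^sup>2 \<le> 2 * e * A\<^sup>2 + 8 * A * \<eta>"
      proof -
        have "s\<^sup>2 \<le> (e * A + 2 * \<eta>)\<^sup>2" using s by (intro power_mono) auto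
        also have "\<dots> \<le> 2 * (e * A)\<^sup>2 + 2 * (2 * \<eta>)\<^sup>2"
          using zero_le_power2[of "e * A - 2 * \<eta>"] by (simp add: power2_eq_square algebra_simps)
        also have "(e * A)\<^sup>2 \<le> e * A\<^sup>2"
          using e A mult_right_mono[of "e * e" e "A * A"] mult_left_mono[of e 1 e] by (simp add: power2_eq_square mult_ac)
        also have "(2 * \<eta>)\<^sup>2 \<le> 4 * A * \<eta>" using 2 \<eta> mult_right_mono[of \<eta> A \<eta>] by (simp add: power2_eq_square)
        finally show ?thesis by (simp add: algebra_simps)
      qed
      finally have "(D + m + s)\<^sup>2 \<le> (9 * e * A + 48 * \<eta>) * A" using D m by (simp add: power2_eq_square algebra_simps)
      then show "(D + m + s)\<^sup>2 / A \<le> 9 * e * A + 48 * \<eta>" using 2 by (simp add: field_simps)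
    qed
    finally have "(A + D + m + s) powr q \<le> A powr q + q * P * (D + m) + P * (11 * e * A + 52 * \<eta>)"
      by (simp add: algebra_simps)
    also have "P * (11 * e * A + 52 * \<eta>) \<le> P * (72 * e * A + 72 * \<eta>)"
    proof (rule mult_left_mono[OF _ P])
      have "0 \<le> e * A" using e A by simp
      then show "11 * e * A + 52 * \<eta> \<le> 72 * e * A + 72 * \<eta>" using \<eta> by (simp only: mult.assoc)
    qed
    finally have "(A + D + m + s) powr q \<le> A powr q + q * P * (D + m) + P * (72 * e * A + 72 * \<eta>)" by simp
    also have "P * (72 * e * A + 72 * \<eta>) \<le> 72 * (e * A powr q + P * \<eta> + \<eta> powr q)"
      unfolding PA by (simp add: algebra_simps)
    finally show ?thesis by (simp add: P_def)
  next
    \<comment> \<open>The constant 72 is fixed here: the left side costs 64, and the first-order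
      term on the right, possibly negative, costs another 8.\<close>
    case 3
    have e\<eta>: "\<eta> powr q = \<eta> powr (q - 1) * \<eta>" using 3 powr_add[of \<eta> "q - 1" 1] by simp
    have "m\<^sup>2 \<le> (3 * \<eta>)\<^sup>2"
    proof -
      have "8 * A * \<eta> \<le> 9 * \<eta> * \<eta>" using 3 by (intro mult_right_mono) auto
      then show ?thesis using m by (simp add: power2_eq_square)
    qed
    then have "\<bar>m\<bar> \<le> \<bar>3 * \<eta>\<bar>" by (simp only: abs_le_square_iff)
    then have absm: "\<bar>m\<bar> \<le> 3 * \<eta>" using \<eta> by simp
    have "e * A \<le> \<eta>" using mult_right_mono[of e 1 A] e A 3 by linarith
    then have "A + D + m + s \<le> 8 * \<eta>" using absD absm s 3 by linarith
    then have "(A + D + m + s) powr q \<le> (8 * \<eta>) powr q" using nn q by (intro powr_mono2) auto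
    also have "\<dots> = 8 powr q * \<eta> powr q" using \<eta> by (simp add: powr_mult)
    also have "\<dots> \<le> 64 * \<eta> powr q"
    proof (rule mult_right_mono)
      have "(8::real) powr q \<le> 8 powr 2" using q by (intro powr_mono) auto
      then show "(8::real) powr q \<le> 64" by simp
    qed simp
    finally have 1: "(A + D + m + s) powr q \<le> 64 * \<eta> powr q" .
    have "- (q * A powr (q - 1) * (D + m)) \<le> q * A powr (q - 1) * (4 * \<eta>)"
    proof -
      have "- (D + m) \<le> 4 * \<eta>" using absD absm 3 by linarith
      then have "q * A powr (q - 1) * (- (D + m)) \<le> q * A powr (q - 1) * (4 * \<eta>)"
        using q by (intro mult_left_mono) auto
      then show ?thesis by (simp only: mult_minus_right)
    qed
    also have "\<dots> \<le> 2 * \<eta> powr (q - 1) * (4 * \<eta>)"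
      using q 3 by (intro mult_right_mono mult_mono powr_mono2) auto
    also have "\<dots> = 8 * \<eta> powr q" by (simp add: e\<eta>)
    finally have 2: "- (q * A powr (q - 1) * (D + m)) \<le> 8 * \<eta> powr q" .
    define S where "S = q * A powr (q - 1) * (D + m)"
    have "0 \<le> e * A powr q" "0 \<le> A powr (q - 1) * \<eta>" "0 \<le> A powr q" using e \<eta> by auto
    then show ?thesis using 1 2[folded S_def] unfolding S_def[symmetric] by argo
  qed
qed

text \<open>Cauchy condensation turns the series into one dominated by a multiple of the sum of n
  powr (-q). The shifts keep every denominator positive from k = 0 on.\<close>

lemma summable_inverse_mult_ln_powr:
  fixes q :: real
  assumes "1 < q"
  shows "summable (\<lambda>k. 1 / (real (k + 1) * ln (real (k + 2)) powr q))"
proof -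
  let ?f = "\<lambda>k. 1 / (real (k + 1) * ln (real (k + 2)) powr q)"
  have "summable (\<lambda>n. 2 ^ n * ?f (2 ^ n))"
  proof (rule summable_comparison_test')
    have "summable (\<lambda>n. real n powr (- q))" using assms by (subst summable_real_powr_iff) auto
    then show "summable (\<lambda>n. ln 2 powr (- q) * real n powr (- q))" by (rule summable_mult)
    fix n :: nat assume n: "n \<ge> 1"
    have "ln 2 * real n = ln (2 ^ n)" by (simp add: ln_realpow)
    also have "\<dots> \<le> ln (real (2 ^ n + 2))" by (subst ln_le_cancel_iff) (auto simp: add_pos_pos)
    finally have l: "ln 2 * real n \<le> ln (real (2 ^ n + 2))" .
    have pos: "0 < ln 2 * real n" using n by simp
    have "(2::real) ^ n * ?f (2 ^ n) = (2 ^ n / (2 ^ n + 1)) * (1 / ln (real (2 ^ n + 2)) powr q)" by simp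
    also have "\<dots> \<le> 1 * (1 / (ln 2 * real n) powr q)"
    proof (intro mult_mono divide_left_mono powr_mono2)
      have "0 < ln (real (2 ^ n + 2))" using pos l by linarith
      then show "0 < ln (real (2 ^ n + 2)) powr q * (ln 2 * real n) powr q"
        using pos by (metis mult_pos_pos powr_gt_zero less_irrefl)
      show "(2::real) ^ n / (2 ^ n + 1) \<le> 1" by (subst divide_le_eq_1_pos) (auto simp: add_pos_pos)
    qed (use pos l assms in auto)
    also have "\<dots> = ln 2 powr (- q) * real n powr (- q)"
      by (simp add: powr_minus powr_mult divide_inverse)
    finally show "norm ((2::real) ^ n * ?f (2 ^ n)) \<le> ln 2 powr (- q) * real n powr (- q)"
      by simp
  qed
  moreover have "summable ?f \<longleftrightarrow> summable (\<lambda>n. 2 ^ n * ?f (2 ^ n))"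
  proof (rule condensation_test)
    fix m :: nat
    show "?f (Suc m) \<le> ?f m"
      by (intro divide_left_mono mult_mono powr_mono2) (use assms in auto)
  qed auto
  ultimately show ?thesis by blast
qed

text \<open>
  An abstract Lyapunov process: on the localising events \<open>J k\<close> the increment of \<open>A\<close> splits into a drift \<open>D\<close>,
  a martingale part \<open>m\<close> and a remainder of the size of the squared noise \<open>\<eta>\<close>. The last two assumptions
  express conditional expectations by testing against bounded \<open>F k\<close>-measurable functions.
\<close>

locale lyapunov_process = prob_space M for M :: "'a measure" +
  fixes F :: "nat \<Rightarrow> 'a measure" and J :: "nat \<Rightarrow> 'a set"
    and A D m \<eta> :: "nat \<Rightarrow> 'a \<Rightarrow> real" and K :: nat and q a :: real and e \<sigma> \<tau> :: "nat \<Rightarrow> real"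
  assumes sub: "\<And>k. subalgebra M (F k)" and mono: "\<And>j k. j \<le> k \<Longrightarrow> sets (F j) \<subseteq> sets (F k)"
    and q: "1 < q" "q \<le> 2" and a: "0 \<le> a"
    and A_meas: "\<And>k. k \<ge> K \<Longrightarrow> A k \<in> borel_measurable (F k)"
    and D_meas: "\<And>k. k \<ge> K \<Longrightarrow> D k \<in> borel_measurable (F k)"
    and m_meas: "\<And>k. k \<ge> K \<Longrightarrow> m k \<in> borel_measurable M"
    and \<eta>_meas: "\<And>k. k \<ge> K \<Longrightarrow> \<eta> k \<in> borel_measurable M"
    and A_nn: "\<And>k \<omega>. k \<ge> K \<Longrightarrow> 0 \<le> A k \<omega>"
    and \<eta>_nn: "\<And>k \<omega>. k \<ge> K \<Longrightarrow> 0 \<le> \<eta> k \<omega>"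
    and J_sets: "\<And>k. k \<ge> K \<Longrightarrow> J k \<in> sets (F k)"
    and e: "\<And>k. 0 \<le> e k" "\<And>k. e k \<le> 1" "summable e"
    and \<sigma>_nn: "\<And>k. 0 \<le> \<sigma> k" and \<tau>_nn: "\<And>k. 0 \<le> \<tau> k"
    and D_sq: "\<And>k \<omega>. k \<ge> K \<Longrightarrow> \<omega> \<in> J k \<Longrightarrow> (D k \<omega>)\<^sup>2 \<le> e k * (A k \<omega>)\<^sup>2"
    and drift: "\<And>k \<omega>. k \<ge> K \<Longrightarrow> \<omega> \<in> J k \<Longrightarrow> D k \<omega> \<le> (e k - 2 * a / real (Suc k)) * A k \<omega>"
    and m_sq: "\<And>k \<omega>. k \<ge> K \<Longrightarrow> \<omega> \<in> J k \<Longrightarrow> (m k \<omega>)\<^sup>2 \<le> 8 * A k \<omega> * \<eta> k \<omega>"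
    and rest: "\<And>k \<omega>. k \<ge> K \<Longrightarrow> \<omega> \<in> J k \<Longrightarrow> 0 \<le> A (Suc k) \<omega> - A k \<omega> - D k \<omega> - m k \<omega>"
      "\<And>k \<omega>. k \<ge> K \<Longrightarrow> \<omega> \<in> J k \<Longrightarrow> A (Suc k) \<omega> - A k \<omega> - D k \<omega> - m k \<omega> \<le> e k * A k \<omega> + 2 * \<eta> k \<omega>"
    and mart: "\<And>k Y B. k \<ge> K \<Longrightarrow> Y \<in> borel_measurable (F k) \<Longrightarrow> (\<And>\<omega>. \<bar>Y \<omega>\<bar> \<le> B) \<Longrightarrow>
        (\<And>\<omega>. Y \<omega> \<noteq> 0 \<Longrightarrow> \<omega> \<in> J k \<and> A k \<omega> \<le> B) \<Longrightarrow>
        integrable M (\<lambda>\<omega>. Y \<omega> * m k \<omega>) \<and> (\<integral>\<omega>. Y \<omega> * m k \<omega> \<partial>M) = 0"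
    and mom: "\<And>k Y B. k \<ge> K \<Longrightarrow> Y \<in> borel_measurable (F k) \<Longrightarrow> (\<And>\<omega>. 0 \<le> Y \<omega>) \<Longrightarrow> (\<And>\<omega>. Y \<omega> \<le> B) \<Longrightarrow>
        (\<And>\<omega>. Y \<omega> \<noteq> 0 \<Longrightarrow> \<omega> \<in> J k) \<Longrightarrow>
        integrable M (\<lambda>\<omega>. Y \<omega> * \<eta> k \<omega>) \<and> (\<integral>\<omega>. Y \<omega> * \<eta> k \<omega> \<partial>M) \<le> \<sigma> k * (\<integral>\<omega>. Y \<omega> \<partial>M) \<and>
        integrable M (\<lambda>\<omega>. Y \<omega> * \<eta> k \<omega> powr q) \<and> (\<integral>\<omega>. Y \<omega> * \<eta> k \<omega> powr q \<partial>M) \<le> \<tau> k * (\<integral>\<omega>. Y \<omega> \<partial>M)"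
begin

lemma A_measM: "k \<ge> K \<Longrightarrow> A k \<in> borel_measurable M"
  by (rule measurable_from_subalg[OF sub A_meas])

text \<open>\<open>power_step\<close> integrated over an event \<open>G\<close> known at time k with
  \<open>A k\<close> bounded on it. The bounded weight \<open>P\<close> is admissible in
  \<open>mart\<close>, which removes \<open>m\<close>, and in \<open>mom\<close>, which replaces the
  noise by \<open>\<sigma> k\<close> and \<open>\<tau> k\<close>.\<close>

lemma moment_step:
  assumes k: "k \<ge> K" and G: "G \<in> sets (F k)" "G \<subseteq> J k" and R: "\<And>\<omega>. \<omega> \<in> G \<Longrightarrow> A k \<omega> \<le> R"
  shows "integrable M (\<lambda>\<omega>. indicator G \<omega> * A (Suc k) \<omega> powr q)"
    and "integrable M (\<lambda>\<omega>. indicator G \<omega> * ((1 - 2 * q * a / real (Suc k) + 74 * e k) * A k \<omega> powr q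
          + 72 * \<sigma> k * A k \<omega> powr (q - 1) + 72 * \<tau> k))"
    and "(\<integral>\<omega>. indicator G \<omega> * A (Suc k) \<omega> powr q \<partial>M) \<le>
      (\<integral>\<omega>. indicator G \<omega> * ((1 - 2 * q * a / real (Suc k) + 74 * e k) * A k \<omega> powr q
          + 72 * \<sigma> k * A k \<omega> powr (q - 1) + 72 * \<tau> k) \<partial>M)"
proof -
  have [measurable]: "A k \<in> borel_measurable (F k)" "D k \<in> borel_measurable (F k)" "G \<in> sets (F k)"
    using A_meas D_meas k G by auto
  have GM[measurable]: "G \<in> sets M" using G sub[of k] by (auto simp: subalgebra_def)
  have [measurable]: "A k \<in> borel_measurable M" "A (Suc k) \<in> borel_measurable M"
    "m k \<in> borel_measurable M" "\<eta> k \<in> borel_measurable M"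
    using A_measM m_meas \<eta>_meas k by auto
  define I :: "'a \<Rightarrow> real" where "I = indicator G"
  define P where "P \<omega> = I \<omega> * A k \<omega> powr (q - 1)" for \<omega>
  \<comment> \<open>At least 1, so that the single bound R'^2 covers all powers of
    \<open>A k\<close> with exponents between 0 and 2.\<close>
  define R' where "R' = max 1 \<bar>R\<bar>"
  have R'1: "R' \<ge> 1" by (simp add: R'_def)
  have AR: "A k \<omega> \<le> R'" if "\<omega> \<in> G" for \<omega> using R[OF that] by (simp add: R'_def)
  have Apow: "A k \<omega> powr r \<le> R'\<^sup>2" if "\<omega> \<in> G" "0 \<le> r" "r \<le> 2" for \<omega> r
  proof -
    have "A k \<omega> powr r \<le> R' powr r" using AR[OF that(1)] A_nn[OF k] that by (intro powr_mono2) auto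
    also have "\<dots> \<le> R' powr 2" using R'1 that by (intro powr_mono) auto
    finally show ?thesis using R'1 by simp
  qed
  have R'2: "R' \<le> R'\<^sup>2" using R'1 by (simp add: power2_eq_square)
  have mI: "I \<in> borel_measurable (F k)" by (simp add: I_def)
  have mP: "P \<in> borel_measurable (F k)" unfolding P_def[abs_def] I_def by measurable
  have [measurable]: "I \<in> borel_measurable M" "P \<in> borel_measurable M"
    using mI mP measurable_from_subalg[OF sub] by auto
  have Inn: "0 \<le> I \<omega>" and Ile: "I \<omega> \<le> 1" for \<omega> by (auto simp: I_def indicator_def)
  have Pnn: "0 \<le> P \<omega>" for \<omega> using Inn by (simp add: P_def)
  have Ple: "P \<omega> \<le> R'\<^sup>2" for \<omega>
    using Apow[of \<omega> "q - 1"] q by (auto simp: P_def I_def indicator_def)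
  have supp: "\<omega> \<in> G" if "P \<omega> \<noteq> 0 \<or> I \<omega> \<noteq> 0" for \<omega> using that by (auto simp: P_def I_def indicator_def split: if_splits)
  have mt: "integrable M (\<lambda>\<omega>. P \<omega> * m k \<omega>)" "(\<integral>\<omega>. P \<omega> * m k \<omega> \<partial>M) = 0"
  proof -
    have "integrable M (\<lambda>\<omega>. P \<omega> * m k \<omega>) \<and> (\<integral>\<omega>. P \<omega> * m k \<omega> \<partial>M) = 0"
    proof (rule mart[OF k mP, where B = "R'\<^sup>2"])
      show "\<bar>P \<omega>\<bar> \<le> R'\<^sup>2" for \<omega> using Pnn Ple by simp
      show "\<omega> \<in> J k \<and> A k \<omega> \<le> R'\<^sup>2" if "P \<omega> \<noteq> 0" for \<omega>
      proof -
        have "\<omega> \<in> G" using supp that by blast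
        then show ?thesis using G AR[of \<omega>] R'2 by auto
      qed
    qed
    then show "integrable M (\<lambda>\<omega>. P \<omega> * m k \<omega>)" "(\<integral>\<omega>. P \<omega> * m k \<omega> \<partial>M) = 0" by auto
  qed
  have mP1: "integrable M (\<lambda>\<omega>. P \<omega> * \<eta> k \<omega>)" "(\<integral>\<omega>. P \<omega> * \<eta> k \<omega> \<partial>M) \<le> \<sigma> k * (\<integral>\<omega>. P \<omega> \<partial>M)"
    using mom[OF k mP Pnn Ple] supp G by auto
  have mI1: "integrable M (\<lambda>\<omega>. I \<omega> * \<eta> k \<omega> powr q)" "(\<integral>\<omega>. I \<omega> * \<eta> k \<omega> powr q \<partial>M) \<le> \<tau> k * (\<integral>\<omega>. I \<omega> \<partial>M)"
    using mom[OF k mI Inn Ile] supp G by auto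
  have iI: "integrable M I"
    by (rule integrable_const_bound[where B = 1]) (use Inn Ile in auto)
  have iP: "integrable M P"
    by (rule integrable_const_bound[where B = "R'\<^sup>2"]) (use Pnn Ple in auto)
  have iQ: "integrable M (\<lambda>\<omega>. I \<omega> * A k \<omega> powr q)"
  proof (rule integrable_const_bound[where B = "R'\<^sup>2"])
    have "norm (I \<omega> * A k \<omega> powr q) \<le> R'\<^sup>2" for \<omega>
      using Apow[of \<omega> q] q by (auto simp: I_def indicator_def)
    then show "AE \<omega> in M. norm (I \<omega> * A k \<omega> powr q) \<le> R'\<^sup>2" by simp
  qed measurable
  \<comment> \<open>74 = 72 + 2: the drift contributes a further \<open>q * e k\<close>, which is at
    most \<open>2 * e k\<close>.\<close>
  define c where "c = 1 - 2 * q * a / real (Suc k) + 74 * e k"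
  let ?rhs = "\<lambda>\<omega>. c * (I \<omega> * A k \<omega> powr q) + q * (P \<omega> * m k \<omega>) + 72 * (P \<omega> * \<eta> k \<omega>) + 72 * (I \<omega> * \<eta> k \<omega> powr q)"
  have pw: "I \<omega> * A (Suc k) \<omega> powr q \<le> ?rhs \<omega>" for \<omega>
  proof (cases "\<omega> \<in> G")
    case True
    then have wJ: "\<omega> \<in> J k" using G by auto
    let ?s = "A (Suc k) \<omega> - A k \<omega> - D k \<omega> - m k \<omega>"
    have "(A k \<omega> + D k \<omega> + m k \<omega> + ?s) powr q \<le> A k \<omega> powr q + q * A k \<omega> powr (q - 1) * (D k \<omega> + m k \<omega>)
      + 72 * (e k * A k \<omega> powr q + A k \<omega> powr (q - 1) * \<eta> k \<omega> + \<eta> k \<omega> powr q)"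
      by (rule power_step) (use q A_nn k A_nn[of "Suc k" \<omega>] D_sq m_sq rest wJ e \<eta>_nn in auto)
    moreover have "A k \<omega> powr (q - 1) * D k \<omega> \<le> (e k - 2 * a / real (Suc k)) * A k \<omega> powr q"
    proof -
      have "A k \<omega> powr (q - 1) * D k \<omega> \<le> A k \<omega> powr (q - 1) * ((e k - 2 * a / real (Suc k)) * A k \<omega>)"
        using drift[OF k wJ] by (intro mult_left_mono) auto
      also have "\<dots> = (e k - 2 * a / real (Suc k)) * (A k \<omega> powr (q - 1) * A k \<omega>)" by (simp only: mult_ac)
      also have "A k \<omega> powr (q - 1) * A k \<omega> = A k \<omega> powr q"
        using A_nn[OF k, of \<omega>] powr_add[of "A k \<omega>" "q - 1" 1] q by (cases "A k \<omega> = 0") auto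
      finally show ?thesis .
    qed
    then have "q * (A k \<omega> powr (q - 1) * D k \<omega>) \<le> q * ((e k - 2 * a / real (Suc k)) * A k \<omega> powr q)"
      using q by (intro mult_left_mono) auto
    moreover have "q * e k * A k \<omega> powr q \<le> 2 * e k * A k \<omega> powr q"
      using q e by (intro mult_right_mono) auto
    ultimately show ?thesis using True
      by (simp add: I_def P_def c_def algebra_simps diff_divide_distrib add_divide_distrib del: of_nat_Suc)
  qed (auto simp: I_def P_def)
  have irhs: "integrable M ?rhs" using iQ mt mP1 mI1 by auto
  have i1: "integrable M (\<lambda>\<omega>. I \<omega> * A (Suc k) \<omega> powr q)"
  proof (rule Bochner_Integration.integrable_bound[OF irhs])
    have "norm (I \<omega> * A (Suc k) \<omega> powr q) \<le> norm (?rhs \<omega>)" for \<omega>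
      using pw[of \<omega>] Inn[of \<omega>] by (simp add: abs_mult)
    then show "AE \<omega> in M. norm (I \<omega> * A (Suc k) \<omega> powr q) \<le> norm (?rhs \<omega>)" by simp
  qed measurable
  then show "integrable M (\<lambda>\<omega>. indicator G \<omega> * A (Suc k) \<omega> powr q)" by (simp add: I_def)
  have eq: "indicator G \<omega> * (c * A k \<omega> powr q + 72 * \<sigma> k * A k \<omega> powr (q - 1) + 72 * \<tau> k)
      = c * (I \<omega> * A k \<omega> powr q) + 72 * \<sigma> k * P \<omega> + 72 * \<tau> k * I \<omega>" for \<omega>
    by (simp add: I_def P_def algebra_simps)
  show "integrable M (\<lambda>\<omega>. indicator G \<omega> * ((1 - 2 * q * a / real (Suc k) + 74 * e k) * A k \<omega> powr q
          + 72 * \<sigma> k * A k \<omega> powr (q - 1) + 72 * \<tau> k))"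
    unfolding c_def[symmetric] eq using iQ iP iI by auto
  have "(\<integral>\<omega>. I \<omega> * A (Suc k) \<omega> powr q \<partial>M) \<le> (\<integral>\<omega>. ?rhs \<omega> \<partial>M)"
    by (rule integral_mono[OF i1 irhs pw])
  also have "\<dots> = c * (\<integral>\<omega>. I \<omega> * A k \<omega> powr q \<partial>M) + q * (\<integral>\<omega>. P \<omega> * m k \<omega> \<partial>M)
      + 72 * (\<integral>\<omega>. P \<omega> * \<eta> k \<omega> \<partial>M) + 72 * (\<integral>\<omega>. I \<omega> * \<eta> k \<omega> powr q \<partial>M)"
    using iQ mt mP1 mI1 by simp
  also have "\<dots> \<le> c * (\<integral>\<omega>. I \<omega> * A k \<omega> powr q \<partial>M) + 72 * (\<sigma> k * (\<integral>\<omega>. P \<omega> \<partial>M)) + 72 * (\<tau> k * (\<integral>\<omega>. I \<omega> \<partial>M))"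
    using mt(2) mP1(2) mI1(2) by simp
  also have "\<dots> = (\<integral>\<omega>. c * (I \<omega> * A k \<omega> powr q) + 72 * \<sigma> k * P \<omega> + 72 * \<tau> k * I \<omega> \<partial>M)"
    using iQ iP iI by simp
  finally show "(\<integral>\<omega>. indicator G \<omega> * A (Suc k) \<omega> powr q \<partial>M) \<le>
      (\<integral>\<omega>. indicator G \<omega> * ((1 - 2 * q * a / real (Suc k) + 74 * e k) * A k \<omega> powr q
          + 72 * \<sigma> k * A k \<omega> powr (q - 1) + 72 * \<tau> k) \<partial>M)"
    unfolding c_def[symmetric] eq by (simp add: I_def)
qed

text \<open>The q-th power of \<open>\<psi> k * A k\<close> satisfies the almost supermartingale
  step as soon as \<open>ineq\<close> holds for every number x, so finding a rate becomes a
  deterministic question about the weight \<open>\<psi>\<close>.\<close>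

lemma weighted_bounded:
  fixes \<psi> u v :: "nat \<Rightarrow> real"
  assumes \<psi>: "\<And>k. k \<ge> K \<Longrightarrow> 0 < \<psi> k" and K': "K' \<ge> K"
    and u: "\<And>k. 0 \<le> u k" "summable u" and v: "\<And>k. 0 \<le> v k" "summable v"
    and ineq: "\<And>k x. k \<ge> K' \<Longrightarrow> 0 \<le> x \<Longrightarrow>
      \<psi> (Suc k) powr q * ((1 - 2 * q * a / real (Suc k) + 74 * e k) * x powr q + 72 * \<sigma> k * x powr (q - 1) + 72 * \<tau> k)
        \<le> (1 + u k) * (\<psi> k * x) powr q + v k"
  shows "AE \<omega> in M. (\<forall>k\<ge>K'. \<omega> \<in> J k) \<longrightarrow> (\<exists>B. \<forall>k\<ge>K'. \<psi> k * A k \<omega> \<le> B)"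
proof -
  define Z where "Z k \<omega> = (\<psi> k * A k \<omega>) powr q" for k \<omega>
  have "AE \<omega> in M. (\<forall>k\<ge>K'. \<omega> \<in> J k) \<longrightarrow> (\<exists>B. \<forall>k\<ge>K'. Z k \<omega> \<le> B)"
  proof (rule almost_supermartingale_bounded[OF sub mono _ _ _ u v])
    show "Z k \<in> borel_measurable (F k)" if "k \<ge> K'" for k
    proof -
      have [measurable]: "A k \<in> borel_measurable (F k)" using that K' by (intro A_meas) simp
      show ?thesis unfolding Z_def[abs_def] by measurable
    qed
    show "0 \<le> Z k \<omega>" for k \<omega> by (simp add: Z_def)
    show "J k \<in> sets (F k)" if "k \<ge> K'" for k using J_sets that K' by auto
    fix k G R assume k': "k \<ge> K'" and G: "G \<in> sets (F k)" "G \<subseteq> J k" and R: "\<And>\<omega>. \<omega> \<in> G \<Longrightarrow> Z k \<omega> \<le> R"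
    have k: "k \<ge> K" using k' K' by simp
    have [measurable]: "G \<in> sets M" using G sub[of k] by (auto simp: subalgebra_def)
    have [measurable]: "A k \<in> borel_measurable M" by (rule A_measM[OF k])
    \<comment> \<open>A bound on the weighted power bounds \<open>A k\<close> itself, as
      \<open>moment_step\<close> demands, because y is at most 1 + y^q.\<close>
    have AR: "A k \<omega> \<le> (1 + \<bar>R\<bar>) / \<psi> k" if "\<omega> \<in> G" for \<omega>
    proof -
      have nn: "0 \<le> \<psi> k * A k \<omega>" using \<psi>[OF k] A_nn[OF k, of \<omega>] by simp
      have "\<psi> k * A k \<omega> \<le> 1 + (\<psi> k * A k \<omega>) powr q"
      proof (cases "\<psi> k * A k \<omega> \<le> 1")
        case True
        then show ?thesis using powr_ge_zero[of "\<psi> k * A k \<omega>" q] by linarith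
      next
        case False
        then have "\<psi> k * A k \<omega> = (\<psi> k * A k \<omega>) powr 1" by simp
        also have "\<dots> \<le> (\<psi> k * A k \<omega>) powr q" using False q by (intro powr_mono) auto
        finally show ?thesis by simp
      qed
      also have "\<dots> \<le> 1 + \<bar>R\<bar>" using R[OF that] by (simp add: Z_def)
      finally show ?thesis using \<psi>[OF k] by (simp add: field_simps)
    qed
    note ms = moment_step[OF k G AR]
    have ZS: "indicator G \<omega> * Z (Suc k) \<omega> = \<psi> (Suc k) powr q * (indicator G \<omega> * A (Suc k) \<omega> powr q)" for \<omega>
      using \<psi>[of "Suc k"] A_nn[of "Suc k" \<omega>] k by (simp add: Z_def powr_mult)
    have i1: "integrable M (\<lambda>\<omega>. indicator G \<omega> * Z (Suc k) \<omega>)" unfolding ZS using ms(1) by auto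
    have iZ: "integrable M (\<lambda>\<omega>. indicator G \<omega> * Z k \<omega>)"
    proof (rule integrable_const_bound[where B = "\<bar>R\<bar>"])
      have "norm (indicator G \<omega> * Z k \<omega>) \<le> \<bar>R\<bar>" for \<omega>
        using R[of \<omega>] by (cases "\<omega> \<in> G") (auto simp: Z_def)
      then show "AE \<omega> in M. norm (indicator G \<omega> * Z k \<omega>) \<le> \<bar>R\<bar>" by simp
      show "(\<lambda>\<omega>. indicator G \<omega> * Z k \<omega>) \<in> borel_measurable M" unfolding Z_def by measurable
    qed
    have "(\<integral>\<omega>. indicator G \<omega> * Z (Suc k) \<omega> \<partial>M) = \<psi> (Suc k) powr q * (\<integral>\<omega>. indicator G \<omega> * A (Suc k) \<omega> powr q \<partial>M)"
      unfolding ZS by simp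
    also have "\<dots> \<le> \<psi> (Suc k) powr q * (\<integral>\<omega>. indicator G \<omega> * ((1 - 2 * q * a / real (Suc k) + 74 * e k) * A k \<omega> powr q
          + 72 * \<sigma> k * A k \<omega> powr (q - 1) + 72 * \<tau> k) \<partial>M)"
      by (intro mult_left_mono ms(3)) auto
    also have "\<dots> = (\<integral>\<omega>. \<psi> (Suc k) powr q * (indicator G \<omega> * ((1 - 2 * q * a / real (Suc k) + 74 * e k) * A k \<omega> powr q
          + 72 * \<sigma> k * A k \<omega> powr (q - 1) + 72 * \<tau> k)) \<partial>M)" by simp
    also have "\<dots> \<le> (\<integral>\<omega>. (1 + u k) * (indicator G \<omega> * Z k \<omega>) + v k * indicator G \<omega> \<partial>M)"
    proof (rule integral_mono)
      show "integrable M (\<lambda>\<omega>. \<psi> (Suc k) powr q * (indicator G \<omega> * ((1 - 2 * q * a / real (Suc k) + 74 * e k) * A k \<omega> powr q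
          + 72 * \<sigma> k * A k \<omega> powr (q - 1) + 72 * \<tau> k)))" by (rule integrable_mult_right[OF ms(2)])
      show "integrable M (\<lambda>\<omega>. (1 + u k) * (indicator G \<omega> * Z k \<omega>) + v k * indicator G \<omega>)"
        using iZ integrable_indicator_prob[of G] by auto
      fix \<omega>
      show "\<psi> (Suc k) powr q * (indicator G \<omega> * ((1 - 2 * q * a / real (Suc k) + 74 * e k) * A k \<omega> powr q
          + 72 * \<sigma> k * A k \<omega> powr (q - 1) + 72 * \<tau> k)) \<le> (1 + u k) * (indicator G \<omega> * Z k \<omega>) + v k * indicator G \<omega>"
        using ineq[OF k' A_nn[OF k, of \<omega>]] by (cases "\<omega> \<in> G") (auto simp: Z_def)
    qed
    also have "\<dots> = (1 + u k) * (\<integral>\<omega>. indicator G \<omega> * Z k \<omega> \<partial>M) + v k * prob G"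
      using iZ integrable_indicator_prob[of G] by simp
    finally show "integrable M (\<lambda>\<omega>. indicator G \<omega> * Z (Suc k) \<omega>) \<and>
        (\<integral>\<omega>. indicator G \<omega> * Z (Suc k) \<omega> \<partial>M) \<le> (1 + u k) * (\<integral>\<omega>. indicator G \<omega> * Z k \<omega> \<partial>M) + v k * prob G"
      using i1 by simp
  qed
  then show ?thesis
  proof (rule AE_mp, intro AE_I2 impI)
    fix \<omega> assume *: "(\<forall>k\<ge>K'. \<omega> \<in> J k) \<longrightarrow> (\<exists>B. \<forall>k\<ge>K'. Z k \<omega> \<le> B)" "\<forall>k\<ge>K'. \<omega> \<in> J k"
    then obtain B where B: "\<And>k. k \<ge> K' \<Longrightarrow> Z k \<omega> \<le> B" by auto
    have "\<psi> k * A k \<omega> \<le> B powr (1 / q)" if "k \<ge> K'" for k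
    proof -
      have nn: "0 \<le> \<psi> k * A k \<omega>" using \<psi>[of k] A_nn[of k \<omega>] that K' by simp
      have "\<psi> k * A k \<omega> = Z k \<omega> powr (1 / q)" using nn q by (simp add: Z_def powr_powr)
      also have "\<dots> \<le> B powr (1 / q)" using B[OF that] q by (intro powr_mono2) (auto simp: Z_def)
      finally show ?thesis .
    qed
    then show "\<exists>B. \<forall>k\<ge>K'. \<psi> k * A k \<omega> \<le> B" by blast
  qed
qed

section \<open>Weights matched to the drift\<close>

lemma exp_le_if_le: "x \<le> y \<Longrightarrow> exp x \<le> exp (y::real)" by simp

text \<open>One step multiplies the power by (1 + 1/(k+1)) powr \<open>\<alpha>\<close>, at most exp
  (\<open>\<alpha>\<close> / (k+1)); a growing denominator \<open>l\<close> can only lower the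
  ratio.\<close>

lemma weight_ratio:
  fixes l :: "nat \<Rightarrow> real"
  assumes "0 \<le> \<alpha>" "0 < l k" "l k \<le> l (Suc k)"
  shows "(real (Suc (Suc k)) powr \<alpha> / l (Suc k)) powr q
      \<le> exp (q * \<alpha> / real (Suc k)) * (real (Suc k) powr \<alpha> / l k) powr q"
proof -
  have "real (Suc (Suc k)) = real (Suc k) * (1 + 1 / real (Suc k))" by (simp add: field_simps)
  also have "\<dots> \<le> real (Suc k) * exp (1 / real (Suc k))" by (intro mult_left_mono exp_ge_add_one_self) auto
  finally have "real (Suc (Suc k)) powr \<alpha> \<le> (real (Suc k) * exp (1 / real (Suc k))) powr \<alpha>"
    using assms by (intro powr_mono2) auto
  also have "\<dots> = real (Suc k) powr \<alpha> * exp (\<alpha> / real (Suc k))"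
    by (simp add: powr_def ln_mult exp_add distrib_left mult_ac del: of_nat_Suc)
  finally have "real (Suc (Suc k)) powr \<alpha> / l (Suc k) \<le> real (Suc k) powr \<alpha> * exp (\<alpha> / real (Suc k)) / l k"
    using assms by (intro frac_le) auto
  then have "(real (Suc (Suc k)) powr \<alpha> / l (Suc k)) powr q \<le> (exp (\<alpha> / real (Suc k)) * (real (Suc k) powr \<alpha> / l k)) powr q"
    using assms q by (intro powr_mono2) (auto simp: mult_ac)
  also have "\<dots> = exp (q * \<alpha> / real (Suc k)) * (real (Suc k) powr \<alpha> / l k) powr q"
    using assms by (subst powr_mult) (auto simp: powr_def mult_ac)
  finally show ?thesis .
qed

text \<open>With exponent 2 a the growth factor exp y of the weight exactly cancels the contraction
  1 - y, which is at most exp (-y). Nothing is left to damp the noise, so the weighted noise itself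
  has to be summable. It is used with \<open>l\<close> equal to 1 and to a squared
  logarithm.\<close>

lemma rate_summable:
  fixes l :: "nat \<Rightarrow> real"
  defines "\<psi> \<equiv> \<lambda>k. real (Suc k) powr (2 * a) / l k"
  assumes l: "\<And>k. 0 < l k" "\<And>k. l k \<le> l (Suc k)"
    and s1: "summable (\<lambda>k. \<psi> k * \<sigma> k)" and s2: "summable (\<lambda>k. \<psi> k powr q * \<tau> k)"
  shows "AE \<omega> in M. (\<forall>k\<ge>K. \<omega> \<in> J k) \<longrightarrow> (\<exists>B. \<forall>k\<ge>K. \<psi> k * A k \<omega> \<le> B)"
proof -
  define C where "C = exp (2 * q * a)"
  have C: "C > 0" by (simp add: C_def)
  have \<psi>: "0 < \<psi> k" for k using l by (simp add: \<psi>_def)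
  define u where "u k = 74 * C * e k + 72 * C * (\<psi> k * \<sigma> k)" for k
  define v where "v k = 72 * C * (\<psi> k * \<sigma> k) + 72 * C * (\<psi> k powr q * \<tau> k)" for k
  show ?thesis
  proof (rule weighted_bounded[where u = u and v = v])
    show "0 \<le> u k" for k using C e(1) \<sigma>_nn \<psi>[of k] by (simp add: u_def)
    show "0 \<le> v k" for k using C \<tau>_nn \<sigma>_nn \<psi>[of k] by (simp add: v_def)
    show "summable u" unfolding u_def by (intro summable_add summable_mult e s1)
    show "summable v" unfolding v_def by (intro summable_add summable_mult s1 s2)
    fix k and x :: real assume k: "k \<ge> K" and x: "0 \<le> x"
    define y where "y = 2 * q * a / real (Suc k)"
    have y0: "0 \<le> y" using q a by (simp add: y_def)
    have yC: "exp y \<le> C" unfolding C_def y_def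
      by (rule exp_le_if_le) (use q a mult_left_mono[of 1 "real (Suc k)" "2 * q * a"] in \<open>simp add: divide_le_eq del: of_nat_Suc\<close>)
    define P where "P = \<psi> k powr q"
    have P: "P > 0" using \<psi>[of k] by (simp add: P_def)
    have P': "\<psi> (Suc k) powr q \<le> exp y * P"
      unfolding \<psi>_def P_def y_def using weight_ratio[of "2 * a" l k] l a by (simp add: mult_ac)
    have P'': "\<psi> (Suc k) powr q \<le> C * P" using P' yC P by (meson mult_right_mono order.trans less_imp_le)
    have "\<psi> (Suc k) powr q * (1 - y + 74 * e k) \<le> \<psi> (Suc k) powr q * (exp (- y) + 74 * e k)"
      using exp_ge_add_one_self[of "- y"] by (intro mult_left_mono) auto
    also have "\<dots> \<le> exp y * P * exp (- y) + C * P * (74 * e k)"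
      unfolding distrib_left using P' P'' e by (intro add_mono mult_right_mono) auto
    also have "\<dots> = P * (1 + 74 * C * e k)" by (simp add: exp_minus field_simps)
    finally have 1: "\<psi> (Suc k) powr q * (1 - y + 74 * e k) \<le> P * (1 + 74 * C * e k)" .
    have Px: "P * x powr q = (\<psi> k * x) powr q" using \<psi>[of k] x by (simp add: P_def powr_mult)
    have t1: "\<psi> (Suc k) powr q * ((1 - y + 74 * e k) * x powr q) \<le> (1 + 74 * C * e k) * (\<psi> k * x) powr q"
    proof -
      have "\<psi> (Suc k) powr q * ((1 - y + 74 * e k) * x powr q) = \<psi> (Suc k) powr q * (1 - y + 74 * e k) * x powr q"
        by (simp only: mult.assoc)
      also have "\<dots> \<le> P * (1 + 74 * C * e k) * x powr q" by (rule mult_right_mono[OF 1]) simp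
      also have "\<dots> = (1 + 74 * C * e k) * (P * x powr q)" by (simp only: mult_ac)
      finally show ?thesis unfolding Px .
    qed
    have "P * x powr (q - 1) = \<psi> k * (\<psi> k * x) powr (q - 1)"
      using \<psi>[of k] x powr_add[of "\<psi> k" "q - 1" 1] by (simp add: P_def powr_mult)
    \<comment> \<open>The intermediate power splits into a constant, charged to \<open>v\<close>,
      and a multiple of the process, charged to \<open>u\<close>.\<close>
    also have "(\<psi> k * x) powr (q - 1) \<le> 1 + (\<psi> k * x) powr q"
    proof (cases "\<psi> k * x \<le> 1")
      case True
      then have "(\<psi> k * x) powr (q - 1) \<le> 1" using \<psi>[of k] x q by (intro powr_le1) auto
      then show ?thesis using powr_ge_zero[of "\<psi> k * x" q] by linarith
    next
      case False
      then have "(\<psi> k * x) powr (q - 1) \<le> (\<psi> k * x) powr q" by (intro powr_mono) auto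
      then show ?thesis by simp
    qed
    finally have "P * x powr (q - 1) \<le> \<psi> k * (1 + (\<psi> k * x) powr q)" using \<psi>[of k] by simp
    then have "C * P * x powr (q - 1) \<le> C * (\<psi> k * (1 + (\<psi> k * x) powr q))"
      using C by (simp add: mult.assoc)
    moreover have "\<psi> (Suc k) powr q * x powr (q - 1) \<le> C * P * x powr (q - 1)"
      using P'' by (rule mult_right_mono) simp
    ultimately have "\<psi> (Suc k) powr q * x powr (q - 1) \<le> C * (\<psi> k * (1 + (\<psi> k * x) powr q))" by linarith
    then have t2: "72 * \<sigma> k * (\<psi> (Suc k) powr q * x powr (q - 1)) \<le> 72 * \<sigma> k * (C * (\<psi> k * (1 + (\<psi> k * x) powr q)))"
      using \<sigma>_nn[of k] by (intro mult_left_mono) auto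
    have t3: "72 * \<tau> k * \<psi> (Suc k) powr q \<le> 72 * \<tau> k * (C * P)"
      using \<tau>_nn[of k] P'' by (intro mult_left_mono) auto
    have "\<psi> (Suc k) powr q * ((1 - y + 74 * e k) * x powr q + 72 * \<sigma> k * x powr (q - 1) + 72 * \<tau> k)
        = \<psi> (Suc k) powr q * ((1 - y + 74 * e k) * x powr q) + 72 * \<sigma> k * (\<psi> (Suc k) powr q * x powr (q - 1))
          + 72 * \<tau> k * \<psi> (Suc k) powr q" by (simp add: algebra_simps)
    also have "\<dots> \<le> (1 + 74 * C * e k) * (\<psi> k * x) powr q + 72 * \<sigma> k * (C * (\<psi> k * (1 + (\<psi> k * x) powr q))) + 72 * \<tau> k * (C * P)"
      using t1 t2 t3 by linarith
    also have "\<dots> = (1 + u k) * (\<psi> k * x) powr q + v k"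
      by (simp add: u_def v_def P_def algebra_simps)
    finally show "\<psi> (Suc k) powr q * ((1 - 2 * q * a / real (Suc k) + 74 * e k) * x powr q + 72 * \<sigma> k * x powr (q - 1) + 72 * \<tau> k)
        \<le> (1 + u k) * (\<psi> k * x) powr q + v k" unfolding y_def .
  qed (use \<psi> in auto)
qed

text \<open>For \<open>\<alpha> < 2 * a\<close> the drift exceeds the growth of the weight by a
  surplus of order c / k. The weighted noise, of order 1/(k ln k), is not summable, but the surplus
  absorbs it unless the weighted process is of order 1 / ln k; in that range it costs only 1/(k (ln
  k)^q), which is summable because q > 1.\<close>

lemma rate_log:
  fixes \<alpha> S :: real
  defines "\<psi> \<equiv> \<lambda>k. real (Suc k) powr \<alpha> / ln (real (k + 2))"
  assumes \<alpha>: "0 \<le> \<alpha>" "\<alpha> < 2 * a" and S: "0 \<le> S"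
    and s1: "\<And>k. \<sigma> k \<le> S * real (Suc k) powr (- \<alpha> - 1)"
    and s2: "\<And>k. \<tau> k \<le> S * real (Suc k) powr (- q * \<alpha> - 1)"
  shows "AE \<omega> in M. (\<forall>k\<ge>K. \<omega> \<in> J k) \<longrightarrow> (\<exists>B. \<forall>k\<ge>K. \<psi> k * A k \<omega> \<le> B)"
proof -
  define C where "C = exp (q * \<alpha>)"
  have C: "C > 0" by (simp add: C_def)
  have lnpos: "0 < ln (real (k + 2))" for k :: nat by simp
  have \<psi>: "0 < \<psi> k" for k using lnpos[of k] by (simp add: \<psi>_def)
  define c where "c = q * (2 * a - \<alpha>)"
  have c: "c > 0" using q \<alpha> by (simp add: c_def)
  \<comment> \<open>From here on \<open>w \<le> 1\<close>, so exp (-w) is at most 1 - w / 2 and half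
    of the surplus survives the linearisation.\<close>
  define K' where "K' = max K (nat \<lceil>c\<rceil>)"
  define T where "T = 72 * C * S"
  have T: "T \<ge> 0" using C S by (simp add: T_def)
  define b where "b k = 1 / (real (k + 1) * ln (real (k + 2)) powr q)" for k
  have b0: "0 \<le> b k" for k by (simp add: b_def)
  define E where "E = T powr q * (2 / c) powr (q - 1) + T"
  have E: "E \<ge> 0" using T by (simp add: E_def)
  have \<psi>\<sigma>: "\<psi> k * \<sigma> k \<le> S / (real (Suc k) * ln (real (k + 2)))" for k
  proof -
    have "\<psi> k * \<sigma> k \<le> \<psi> k * (S * real (Suc k) powr (- \<alpha> - 1))" using s1[of k] \<psi>[of k] by simp
    also have "\<dots> = S * (real (Suc k) powr \<alpha> * real (Suc k) powr (- \<alpha> - 1)) / ln (real (k + 2))"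
      by (simp add: \<psi>_def)
    also have "real (Suc k) powr \<alpha> * real (Suc k) powr (- \<alpha> - 1) = 1 / real (Suc k)"
      by (simp add: powr_add[symmetric] powr_minus divide_inverse del: of_nat_Suc)
    finally show ?thesis by (simp add: field_simps)
  qed
  have \<psi>\<tau>: "\<psi> k powr q * \<tau> k \<le> S * b k" for k
  proof -
    have "\<psi> k powr q * \<tau> k \<le> \<psi> k powr q * (S * real (Suc k) powr (- q * \<alpha> - 1))" using s2[of k] by (intro mult_left_mono) auto
    also have "\<dots> = S * (real (Suc k) powr (q * \<alpha>) * real (Suc k) powr (- q * \<alpha> - 1)) / ln (real (k + 2)) powr q"
      by (simp add: \<psi>_def powr_divide powr_powr mult.commute del: of_nat_Suc)
    also have "real (Suc k) powr (q * \<alpha>) * real (Suc k) powr (- q * \<alpha> - 1) = 1 / real (Suc k)"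
      by (simp add: powr_add[symmetric] powr_minus divide_inverse del: of_nat_Suc)
    finally show ?thesis by (simp add: b_def)
  qed
  define u where "u k = 74 * C * e k" for k
  define v where "v k = E * b k" for k
  have main: "AE \<omega> in M. (\<forall>k\<ge>K'. \<omega> \<in> J k) \<longrightarrow> (\<exists>B. \<forall>k\<ge>K'. \<psi> k * A k \<omega> \<le> B)"
  proof (rule weighted_bounded[where u = u and v = v])
    show "K' \<ge> K" by (simp add: K'_def)
    show "0 < \<psi> k" for k by (rule \<psi>)
    show "0 \<le> u k" for k using C e(1) by (simp add: u_def)
    show "0 \<le> v k" for k using E b0 by (simp add: v_def)
    show "summable u" unfolding u_def by (intro summable_mult e)
    show "summable v" unfolding v_def b_def by (intro summable_mult summable_inverse_mult_ln_powr q)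
    fix k and x :: real assume k: "k \<ge> K'" and x: "0 \<le> x"
    define y where "y = 2 * q * a / real (Suc k)"
    define z where "z = q * \<alpha> / real (Suc k)"
    define w where "w = c / real (Suc k)"
    have zyw: "z - y = - w" by (simp add: y_def z_def w_def c_def algebra_simps diff_divide_distrib)
    have "c \<le> real k" using k by (simp add: K'_def)
    then have w: "0 < w" "w \<le> 1" using c by (auto simp: w_def)
    have ew: "exp (- w) \<le> 1 - w / 2"
    proof -
      have "exp (- w) = inverse (exp w)" by (rule exp_minus)
      also have "\<dots> \<le> inverse (1 + w)" using w by (intro le_imp_inverse_le exp_ge_add_one_self) auto
      also have "\<dots> \<le> 1 - w / 2"
      proof -
        have "w * w \<le> w" using w mult_left_mono[of w 1 w] by simp
        then have "1 \<le> (1 - w / 2) * (1 + w)" by (simp add: algebra_simps)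
        then show ?thesis using w by (simp add: inverse_eq_divide divide_le_eq)
      qed
      finally show ?thesis .
    qed
    have zC: "exp z \<le> C" unfolding C_def z_def
      by (rule exp_le_if_le) (use q \<alpha> mult_left_mono[of 1 "real (Suc k)" "q * \<alpha>"] in \<open>simp add: divide_le_eq del: of_nat_Suc\<close>)
    define P where "P = \<psi> k powr q"
    have P: "P > 0" using \<psi>[of k] by (simp add: P_def)
    have P': "\<psi> (Suc k) powr q \<le> exp z * P"
    proof -
      have "0 < ln (real (k + 2))" "ln (real (k + 2)) \<le> ln (real (Suc k + 2))" by auto
      from weight_ratio[of \<alpha> "\<lambda>k. ln (real (k + 2))" k, OF \<alpha>(1) this]
      show ?thesis unfolding \<psi>_def P_def z_def .
    qed
    have P'': "\<psi> (Suc k) powr q \<le> C * P" using P' zC P by (meson mult_right_mono order.trans less_imp_le)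
    have "\<psi> (Suc k) powr q * (1 - y + 74 * e k) \<le> \<psi> (Suc k) powr q * (exp (- y) + 74 * e k)"
      using exp_ge_add_one_self[of "- y"] by (intro mult_left_mono) auto
    also have "\<dots> \<le> exp z * P * exp (- y) + C * P * (74 * e k)"
      unfolding distrib_left using P' P'' e by (intro add_mono mult_right_mono) auto
    also have "exp z * P * exp (- y) = P * exp (- w)"
      using exp_add[of z "- y"] zyw by simp
    also have "P * exp (- w) + C * P * (74 * e k) \<le> P * (1 - w / 2) + C * P * (74 * e k)"
      using ew P by simp
    also have "\<dots> = P * (1 - w / 2 + u k)" by (simp add: u_def algebra_simps)
    finally have 1: "\<psi> (Suc k) powr q * (1 - y + 74 * e k) \<le> P * (1 - w / 2 + u k)" .
    define Y where "Y = \<psi> k * x"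
    have Y: "Y \<ge> 0" using \<psi>[of k] x by (simp add: Y_def)
    have Px: "P * x powr q = Y powr q" using \<psi>[of k] x by (simp add: P_def Y_def powr_mult)
    have t1: "\<psi> (Suc k) powr q * ((1 - y + 74 * e k) * x powr q) \<le> (1 - w / 2 + u k) * Y powr q"
    proof -
      have "\<psi> (Suc k) powr q * ((1 - y + 74 * e k) * x powr q) = \<psi> (Suc k) powr q * (1 - y + 74 * e k) * x powr q"
        by (simp only: mult.assoc)
      also have "\<dots> \<le> P * (1 - w / 2 + u k) * x powr q" by (rule mult_right_mono[OF 1]) simp
      also have "\<dots> = (1 - w / 2 + u k) * (P * x powr q)" by (simp only: mult_ac)
      finally show ?thesis unfolding Px .
    qed
    have Px1: "P * x powr (q - 1) = \<psi> k * Y powr (q - 1)"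
      using \<psi>[of k] x powr_add[of "\<psi> k" "q - 1" 1] by (simp add: P_def Y_def powr_mult)
    define t where "t = T / ln (real (k + 2))"
    have t: "t \<ge> 0" using T lnpos[of k] by (simp add: t_def)
    have "72 * \<sigma> k * (\<psi> (Suc k) powr q * x powr (q - 1)) \<le> 72 * \<sigma> k * (C * P * x powr (q - 1))"
      using \<sigma>_nn[of k] P'' by (intro mult_left_mono mult_right_mono) auto
    also have "\<dots> = 72 * C * (\<psi> k * \<sigma> k) * Y powr (q - 1)"
      using Px1 by (simp add: mult_ac)
    also have "\<dots> \<le> 72 * C * (S / (real (Suc k) * ln (real (k + 2)))) * Y powr (q - 1)"
      using C \<psi>\<sigma>[of k] by (intro mult_left_mono mult_right_mono) auto
    also have "\<dots> = (t * Y powr (q - 1)) / real (Suc k)" by (simp add: t_def T_def)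
    \<comment> \<open>Above the level \<open>2 * t / c\<close> the surplus dominates the noise;
      below it monotonicity of powers leaves a multiple of t^q, hence of the reciprocal q-th power
      of the logarithm.\<close>
    also have "t * Y powr (q - 1) \<le> c / 2 * Y powr q + T powr q * (2 / c) powr (q - 1) / ln (real (k + 2)) powr q"
    proof (cases "Y \<ge> 2 * t / c")
      case True
      then have "t \<le> c / 2 * Y" using c by (simp add: field_simps)
      then have "t * Y powr (q - 1) \<le> c / 2 * Y * Y powr (q - 1)" by (intro mult_right_mono) auto
      also have "\<dots> = c / 2 * Y powr q" using Y powr_add[of Y "q - 1" 1] by (cases "Y = 0") auto
      finally show ?thesis using T by (simp add: add_increasing2)
    next
      case False
      then have "t > 0" using Y c t by (cases "t = 0") auto
      have "t * Y powr (q - 1) \<le> t * (2 * t / c) powr (q - 1)"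
        using False Y q t by (intro mult_left_mono powr_mono2) auto
      also have "\<dots> = t powr q * (2 / c) powr (q - 1)"
        using \<open>t > 0\<close> c powr_add[of t "q - 1" 1] powr_mult[of t "2 / c" "q - 1"] by (simp add: mult.commute)
      also have "t powr q = T powr q / ln (real (k + 2)) powr q"
        using T lnpos[of k] by (simp add: t_def powr_divide)
      finally have "t * Y powr (q - 1) \<le> T powr q * (2 / c) powr (q - 1) / ln (real (k + 2)) powr q" by simp
      moreover have "0 \<le> c / 2 * Y powr q" using c by simp
      ultimately show ?thesis by linarith
    qed
    finally have "72 * \<sigma> k * (\<psi> (Suc k) powr q * x powr (q - 1)) \<le>
        (c / 2 * Y powr q + T powr q * (2 / c) powr (q - 1) / ln (real (k + 2)) powr q) / real (Suc k)"
      by (simp add: divide_right_mono)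
    also have "\<dots> = w / 2 * Y powr q + T powr q * (2 / c) powr (q - 1) * b k"
      by (simp add: w_def b_def add_divide_distrib del: of_nat_Suc) (simp add: mult.commute add.commute)
    finally have t2: "72 * \<sigma> k * (\<psi> (Suc k) powr q * x powr (q - 1)) \<le> w / 2 * Y powr q + T powr q * (2 / c) powr (q - 1) * b k" .
    have "72 * \<tau> k * \<psi> (Suc k) powr q \<le> 72 * \<tau> k * (C * P)"
      using \<tau>_nn[of k] P'' by (intro mult_left_mono) auto
    also have "\<dots> = 72 * C * (\<psi> k powr q * \<tau> k)" by (simp add: P_def)
    also have "\<dots> \<le> 72 * C * (S * b k)" using \<psi>\<tau>[of k] C by (intro mult_left_mono) auto
    finally have t3: "72 * \<tau> k * \<psi> (Suc k) powr q \<le> T * b k" by (simp add: T_def mult_ac)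
    have "\<psi> (Suc k) powr q * ((1 - y + 74 * e k) * x powr q + 72 * \<sigma> k * x powr (q - 1) + 72 * \<tau> k)
        = \<psi> (Suc k) powr q * ((1 - y + 74 * e k) * x powr q) + 72 * \<sigma> k * (\<psi> (Suc k) powr q * x powr (q - 1))
          + 72 * \<tau> k * \<psi> (Suc k) powr q" by (simp add: algebra_simps)
    also have "\<dots> \<le> (1 - w / 2 + u k) * Y powr q + (w / 2 * Y powr q + T powr q * (2 / c) powr (q - 1) * b k) + T * b k"
      using t1 t2 t3 by linarith
    also have "\<dots> = (1 + u k) * Y powr q + v k"
      by (simp add: v_def E_def algebra_simps)
    finally show "\<psi> (Suc k) powr q * ((1 - 2 * q * a / real (Suc k) + 74 * e k) * x powr q + 72 * \<sigma> k * x powr (q - 1) + 72 * \<tau> k)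
        \<le> (1 + u k) * (\<psi> k * x) powr q + v k" unfolding y_def Y_def .
  qed
  then show ?thesis
  proof (rule AE_mp, intro AE_I2 impI)
    fix \<omega> assume *: "(\<forall>k\<ge>K'. \<omega> \<in> J k) \<longrightarrow> (\<exists>B. \<forall>k\<ge>K'. \<psi> k * A k \<omega> \<le> B)" "\<forall>k\<ge>K. \<omega> \<in> J k"
    then obtain B where B: "\<And>k. k \<ge> K' \<Longrightarrow> \<psi> k * A k \<omega> \<le> B" by (auto simp: K'_def)
    have "\<psi> k * A k \<omega> \<le> \<bar>B\<bar> + (\<Sum>j<K'. \<bar>\<psi> j * A j \<omega>\<bar>)" for k
    proof (cases "k \<ge> K'")
      case True
      then have "\<psi> k * A k \<omega> \<le> \<bar>B\<bar>" using B[of k] by linarith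
      moreover have "0 \<le> (\<Sum>j<K'. \<bar>\<psi> j * A j \<omega>\<bar>)" by (intro sum_nonneg) auto
      ultimately show ?thesis by linarith
    next
      case False
      then have "\<bar>\<psi> k * A k \<omega>\<bar> \<le> (\<Sum>j<K'. \<bar>\<psi> j * A j \<omega>\<bar>)" by (intro member_le_sum) auto
      then show ?thesis by linarith
    qed
    then show "\<exists>B. \<forall>k\<ge>K. \<psi> k * A k \<omega> \<le> B" by blast
  qed
qed

end

section \<open>Laplace dithers and the noise filtration\<close>

lemma nn_integral_laplace_atLeast:
  assumes "0 \<le> t"
  shows "(\<integral>\<^sup>+x. ennreal (exp (- \<bar>x\<bar>) / 2) * indicator {t..} x \<partial>lborel) = ennreal (exp (- t) / 2)"
proof -
  have "(\<integral>\<^sup>+x. ennreal (exp (- \<bar>x\<bar>) / 2) * indicator {t..} x \<partial>lborel)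
      = (\<integral>\<^sup>+x. ennreal (exp (- x) / 2) * indicator {t..} x \<partial>lborel)"
    using assms by (intro nn_integral_cong) (auto simp: indicator_def)
  also have "\<dots> = 0 - (- exp (- t) / 2)"
  proof (rule nn_integral_FTC_atLeast)
    show "((\<lambda>x. - exp (- x) / 2) has_real_derivative exp (- x) / 2) (at x)" for x :: real
      by (auto intro!: derivative_eq_intros)
    show "((\<lambda>x::real. - exp (- x) / 2) \<longlongrightarrow> 0) at_top"
    proof -
      have "((\<lambda>x::real. exp (- x)) \<longlongrightarrow> 0) at_top"
        by (rule filterlim_compose[OF exp_at_bot filterlim_uminus_at_bot_at_top])
      then have "((\<lambda>x::real. - exp (- x) / 2) \<longlongrightarrow> - 0 / 2) at_top" by (intro tendsto_intros) auto
      then show ?thesis by simp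
    qed
  qed auto
  finally show ?thesis by simp
qed

lemma nn_integral_laplace_atMost:
  assumes "t \<le> 0"
  shows "(\<integral>\<^sup>+x. ennreal (exp (- \<bar>x\<bar>) / 2) * indicator {..t} x \<partial>lborel) = ennreal (exp t / 2)"
proof -
  have "(\<integral>\<^sup>+x. ennreal (exp (- \<bar>x\<bar>) / 2) * indicator {..t} x \<partial>lborel)
      = ennreal \<bar>-1\<bar> * (\<integral>\<^sup>+x. ennreal (exp (- \<bar>0 + (-1) * x\<bar>) / 2) * indicator {..t} (0 + (-1) * x) \<partial>lborel)"
    by (rule nn_integral_real_affine) auto
  also have "\<dots> = (\<integral>\<^sup>+x. ennreal (exp (- \<bar>x\<bar>) / 2) * indicator {-t..} x \<partial>lborel)"
    by (auto intro!: nn_integral_cong simp: indicator_def)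
  also have "\<dots> = ennreal (exp t / 2)" using nn_integral_laplace_atLeast[of "- t"] assms by simp
  finally show ?thesis .
qed

lemma (in prob_space) laplace_tail_probs:
  assumes d: "distributed M lborel X (\<lambda>x. ennreal (exp (- \<bar>x\<bar>) / 2))"
  shows "measure (distr M borel X) {t<..} = 1 - lapF t" "measure (distr M borel X) {..<t} = lapF t"
proof -
  have [measurable]: "X \<in> borel_measurable M" using d by (simp add: distributed_def)
  let ?P = "distr M borel X"
  have P: "?P = density lborel (\<lambda>x. ennreal (exp (- \<bar>x\<bar>) / 2))"
  proof -
    have "distr M lborel X = density lborel (\<lambda>x. ennreal (exp (- \<bar>x\<bar>) / 2))" using d by (simp add: distributed_def)
    moreover have "distr M lborel X = distr M borel X" by (rule distr_cong) auto
    ultimately show ?thesis by simp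
  qed
  interpret P: prob_space ?P by (rule prob_space_distr) simp
  have em: "emeasure ?P A = (\<integral>\<^sup>+x. ennreal (exp (- \<bar>x\<bar>) / 2) * indicator A x \<partial>lborel)" if "A \<in> sets borel" for A
    using that unfolding P by (subst emeasure_density) auto
  have sing: "measure ?P {t} = 0" for t
  proof -
    have "emeasure ?P {t} = (\<integral>\<^sup>+x. 0 \<partial>(lborel :: real measure))"
      unfolding em[OF borel_singleton[OF sets.empty_sets]]
      by (rule nn_integral_cong_AE) (use AE_lborel_singleton[of t] in \<open>auto simp: indicator_def\<close>)
    then show ?thesis by (simp add: measure_def)
  qed
  have ge: "measure ?P {t..} = exp (- t) / 2" if "0 \<le> t" for t
    using em[of "{t..}"] nn_integral_laplace_atLeast[OF that] by (simp add: measure_def)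
  have le: "measure ?P {..t} = exp t / 2" if "t \<le> 0" for t
    using em[of "{..t}"] nn_integral_laplace_atMost[OF that] by (simp add: measure_def)
  have gt: "measure ?P {t<..} = measure ?P {t..}" for t
  proof -
    have "{t..} = {t<..} \<union> {t}" by auto
    moreover have "measure ?P ({t<..} \<union> {t}) = measure ?P {t<..} + measure ?P {t}"
      by (rule P.finite_measure_Union) auto
    ultimately show ?thesis using sing by simp
  qed
  have lt: "measure ?P {..<t} = measure ?P {..t}" for t
  proof -
    have "{..t} = {..<t} \<union> {t}" by auto
    moreover have "measure ?P ({..<t} \<union> {t}) = measure ?P {..<t} + measure ?P {t}"
      by (rule P.finite_measure_Union) auto
    ultimately show ?thesis using sing by simp
  qed
  have c1: "measure ?P {t<..} = 1 - measure ?P {..t}" for t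
  proof -
    have "{t<..} = space ?P - {..t}" by auto
    then show ?thesis using P.prob_compl[of "{..t}"] by simp
  qed
  have c2: "measure ?P {..<t} = 1 - measure ?P {t..}" for t
  proof -
    have "{..<t} = space ?P - {t..}" by auto
    then show ?thesis using P.prob_compl[of "{t..}"] by simp
  qed
  show "measure ?P {t<..} = 1 - lapF t"
    using c1[of t] gt[of t] ge[of t] le[of t] by (auto simp: lapF_def)
  show "measure ?P {..<t} = lapF t"
    using c2[of t] lt[of t] ge[of t] le[of t] by (auto simp: lapF_def)
qed

lemma borel_measurable_lapF[measurable]: "lapF \<in> borel_measurable borel"
  unfolding lapF_def[abs_def] by measurable

text \<open>Freezing the threshold: \<open>T\<close> is known to \<open>F\<close> and
  \<open>X\<close> is independent of \<open>F\<close>, so the pair of the identity into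
  \<open>F\<close> and \<open>X\<close> has a product law, and Fubini integrates \<open>X\<close>
  out with \<open>T\<close> held fixed. Testing against bounded \<open>Y\<close> stands for
  conditional expectation.\<close>

lemma (in prob_space) independent_threshold:
  fixes Y T :: "'a \<Rightarrow> real"
  assumes sub: "subalgebra M F" and ind: "indep_set (sets F) {X -` A \<inter> space M | A. A \<in> sets borel}"
    and d: "distributed M lborel X (\<lambda>x. ennreal (exp (- \<bar>x\<bar>) / 2))"
    and Y[measurable]: "Y \<in> borel_measurable F" and B: "\<And>\<omega>. \<bar>Y \<omega>\<bar> \<le> B"
    and T[measurable]: "T \<in> borel_measurable F"
  shows "(\<integral>\<omega>. Y \<omega> * indicator {T \<omega><..} (X \<omega>) \<partial>M) = (\<integral>\<omega>. Y \<omega> * (1 - lapF (T \<omega>)) \<partial>M)"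
    and "(\<integral>\<omega>. Y \<omega> * indicator {..<T \<omega>} (X \<omega>) \<partial>M) = (\<integral>\<omega>. Y \<omega> * lapF (T \<omega>) \<partial>M)"
proof -
  have id[measurable]: "(\<lambda>\<omega>. \<omega>) \<in> measurable M F"
    using sub by (auto simp: subalgebra_def measurable_def)
  have X[measurable]: "X \<in> borel_measurable M" using d by (simp add: distributed_def)
  let ?F = "distr M F (\<lambda>\<omega>. \<omega>)" and ?P = "distr M borel X"
  interpret F: prob_space ?F by (rule prob_space_distr) simp
  interpret P: prob_space ?P by (rule prob_space_distr) simp
  interpret FP: pair_prob_space ?F ?P by standard
  have eq: "?F \<Otimes>\<^sub>M ?P = distr M (F \<Otimes>\<^sub>M borel) (\<lambda>\<omega>. (\<omega>, X \<omega>))"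
  proof (rule pair_measure_eqI)
    show "sets (?F \<Otimes>\<^sub>M ?P) = sets (distr M (F \<Otimes>\<^sub>M borel) (\<lambda>\<omega>. (\<omega>, X \<omega>)))"
      by (simp cong: sets_pair_measure_cong)
    fix A B assume A: "A \<in> sets ?F" and B: "B \<in> sets ?P"
    have sA: "A \<inter> space M = A" using A sets.sets_into_space[of A F] sub by (auto simp: subalgebra_def)
    have "emeasure ?F A * emeasure ?P B = ennreal (prob A * prob (X -` B \<inter> space M))"
      using A B sA by (simp add: emeasure_distr emeasure_eq_measure ennreal_mult')
    also have "prob A * prob (X -` B \<inter> space M) = prob (A \<inter> (X -` B \<inter> space M))"
      by (rule indep_setD[OF ind, symmetric]) (use A B in auto)
    also have "A \<inter> (X -` B \<inter> space M) = (\<lambda>\<omega>. (\<omega>, X \<omega>)) -` (A \<times> B) \<inter> space M" by auto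
    also have "ennreal (prob \<dots>) = emeasure (distr M (F \<Otimes>\<^sub>M borel) (\<lambda>\<omega>. (\<omega>, X \<omega>))) (A \<times> B)"
      using A B by (subst emeasure_distr) (auto simp: emeasure_eq_measure)
    finally show "emeasure ?F A * emeasure ?P B = emeasure (distr M (F \<Otimes>\<^sub>M borel) (\<lambda>\<omega>. (\<omega>, X \<omega>))) (A \<times> B)" .
  qed (intro F.sigma_finite_measure_axioms P.sigma_finite_measure_axioms)+
  have gen: "(\<integral>\<omega>. Y \<omega> * indicator (S (T \<omega>)) (X \<omega>) \<partial>M) = (\<integral>\<omega>. Y \<omega> * measure ?P (S (T \<omega>)) \<partial>M)"
    if S: "\<And>t. S t \<in> sets borel" and SM[measurable]: "(\<lambda>z. indicator (S (T (fst z))) (snd z) :: real) \<in> borel_measurable (F \<Otimes>\<^sub>M borel)"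
      and SP: "(\<lambda>t. measure ?P (S t)) \<in> borel_measurable borel"
      for S :: "real \<Rightarrow> real set"
  proof -
    define g where "g z = Y (fst z) * indicator (S (T (fst z))) (snd z)" for z :: "'a \<times> real"
    have gm[measurable]: "g \<in> borel_measurable (F \<Otimes>\<^sub>M borel)" unfolding g_def[abs_def] by measurable
    have gm'[measurable]: "g \<in> borel_measurable (?F \<Otimes>\<^sub>M ?P)" by (simp cong: measurable_cong_sets)
    have gi: "integrable (?F \<Otimes>\<^sub>M ?P) g"
    proof (rule FP.integrable_const_bound[where B = B])
      have "norm (g z) \<le> B" for z using B[of "fst z"] by (auto simp: g_def indicator_def intro: order.trans[OF abs_ge_zero])
      then show "AE z in ?F \<Otimes>\<^sub>M ?P. norm (g z) \<le> B" by simp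
    qed simp
    have "(\<integral>\<omega>. Y \<omega> * indicator (S (T \<omega>)) (X \<omega>) \<partial>M) = (\<integral>\<omega>. g (\<omega>, X \<omega>) \<partial>M)" by (simp add: g_def)
    also have "\<dots> = (\<integral>z. g z \<partial>distr M (F \<Otimes>\<^sub>M borel) (\<lambda>\<omega>. (\<omega>, X \<omega>)))"
      by (rule integral_distr[symmetric]) measurable
    also have "\<dots> = (\<integral>z. g z \<partial>(?F \<Otimes>\<^sub>M ?P))" by (simp add: eq)
    also have "\<dots> = (\<integral>\<omega>. (\<integral>x. g (\<omega>, x) \<partial>?P) \<partial>?F)" by (rule FP.integral_fst'[OF gi, symmetric])
    also have "\<dots> = (\<integral>\<omega>. Y \<omega> * measure ?P (S (T \<omega>)) \<partial>?F)"
      using S by (intro Bochner_Integration.integral_cong refl) (simp add: g_def)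
    also have "\<dots> = (\<integral>\<omega>. Y \<omega> * measure ?P (S (T \<omega>)) \<partial>M)"
    proof (rule integral_distr)
      have "(\<lambda>\<omega>. measure ?P (S (T \<omega>))) \<in> borel_measurable F" by (rule measurable_compose[OF T SP])
      then show "(\<lambda>\<omega>. Y \<omega> * measure ?P (S (T \<omega>))) \<in> borel_measurable F" by measurable
    qed simp
    finally show ?thesis .
  qed
  have "(\<integral>\<omega>. Y \<omega> * indicator {T \<omega><..} (X \<omega>) \<partial>M) = (\<integral>\<omega>. Y \<omega> * measure ?P {T \<omega><..} \<partial>M)"
  proof (rule gen)
    have "(\<lambda>z. indicator {T (fst z)<..} (snd z) :: real) = (\<lambda>z. if T (fst z) < snd z then 1 else 0)"
      by (auto simp: indicator_def)
    also have "\<dots> \<in> borel_measurable (F \<Otimes>\<^sub>M borel)" by measurable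
    finally show "(\<lambda>z. indicator {T (fst z)<..} (snd z) :: real) \<in> borel_measurable (F \<Otimes>\<^sub>M borel)" .
    show "(\<lambda>t. measure ?P {t<..}) \<in> borel_measurable borel"
      unfolding laplace_tail_probs[OF d] by measurable
  qed simp
  then show "(\<integral>\<omega>. Y \<omega> * indicator {T \<omega><..} (X \<omega>) \<partial>M) = (\<integral>\<omega>. Y \<omega> * (1 - lapF (T \<omega>)) \<partial>M)"
    by (simp add: laplace_tail_probs[OF d])
  have "(\<integral>\<omega>. Y \<omega> * indicator {..<T \<omega>} (X \<omega>) \<partial>M) = (\<integral>\<omega>. Y \<omega> * measure ?P {..<T \<omega>} \<partial>M)"
  proof (rule gen)
    have "(\<lambda>z. indicator {..<T (fst z)} (snd z) :: real) = (\<lambda>z. if snd z < T (fst z) then 1 else 0)"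
      by (auto simp: indicator_def)
    also have "\<dots> \<in> borel_measurable (F \<Otimes>\<^sub>M borel)" by measurable
    finally show "(\<lambda>z. indicator {..<T (fst z)} (snd z) :: real) \<in> borel_measurable (F \<Otimes>\<^sub>M borel)" .
    show "(\<lambda>t. measure ?P {..<t}) \<in> borel_measurable borel"
      unfolding laplace_tail_probs[OF d] by measurable
  qed simp
  then show "(\<integral>\<omega>. Y \<omega> * indicator {..<T \<omega>} (X \<omega>) \<partial>M) = (\<integral>\<omega>. Y \<omega> * lapF (T \<omega>) \<partial>M)"
    by (simp add: laplace_tail_probs[OF d])
qed

text \<open>For indicators this is the product rule; it extends along the usual construction of
  nonnegative measurable functions from simple ones.\<close>

lemma (in prob_space) nn_integral_indep_set:
  assumes ind: "indep_set (sets D) (sets W)" and subW: "subalgebra M W"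
    and B: "B \<in> sets D" and g: "g \<in> borel_measurable W"
  shows "(\<integral>\<^sup>+\<omega>. indicator B \<omega> * g \<omega> \<partial>M) = ennreal (prob B) * (\<integral>\<^sup>+\<omega>. g \<omega> \<partial>M)"
proof -
  have [measurable]: "B \<in> sets M" using indep_setD_ev1[OF ind] B by blast
  have spW: "space W = space M" using subW by (simp add: subalgebra_def)
  note meas = measurable_from_subalg[OF subW]
  show ?thesis using g
  proof (induction g rule: borel_measurable_induct)
    case (cong f g)
    have "(\<integral>\<^sup>+\<omega>. indicator B \<omega> * f \<omega> \<partial>M) = (\<integral>\<^sup>+\<omega>. indicator B \<omega> * g \<omega> \<partial>M)"
      "(\<integral>\<^sup>+\<omega>. f \<omega> \<partial>M) = (\<integral>\<^sup>+\<omega>. g \<omega> \<partial>M)"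
      using cong(3) by (auto intro!: nn_integral_cong simp: spW)
    then show ?case using cong by simp
  next
    case (set A)
    have [measurable]: "A \<in> sets M" using set subW by (auto simp: subalgebra_def)
    have "(\<integral>\<^sup>+\<omega>. indicator B \<omega> * indicator A \<omega> \<partial>M) = emeasure M (B \<inter> A)"
      unfolding nn_integral_indicator[OF sets.Int[OF \<open>B \<in> sets M\<close> \<open>A \<in> sets M\<close>], symmetric]
      by (intro nn_integral_cong) (auto simp: indicator_def)
    then show ?case using indep_setD[OF ind B set] by (simp add: emeasure_eq_measure ennreal_mult')
  next
    case (mult u c)
    have [measurable]: "u \<in> borel_measurable M" using mult meas by blast
    show ?case using mult by (simp add: nn_integral_cmult mult.left_commute)
  next
    case (add u v)
    have [measurable]: "u \<in> borel_measurable M" "v \<in> borel_measurable M" using add meas by blast+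
    show ?case using add by (simp add: nn_integral_add distrib_left)
  next
    case (seq U)
    have [measurable]: "U i \<in> borel_measurable M" for i using seq meas by blast
    have inc: "incseq (\<lambda>i. U i \<omega>)" for \<omega> using \<open>incseq U\<close> by (auto simp: incseq_def le_fun_def)
    have "(\<integral>\<^sup>+\<omega>. indicator B \<omega> * (SUP i. U i) \<omega> \<partial>M) = (\<integral>\<^sup>+\<omega>. (SUP i. indicator B \<omega> * U i \<omega>) \<partial>M)"
      by (simp add: SUP_mult_left_ennreal image_comp)
    also have "\<dots> = (SUP i. \<integral>\<^sup>+\<omega>. indicator B \<omega> * U i \<omega> \<partial>M)"
      by (rule nn_integral_monotone_convergence_SUP) (use \<open>incseq U\<close> in \<open>auto simp: incseq_def le_fun_def intro!: mult_left_mono\<close>)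
    also have "\<dots> = (SUP i. ennreal (prob B) * (\<integral>\<^sup>+\<omega>. U i \<omega> \<partial>M))" using seq by simp
    also have "\<dots> = ennreal (prob B) * (SUP i. \<integral>\<^sup>+\<omega>. U i \<omega> \<partial>M)" by (simp add: SUP_mult_left_ennreal)
    also have "(SUP i. \<integral>\<^sup>+\<omega>. U i \<omega> \<partial>M) = (\<integral>\<^sup>+\<omega>. (SUP i. U i \<omega>) \<partial>M)"
      by (rule nn_integral_monotone_convergence_SUP[symmetric]) (use \<open>incseq U\<close> in auto)
    finally show ?case by (simp add: image_comp)
  qed
qed

section \<open>Filtrations of the observation noise and the dithers\<close>

locale sc_noise = prob_space M for M :: "'w measure" +
  fixes N :: nat and m :: "nat \<Rightarrow> nat" and w :: "nat \<Rightarrow> nat \<Rightarrow> 'w \<Rightarrow> nat \<Rightarrow> real"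
    and d :: "nat \<Rightarrow> nat \<Rightarrow> 'w \<Rightarrow> real" and \<rho> :: real
  assumes w_int: "\<And>i k r. i < N \<Longrightarrow> 1 \<le> k \<Longrightarrow> r < m i \<Longrightarrow> integrable M (\<lambda>\<omega>. w i k \<omega> r)"
    and w_mds: "\<And>i k r. i < N \<Longrightarrow> 1 \<le> k \<Longrightarrow> r < m i \<Longrightarrow>
        AE \<omega> in M. real_cond_exp M (filt_wd M N m w d (k - 1)) (\<lambda>\<omega>. w i k \<omega> r) \<omega> = 0"
    and \<rho>: "\<rho> > 2"
    and w_mom: "AE \<omega> in M.
        (\<Squnion>i\<in>{..<N}. \<Squnion>k\<in>{1..}. nn_cond_exp M (filt_w M N m w (k - 1))
           (\<lambda>\<omega>. ennreal (vnorm (m i) (w i k \<omega>) powr \<rho>)) \<omega>) < \<infinity>"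
    and d_lap: "\<And>i k. i < N \<Longrightarrow> 1 \<le> k \<Longrightarrow>
        distributed M lborel (d i k) (\<lambda>x. ennreal (exp (- \<bar>x\<bar>) / 2))"
    and d_indep: "indep_vars (\<lambda>_. borel) (\<lambda>(i, k). d i k) ({..<N} \<times> {1..})"
    and dw_indep: "indep_set (events_d M N d) (events_w M N m w)"
begin

abbreviation "F \<equiv> filt_wd M N m w d"
abbreviation "Fw \<equiv> filt_w M N m w"

text \<open>Generators over an arbitrary set of times, so that the filtrations, with
  \<open>{1..k}\<close>, and the full noise sigma-algebras, with \<open>{1..}\<close>, are instances
  of one construction.\<close>

definition "gen_d I = (\<Union>i<N. \<Union>t\<in>I. {d i t -` A \<inter> space M | A. A \<in> sets borel})"
definition "gen_w I = (\<Union>i<N. \<Union>t\<in>I. \<Union>r<m i. {(\<lambda>\<omega>. w i t \<omega> r) -` A \<inter> space M | A. A \<in> sets borel})"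

lemma d_meas[measurable]: "i < N \<Longrightarrow> 1 \<le> k \<Longrightarrow> d i k \<in> borel_measurable M"
  using d_lap[of i k] by (simp add: distributed_def)

lemma w_meas[measurable]: "i < N \<Longrightarrow> 1 \<le> k \<Longrightarrow> r < m i \<Longrightarrow> (\<lambda>\<omega>. w i k \<omega> r) \<in> borel_measurable M"
  by (rule borel_measurable_integrable[OF w_int])

lemma gen_d_sets: "I \<subseteq> {1..} \<Longrightarrow> gen_d I \<subseteq> sets M"
proof
  fix S assume I: "I \<subseteq> {1..}" and "S \<in> gen_d I"
  then obtain i t A where "i < N" "t \<in> I" "A \<in> sets borel" and S: "S = d i t -` A \<inter> space M"
    unfolding gen_d_def by blast
  then show "S \<in> sets M" unfolding S using I by (intro measurable_sets[OF d_meas]) auto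
qed

lemma gen_w_sets: "I \<subseteq> {1..} \<Longrightarrow> gen_w I \<subseteq> sets M"
proof
  fix S assume I: "I \<subseteq> {1..}" and "S \<in> gen_w I"
  then obtain i t r A where "i < N" "t \<in> I" "r < m i" "A \<in> sets borel" and S: "S = (\<lambda>\<omega>. w i t \<omega> r) -` A \<inter> space M"
    unfolding gen_w_def by blast
  then show "S \<in> sets M" unfolding S using I by (intro measurable_sets[OF w_meas]) auto
qed

lemma gen_dI: "i < N \<Longrightarrow> t \<in> I \<Longrightarrow> A \<in> sets borel \<Longrightarrow> d i t -` A \<inter> space M \<in> gen_d I"
  and gen_wI: "i < N \<Longrightarrow> t \<in> I \<Longrightarrow> r < m i \<Longrightarrow> A \<in> sets borel \<Longrightarrow> (\<lambda>\<omega>. w i t \<omega> r) -` A \<inter> space M \<in> gen_w I"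
  unfolding gen_d_def gen_w_def by blast+

lemma gen_d_mono: "I \<subseteq> I' \<Longrightarrow> gen_d I \<subseteq> gen_d I'"
  and gen_w_mono: "I \<subseteq> I' \<Longrightarrow> gen_w I \<subseteq> gen_w I'"
  unfolding gen_d_def gen_w_def by blast+

lemma gen_Pow: "gen_d I \<subseteq> Pow (space M)" "gen_w I \<subseteq> Pow (space M)"
  by (auto simp: gen_d_def gen_w_def)

lemma sets_F: "sets (F k) = sigma_sets (space M) (gen_w {1..k} \<union> gen_d {1..k})"
  unfolding filt_wd_def gen_w_def[symmetric] gen_d_def[symmetric]
  by (rule sets_measure_of) (simp add: gen_Pow)

lemma sets_Fw: "sets (Fw k) = sigma_sets (space M) (gen_w {1..k})"
  unfolding filt_w_def gen_w_def[symmetric] by (rule sets_measure_of) (simp add: gen_Pow)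

lemma space_F: "space (F k) = space M" "space (Fw k) = space M"
  unfolding filt_wd_def filt_w_def by (auto simp: space_measure_of_conv)

lemma sigma_sets_events: "A \<subseteq> sets M \<Longrightarrow> sigma_sets (space M) A \<subseteq> sets M"
  by (rule sets.sigma_sets_subset)

lemma subalg_F: "subalgebra M (F k)"
proof -
  have "gen_w {1..k} \<union> gen_d {1..k} \<subseteq> sets M" using gen_d_sets[of "{1..k}"] gen_w_sets[of "{1..k}"] by auto
  then show ?thesis unfolding subalgebra_def sets_F space_F using sigma_sets_events by auto
qed

lemma subalg_Fw: "subalgebra M (Fw k)"
proof -
  have "gen_w {1..k} \<subseteq> sets M" using gen_w_sets[of "{1..k}"] by auto
  then show ?thesis unfolding subalgebra_def sets_Fw space_F using sigma_sets_events by auto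
qed

lemma F_mono: "j \<le> k \<Longrightarrow> sets (F j) \<subseteq> sets (F k)"
  unfolding sets_F by (intro sigma_sets_mono' Un_mono gen_d_mono gen_w_mono) simp_all

lemma Fw_le_F: "sets (Fw k) \<subseteq> sets (F k)"
  unfolding sets_F sets_Fw by (rule sigma_sets_mono') auto

lemma d_measF: assumes "i < N" "1 \<le> t" "t \<le> k" shows "d i t \<in> borel_measurable (F k)"
proof (rule measurableI)
  fix A :: "real set" assume "A \<in> sets borel"
  then have "d i t -` A \<inter> space M \<in> gen_d {1..k}" using assms by (intro gen_dI) auto
  then show "d i t -` A \<inter> space (F k) \<in> sets (F k)" unfolding sets_F space_F by (intro sigma_sets.Basic) auto
qed simp

lemma w_measF: assumes "i < N" "1 \<le> t" "t \<le> k" "r < m i" shows "(\<lambda>\<omega>. w i t \<omega> r) \<in> borel_measurable (F k)"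
proof (rule measurableI)
  fix A :: "real set" assume "A \<in> sets borel"
  then have "(\<lambda>\<omega>. w i t \<omega> r) -` A \<inter> space M \<in> gen_w {1..k}" using assms by (intro gen_wI) auto
  then show "(\<lambda>\<omega>. w i t \<omega> r) -` A \<inter> space (F k) \<in> sets (F k)" unfolding sets_F space_F by (intro sigma_sets.Basic) auto
qed simp

definition "Ew = sigma (space M) (gen_w {1..})"
definition "Ed = sigma (space M) (gen_d {1..})"

lemma sets_Ew: "sets Ew = sigma_sets (space M) (gen_w {1..})" "sets Ew = events_w M N m w"
  and sets_Ed: "sets Ed = sigma_sets (space M) (gen_d {1..})" "sets Ed = events_d M N d"
  unfolding Ew_def Ed_def events_w_def events_d_def gen_w_def[symmetric] gen_d_def[symmetric]
  by (simp_all add: gen_Pow)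

lemma subalg_Ew: "subalgebra M Ew"
  using gen_w_sets[of "{1..}"] sigma_sets_events unfolding subalgebra_def sets_Ew(1) by (auto simp: Ew_def space_measure_of_conv)

lemma ind_Ed_Ew: "indep_set (sets Ed) (sets Ew)"
  unfolding sets_Ew(2) sets_Ed(2) by (rule dw_indep)

lemma Fw_le_Ew: "sets (Fw k) \<subseteq> sets Ew"
  unfolding sets_Fw sets_Ew(1) by (intro sigma_sets_mono' gen_w_mono) auto

lemma w_measEw: assumes "i < N" "1 \<le> t" "r < m i" shows "(\<lambda>\<omega>. w i t \<omega> r) \<in> borel_measurable Ew"
proof (rule measurableI)
  fix A :: "real set" assume "A \<in> sets borel"
  then have "(\<lambda>\<omega>. w i t \<omega> r) -` A \<inter> space M \<in> gen_w {1..}" using assms by (intro gen_wI) auto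
  then show "(\<lambda>\<omega>. w i t \<omega> r) -` A \<inter> space Ew \<in> sets Ew" unfolding sets_Ew(1)
    by (auto simp: Ew_def space_measure_of_conv)
qed simp

text \<open>The independent dithers are grouped into two disjoint blocks of indices, all pairs up to
  time k and the single pair (j, k + 1).\<close>

lemma ind_past_next:
  assumes j: "j < N"
  shows "indep_set (sigma_sets (space M) (gen_d {1..k})) (sigma_sets (space M) {d j (Suc k) -` A \<inter> space M | A. A \<in> sets borel})"
proof -
  let ?E = "\<lambda>(i, t). {d i t -` A \<inter> space M | A. A \<in> sets borel}"
  let ?I = "case_bool ({..<N} \<times> {1..k}) {(j, Suc k)}"
  have ind0: "indep_sets ?E ({..<N} \<times> {1..})"
    using d_indep unfolding indep_vars_def2 by (simp add: case_prod_unfold)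
  have "indep_sets (\<lambda>b. sigma_sets (space M) (\<Union>i\<in>?I b. ?E i)) UNIV"
  proof (rule indep_sets_collect_sigma)
    show "indep_sets ?E (\<Union>b\<in>UNIV. ?I b)"
      by (rule indep_sets_mono_index[OF _ ind0]) (use j in \<open>auto simp: UNIV_bool\<close>)
    show "Int_stable (?E i)" for i
    proof (cases i)
      case (Pair a c)
      show ?thesis unfolding Int_stable_def Pair
      proof (clarsimp)
        fix A B :: "real set" assume "A \<in> sets borel" "B \<in> sets borel"
        then show "\<exists>C. d a c -` A \<inter> space M \<inter> (d a c -` B \<inter> space M) = d a c -` C \<inter> space M \<and> C \<in> sets borel"
          by (intro exI[of _ "A \<inter> B"]) auto
      qed
    qed
    show "disjoint_family_on ?I UNIV" by (auto simp: disjoint_family_on_def split: bool.splits)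
  qed
  then have "indep_sets (case_bool (sigma_sets (space M) (gen_d {1..k})) (sigma_sets (space M) {d j (Suc k) -` A \<inter> space M | A. A \<in> sets borel})) UNIV"
  proof (rule indep_sets_mono_sets)
    fix b :: bool
    have "(\<Union>i\<in>{..<N} \<times> {1..k}. ?E i) = gen_d {1..k}" by (auto simp: gen_d_def)
    then show "(case b of True \<Rightarrow> sigma_sets (space M) (gen_d {1..k}) | False \<Rightarrow> sigma_sets (space M) {d j (Suc k) -` A \<inter> space M | A. A \<in> sets borel})
      \<subseteq> sigma_sets (space M) (\<Union>i\<in>?I b. ?E i)" by (cases b) auto
  qed
  then show ?thesis unfolding indep_set_def .
qed

text \<open>An intersection-stable generator of \<open>F k\<close> when \<open>D\<close> and
  \<open>W\<close> hold the past dither and past noise events; on each member the independence of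
  the two families applies directly.\<close>

definition "rects D W = {B \<inter> C | B C. B \<in> D \<and> C \<in> W}"

lemma Int_stable_rects:
  assumes "\<And>a b. a \<in> D \<Longrightarrow> b \<in> D \<Longrightarrow> a \<inter> b \<in> D" "\<And>a b. a \<in> W \<Longrightarrow> b \<in> W \<Longrightarrow> a \<inter> b \<in> W"
  shows "Int_stable (rects D W)"
  unfolding Int_stable_def rects_def
proof clarify
  fix B C B' C' assume "B \<in> D" "C \<in> W" "B' \<in> D" "C' \<in> W"
  then have "(B \<inter> C) \<inter> (B' \<inter> C') = (B \<inter> B') \<inter> (C \<inter> C')" "B \<inter> B' \<in> D" "C \<inter> C' \<in> W" using assms by auto
  then show "\<exists>Ba Ca. B \<inter> C \<inter> (B' \<inter> C') = Ba \<inter> Ca \<and> Ba \<in> D \<and> Ca \<in> W" by blast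
qed

abbreviation "Dk k \<equiv> sigma_sets (space M) (gen_d {1..k})"

lemma Dk_sub: "Dk k \<subseteq> sets Ed"
  unfolding sets_Ed(1) by (intro sigma_sets_mono' gen_d_mono) auto

lemma Ed_sub: "sets Ed \<subseteq> sets M" using gen_d_sets[of "{1..}"] sigma_sets_events unfolding sets_Ed(1) by auto

lemma Int_Dk: "a \<in> Dk k \<Longrightarrow> b \<in> Dk k \<Longrightarrow> a \<inter> b \<in> Dk k"
proof -
  interpret sigma_algebra "space M" "Dk k" by (rule sigma_algebra_sigma_sets[OF gen_Pow(1)])
  show "a \<in> Dk k \<Longrightarrow> b \<in> Dk k \<Longrightarrow> a \<inter> b \<in> Dk k" by (rule Int)
qed

lemma sets_F_rects: "sets (F k) \<subseteq> sigma_sets (space M) (rects (Dk k) (sets (Fw k)))"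
  unfolding sets_F
proof (rule sigma_sets_mono)
  show "gen_w {1..k} \<union> gen_d {1..k} \<subseteq> sigma_sets (space M) (rects (Dk k) (sets (Fw k)))"
  proof
    fix A assume A: "A \<in> gen_w {1..k} \<union> gen_d {1..k}"
    then have sA: "A \<subseteq> space M" using gen_Pow[of "{1..k}"] by blast
    have sp: "space M \<in> Dk k" "space M \<in> sets (Fw k)"
      using sigma_sets_top[of "space M"] by (auto simp: sets_Fw)
    have "A \<in> rects (Dk k) (sets (Fw k))"
    proof (cases "A \<in> gen_w {1..k}")
      case True
      then have "A \<in> sets (Fw k)" by (auto simp: sets_Fw)
      then show ?thesis unfolding rects_def using sA sp by (intro CollectI exI[of _ "space M"] exI[of _ A]) auto
    next
      case False
      then have "A \<in> Dk k" using A by auto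
      then show ?thesis unfolding rects_def using sA sp by (intro CollectI exI[of _ A] exI[of _ "space M"]) auto
    qed
    then show "A \<in> sigma_sets (space M) (rects (Dk k) (sets (Fw k)))" by auto
  qed
qed

lemma rects_F: "rects (Dk k) (sets (Fw k)) \<subseteq> sets (F k)"
proof -
  have "Dk k \<subseteq> sets (F k)" unfolding sets_F by (rule sigma_sets_mono') auto
  then show ?thesis using Fw_le_F[of k] by (auto simp: rects_def)
qed

text \<open>For a dither event B, a noise event C and an event D of the next dither, P(B C D) = P(B
  D) P(C) by independence of the two families, and P(B D) = P(B) P(D) among the dithers. A pi-system
  argument passes from such intersections to \<open>F k\<close>.\<close>

lemma ind_next:
  assumes j: "j < N"
  shows "indep_set (sets (F k)) {d j (Suc k) -` A \<inter> space M | A. A \<in> sets borel}"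
proof -
  let ?X = "{d j (Suc k) -` A \<inter> space M | A. A \<in> sets borel}"
  have X_Ed: "?X \<subseteq> sets Ed"
  proof -
    have "?X \<subseteq> gen_d {1..}" using j gen_dI by auto
    then show ?thesis unfolding sets_Ed(1) by auto
  qed
  have "indep_set (rects (Dk k) (sets (Fw k))) ?X"
  proof (rule indep_setI)
    show "rects (Dk k) (sets (Fw k)) \<subseteq> events" using rects_F[of k] subalg_F[of k] unfolding subalgebra_def by blast
    show "?X \<subseteq> events" using X_Ed Ed_sub by blast
    fix a D assume "a \<in> rects (Dk k) (sets (Fw k))" and D: "D \<in> ?X"
    then obtain B C where a: "a = B \<inter> C" and B: "B \<in> Dk k" and C: "C \<in> sets (Fw k)" by (auto simp: rects_def)
    have C': "C \<in> sets Ew" using C Fw_le_Ew by auto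
    have BD: "B \<inter> D \<in> sets Ed" using B D Dk_sub X_Ed by (intro sets.Int) auto
    have B': "B \<in> sets Ed" using B Dk_sub by auto
    have "prob (a \<inter> D) = prob ((B \<inter> D) \<inter> C)" unfolding a by (rule arg_cong[of _ _ prob]) auto
    also have "\<dots> = prob (B \<inter> D) * prob C" by (rule indep_setD[OF ind_Ed_Ew BD C'])
    also have "prob (B \<inter> D) = prob B * prob D"
      by (rule indep_setD[OF ind_past_next[OF j] B]) (use D in auto)
    also have "prob B * prob D * prob C = (prob B * prob C) * prob D" by simp
    also have "prob B * prob C = prob a" unfolding a by (rule indep_setD[OF ind_Ed_Ew B' C', symmetric])
    finally show "prob (a \<inter> D) = prob a * prob D" .
  qed
  then have "indep_set (sigma_sets (space M) (rects (Dk k) (sets (Fw k)))) (sigma_sets (space M) ?X)"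
  proof (rule indep_set_sigma_sets)
    show "Int_stable (rects (Dk k) (sets (Fw k)))" by (rule Int_stable_rects) (rule Int_Dk sets.Int; assumption)+
    show "Int_stable ?X" unfolding Int_stable_def
    proof (clarsimp)
      fix A B :: "real set" assume "A \<in> sets borel" "B \<in> sets borel"
      then show "\<exists>C. d j (Suc k) -` A \<inter> space M \<inter> (d j (Suc k) -` B \<inter> space M) = d j (Suc k) -` C \<inter> space M \<and> C \<in> sets borel"
        by (intro exI[of _ "A \<inter> B"]) auto
    qed
  qed
  then show ?thesis unfolding indep_set_def
    by (rule indep_sets_mono_sets) (use sets_F_rects[of k] in \<open>auto split: bool.splits\<close>)
qed

definition "wpow i k \<omega> = ennreal (vnorm (m i) (w i k \<omega>) powr \<rho>)"
definition "Sw i k = nn_cond_exp M (Fw (k - 1)) (wpow i k)"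

lemma wpow_measEw: "i < N \<Longrightarrow> 1 \<le> k \<Longrightarrow> wpow i k \<in> borel_measurable Ew"
proof -
  assume "i < N" "1 \<le> k"
  then have [measurable]: "r < m i \<Longrightarrow> (\<lambda>\<omega>. w i k \<omega> r) \<in> borel_measurable Ew" for r using w_measEw by auto
  show ?thesis unfolding wpow_def[abs_def] vnorm_def by measurable
qed

lemma Sw_measFw: "Sw i k \<in> borel_measurable (Fw (k - 1))"
  unfolding Sw_def by (rule borel_measurable_nn_cond_exp)

text \<open>The moment bound conditions on past observation noise only, whereas the recursion also
  sees past dithers. Independence makes the extra conditioning harmless: the measures with densities
  \<open>wpow\<close> and \<open>Sw\<close> agree on intersections of a dither event and a noise
  event, hence on all of \<open>F k\<close>.\<close>

lemma wpow_moment: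
  fixes Y :: "'w \<Rightarrow> ennreal"
  assumes i: "i < N" and Y: "Y \<in> borel_measurable (F k)"
    and supp: "\<And>\<omega>. Y \<omega> \<noteq> 0 \<Longrightarrow> Sw i (Suc k) \<omega> \<le> ennreal L"
  shows "(\<integral>\<^sup>+\<omega>. Y \<omega> * wpow i (Suc k) \<omega> \<partial>M) \<le> ennreal L * (\<integral>\<^sup>+\<omega>. Y \<omega> \<partial>M)"
proof -
  interpret fw: finite_measure_subalgebra M "Fw k" by (rule finite_measure_subalgebra.intro[OF finite_measure_axioms]) (simp add: finite_measure_subalgebra_axioms_def subalg_Fw)
  let ?S = "Sw i (Suc k)" and ?f = "wpow i (Suc k)"
  have S[measurable]: "?S \<in> borel_measurable (Fw k)" using Sw_measFw[of i "Suc k"] by simp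
  have SM[measurable]: "?S \<in> borel_measurable M" by (rule measurable_from_subalg[OF subalg_Fw S])
  have fE: "?f \<in> borel_measurable Ew" using wpow_measEw[OF i, of "Suc k"] by simp
  have fM[measurable]: "?f \<in> borel_measurable M" by (rule measurable_from_subalg[OF subalg_Ew fE])
  have SF: "?S \<in> borel_measurable (F k)" using S Fw_le_F[of k] by (auto simp: measurable_def space_F)
  have SE: "?S \<in> borel_measurable Ew" using S Fw_le_Ew[of k] by (auto simp: measurable_def space_F Ew_def space_measure_of_conv)
  \<comment> \<open>Restricting both densities to \<open>Q\<close> makes the two measures finite,
    which the complement step of the generation argument requires.\<close>
  define Q where "Q = {\<omega> \<in> space M. ?S \<omega> \<le> ennreal L}"
  have QW: "Q \<in> sets (Fw k)"
  proof -
    have "Q = {\<omega> \<in> space (Fw k). ?S \<omega> \<le> ennreal L}" by (simp add: Q_def space_F)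
    also have "\<dots> \<in> sets (Fw k)" by measurable
    finally show ?thesis .
  qed
  have QM[measurable]: "Q \<in> sets M" using QW subalg_Fw by (auto simp: subalgebra_def)
  have QE[measurable]: "Q \<in> sets Ew" using QW Fw_le_Ew by auto
  let ?M1 = "density M (\<lambda>\<omega>. indicator Q \<omega> * ?f \<omega>)" and ?M2 = "density M (\<lambda>\<omega>. indicator Q \<omega> * ?S \<omega>)"
  have e1: "emeasure ?M1 A = (\<integral>\<^sup>+\<omega>. indicator A \<omega> * (indicator Q \<omega> * ?f \<omega>) \<partial>M)" if "A \<in> sets M" for A
    using that by (subst emeasure_density) (auto simp: mult_ac)
  have e2: "emeasure ?M2 A = (\<integral>\<^sup>+\<omega>. indicator A \<omega> * (indicator Q \<omega> * ?S \<omega>) \<partial>M)" if "A \<in> sets M" for A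
    using that by (subst emeasure_density) (auto simp: mult_ac)
  have Feq: "(\<integral>\<^sup>+\<omega>. indicator C \<omega> * (indicator Q \<omega> * ?f \<omega>) \<partial>M) = (\<integral>\<^sup>+\<omega>. indicator C \<omega> * (indicator Q \<omega> * ?S \<omega>) \<partial>M)"
    if C: "C \<in> sets (Fw k)" for C
  proof -
    have [measurable]: "C \<in> sets (Fw k)" "Q \<in> sets (Fw k)" using C QW by auto
    have "(\<integral>\<^sup>+\<omega>. (indicator C \<omega> * indicator Q \<omega>) * nn_cond_exp M (Fw k) ?f \<omega> \<partial>M) = (\<integral>\<^sup>+\<omega>. (indicator C \<omega> * indicator Q \<omega>) * ?f \<omega> \<partial>M)"
      by (rule fw.nn_cond_exp_intg) measurable
    then show ?thesis by (simp add: Sw_def mult.assoc)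
  qed
  have rect: "emeasure ?M1 a = emeasure ?M2 a" if a: "a \<in> rects (Dk k) (sets (Fw k))" for a
  proof -
    obtain B C where a: "a = B \<inter> C" and B: "B \<in> Dk k" and C: "C \<in> sets (Fw k)" using a by (auto simp: rects_def)
    have B': "B \<in> sets Ed" using B Dk_sub by auto
    have C': "C \<in> sets Ew" using C Fw_le_Ew by auto
    have aM: "a \<in> sets M" using that rects_F[of k] subalg_F[of k] unfolding subalgebra_def by blast
    have [measurable]: "C \<in> sets Ew" "?f \<in> borel_measurable Ew" "?S \<in> borel_measurable Ew" using C' fE SE by auto
    have "emeasure ?M1 a = (\<integral>\<^sup>+\<omega>. indicator B \<omega> * (indicator C \<omega> * (indicator Q \<omega> * ?f \<omega>)) \<partial>M)"
      by (subst e1[OF aM], unfold a, intro nn_integral_cong) (auto simp: indicator_def)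
    also have "\<dots> = ennreal (prob B) * (\<integral>\<^sup>+\<omega>. indicator C \<omega> * (indicator Q \<omega> * ?f \<omega>) \<partial>M)"
      by (rule nn_integral_indep_set[OF ind_Ed_Ew subalg_Ew B']) measurable
    also have "\<dots> = ennreal (prob B) * (\<integral>\<^sup>+\<omega>. indicator C \<omega> * (indicator Q \<omega> * ?S \<omega>) \<partial>M)"
      using Feq[OF C] by simp
    also have "\<dots> = (\<integral>\<^sup>+\<omega>. indicator B \<omega> * (indicator C \<omega> * (indicator Q \<omega> * ?S \<omega>)) \<partial>M)"
      by (rule nn_integral_indep_set[OF ind_Ed_Ew subalg_Ew B', symmetric]) measurable
    also have "\<dots> = emeasure ?M2 a"
      by (subst e2[OF aM], unfold a, intro nn_integral_cong) (auto simp: indicator_def)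
    finally show ?thesis .
  qed
  have sigM: "sigma_sets (space M) (rects (Dk k) (sets (Fw k))) \<subseteq> sets M"
    using rects_F[of k] subalg_F[of k] unfolding subalgebra_def by (intro sigma_sets_events) blast
  have spr: "space M \<in> rects (Dk k) (sets (Fw k))"
    unfolding rects_def using sigma_sets_top[of "space M" "gen_d {1..k}"] sets.top[of "Fw k"]
    by (intro CollectI exI[of _ "space M"]) (auto simp: space_F)
  have fin2: "emeasure ?M2 (space M) \<noteq> \<infinity>"
  proof -
    have "emeasure ?M2 (space M) \<le> (\<integral>\<^sup>+\<omega>. ennreal L \<partial>M)"
      unfolding e2[OF sets.top] by (intro nn_integral_mono) (auto simp: Q_def indicator_def)
    also have "\<dots> < \<infinity>" by (simp add: emeasure_space_1 less_top[symmetric] ennreal_mult_eq_top_iff)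
    finally show ?thesis by simp
  qed
  have all: "emeasure ?M1 A = emeasure ?M2 A" if A: "A \<in> sets (F k)" for A
  proof -
    have "Int_stable (rects (Dk k) (sets (Fw k)))" by (rule Int_stable_rects) (rule Int_Dk sets.Int; assumption)+
    moreover have "rects (Dk k) (sets (Fw k)) \<subseteq> Pow (space M)"
      using rects_F[of k] sets.sets_into_space[of _ "F k"] unfolding space_F by blast
    moreover have "A \<in> sigma_sets (space M) (rects (Dk k) (sets (Fw k)))" using A sets_F_rects by auto
    ultimately show ?thesis
    proof (induction rule: sigma_sets_induct_disjoint)
      case (basic A)
      then show ?case by (rule rect)
    next
      case empty
      show ?case by simp
    next
      case (compl A)
      have AM: "A \<in> sets M" using compl sigM by auto
      have t: "emeasure ?M1 (space M) = emeasure ?M2 (space M)" by (rule rect[OF spr])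
      have "emeasure ?M2 A \<le> emeasure ?M2 (space M)" using AM by (intro emeasure_mono) (auto dest: sets.sets_into_space)
      then have fA: "emeasure ?M2 A \<noteq> \<infinity>" using fin2 by (auto simp: top_unique)
      have "emeasure ?M1 (space M - A) = emeasure ?M1 (space M) - emeasure ?M1 A"
        using emeasure_compl[of A ?M1] AM fA compl by simp
      also have "\<dots> = emeasure ?M2 (space M - A)"
        using emeasure_compl[of A ?M2] AM fA compl t by simp
      finally show ?case .
    next
      case (union A)
      then have "range A \<subseteq> sets M" using sigM by auto
      then show ?case using union
        by (subst (1 2) suminf_emeasure[symmetric]) auto
    qed
  qed
  have Yeq: "Y \<omega> = Y \<omega> * indicator Q \<omega>" if "\<omega> \<in> space M" for \<omega>
    using supp[of \<omega>] that by (cases "Y \<omega> = 0") (auto simp: Q_def indicator_def)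
  have YM[measurable]: "Y \<in> borel_measurable M" by (rule measurable_from_subalg[OF subalg_F Y])
  have "(\<integral>\<^sup>+\<omega>. Y \<omega> * ?f \<omega> \<partial>M) = (\<integral>\<^sup>+\<omega>. (indicator Q \<omega> * ?f \<omega>) * Y \<omega> \<partial>M)"
    by (rule nn_integral_cong, subst Yeq) (auto simp: mult_ac)
  also have "\<dots> = (\<integral>\<^sup>+\<omega>. Y \<omega> \<partial>?M1)" by (rule nn_integral_density[symmetric]) measurable
  \<comment> \<open>\<open>Y\<close> is \<open>F k\<close>-measurable, so its integral sees only the
    restriction to \<open>F k\<close>, where the two measures coincide.\<close>
  also have "\<dots> = (\<integral>\<^sup>+\<omega>. Y \<omega> \<partial>restr_to_subalg ?M1 (F k))"
    by (rule nn_integral_subalgebra2[symmetric]) (use subalg_F Y in \<open>auto simp: subalgebra_def\<close>)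
  also have "restr_to_subalg ?M1 (F k) = restr_to_subalg ?M2 (F k)"
  proof (rule measure_eqI)
    have s: "subalgebra ?M1 (F k)" "subalgebra ?M2 (F k)" using subalg_F[of k] by (auto simp: subalgebra_def)
    show "sets (restr_to_subalg ?M1 (F k)) = sets (restr_to_subalg ?M2 (F k))"
      using s by (simp add: sets_restr_to_subalg)
    show "emeasure (restr_to_subalg ?M1 (F k)) A = emeasure (restr_to_subalg ?M2 (F k)) A"
      if "A \<in> sets (restr_to_subalg ?M1 (F k))" for A
      using that s all by (simp add: sets_restr_to_subalg emeasure_restr_to_subalg)
  qed
  also have "(\<integral>\<^sup>+\<omega>. Y \<omega> \<partial>restr_to_subalg ?M2 (F k)) = (\<integral>\<^sup>+\<omega>. Y \<omega> \<partial>?M2)"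
    by (rule nn_integral_subalgebra2) (use subalg_F Y in \<open>auto simp: subalgebra_def\<close>)
  also have "\<dots> = (\<integral>\<^sup>+\<omega>. (indicator Q \<omega> * ?S \<omega>) * Y \<omega> \<partial>M)" by (rule nn_integral_density) measurable
  also have "\<dots> \<le> (\<integral>\<^sup>+\<omega>. ennreal L * Y \<omega> \<partial>M)"
    by (intro nn_integral_mono mult_right_mono) (auto simp: Q_def indicator_def)
  also have "\<dots> = ennreal L * (\<integral>\<^sup>+\<omega>. Y \<omega> \<partial>M)" by (rule nn_integral_cmult) measurable
  finally show ?thesis .
qed

lemma w_moment:
  assumes i: "i < N" and Y: "Y \<in> borel_measurable (F k)" and Y0: "\<And>\<omega>. 0 \<le> Y \<omega>" and YB: "\<And>\<omega>. Y \<omega> \<le> B"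
    and L: "0 \<le> L" and supp: "\<And>\<omega>. Y \<omega> \<noteq> 0 \<Longrightarrow> Sw i (Suc k) \<omega> \<le> ennreal L"
  shows "integrable M (\<lambda>\<omega>. Y \<omega> * vnorm (m i) (w i (Suc k) \<omega>) powr \<rho>)"
    and "(\<integral>\<omega>. Y \<omega> * vnorm (m i) (w i (Suc k) \<omega>) powr \<rho> \<partial>M) \<le> L * (\<integral>\<omega>. Y \<omega> \<partial>M)"
proof -
  have YM[measurable]: "Y \<in> borel_measurable M" by (rule measurable_from_subalg[OF subalg_F Y])
  have [measurable]: "r < m i \<Longrightarrow> (\<lambda>\<omega>. w i (Suc k) \<omega> r) \<in> borel_measurable M" for r using w_meas[OF i, of "Suc k"] by auto
  have vm[measurable]: "(\<lambda>\<omega>. vnorm (m i) (w i (Suc k) \<omega>)) \<in> borel_measurable M" unfolding vnorm_def by measurable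
  have iY: "integrable M Y" by (rule integrable_const_bound[where B = B]) (use Y0 YB in auto)
  have "(\<integral>\<^sup>+\<omega>. ennreal (Y \<omega> * vnorm (m i) (w i (Suc k) \<omega>) powr \<rho>) \<partial>M) = (\<integral>\<^sup>+\<omega>. ennreal (Y \<omega>) * wpow i (Suc k) \<omega> \<partial>M)"
    by (intro nn_integral_cong) (simp add: wpow_def ennreal_mult Y0)
  also have "\<dots> \<le> ennreal L * (\<integral>\<^sup>+\<omega>. ennreal (Y \<omega>) \<partial>M)"
    by (rule wpow_moment[OF i]) (use Y supp Y0 in auto)
  also have "\<dots> = ennreal (L * (\<integral>\<omega>. Y \<omega> \<partial>M))"
    using iY Y0 L by (simp add: nn_integral_eq_integral ennreal_mult)
  finally have le: "(\<integral>\<^sup>+\<omega>. ennreal (Y \<omega> * vnorm (m i) (w i (Suc k) \<omega>) powr \<rho>) \<partial>M) \<le> ennreal (L * (\<integral>\<omega>. Y \<omega> \<partial>M))" .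
  show int: "integrable M (\<lambda>\<omega>. Y \<omega> * vnorm (m i) (w i (Suc k) \<omega>) powr \<rho>)"
    by (rule integrableI_nonneg) (use le Y0 in \<open>auto intro: order.strict_trans1\<close>)
  have "ennreal (\<integral>\<omega>. Y \<omega> * vnorm (m i) (w i (Suc k) \<omega>) powr \<rho> \<partial>M) \<le> ennreal (L * (\<integral>\<omega>. Y \<omega> \<partial>M))"
    using le int Y0 by (subst nn_integral_eq_integral[symmetric]) auto
  moreover have "0 \<le> L * (\<integral>\<omega>. Y \<omega> \<partial>M)" using L Y0 by (simp add: integral_nonneg_AE)
  ultimately show "(\<integral>\<omega>. Y \<omega> * vnorm (m i) (w i (Suc k) \<omega>) powr \<rho> \<partial>M) \<le> L * (\<integral>\<omega>. Y \<omega> \<partial>M)"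
    by (simp add: ennreal_le_iff)
qed

lemma w_martingale:
  assumes i: "i < N" and r: "r < m i" and Y: "Y \<in> borel_measurable (F k)" and YB: "\<And>\<omega>. \<bar>Y \<omega>\<bar> \<le> B"
  shows "integrable M (\<lambda>\<omega>. Y \<omega> * w i (Suc k) \<omega> r)" "(\<integral>\<omega>. Y \<omega> * w i (Suc k) \<omega> r \<partial>M) = 0"
proof -
  interpret f: finite_measure_subalgebra M "F k" by (rule finite_measure_subalgebra.intro[OF finite_measure_axioms]) (simp add: finite_measure_subalgebra_axioms_def subalg_F)
  have YM[measurable]: "Y \<in> borel_measurable M" by (rule measurable_from_subalg[OF subalg_F Y])
  have [measurable]: "(\<lambda>\<omega>. w i (Suc k) \<omega> r) \<in> borel_measurable M" using w_meas[OF i _ r] by simp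
  have iw: "integrable M (\<lambda>\<omega>. w i (Suc k) \<omega> r)" by (rule w_int[OF i _ r]) simp
  show int: "integrable M (\<lambda>\<omega>. Y \<omega> * w i (Suc k) \<omega> r)"
  proof (rule Bochner_Integration.integrable_bound[of _ "\<lambda>\<omega>. B * w i (Suc k) \<omega> r"])
    have "norm (Y \<omega> * w i (Suc k) \<omega> r) \<le> norm (B * w i (Suc k) \<omega> r)" for \<omega>
      using YB[of \<omega>] by (auto simp: abs_mult intro!: mult_right_mono)
    then show "AE \<omega> in M. norm (Y \<omega> * w i (Suc k) \<omega> r) \<le> norm (B * w i (Suc k) \<omega> r)" by simp
  qed (use iw in auto)
  have "(\<integral>\<omega>. Y \<omega> * w i (Suc k) \<omega> r \<partial>M) = (\<integral>\<omega>. Y \<omega> * real_cond_exp M (F k) (\<lambda>\<omega>. w i (Suc k) \<omega> r) \<omega> \<partial>M)"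
    by (rule f.real_cond_exp_intg(2)[symmetric, OF int Y]) simp
  also have "\<dots> = (\<integral>\<omega>. 0 \<partial>M)"
  proof (rule integral_cong_AE)
    show "AE \<omega> in M. Y \<omega> * real_cond_exp M (F k) (\<lambda>\<omega>. w i (Suc k) \<omega> r) \<omega> = 0"
      using w_mds[OF i _ r, of "Suc k"] by auto
  qed simp_all
  finally show "(\<integral>\<omega>. Y \<omega> * w i (Suc k) \<omega> r \<partial>M) = 0" by simp
qed

text \<open>The bound on the conditional moments varies with the outcome. Rounding it up to a
  natural number lets later arguments fix \<open>L\<close> and recover almost every outcome by a
  countable union.\<close>

lemma moment_bound_AE: "AE \<omega> in M. \<exists>L::nat. \<forall>i<N. \<forall>k. Sw i (Suc k) \<omega> \<le> ennreal (real L)"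
  using w_mom
proof (rule AE_mp, intro AE_I2 impI)
  fix \<omega> assume *: "(\<Squnion>i\<in>{..<N}. \<Squnion>k\<in>{1..}. nn_cond_exp M (filt_w M N m w (k - 1))
           (\<lambda>\<omega>. ennreal (vnorm (m i) (w i k \<omega>) powr \<rho>)) \<omega>) < \<infinity>" (is "?s < _")
  have le: "Sw i (Suc k) \<omega> \<le> ?s" if "i < N" for i k
    unfolding Sw_def wpow_def[abs_def]
    by (rule order.trans[OF _ SUP_upper[of i]], rule order.trans[OF _ SUP_upper[of "Suc k"]]) (use that in auto)
  have "\<exists>x\<ge>0. s = ennreal x" if "s < \<infinity>" for s using that by (cases s) auto
  from this[OF *] obtain x where x: "?s = ennreal x" "0 \<le> x" by blast
  obtain L :: nat where "x \<le> real L" using real_arch_simple by blast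
  then have "?s \<le> ennreal (real L)" unfolding x(1) by (rule ennreal_leI)
  then show "\<exists>L::nat. \<forall>i<N. \<forall>k. Sw i (Suc k) \<omega> \<le> ennreal (real L)" using le by (meson order.trans)
qed

end

section \<open>The deterministic part of the recursion\<close>

lemma lapF_nonpos: "x \<le> 0 \<Longrightarrow> lapF x = exp x / 2"
  by (cases "x = 0") (auto simp: lapF_def)

lemma lapF_pos: "0 < lapF x"
proof (cases "x < 0")
  case False
  then have "exp (- x) \<le> 1" by simp
  then show ?thesis unfolding lapF_def if_not_P[OF False] by linarith
qed (simp add: lapF_def)

lemma lapF_le_1: "lapF x \<le> 1"
proof (cases "x < 0")
  case True
  then have "exp x \<le> 1" by simp
  then show ?thesis unfolding lapF_def if_P[OF True] by linarith
qed (simp add: lapF_def)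

lemma lapF_uminus: "lapF (- x) = 1 - lapF x"
  by (cases "x = 0") (auto simp: lapF_def)

text \<open>For nonnegative x this amounts to 2 being at most exp x + exp (-x). The exponential
  bound is what turns a logarithmic trigger threshold into a power of the time.\<close>

lemma lapF_le_exp: "lapF x \<le> exp x / 2"
proof (cases "x < 0")
  case False
  have "2 \<le> exp x + exp (- x)"
  proof -
    have "0 \<le> (exp (x / 2) - exp (- x / 2))\<^sup>2" by simp
    also have "\<dots> = exp x + exp (- x) - 2"
      by (simp add: power2_eq_square algebra_simps exp_add[symmetric])
    finally show ?thesis by simp
  qed
  then show ?thesis using False by (simp add: lapF_def field_simps)
qed (simp add: lapF_def)

lemma exp_diff_bounds:
  fixes x y :: real
  assumes "x \<le> y"
  shows "exp x * (y - x) \<le> exp y - exp x" "exp y - exp x \<le> exp y * (y - x)"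
proof -
  have "exp x * (1 + (y - x)) \<le> exp x * exp (y - x)" by (intro mult_left_mono exp_ge_add_one_self) auto
  also have "\<dots> = exp y" by (simp add: exp_diff)
  finally show "exp x * (y - x) \<le> exp y - exp x" by (simp add: algebra_simps)
  have "exp y * (1 + (x - y)) \<le> exp y * exp (x - y)" by (intro mult_left_mono exp_ge_add_one_self) auto
  also have "\<dots> = exp x" by (simp add: exp_diff)
  finally show "exp y - exp x \<le> exp y * (y - x)" by (simp add: algebra_simps)
qed

text \<open>The density lies between exp (-Z) / 2 and 1/2 on [-Z, Z]. Tangent bounds for exp settle
  the negative half-line, reflection the positive one, and an interval around 0 is cut
  there.\<close>

lemma lapF_diff_bounds:
  assumes xy: "x \<le> y"
  shows "lapF y - lapF x \<le> (y - x) / 2"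
    and "\<bar>x\<bar> \<le> Z \<Longrightarrow> \<bar>y\<bar> \<le> Z \<Longrightarrow> exp (- Z) * (y - x) / 2 \<le> lapF y - lapF x"
proof -
  have neg: "lapF y - lapF x \<le> (y - x) / 2 \<and> (\<bar>x\<bar> \<le> Z \<longrightarrow> \<bar>y\<bar> \<le> Z \<longrightarrow> exp (- Z) * (y - x) / 2 \<le> lapF y - lapF x)"
    if "x \<le> y" "y \<le> 0" for x y Z
  proof (intro conjI impI)
    have "exp y * (y - x) \<le> 1 * (y - x)" using that by (intro mult_right_mono) auto
    then show "lapF y - lapF x \<le> (y - x) / 2"
      using exp_diff_bounds(2)[OF that(1)] that by (simp add: lapF_nonpos)
    assume "\<bar>x\<bar> \<le> Z" "\<bar>y\<bar> \<le> Z"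
    then have "exp (- Z) * (y - x) \<le> exp x * (y - x)" using that by (intro mult_right_mono) auto
    then show "exp (- Z) * (y - x) / 2 \<le> lapF y - lapF x"
      using exp_diff_bounds(1)[OF that(1)] that by (simp add: lapF_nonpos)
  qed
  have pos: "lapF y - lapF x \<le> (y - x) / 2 \<and> (\<bar>x\<bar> \<le> Z \<longrightarrow> \<bar>y\<bar> \<le> Z \<longrightarrow> exp (- Z) * (y - x) / 2 \<le> lapF y - lapF x)"
    if "x \<le> y" "0 \<le> x" for x y Z
    using neg[of "- y" "- x" Z] that by (simp add: lapF_uminus)
  consider "y \<le> 0" | "0 \<le> x" | "x < 0" "0 < y" by linarith
  then have "lapF y - lapF x \<le> (y - x) / 2 \<and> (\<bar>x\<bar> \<le> Z \<longrightarrow> \<bar>y\<bar> \<le> Z \<longrightarrow> exp (- Z) * (y - x) / 2 \<le> lapF y - lapF x)"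
  proof cases
    case 3
    have n: "lapF 0 - lapF x \<le> (0 - x) / 2 \<and> (\<bar>x\<bar> \<le> Z \<longrightarrow> \<bar>0\<bar> \<le> Z \<longrightarrow> exp (- Z) * (0 - x) / 2 \<le> lapF 0 - lapF x)"
      by (rule neg) (use 3 in auto)
    have p: "lapF y - lapF 0 \<le> (y - 0) / 2 \<and> (\<bar>0\<bar> \<le> Z \<longrightarrow> \<bar>y\<bar> \<le> Z \<longrightarrow> exp (- Z) * (y - 0) / 2 \<le> lapF y - lapF 0)"
      by (rule pos) (use 3 in auto)
    have "exp (- Z) * (y - x) / 2 = exp (- Z) * (0 - x) / 2 + exp (- Z) * (y - 0) / 2"
      by (simp add: add_divide_distrib[symmetric] right_diff_distrib)
    then show ?thesis using n p by auto
  qed (use neg pos xy in auto)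
  then show "lapF y - lapF x \<le> (y - x) / 2"
    and "\<bar>x\<bar> \<le> Z \<Longrightarrow> \<bar>y\<bar> \<le> Z \<Longrightarrow> exp (- Z) * (y - x) / 2 \<le> lapF y - lapF x" by auto
qed

text \<open>Mean of a received message, an untriggered one counting as 0, at coordinate value
  \<open>z\<close>, trigger threshold \<open>C\<close> and dither scale \<open>b\<close>.\<close>

definition trG :: "real \<Rightarrow> real \<Rightarrow> real \<Rightarrow> real" where
  "trG C b z = lapF ((z - C) / b) - lapF ((- z - C) / b)"

text \<open>Each of the two Laplace terms has slope at most 1 / (2 b) and, on [-Z, Z], at least exp
  (-(Z + C) / b) / (2 b). The lower slope is the source of the exponential factor in the rate
  constant.\<close>

lemma trG_diff:
  assumes b: "0 < b" and C: "0 \<le> C" and z: "z' \<le> z"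
  shows "trG C b z - trG C b z' \<le> (z - z') / b" "0 \<le> trG C b z - trG C b z'"
    and "\<bar>z\<bar> \<le> Z \<Longrightarrow> \<bar>z'\<bar> \<le> Z \<Longrightarrow> exp (- (Z + C) / b) / b * (z - z') \<le> trG C b z - trG C b z'"
proof -
  have eq: "trG C b z - trG C b z' = (lapF ((z - C) / b) - lapF ((z' - C) / b)) + (lapF ((- z' - C) / b) - lapF ((- z - C) / b))"
    by (simp add: trG_def)
  have l1: "(z' - C) / b \<le> (z - C) / b" and l2: "(- z - C) / b \<le> (- z' - C) / b"
    using b z by (auto intro!: divide_right_mono)
  have d1: "(z - C) / b - (z' - C) / b = (z - z') / b" and d2: "(- z' - C) / b - (- z - C) / b = (z - z') / b"
    by (auto simp: diff_divide_distrib)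
  show "trG C b z - trG C b z' \<le> (z - z') / b"
    using lapF_diff_bounds(1)[OF l1] lapF_diff_bounds(1)[OF l2] unfolding eq d1 d2 by linarith
  have low: "exp (- (Z + C) / b) / b * (z - z') \<le> trG C b z - trG C b z'" if "\<bar>z\<bar> \<le> Z" "\<bar>z'\<bar> \<le> Z" for Z
  proof -
    have a: "\<bar>(u - C) / b\<bar> \<le> (Z + C) / b" if "\<bar>u\<bar> \<le> Z" for u
      using that b C by (auto simp: abs_le_iff field_simps)
    have "exp (- ((Z + C) / b)) * ((z - C) / b - (z' - C) / b) / 2 \<le> lapF ((z - C) / b) - lapF ((z' - C) / b)"
      by (rule lapF_diff_bounds(2)[OF l1]) (use a that in auto)
    moreover have "exp (- ((Z + C) / b)) * ((- z' - C) / b - (- z - C) / b) / 2 \<le> lapF ((- z' - C) / b) - lapF ((- z - C) / b)"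
      by (rule lapF_diff_bounds(2)[OF l2]) (use a[of "- z"] a[of "- z'"] that in auto)
    ultimately have "exp (- ((Z + C) / b)) * ((z - z') / b) \<le> trG C b z - trG C b z'"
      unfolding eq d1 d2 by linarith
    then show ?thesis by (simp add: minus_divide_left mult.commute)
  qed
  then show "\<bar>z\<bar> \<le> Z \<Longrightarrow> \<bar>z'\<bar> \<le> Z \<Longrightarrow> exp (- (Z + C) / b) / b * (z - z') \<le> trG C b z - trG C b z'" .
  have "0 \<le> exp (- (max \<bar>z\<bar> \<bar>z'\<bar> + C) / b) / b * (z - z')" using b z by simp
  also have "\<dots> \<le> trG C b z - trG C b z'" by (rule low) auto
  finally show "0 \<le> trG C b z - trG C b z'" .
qed

lemma trG_lipschitz:
  assumes "0 < b" "0 \<le> C"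
  shows "\<bar>trG C b z - trG C b z'\<bar> \<le> \<bar>z - z'\<bar> / b"
  using trG_diff(1,2)[OF assms, of z z'] trG_diff(1,2)[OF assms, of z' z] by (cases "z \<le> z'") auto

lemma trG_monotone:
  assumes "0 < b" "0 \<le> C"
  shows "0 \<le> (z - z') * (trG C b z - trG C b z')"
  using trG_diff(2)[OF assms, of z z'] trG_diff(2)[OF assms, of z' z]
  by (cases "z \<le> z'") (auto simp: zero_le_mult_iff)

lemma trG_strongly_monotone:
  assumes b: "0 < b" "0 \<le> C" and Z: "\<bar>z\<bar> \<le> Z" "\<bar>z'\<bar> \<le> Z"
  shows "exp (- (Z + C) / b) / b * (z - z')\<^sup>2 \<le> (z - z') * (trG C b z - trG C b z')"
proof -
  have *: "exp (- (Z + C) / b) / b * (z - z')\<^sup>2 \<le> (z - z') * (trG C b z - trG C b z')"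
    if "z' \<le> z" "\<bar>z\<bar> \<le> Z" "\<bar>z'\<bar> \<le> Z" for z z'
    using mult_left_mono[OF trG_diff(3)[OF b that], of "z - z'"] that
    by (simp add: power2_eq_square mult_ac)
  show ?thesis
  proof (cases "z' \<le> z")
    case False
    have "(z - z') * (trG C b z - trG C b z') = (z' - z) * (trG C b z' - trG C b z)" by (simp add: algebra_simps)
    then show ?thesis using *[of z z'] False Z by (simp add: power2_commute)
  qed (use * Z in auto)
qed

text \<open>A supremum of reals is informative only for a set known to be bounded; the Frobenius
  norm supplies the bound. The rest is scaling to a unit vector.\<close>

lemma matvec_opnorm_le:
  assumes "opnorm mr nc A \<le> K" "0 \<le> K"
  shows "(\<Sum>r<mr. (matvec nc A x r)\<^sup>2) \<le> K\<^sup>2 * (\<Sum>c<nc. (x c)\<^sup>2)"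
proof -
  let ?S = "{vnorm mr (matvec nc A x) | x. vnorm nc x \<le> 1}"
  define Fr where "Fr = (\<Sum>r<mr. \<Sum>c<nc. (A r c)\<^sup>2)"
  have fr: "(\<Sum>r<mr. (matvec nc A x r)\<^sup>2) \<le> Fr * (\<Sum>c<nc. (x c)\<^sup>2)" for x
    unfolding Fr_def sum_distrib_right[of _ "{..<mr}"] matvec_def by (intro sum_mono Cauchy_Schwarz_ineq_sum)
  have Fr0: "0 \<le> Fr" unfolding Fr_def by (intro sum_nonneg) auto
  have sq: "(vnorm k y)\<^sup>2 = (\<Sum>c<k. (y c)\<^sup>2)" for k y unfolding vnorm_def by (simp add: sum_nonneg)
  have bdd: "bdd_above ?S"
  proof (rule bdd_aboveI)
    fix s assume "s \<in> ?S"
    then obtain x where s: "s = vnorm mr (matvec nc A x)" and x: "vnorm nc x \<le> 1" by auto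
    have "(\<Sum>c<nc. (x c)\<^sup>2) \<le> 1" using x by (simp add: vnorm_def)
    then have "(\<Sum>r<mr. (matvec nc A x r)\<^sup>2) \<le> Fr * 1" using fr[of x] Fr0 by (meson mult_left_mono order.trans)
    then show "s \<le> sqrt Fr" unfolding s vnorm_def by simp
  qed
  have unit: "(\<Sum>r<mr. (matvec nc A y r)\<^sup>2) \<le> K\<^sup>2" if "vnorm nc y \<le> 1" for y
  proof -
    have "vnorm mr (matvec nc A y) \<le> opnorm mr nc A"
      unfolding opnorm_def by (rule cSup_upper[OF _ bdd]) (use that in auto)
    then have "vnorm mr (matvec nc A y) \<le> K" using assms by simp
    then have "(vnorm mr (matvec nc A y))\<^sup>2 \<le> K\<^sup>2" by (intro power_mono) (auto simp: vnorm_def sum_nonneg)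
    then show ?thesis unfolding sq .
  qed
  define s where "s = vnorm nc x"
  show ?thesis
  proof (cases "s = 0")
    case True
    then have "(\<Sum>c<nc. (x c)\<^sup>2) = 0" using sq[of nc x] by (simp add: s_def)
    then show ?thesis using fr[of x] by simp
  next
    case False
    have s0: "s > 0" using False by (simp add: s_def vnorm_def sum_nonneg order.strict_iff_order)
    let ?y = "\<lambda>c. x c / s"
    have "(vnorm nc ?y)\<^sup>2 = 1"
      unfolding sq power_divide sum_divide_distrib[symmetric] sq[of nc x, symmetric] s_def[symmetric] using s0 by simp
    then have "vnorm nc ?y \<le> 1" by (metis abs_square_eq_1 abs_le_D1 order_refl)
    from unit[OF this] have "(\<Sum>r<mr. (matvec nc A ?y r)\<^sup>2) \<le> K\<^sup>2" .
    moreover have "matvec nc A ?y r = matvec nc A x r / s" for r by (simp add: matvec_def sum_divide_distrib)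
    ultimately have "(\<Sum>r<mr. (matvec nc A x r)\<^sup>2) \<le> K\<^sup>2 * s\<^sup>2"
      using s0 by (simp add: power_divide sum_divide_distrib[symmetric] divide_le_eq)
    then show ?thesis using sq[of nc x] by (simp add: s_def)
  qed
qed

text \<open>Column \<open>c\<close> is the image of a unit vector, so its squared norm is at most
  K^2; Cauchy-Schwarz finishes.\<close>

lemma matvec_transpose_le:
  assumes "\<And>x. (\<Sum>r<mr. (matvec nc A x r)\<^sup>2) \<le> K\<^sup>2 * (\<Sum>c<nc. (x c)\<^sup>2)" and c: "c < nc"
  shows "(\<Sum>r<mr. A r c * y r)\<^sup>2 \<le> K\<^sup>2 * (\<Sum>r<mr. (y r)\<^sup>2)"
proof -
  let ?u = "\<lambda>i. if i = c then 1 else 0 :: real"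
  have u1: "(\<Sum>i<nc. (?u i)\<^sup>2) = 1"
  proof -
    have "(\<Sum>i<nc. (?u i)\<^sup>2) = (\<Sum>i<nc. ?u i)" by (intro sum.cong) auto
    then show ?thesis using c by simp
  qed
  have "matvec nc A ?u r = A r c" for r using c by (simp add: matvec_def if_distrib cong: if_cong)
  then have "(\<Sum>r<mr. (A r c)\<^sup>2) \<le> K\<^sup>2" using assms(1)[of ?u] u1 by simp
  then have "(\<Sum>r<mr. (A r c)\<^sup>2) * (\<Sum>r<mr. (y r)\<^sup>2) \<le> K\<^sup>2 * (\<Sum>r<mr. (y r)\<^sup>2)"
    by (intro mult_right_mono sum_nonneg) auto
  then show ?thesis using Cauchy_Schwarz_ineq_sum[of "\<lambda>r. A r c" y "{..<mr}"] by linarith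
qed

text \<open>The window weights decrease linearly to zero, so that advancing the window telescopes (\<open>wsum_Suc\<close>).\<close>

definition wsum :: "nat \<Rightarrow> (nat \<Rightarrow> real) \<Rightarrow> nat \<Rightarrow> real" where
  "wsum P f k = (\<Sum>s<P. (1 - real s / real P) * f (k + s))"

lemma wsum_Suc:
  assumes "P > 0"
  shows "wsum P f (Suc k) = wsum P f k - f k + (\<Sum>s<P. f (Suc k + s)) / real P"
proof -
  have a: "(\<Sum>s<P. (real P - real s) * g (Suc s)) = (\<Sum>s<P. (real P - real s) * g s) - real P * g 0 + (\<Sum>s<P. g (Suc s))" for g :: "nat \<Rightarrow> real"
  proof (induction P)
    case (Suc P)
    have e: "(\<Sum>s<Suc P. (real (Suc P) - real s) * h s) = (\<Sum>s<P. (real P - real s) * h s) + (\<Sum>s<Suc P. h s)" for h :: "nat \<Rightarrow> real"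
      by (simp add: sum.distrib[symmetric] algebra_simps)
    show ?case unfolding e Suc.IH using sum.lessThan_Suc_shift[of g P] by (simp add: algebra_simps del: sum.lessThan_Suc) 
  qed simp
  have w: "real P * wsum P f j = (\<Sum>s<P. (real P - real s) * f (j + s))" for j
    using assms by (simp add: wsum_def sum_distrib_left algebra_simps)
  have "real P * wsum P f (Suc k) = real P * wsum P f k - real P * f k + (\<Sum>s<P. f (Suc k + s))"
    unfolding w using a[of "\<lambda>s. f (k + s)"] by simp
  then have "wsum P f (Suc k) = (real P * wsum P f k - real P * f k + (\<Sum>s<P. f (Suc k + s))) / real P"
    using assms by (simp add: field_simps)
  then show ?thesis using assms by (simp add: add_divide_distrib diff_divide_distrib)
qed

lemma sum_mod_period:
  fixes f :: "nat \<Rightarrow> real"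
  shows "(\<Sum>s<n. f ((k + s) mod n)) = (\<Sum>l<n. f l)"
proof (cases "n = 0")
  case False
  show ?thesis
  proof (rule sum.reindex_bij_betw[of "\<lambda>s. (k + s) mod n" "{..<n}" "{..<n}" f])
    have inj: "inj_on (\<lambda>s. (k + s) mod n) {..<n}"
    proof (rule inj_onI)
      fix x y assume xy: "x \<in> {..<n}" "y \<in> {..<n}" and eq: "(k + x) mod n = (k + y) mod n"
      then have "[k + x = k + y] (mod n)" by (simp add: cong_def)
      then have "[x = y] (mod n)" by (simp add: cong_add_lcancel_nat)
      then show "x = y" using xy by (simp add: cong_def)
    qed
    moreover have "(\<lambda>s. (k + s) mod n) ` {..<n} \<subseteq> {..<n}" using False by auto
    ultimately show "bij_betw (\<lambda>s. (k + s) mod n) {..<n} {..<n}"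
      unfolding bij_betw_def using endo_inj_surj[of "{..<n}"] by blast
  qed
qed simp

section \<open>Quadratic forms in the stacked error and its mean increment\<close>

locale sc_det =
  fixes N n :: nat and m :: "nat \<Rightarrow> nat" and aw :: "nat \<Rightarrow> nat \<Rightarrow> real"
    and H :: "nat \<Rightarrow> nat \<Rightarrow> nat \<Rightarrow> nat \<Rightarrow> real" and \<theta> :: "nat \<Rightarrow> real"
    and nu b alpha1 gamma :: "nat \<Rightarrow> nat \<Rightarrow> real" and beta1 :: "nat \<Rightarrow> real"
    and Hbar \<delta> :: real and p :: nat
  assumes Npos: "2 \<le> N" and npos: "0 < n"
    and aw_sym: "\<And>i j. i < N \<Longrightarrow> j < N \<Longrightarrow> aw i j = aw j i"
    and aw_nonneg: "\<And>i j. i < N \<Longrightarrow> j < N \<Longrightarrow> aw i j \<ge> 0"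
    and Hbar: "Hbar > 0" "\<And>i k. i < N \<Longrightarrow> 1 \<le> k \<Longrightarrow> opnorm (m i) n (H i k) \<le> Hbar"
    and pe: "p > 0" "\<delta> > 0"
        "\<And>k x. 1 \<le> k \<Longrightarrow>
            (1 / real p) * (\<Sum>t\<in>{k..k+p-1}. \<Sum>i<N. (vnorm (m i) (matvec n (H i t) x))\<^sup>2)
              \<ge> \<delta> * (vnorm n x)\<^sup>2"
    and conn: "mat_rank (laplacian N aw) = N - 1"
    and nu_sym: "\<And>i j. (i, j) \<in> edges N aw \<Longrightarrow> nu i j = nu j i \<and> nu i j \<ge> 0"
    and b_sym: "\<And>i j. (i, j) \<in> edges N aw \<Longrightarrow> b i j = b j i \<and> b i j > 0"
    and alpha_sym: "\<And>i j. (i, j) \<in> edges N aw \<Longrightarrow> alpha1 i j = alpha1 j i \<and> alpha1 i j > 0"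
    and beta_pos: "\<And>i. i < N \<Longrightarrow> beta1 i > 0"
    and gamma_cond: "\<And>i j. (i, j) \<in> edges N aw \<Longrightarrow>
        gamma i j = gamma j i \<and> 1/2 < gamma i j \<and> gamma i j \<le> 1 \<and> nu i j + gamma i j \<le> 1"
begin

abbreviation "E \<equiv> edges N aw"

lemma edgeI: "i < N \<Longrightarrow> j < N \<Longrightarrow> aw i j \<noteq> 0 \<Longrightarrow> (i, j) \<in> E"
  using aw_nonneg[of i j] by (auto simp: edges_def)

lemma edgeD: "(i, j) \<in> E \<Longrightarrow> i < N \<and> j < N \<and> 0 < aw i j"
  by (auto simp: edges_def)

lemma finite_E: "finite E"
  by (rule finite_subset[of _ "{..<N} \<times> {..<N}"]) (auto simp: edges_def)

definition ip :: "(nat \<Rightarrow> nat \<Rightarrow> real) \<Rightarrow> (nat \<Rightarrow> nat \<Rightarrow> real) \<Rightarrow> real" where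
  "ip x y = (\<Sum>i<N. \<Sum>c<n. x i c * y i c)"

definition V :: "(nat \<Rightarrow> nat \<Rightarrow> real) \<Rightarrow> real" where "V x = (\<Sum>i<N. \<Sum>c<n. (x i c)\<^sup>2)"

lemma V_ip: "V x = ip x x" by (simp add: V_def ip_def power2_eq_square)
lemma V_nonneg: "0 \<le> V x" unfolding V_def by (intro sum_nonneg) auto
lemma ip_sym: "ip x y = ip y x" by (simp add: ip_def mult.commute)
lemma ip_add: "ip x (\<lambda>i c. y i c + z i c) = ip x y + ip x z"
  by (simp add: ip_def distrib_left sum.distrib)
lemma ip_scale: "ip x (\<lambda>i c. t * y i c) = t * ip x y"
  by (simp add: ip_def sum_distrib_left mult_ac)

lemma sum_sq_le_V: "i < N \<Longrightarrow> (\<Sum>c<n. (x i c)\<^sup>2) \<le> V x"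
  unfolding V_def by (rule member_le_sum[of i "{..<N}" "\<lambda>i. \<Sum>c<n. (x i c)\<^sup>2"]) (auto intro: sum_nonneg)

lemma sq_le_V: "i < N \<Longrightarrow> c < n \<Longrightarrow> (x i c)\<^sup>2 \<le> V x"
  by (rule order.trans[OF _ sum_sq_le_V]) (auto intro: member_le_sum)

text \<open>Symmetric bilinear forms between zero and \<open>C\<close> times the identity; linearity is encoded by Riesz representability.\<close>

definition bform :: "real \<Rightarrow> ((nat \<Rightarrow> nat \<Rightarrow> real) \<Rightarrow> (nat \<Rightarrow> nat \<Rightarrow> real) \<Rightarrow> real) \<Rightarrow> bool" where
  "bform C f \<longleftrightarrow> (\<forall>x y. f x y = f y x) \<and> (\<forall>x. \<exists>g. \<forall>y. f x y = ip g y) \<and> (\<forall>x. 0 \<le> f x x \<and> f x x \<le> C * V x)"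

lemma bform_zero: "bform 0 (\<lambda>x y. 0)"
  unfolding bform_def by (auto intro!: exI[of _ "\<lambda>i c. 0"] simp: ip_def)

lemma bform_add:
  assumes "bform C f" "bform C' f'" shows "bform (C + C') (\<lambda>x y. f x y + f' x y)"
  unfolding bform_def
proof (intro conjI allI)
  fix x
  obtain g g' where g: "\<And>y. f x y = ip g y" "\<And>y. f' x y = ip g' y" using assms unfolding bform_def by metis
  show "\<exists>g. \<forall>y. f x y + f' x y = ip g y"
    by (rule exI[of _ "\<lambda>i c. g i c + g' i c"]) (simp add: g ip_sym[of "\<lambda>i c. g i c + g' i c"] ip_add ip_sym[of g] ip_sym[of g'])
  show "0 \<le> f x x + f' x x" "f x x + f' x x \<le> (C + C') * V x"
    using assms unfolding bform_def by (auto simp: distrib_right intro: add_mono add_nonneg_nonneg)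
  fix y show "f x y + f' x y = f y x + f' y x" using assms unfolding bform_def by metis
qed

lemma bform_scale:
  assumes "bform C f" "0 \<le> t" shows "bform (t * C) (\<lambda>x y. t * f x y)"
  unfolding bform_def
proof (intro conjI allI)
  fix x
  obtain g where g: "\<And>y. f x y = ip g y" using assms unfolding bform_def by metis
  show "\<exists>g. \<forall>y. t * f x y = ip g y"
    by (rule exI[of _ "\<lambda>i c. t * g i c"]) (simp add: g ip_sym[of "\<lambda>i c. t * g i c"] ip_scale ip_sym[of g])
  show "0 \<le> t * f x x" using assms unfolding bform_def by auto
  show "t * f x x \<le> t * C * V x" using assms unfolding bform_def by (simp add: mult.assoc mult_left_mono)
  fix y show "t * f x y = t * f y x" using assms unfolding bform_def by metis
qed

lemma bform_sum:
  assumes "finite S" "\<And>s. s \<in> S \<Longrightarrow> bform (C s) (f s)"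
  shows "bform (\<Sum>s\<in>S. C s) (\<lambda>x y. \<Sum>s\<in>S. f s x y)"
  using assms
proof (induction S rule: finite_induct)
  case empty
  then show ?case using bform_zero by simp
next
  case (insert s S)
  have "bform (C s + sum C S) (\<lambda>x y. f s x y + (\<Sum>s\<in>S. f s x y))"
    by (rule bform_add) (use insert in auto)
  then show ?case using insert by simp
qed

lemma bform_mono: "bform C f \<Longrightarrow> C \<le> C' \<Longrightarrow> bform C' f"
  unfolding bform_def by (meson V_nonneg mult_right_mono order.trans)

lemma bform_symD: "bform C f \<Longrightarrow> f x y = f y x" unfolding bform_def by blast
lemma bform_nonneg: "bform C f \<Longrightarrow> 0 \<le> f x x" unfolding bform_def by blast
lemma bform_le: "bform C f \<Longrightarrow> f x x \<le> C * V x" unfolding bform_def by blast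

lemma bform_addD:
  assumes "bform C f" shows "f x (\<lambda>i c. y i c + z i c) = f x y + f x z"
proof -
  obtain g where g: "\<And>y. f x y = ip g y" using assms unfolding bform_def by metis
  show ?thesis unfolding g by (rule ip_add)
qed

lemma bform_scaleD:
  assumes "bform C f" shows "f x (\<lambda>i c. t * y i c) = t * f x y"
proof -
  obtain g where g: "\<And>y. f x y = ip g y" using assms unfolding bform_def by metis
  show ?thesis unfolding g by (rule ip_scale)
qed

lemma bform_square_add:
  assumes "bform C f"
  shows "f (\<lambda>i c. x i c + y i c) (\<lambda>i c. x i c + y i c) = f x x + 2 * f x y + f y y"
  using bform_addD[OF assms, of "\<lambda>i c. x i c + y i c" x y] bform_addD[OF assms, of x x y] bform_addD[OF assms, of y x y]
    bform_symD[OF assms, of "\<lambda>i c. x i c + y i c" x] bform_symD[OF assms, of "\<lambda>i c. x i c + y i c" y] bform_symD[OF assms, of y x]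
  by simp

lemma bform_CS:
  assumes f: "bform C f" shows "(f x y)\<^sup>2 \<le> f x x * f y y"
proof -
  have q: "0 \<le> f x x + 2 * t * f x y + t\<^sup>2 * f y y" for t
  proof -
    have "0 \<le> f (\<lambda>i c. x i c + t * y i c) (\<lambda>i c. x i c + t * y i c)" by (rule bform_nonneg[OF f])
    also have "\<dots> = f x x + 2 * f x (\<lambda>i c. t * y i c) + f (\<lambda>i c. t * y i c) (\<lambda>i c. t * y i c)" by (rule bform_square_add[OF f])
    also have "\<dots> = f x x + 2 * t * f x y + t\<^sup>2 * f y y"
      using bform_symD[OF f, of "\<lambda>i c. t * y i c" y] by (simp add: bform_scaleD[OF f] power2_eq_square)
    finally show ?thesis .
  qed
  show ?thesis
  proof (cases "f y y = 0")
    case True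
    have "f x y = 0"
    proof (rule ccontr)
      assume ne: "f x y \<noteq> 0"
      have "0 \<le> f x x + 2 * (- (f x x + 1) / (2 * f x y)) * f x y" using q[of "- (f x x + 1) / (2 * f x y)"] True by simp
      also have "\<dots> = - 1" using ne by (simp add: field_simps)
      finally show False by simp
    qed
    then show ?thesis using True by simp
  next
    case False
    then have p: "f y y > 0" using bform_nonneg[OF f, of y] by simp
    have "0 \<le> (f x x + 2 * (- f x y / f y y) * f x y + (- f x y / f y y)\<^sup>2 * f y y) * f y y"
      using q[of "- f x y / f y y"] p by simp
    also have "\<dots> = f x x * f y y - (f x y)\<^sup>2" using False by (simp add: field_simps power2_eq_square)
    finally show ?thesis by simp
  qed
qed

definition unit :: "nat \<Rightarrow> nat \<Rightarrow> nat \<Rightarrow> nat \<Rightarrow> real" where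
  "unit i c = (\<lambda>i' c'. if i' = i \<and> c' = c then 1 else 0)"

lemma ip_unit: assumes "i < N" "c < n" shows "ip g (unit i c) = g i c"
proof -
  have "ip g (unit i c) = (\<Sum>i'<N. \<Sum>c'<n. if c' = c then (if i' = i then g i' c' else 0) else 0)"
    unfolding ip_def unit_def by (intro sum.cong refl) auto
  also have "\<dots> = g i c" using assms by simp
  finally show ?thesis .
qed

text \<open>The coefficients are the coordinates of the representing vector. In this shape a form
  evaluated at random vectors is a finite sum of products, from which measurability and the
  martingale property are read off.\<close>

lemma bform_expand:
  assumes f: "bform C f" shows "f x y = (\<Sum>i<N. \<Sum>c<n. f (unit i c) x * y i c)"
proof -
  obtain g where g: "\<And>y. f x y = ip g y" using f unfolding bform_def by metis
  have "g i c = f (unit i c) x" if "i < N" "c < n" for i c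
    using ip_unit[OF that, of g] g bform_symD[OF f] by metis
  then show ?thesis unfolding g ip_def by simp
qed

definition qf :: "nat \<Rightarrow> (nat \<Rightarrow> nat \<Rightarrow> real) \<Rightarrow> (nat \<Rightarrow> nat \<Rightarrow> real) \<Rightarrow> real" where
  "qf t x y = (\<Sum>i<N. \<Sum>r<m i. matvec n (H i t) (x i) r * matvec n (H i t) (y i) r)"

lemma Hbound: "i < N \<Longrightarrow> 1 \<le> k \<Longrightarrow> (\<Sum>r<m i. (matvec n (H i k) x r)\<^sup>2) \<le> Hbar\<^sup>2 * (\<Sum>c<n. (x c)\<^sup>2)"
  by (rule matvec_opnorm_le) (use Hbar in \<open>auto intro: less_imp_le\<close>)

lemma bform_qf: assumes t: "1 \<le> t" shows "bform (Hbar\<^sup>2) (qf t)"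
  unfolding bform_def
proof (intro conjI allI)
  fix x
  show "0 \<le> qf t x x" unfolding qf_def by (intro sum_nonneg) auto
  show "qf t x x \<le> Hbar\<^sup>2 * V x"
    unfolding qf_def V_def sum_distrib_left[of _ _ "{..<N}"]
    by (intro sum_mono) (use Hbound[OF _ t] in \<open>simp add: power2_eq_square\<close>)
  show "\<exists>g. \<forall>y. qf t x y = ip g y"
  proof (intro exI allI)
    fix y
    have "qf t x y = (\<Sum>i<N. \<Sum>r<m i. \<Sum>c<n. matvec n (H i t) (x i) r * H i t r c * y i c)"
      unfolding qf_def by (intro sum.cong refl) (simp add: matvec_def[of n _ "y _"] sum_distrib_left mult_ac)
    also have "\<dots> = (\<Sum>i<N. \<Sum>c<n. \<Sum>r<m i. matvec n (H i t) (x i) r * H i t r c * y i c)"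
      by (intro sum.cong refl sum.swap)
    also have "\<dots> = ip (\<lambda>i c. \<Sum>r<m i. matvec n (H i t) (x i) r * H i t r c) y"
      by (simp add: ip_def sum_distrib_right)
    finally show "qf t x y = ip (\<lambda>i c. \<Sum>r<m i. matvec n (H i t) (x i) r * H i t r c) y" .
  qed
  fix y show "qf t x y = qf t y x" by (simp add: qf_def mult.commute)
qed

text \<open>The sum runs over ordered pairs, so on the diagonal this is twice the Laplacian form of
  coordinate \<open>l\<close>; hence the division by 2 in \<open>Qf\<close>.\<close>

definition sf :: "nat \<Rightarrow> (nat \<Rightarrow> nat \<Rightarrow> real) \<Rightarrow> (nat \<Rightarrow> nat \<Rightarrow> real) \<Rightarrow> real" where
  "sf l x y = (\<Sum>i<N. \<Sum>j<N. aw i j * (x i l - x j l) * (y i l - y j l))"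

definition "CA = 4 * (\<Sum>i<N. \<Sum>j<N. aw i j)"

lemma CA_nonneg: "0 \<le> CA" unfolding CA_def by (auto intro!: sum_nonneg aw_nonneg)

lemma diff_sq_le: "((u::real) - v)\<^sup>2 \<le> 2 * u\<^sup>2 + 2 * v\<^sup>2"
  using zero_le_power2[of "u + v"] by (simp add: power2_eq_square algebra_simps)

lemma bform_sf: assumes l: "l < n" shows "bform CA (sf l)"
  unfolding bform_def
proof (intro conjI allI)
  fix x
  show "0 \<le> sf l x x" unfolding sf_def by (intro sum_nonneg) (simp add: mult.assoc aw_nonneg)
  show "sf l x x \<le> CA * V x"
  proof -
    have "sf l x x \<le> (\<Sum>i<N. \<Sum>j<N. aw i j * (4 * V x))"
      unfolding sf_def
    proof (intro sum_mono)
      fix i j assume ij: "i \<in> {..<N}" "j \<in> {..<N}"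
      have "(x i l - x j l)\<^sup>2 \<le> 4 * V x" using diff_sq_le[of "x i l" "x j l"] sq_le_V[of i l x] sq_le_V[of j l x] ij l by simp
      then have "aw i j * (x i l - x j l)\<^sup>2 \<le> aw i j * (4 * V x)" using ij aw_nonneg by (intro mult_left_mono) auto
      then show "aw i j * (x i l - x j l) * (x i l - x j l) \<le> aw i j * (4 * V x)" by (simp add: power2_eq_square mult.assoc)
    qed
    also have "\<dots> = CA * V x" by (simp add: CA_def sum_distrib_left sum_distrib_right mult_ac)
    finally show ?thesis .
  qed
  show "\<exists>g. \<forall>y. sf l x y = ip g y"
  proof (intro exI allI)
    fix y
    have "sf l x y = 2 * (\<Sum>i<N. y i l * (\<Sum>j<N. aw i j * (x i l - x j l)))"
      unfolding sf_def by (rule sum_edge_differences) (use aw_sym in auto)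
    also have "\<dots> = ip (\<lambda>i c. if c = l then 2 * (\<Sum>j<N. aw i j * (x i l - x j l)) else 0) y"
    proof -
      have "(\<Sum>c<n. (if c = l then u else 0) * y i c) = u * y i l" for u i
      proof -
        have "(\<Sum>c<n. (if c = l then u else 0) * y i c) = (\<Sum>c<n. if c = l then u * y i c else 0)"
          by (intro sum.cong) auto
        then show ?thesis using l by simp
      qed
      then show ?thesis unfolding ip_def by (simp add: sum_distrib_left mult_ac)
    qed
    finally show "sf l x y = ip (\<lambda>i c. if c = l then 2 * (\<Sum>j<N. aw i j * (x i l - x j l)) else 0) y" .
  qed
  fix y show "sf l x y = sf l y x" by (simp add: sf_def mult_ac)
qed

text \<open>Index \<open>k\<close> labels the transition from time k to k + 1: step size and
  threshold are those of time \<open>Suc k\<close>, and \<open>lc k\<close> is the 0-based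
  coordinate transmitted then.\<close>

definition "al i j k = alpha1 i j / real (Suc k) powr gamma i j"
definition "thr i j k = nu i j * b i j * ln (real (Suc k))"
definition "G i j k z = trG (thr i j k) (b i j) z"
definition "lc k = k mod n"

lemma lc_less: "lc k < n" using npos by (simp add: lc_def)

lemma thr_nonneg: "(i, j) \<in> E \<Longrightarrow> 0 \<le> thr i j k"
  using nu_sym[of i j] b_sym[of i j] by (simp add: thr_def)

lemma al_pos: "(i, j) \<in> E \<Longrightarrow> 0 < al i j k" using alpha_sym[of i j] by (simp add: al_def)

lemma edge_fun_sym:
  assumes "(i, j) \<in> E"
  shows "al i j k = al j i k \<and> thr i j k = thr j i k \<and> G i j k z = G j i k z"
proof -
  have s: "nu i j = nu j i" "b i j = b j i" "alpha1 i j = alpha1 j i" "gamma i j = gamma j i"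
    using nu_sym[OF assms] b_sym[OF assms] alpha_sym[OF assms] gamma_cond[OF assms] by blast+
  show ?thesis unfolding al_def thr_def G_def s by (intro conjI refl)
qed

definition zc :: "nat \<Rightarrow> (nat \<Rightarrow> nat \<Rightarrow> real) \<Rightarrow> nat \<Rightarrow> real" where "zc k x i = \<theta> (lc k) + x i (lc k)"

definition dG :: "nat \<Rightarrow> (nat \<Rightarrow> nat \<Rightarrow> real) \<Rightarrow> nat \<Rightarrow> real" where
  "dG k x i = (\<Sum>j<N. aw i j * (al i j k * (G i j k (zc k x j) - G i j k (zc k x i))))"

definition dH :: "nat \<Rightarrow> (nat \<Rightarrow> nat \<Rightarrow> real) \<Rightarrow> nat \<Rightarrow> nat \<Rightarrow> real" where
  "dH k x i c = beta1 i / real (Suc k) * (\<Sum>r<m i. H i (Suc k) r c * matvec n (H i (Suc k)) (x i) r)"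

text \<open>Mean increment of the error given the past, when the current error is \<open>x\<close>:
  messages are replaced by their means and the observation noise by 0.\<close>

definition U :: "nat \<Rightarrow> (nat \<Rightarrow> nat \<Rightarrow> real) \<Rightarrow> nat \<Rightarrow> nat \<Rightarrow> real" where
  "U k x i c = (if c = lc k then dG k x i else 0) - dH k x i c"

text \<open>Nonlinear counterpart of \<open>sf\<close>, one difference being replaced by the
  difference of quantiser means. To first order, consensus lowers \<open>V\<close> by this amount
  (\<open>ip_dG\<close>).\<close>

definition cons :: "nat \<Rightarrow> (nat \<Rightarrow> nat \<Rightarrow> real) \<Rightarrow> real" where
  "cons k x = (\<Sum>i<N. \<Sum>j<N. aw i j * al i j k * (zc k x i - zc k x j) * (G i j k (zc k x i) - G i j k (zc k x j)))"

lemma sum_if_lc: "(\<Sum>c<n. (if c = lc k then u else 0) * y c) = u * (y (lc k) :: real)"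
proof -
  have "(\<Sum>c<n. (if c = lc k then u else 0) * y c) = (\<Sum>c<n. if c = lc k then u * y c else 0)"
    by (intro sum.cong) auto
  then show ?thesis using lc_less by simp
qed

lemma ip_dH:
  "(\<Sum>c<n. x i c * dH k x i c) = beta1 i / real (Suc k) * (\<Sum>r<m i. (matvec n (H i (Suc k)) (x i) r)\<^sup>2)"
proof -
  define A where "A = H i (Suc k)"
  define M where "M r = matvec n A (x i) r" for r
  define t where "t = beta1 i / real (Suc k)"
  have mv: "M r = (\<Sum>c<n. A r c * x i c)" for r by (simp add: matvec_def M_def)
  have "(\<Sum>c<n. x i c * (\<Sum>r<m i. A r c * M r)) = (\<Sum>c<n. \<Sum>r<m i. A r c * x i c * M r)"
    unfolding sum_distrib_left by (intro sum.cong refl) simp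
  also have "\<dots> = (\<Sum>r<m i. \<Sum>c<n. A r c * x i c * M r)" by (rule sum.swap)
  also have "\<dots> = (\<Sum>r<m i. (M r)\<^sup>2)"
    unfolding sum_distrib_right[symmetric] mv[symmetric] power2_eq_square ..
  finally have e: "(\<Sum>c<n. x i c * (\<Sum>r<m i. A r c * M r)) = (\<Sum>r<m i. (M r)\<^sup>2)" .
  have "(\<Sum>c<n. x i c * dH k x i c) = (\<Sum>c<n. t * (x i c * (\<Sum>r<m i. A r c * M r)))"
    unfolding dH_def A_def[symmetric] M_def[symmetric] t_def[symmetric] by (intro sum.cong refl) simp
  also have "\<dots> = t * (\<Sum>r<m i. (M r)\<^sup>2)" unfolding sum_distrib_left[symmetric] e ..
  finally show ?thesis by (simp add: A_def M_def t_def)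
qed

text \<open>Both endpoints of an edge use the same step size, threshold and mean function, so the
  flow \<open>Fi\<close> along edges is antisymmetric and \<open>sum_edge_differences\<close>
  applies.\<close>

lemma ip_dG: "cons k x = - 2 * (\<Sum>i<N. x i (lc k) * dG k x i)"
proof -
  let ?l = "lc k"
  define Fi where "Fi i j = aw i j * (al i j k * (G i j k (zc k x i) - G i j k (zc k x j)))" for i j
  have anti: "Fi i j = - Fi j i" if "i < N" "j < N" for i j
  proof (cases "aw i j = 0")
    case True
    then show ?thesis using aw_sym[OF that] by (simp add: Fi_def)
  next
    case False
    then have e: "(i, j) \<in> E" using edgeI that by blast
    have "Fi j i = aw i j * (al i j k * (G i j k (zc k x j) - G i j k (zc k x i)))"
      unfolding Fi_def using edge_fun_sym[OF e, of k "zc k x j"] edge_fun_sym[OF e, of k "zc k x i"] aw_sym[OF that] by metis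
    then show ?thesis by (simp add: Fi_def algebra_simps)
  qed
  have "(\<Sum>i<N. \<Sum>j<N. 1 * Fi i j * (x i ?l - x j ?l)) = 2 * (\<Sum>i<N. x i ?l * (\<Sum>j<N. 1 * Fi i j))"
    by (rule sum_edge_differences) (rule refl, rule anti)
  moreover have "(\<Sum>j<N. 1 * Fi i j) = - dG k x i" for i
  proof -
    have "dG k x i = (\<Sum>j<N. - (1 * Fi i j))"
      unfolding dG_def Fi_def by (intro sum.cong refl) (simp add: algebra_simps)
    then show ?thesis by (simp add: sum_negf)
  qed
  moreover have "(\<Sum>i<N. \<Sum>j<N. 1 * Fi i j * (x i ?l - x j ?l)) = cons k x"
    unfolding cons_def Fi_def by (intro sum.cong refl) (simp add: zc_def)
  ultimately show ?thesis by (simp add: sum_negf)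
qed

lemma ip_U: "2 * ip x (U k x) = - cons k x - 2 * (\<Sum>i<N. beta1 i / real (Suc k) * (\<Sum>r<m i. (matvec n (H i (Suc k)) (x i) r)\<^sup>2))"
proof -
  let ?l = "lc k"
  have "ip x (U k x) = (\<Sum>i<N. (\<Sum>c<n. (if c = ?l then dG k x i else 0) * x i c) - (\<Sum>c<n. x i c * dH k x i c))"
    unfolding ip_def
  proof (intro sum.cong refl)
    fix i
    show "(\<Sum>c<n. x i c * U k x i c) = (\<Sum>c<n. (if c = ?l then dG k x i else 0) * x i c) - (\<Sum>c<n. x i c * dH k x i c)"
      unfolding sum_subtractf[symmetric] by (intro sum.cong refl) (simp add: U_def algebra_simps)
  qed
  also have "\<dots> = (\<Sum>i<N. dG k x i * x i ?l - beta1 i / real (Suc k) * (\<Sum>r<m i. (matvec n (H i (Suc k)) (x i) r)\<^sup>2))"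
    by (intro sum.cong refl) (simp only: sum_if_lc ip_dH)
  also have "\<dots> = (\<Sum>i<N. x i ?l * dG k x i) - (\<Sum>i<N. beta1 i / real (Suc k) * (\<Sum>r<m i. (matvec n (H i (Suc k)) (x i) r)\<^sup>2))"
    by (simp only: sum_subtractf mult.commute[of "dG k x _"])
  finally show ?thesis using ip_dG[of k x] by linarith
qed

lemma cons_nonneg: "0 \<le> cons k x"
  unfolding cons_def
proof (intro sum_nonneg)
  fix i j assume ij: "i \<in> {..<N}" "j \<in> {..<N}"
  show "0 \<le> aw i j * al i j k * (zc k x i - zc k x j) * (G i j k (zc k x i) - G i j k (zc k x j))"
  proof (cases "aw i j = 0")
    case False
    then have e: "(i, j) \<in> E" using edgeI ij by auto
    have "0 \<le> (zc k x i - zc k x j) * (G i j k (zc k x i) - G i j k (zc k x j))"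
      unfolding G_def by (rule trG_monotone) (use b_sym[OF e] thr_nonneg[OF e] in auto)
    then show ?thesis using edgeD[OF e] al_pos[OF e, of k] by (simp add: mult.assoc)
  qed simp
qed

end

lemma summable_Suc_powr: "s < -1 \<Longrightarrow> summable (\<lambda>k. real (Suc k) powr s)"
  by (subst summable_Suc_iff[of "\<lambda>k. real k powr s"]) (simp add: summable_real_powr_iff)

lemma tendsto_Suc_powr_0: "s < 0 \<Longrightarrow> (\<lambda>k. real (Suc k) powr s) \<longlonglongrightarrow> 0"
  by (rule LIMSEQ_Suc[of "\<lambda>k. real k powr s"]) (rule tendsto_neg_powr[OF _ filterlim_real_sequentially])

section \<open>Quadratic bounds on the mean increment\<close>

context sc_det
begin

text \<open>The inserted 1 keeps the minimum defined for an empty edge set and lies in the range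
  allowed for the exponents.\<close>

definition "gmin = Min (insert 1 ((\<lambda>(i, j). gamma i j) ` E))"

lemma gmin: "1/2 < gmin" "gmin \<le> 1" "(i, j) \<in> E \<Longrightarrow> gmin \<le> gamma i j"
proof -
  have fin: "finite (insert 1 ((\<lambda>(i, j). gamma i j) ` E))" using finite_E by simp
  show "1/2 < gmin" unfolding gmin_def by (subst Min_gr_iff[OF fin]) (use gamma_cond in auto)
  show "gmin \<le> 1" unfolding gmin_def by (rule Min_le[OF fin]) simp
  show "(i, j) \<in> E \<Longrightarrow> gmin \<le> gamma i j" unfolding gmin_def by (rule Min_le[OF fin]) (auto intro: rev_image_eqI)
qed

definition "KG = (\<Sum>i<N. \<Sum>j<N. aw i j * (alpha1 i j / b i j))"
definition "KU = 8 * real N * KG\<^sup>2 + 2 * real n * (\<Sum>i<N. (beta1 i)\<^sup>2) * Hbar^4"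
text \<open>Order of the squared step sizes, summable because every exponent exceeds 1/2;
  \<open>KU\<close> collects the squared Lipschitz constants of the mean increment.\<close>

definition "ku k = real (Suc k) powr (- 2 * gmin)"

lemma ab_nonneg: "i < N \<Longrightarrow> j < N \<Longrightarrow> 0 \<le> aw i j * (alpha1 i j / b i j)"
proof (cases "aw i j = 0")
  case False
  assume "i < N" "j < N"
  then have e: "(i, j) \<in> E" using edgeI False by blast
  show ?thesis using edgeD[OF e] alpha_sym[OF e] b_sym[OF e] by auto
qed simp

lemma KU_nonneg: "0 \<le> KU" unfolding KU_def by (auto intro!: add_nonneg_nonneg mult_nonneg_nonneg sum_nonneg)

lemma al_le: assumes e: "(i, j) \<in> E" shows "al i j k \<le> alpha1 i j * real (Suc k) powr (- gmin)"
proof -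
  have "real (Suc k) powr (- gamma i j) \<le> real (Suc k) powr (- gmin)"
    using gmin(3)[OF e] by (intro powr_mono) auto
  then have "alpha1 i j * real (Suc k) powr (- gamma i j) \<le> alpha1 i j * real (Suc k) powr (- gmin)"
    using alpha_sym[OF e] by (intro mult_left_mono) auto
  then show ?thesis by (simp add: al_def powr_minus divide_inverse)
qed

lemma dG_sq_le: assumes i: "i < N" shows "(dG k x i)\<^sup>2 \<le> 4 * KG\<^sup>2 * ku k * V x"
proof -
  define R where "R = real (Suc k) powr (- gmin) * (2 * sqrt (V x))"
  have R0: "0 \<le> R" using V_nonneg by (simp add: R_def)
  have xl: "\<bar>x j (lc k)\<bar> \<le> sqrt (V x)" if "j < N" for j
    using sq_le_V[OF that lc_less, of x k] by (simp add: real_le_rsqrt)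
  have tm: "\<bar>aw i j * (al i j k * (G i j k (zc k x j) - G i j k (zc k x i)))\<bar> \<le> aw i j * (alpha1 i j / b i j) * R"
    if j: "j < N" for j
  proof (cases "aw i j = 0")
    case False
    then have e: "(i, j) \<in> E" using edgeI i j by blast
    have "\<bar>G i j k (zc k x j) - G i j k (zc k x i)\<bar> \<le> \<bar>zc k x j - zc k x i\<bar> / b i j"
      unfolding G_def by (rule trG_lipschitz) (use b_sym[OF e] thr_nonneg[OF e] in auto)
    also have "\<dots> \<le> 2 * sqrt (V x) / b i j"
      using xl[OF i] xl[OF j] b_sym[OF e] by (intro divide_right_mono) (auto simp: zc_def)
    finally have "al i j k * \<bar>G i j k (zc k x j) - G i j k (zc k x i)\<bar>
        \<le> (alpha1 i j * real (Suc k) powr (- gmin)) * (2 * sqrt (V x) / b i j)"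
      using al_le[OF e, of k] al_pos[OF e, of k] alpha_sym[OF e] by (intro mult_mono) auto
    then have "aw i j * (al i j k * \<bar>G i j k (zc k x j) - G i j k (zc k x i)\<bar>)
        \<le> aw i j * ((alpha1 i j * real (Suc k) powr (- gmin)) * (2 * sqrt (V x) / b i j))"
      using edgeD[OF e] by (intro mult_left_mono) auto
    then show ?thesis using edgeD[OF e] al_pos[OF e, of k] by (simp add: abs_mult R_def mult_ac)
  qed simp
  have "\<bar>dG k x i\<bar> \<le> (\<Sum>j<N. aw i j * (alpha1 i j / b i j) * R)"
    unfolding dG_def by (rule order.trans[OF sum_abs]) (intro sum_mono, use tm in auto)
  also have "\<dots> = (\<Sum>j<N. aw i j * (alpha1 i j / b i j)) * R" by (simp add: sum_distrib_right)
  also have "\<dots> \<le> KG * R"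
    unfolding KG_def by (intro mult_right_mono R0, rule member_le_sum[of i "{..<N}" "\<lambda>i. \<Sum>j<N. aw i j * (alpha1 i j / b i j)"])
      (use i ab_nonneg in \<open>auto intro!: sum_nonneg\<close>)
  finally have "\<bar>dG k x i\<bar> \<le> KG * R" .
  then have "\<bar>dG k x i\<bar>\<^sup>2 \<le> (KG * R)\<^sup>2" by (intro power_mono) auto
  also have "(KG * R)\<^sup>2 = KG\<^sup>2 * ((real (Suc k) powr (- gmin))\<^sup>2 * (4 * V x))"
    using V_nonneg[of x] by (simp add: R_def power_mult_distrib)
  also have "(real (Suc k) powr (- gmin))\<^sup>2 = ku k"
    by (simp add: ku_def power2_eq_square powr_add[symmetric])
  finally show ?thesis by (simp add: mult_ac)
qed

lemma ku_ge: "(1 / real (Suc k))\<^sup>2 \<le> ku k"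
proof -
  have "(1 / real (Suc k))\<^sup>2 = real (Suc k) powr (- 2)" by (simp add: powr_minus power_divide divide_inverse power_inverse del: of_nat_Suc)
  also have "\<dots> \<le> ku k" unfolding ku_def using gmin(2) by (intro powr_mono) auto
  finally show ?thesis .
qed

lemma dH_sq_le: assumes i: "i < N" and c: "c < n" shows "(dH k x i c)\<^sup>2 \<le> (beta1 i)\<^sup>2 * Hbar^4 * ku k * V x"
proof -
  have "(\<Sum>r<m i. H i (Suc k) r c * matvec n (H i (Suc k)) (x i) r)\<^sup>2 \<le> Hbar\<^sup>2 * (\<Sum>r<m i. (matvec n (H i (Suc k)) (x i) r)\<^sup>2)"
    by (rule matvec_transpose_le[OF _ c]) (use Hbound[OF i, of "Suc k"] in auto)
  also have "\<dots> \<le> Hbar\<^sup>2 * (Hbar\<^sup>2 * (\<Sum>c<n. (x i c)\<^sup>2))"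
    by (intro mult_left_mono Hbound) (use i in auto)
  also have "\<dots> \<le> Hbar\<^sup>2 * (Hbar\<^sup>2 * V x)" using sum_sq_le_V[OF i] by (intro mult_left_mono) auto
  also have "\<dots> = Hbar^4 * V x" by (simp add: power2_eq_square eval_nat_numeral)
  finally have h: "(\<Sum>r<m i. H i (Suc k) r c * matvec n (H i (Suc k)) (x i) r)\<^sup>2 \<le> Hbar^4 * V x" .
  have "(dH k x i c)\<^sup>2 = (beta1 i)\<^sup>2 * (1 / real (Suc k))\<^sup>2 * (\<Sum>r<m i. H i (Suc k) r c * matvec n (H i (Suc k)) (x i) r)\<^sup>2"
    by (simp add: dH_def power_mult_distrib power_divide)
  also have "\<dots> \<le> (beta1 i)\<^sup>2 * ku k * (Hbar^4 * V x)"
    using ku_ge[of k] h by (intro mult_mono) (auto simp: ku_def)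
  finally show ?thesis by (simp add: mult_ac)
qed

lemma V_U_le: "V (U k x) \<le> KU * ku k * V x"
proof -
  have "V (U k x) \<le> (\<Sum>i<N. \<Sum>c<n. 2 * (if c = lc k then (dG k x i)\<^sup>2 else 0) + 2 * (dH k x i c)\<^sup>2)"
    unfolding V_def U_def using diff_sq_le by (intro sum_mono) (auto intro: order.trans[OF diff_sq_le])
  also have "\<dots> = (\<Sum>i<N. 2 * (dG k x i)\<^sup>2 + 2 * (\<Sum>c<n. (dH k x i c)\<^sup>2))"
    using lc_less by (simp add: sum.distrib sum_distrib_left[symmetric])
  also have "\<dots> \<le> (\<Sum>i<N. 2 * (4 * KG\<^sup>2 * ku k * V x) + 2 * (\<Sum>c<n. (beta1 i)\<^sup>2 * Hbar^4 * ku k * V x))"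
    by (intro sum_mono add_mono mult_left_mono dG_sq_le dH_sq_le) auto
  also have "\<dots> = KU * ku k * V x"
    by (simp add: KU_def sum.distrib sum_distrib_left sum_distrib_right algebra_simps)
  finally show ?thesis .
qed

end

text \<open>
  The averaged measurement and consensus forms dominate \<open>a V\<close> up to a summable loss \<open>om\<close>. The exponent \<open>eps\<close>
  is positive only without critical edges, where the consensus gain decays more slowly than \<open>1/k\<close> and
  hence can be given an unbounded relative weight.
\<close>

locale sc_form = sc_det +
  fixes bb kap eps a :: real and om :: "nat \<Rightarrow> real" and K0 :: nat
  assumes bb: "0 \<le> bb" "\<And>i. i < N \<Longrightarrow> bb \<le> beta1 i" and kap: "0 \<le> kap" and eps: "0 \<le> eps" "eps \<le> 1/4"
    and a: "0 \<le> a" and om: "\<And>k. 0 \<le> om k" "summable (\<lambda>k. om k / real (Suc k))"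
    and Qf: "\<And>k x. K0 \<le> k \<Longrightarrow> (a - om k) * V x \<le> bb * ((\<Sum>s<p. qf (Suc (Suc k) + s) x x) / real p)
        + kap * real (Suc k) powr eps * ((\<Sum>l<n. sf l x x) / real n) / 2"
begin

text \<open>Scale of the consensus correction; it is square summable because \<open>eps\<close> is
  at most 1/4.\<close>

definition "zz k = real (Suc k) powr (eps - 1)"

lemma zz_pos: "0 < zz k" by (simp add: zz_def)
lemma zz_mono: "zz (Suc k) \<le> zz k" unfolding zz_def using eps by (intro powr_mono2') auto
lemma zz_ge: "1 / real (Suc k) \<le> zz k"
proof -
  have "1 / real (Suc k) = real (Suc k) powr (- 1)" by (simp add: powr_minus divide_inverse del: of_nat_Suc)
  also have "\<dots> \<le> zz k" unfolding zz_def using eps by (intro powr_mono) auto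
  finally show ?thesis .
qed
lemma zz_eq: "zz k = real (Suc k) powr eps / real (Suc k)" by (simp add: zz_def powr_diff del: of_nat_Suc)

text \<open>The windows have length \<open>p\<close>, over which excitation is assumed, and
  \<open>n\<close>, over which each coordinate is transmitted once. Up to summable terms,
  \<open>rf k - rf (Suc k)\<close> is the scaled current forms minus the scaled window
  averages.\<close>

definition rf :: "nat \<Rightarrow> (nat \<Rightarrow> nat \<Rightarrow> real) \<Rightarrow> (nat \<Rightarrow> nat \<Rightarrow> real) \<Rightarrow> real" where
  "rf k x y = 2 * (bb / real (Suc k)) * (\<Sum>s<p. (1 - real s / real p) * qf (Suc k + s) x y)
     + kap * zz k * (\<Sum>s<n. (1 - real s / real n) * sf ((k + s) mod n) x y)"

definition "RR = 2 * bb * real p * Hbar\<^sup>2 + kap * real n * CA"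

lemma RR_nonneg: "0 \<le> RR" using bb kap CA_nonneg by (simp add: RR_def)

lemma bform_wq: "bform (real p * Hbar\<^sup>2) (\<lambda>x y. \<Sum>s<p. (1 - real s / real p) * qf (Suc k + s) x y)"
proof (rule bform_mono)
  show "bform (\<Sum>s<p. (1 - real s / real p) * Hbar\<^sup>2) (\<lambda>x y. \<Sum>s<p. (1 - real s / real p) * qf (Suc k + s) x y)"
    by (intro bform_sum bform_scale bform_qf) auto
  have "(\<Sum>s<p. (1 - real s / real p) * Hbar\<^sup>2) \<le> (\<Sum>s<p. 1 * Hbar\<^sup>2)" by (intro sum_mono mult_right_mono) auto
  then show "(\<Sum>s<p. (1 - real s / real p) * Hbar\<^sup>2) \<le> real p * Hbar\<^sup>2" by simp
qed

lemma bform_ws: "bform (real n * CA) (\<lambda>x y. \<Sum>s<n. (1 - real s / real n) * sf ((k + s) mod n) x y)"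
proof (rule bform_mono)
  show "bform (\<Sum>s<n. (1 - real s / real n) * CA) (\<lambda>x y. \<Sum>s<n. (1 - real s / real n) * sf ((k + s) mod n) x y)"
    by (intro bform_sum bform_scale bform_sf) (use npos in auto)
  have "(\<Sum>s<n. (1 - real s / real n) * CA) \<le> (\<Sum>s<n. 1 * CA)" by (intro sum_mono mult_right_mono CA_nonneg) auto
  then show "(\<Sum>s<n. (1 - real s / real n) * CA) \<le> real n * CA" by simp
qed

lemma bform_rf: "bform (RR * zz k) (rf k)"
proof (rule bform_mono)
  show "bform (2 * (bb / real (Suc k)) * (real p * Hbar\<^sup>2) + kap * zz k * (real n * CA)) (rf k)"
    unfolding rf_def[abs_def] using bb kap zz_pos[of k]
    by (intro bform_add bform_scale bform_wq bform_ws) auto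
  have "2 * bb * real p * Hbar\<^sup>2 * (1 / real (Suc k)) \<le> 2 * bb * real p * Hbar\<^sup>2 * zz k"
    using zz_ge[of k] bb by (intro mult_left_mono) auto
  then show "2 * (bb / real (Suc k)) * (real p * Hbar\<^sup>2) + kap * zz k * (real n * CA) \<le> RR * zz k"
    unfolding RR_def by (simp add: algebra_simps)
qed

definition phi :: "nat \<Rightarrow> (nat \<Rightarrow> nat \<Rightarrow> real) \<Rightarrow> (nat \<Rightarrow> nat \<Rightarrow> real) \<Rightarrow> real" where
  "phi k x y = ip x y - rf k x y"

lemma phi_bounds: assumes "RR * zz k \<le> 1/2" shows "V x / 2 \<le> phi k x x" "phi k x x \<le> V x"
proof -
  have "rf k x x \<le> RR * zz k * V x" by (rule bform_le[OF bform_rf])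
  also have "\<dots> \<le> 1/2 * V x" using assms V_nonneg by (intro mult_right_mono) auto
  finally show "V x / 2 \<le> phi k x x" by (simp add: phi_def V_ip)
  show "phi k x x \<le> V x" using bform_nonneg[OF bform_rf, of k x] by (simp add: phi_def V_ip)
qed

lemma bform_phi: assumes "RR * zz k \<le> 1/2" shows "bform 1 (phi k)"
  unfolding bform_def
proof (intro conjI allI)
  fix x
  show "0 \<le> phi k x x" using phi_bounds(1)[OF assms, of x] V_nonneg[of x] by simp
  show "phi k x x \<le> 1 * V x" using phi_bounds(2)[OF assms, of x] by simp
  obtain g where g: "\<And>y. rf k x y = ip g y" using bform_rf[of k] unfolding bform_def by metis
  show "\<exists>g. \<forall>y. phi k x y = ip g y"
  proof (intro exI allI)
    fix y show "phi k x y = ip (\<lambda>i c. x i c - g i c) y"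
      unfolding phi_def g ip_def by (simp add: left_diff_distrib sum_subtractf)
  qed
  fix y show "phi k x y = phi k y x" using bform_symD[OF bform_rf, of k x y] ip_sym[of x y] by (simp add: phi_def)
qed

text \<open>Mean change of \<open>phi k x x\<close> over one transition, up to the term quadratic in
  the increment.\<close>

definition DD :: "nat \<Rightarrow> (nat \<Rightarrow> nat \<Rightarrow> real) \<Rightarrow> real" where
  "DD k x = phi (Suc k) x x - phi k x x + 2 * phi (Suc k) x (U k x)"

text \<open>One summable sequence for all errors: the coefficients 4 and \<open>2 * RR\<close> serve
  \<open>drift\<close>, the coefficients of \<open>RR\<close> squared and \<open>KU\<close> are
  dictated by \<open>DD_sq\<close>.\<close>

definition "ee k = (4 + 2 * RR + 8 * RR\<^sup>2 + 32 * KU) * ((zz k)\<^sup>2 + ku k + (zz k - zz (Suc k))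
   + (1 / real (Suc k) - 1 / real (Suc (Suc k))) + om k / real (Suc k))"

lemma ee_parts: "0 \<le> (zz k)\<^sup>2" "0 \<le> ku k" "0 \<le> zz k - zz (Suc k)"
  "0 \<le> 1 / real (Suc k) - 1 / real (Suc (Suc k))" "0 \<le> om k / real (Suc k)"
  using zz_mono[of k] om by (auto simp: ku_def frac_le)

lemma ee_nonneg: "0 \<le> ee k"
  unfolding ee_def using ee_parts[of k] RR_nonneg KU_nonneg by (intro mult_nonneg_nonneg add_nonneg_nonneg) auto

lemma summable_ee: "summable ee"
proof -
  have z2: "(zz k)\<^sup>2 = real (Suc k) powr (2 * eps - 2)" for k
    by (simp add: zz_def power2_eq_square powr_add[symmetric])
  have zlim: "zz \<longlonglongrightarrow> 0" unfolding zz_def[abs_def] using eps by (intro tendsto_Suc_powr_0) auto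
  have olim: "(\<lambda>k. 1 / real (Suc k)) \<longlonglongrightarrow> 0" by (rule LIMSEQ_Suc[OF lim_1_over_n])
  show ?thesis unfolding ee_def[abs_def]
  proof (intro summable_mult summable_add)
    show "summable (\<lambda>k. (zz k)\<^sup>2)" unfolding z2 using eps by (intro summable_Suc_powr) auto
    show "summable ku" unfolding ku_def[abs_def] using gmin(1) by (intro summable_Suc_powr) auto
    show "summable (\<lambda>k. zz k - zz (Suc k))" by (rule telescope_summable'[OF zlim])
    show "summable (\<lambda>k. 1 / real (Suc k) - 1 / real (Suc (Suc k)))" using telescope_summable'[OF olim] .
    show "summable (\<lambda>k. om k / real (Suc k))" by (rule om)
  qed
qed

lemma rf_diag: "rf k x x = 2 * (bb / real (Suc k)) * wsum p (\<lambda>t. qf t x x) (Suc k) + kap * zz k * wsum n (\<lambda>t. sf (t mod n) x x) k"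
  by (simp add: rf_def wsum_def)

lemma data_drift: "2 * (bb / real (Suc k)) * qf (Suc k) x x \<le> 2 * (\<Sum>i<N. beta1 i / real (Suc k) * (\<Sum>r<m i. (matvec n (H i (Suc k)) (x i) r)\<^sup>2))"
proof -
  have "bb / real (Suc k) * qf (Suc k) x x = (\<Sum>i<N. bb / real (Suc k) * (\<Sum>r<m i. (matvec n (H i (Suc k)) (x i) r)\<^sup>2))"
    by (simp only: qf_def sum_distrib_left power2_eq_square)
  also have "\<dots> \<le> (\<Sum>i<N. beta1 i / real (Suc k) * (\<Sum>r<m i. (matvec n (H i (Suc k)) (x i) r)\<^sup>2))"
    using bb by (intro sum_mono mult_right_mono divide_right_mono sum_nonneg) auto
  finally show ?thesis by simp
qed

text \<open>Both windows advance by \<open>wsum_Suc\<close>. The change of the factors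
  \<open>1 / real (Suc k)\<close> and \<open>zz k\<close> multiplies windows bounded by a multiple
  of \<open>V x\<close>, which gives the telescoping remainder.\<close>

lemma rf_diff:
  "rf k x x - rf (Suc k) x x \<le> 2 * (bb / real (Suc k)) * (qf (Suc k) x x - (\<Sum>s<p. qf (Suc (Suc k) + s) x x) / real p)
    + kap * zz k * (sf (lc k) x x - (\<Sum>l<n. sf l x x) / real n)
    + RR * ((zz k - zz (Suc k)) + (1 / real (Suc k) - 1 / real (Suc (Suc k)))) * V x"
proof -
  define Wq where "Wq j = wsum p (\<lambda>t. qf t x x) j" for j
  define Ws where "Ws j = wsum n (\<lambda>t. sf (t mod n) x x) j" for j
  define i1 where "i1 = 1 / real (Suc k)"
  define i2 where "i2 = 1 / real (Suc (Suc k))"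
  have q: "Wq (Suc (Suc k)) = Wq (Suc k) - qf (Suc k) x x + (\<Sum>s<p. qf (Suc (Suc k) + s) x x) / real p"
    unfolding Wq_def by (rule wsum_Suc[OF pe(1)])
  have s: "Ws (Suc k) = Ws k - sf (lc k) x x + (\<Sum>l<n. sf l x x) / real n"
    using wsum_Suc[OF npos, of "\<lambda>t. sf (t mod n) x x" k] sum_mod_period[of "\<lambda>l. sf l x x" "Suc k" n]
    unfolding Ws_def lc_def by simp
  have r1: "rf k x x = 2 * bb * i1 * Wq (Suc k) + kap * zz k * Ws k"
    unfolding rf_diag Wq_def Ws_def i1_def by simp
  have r2: "rf (Suc k) x x = 2 * bb * i2 * Wq (Suc (Suc k)) + kap * zz (Suc k) * Ws (Suc k)"
    unfolding rf_diag Wq_def Ws_def i2_def by simp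
  have Wq_le: "Wq (Suc (Suc k)) \<le> real p * Hbar\<^sup>2 * V x" and Wq0: "0 \<le> Wq (Suc (Suc k))"
    using bform_le[OF bform_wq[of "Suc k"], of x] bform_nonneg[OF bform_wq[of "Suc k"], of x] by (auto simp: Wq_def wsum_def)
  have Ws_le: "Ws (Suc k) \<le> real n * CA * V x" and Ws0: "0 \<le> Ws (Suc k)"
    using bform_le[OF bform_ws[of "Suc k"], of x] bform_nonneg[OF bform_ws[of "Suc k"], of x] by (auto simp: Ws_def wsum_def)
  have di: "0 \<le> i1 - i2" unfolding i1_def i2_def by (rule ee_parts)
  have dz: "0 \<le> zz k - zz (Suc k)" by (rule ee_parts)
  have e1: "2 * bb * (i1 - i2) * Wq (Suc (Suc k)) \<le> (i1 - i2) * ((2 * bb * real p * Hbar\<^sup>2) * V x)"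
  proof -
    have "2 * bb * (i1 - i2) * Wq (Suc (Suc k)) \<le> 2 * bb * (i1 - i2) * (real p * Hbar\<^sup>2 * V x)"
      by (rule mult_left_mono[OF Wq_le]) (use bb di in simp)
    then show ?thesis by (simp only: mult_ac)
  qed
  have e2: "kap * (zz k - zz (Suc k)) * Ws (Suc k) \<le> (zz k - zz (Suc k)) * ((kap * real n * CA) * V x)"
  proof -
    have "kap * (zz k - zz (Suc k)) * Ws (Suc k) \<le> kap * (zz k - zz (Suc k)) * (real n * CA * V x)"
      by (rule mult_left_mono[OF Ws_le]) (use kap dz in simp)
    then show ?thesis by (simp only: mult_ac)
  qed
  have f1: "(i1 - i2) * ((2 * bb * real p * Hbar\<^sup>2) * V x) \<le> (i1 - i2) * (RR * V x)"
    unfolding RR_def using di V_nonneg kap CA_nonneg by (intro mult_left_mono mult_right_mono) auto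
  have f2: "(zz k - zz (Suc k)) * ((kap * real n * CA) * V x) \<le> (zz k - zz (Suc k)) * (RR * V x)"
    unfolding RR_def using dz V_nonneg bb by (intro mult_left_mono mult_right_mono) auto
  have "rf k x x - rf (Suc k) x x = 2 * bb * i1 * (Wq (Suc k) - Wq (Suc (Suc k))) + kap * zz k * (Ws k - Ws (Suc k))
     + 2 * bb * (i1 - i2) * Wq (Suc (Suc k)) + kap * (zz k - zz (Suc k)) * Ws (Suc k)"
    unfolding r1 r2 by (simp add: algebra_simps)
  also have "\<dots> \<le> 2 * bb * i1 * (Wq (Suc k) - Wq (Suc (Suc k))) + kap * zz k * (Ws k - Ws (Suc k))
     + (i1 - i2) * (RR * V x) + (zz k - zz (Suc k)) * (RR * V x)"
    using e1 e2 f1 f2 by linarith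
  finally show ?thesis unfolding q s i1_def i2_def by (simp add: algebra_simps)
qed

text \<open>The current forms \<open>q1\<close> and \<open>s1\<close> released by the correction
  cancel against the dissipation of the mean increment, where \<open>cs\<close> lets
  \<open>cons\<close> pay for \<open>s1\<close>. The averages \<open>q2\<close> and
  \<open>s2\<close> remain with negative sign, and \<open>Qf\<close> bounds them.\<close>

lemma drift:
  assumes k: "K0 \<le> k" and small: "RR * zz k \<le> 1/2" and cs: "kap * zz k * sf (lc k) x x \<le> cons k x"
  shows "DD k x \<le> (ee k - 2 * a / real (Suc k)) * phi k x x"
proof -
  define v where "v = V x"
  have v0: "0 \<le> v" by (simp add: v_def V_nonneg)
  define E1 where "E1 = (zz k - zz (Suc k)) + (1 / real (Suc k) - 1 / real (Suc (Suc k)))"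
  define q1 where "q1 = 2 * (bb / real (Suc k)) * qf (Suc k) x x"
  define q2 where "q2 = 2 * (bb / real (Suc k)) * ((\<Sum>s<p. qf (Suc (Suc k) + s) x x) / real p)"
  define s1 where "s1 = kap * zz k * sf (lc k) x x"
  define s2 where "s2 = kap * zz k * ((\<Sum>l<n. sf l x x) / real n)"
  have d1: "rf k x x - rf (Suc k) x x \<le> q1 - q2 + s1 - s2 + RR * E1 * v"
    using rf_diff[of k x] unfolding q1_def q2_def s1_def s2_def E1_def v_def by (simp add: algebra_simps)
  have d2: "2 * ip x (U k x) \<le> - s1 - q1" using ip_U[of x k] data_drift[of k x] cs unfolding q1_def s1_def by linarith
  \<comment> \<open>Cross term between correction and increment: Cauchy-Schwarz for
    \<open>rf\<close>, then the inequality of arithmetic and geometric means, leave only squared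
    step sizes.\<close>
  have d3: "- 2 * rf (Suc k) x (U k x) \<le> RR\<^sup>2 * (zz k)\<^sup>2 * v + KU * ku k * v"
  proof -
    let ?r = "rf (Suc k) x (U k x)"
    have "?r\<^sup>2 \<le> rf (Suc k) x x * rf (Suc k) (U k x) (U k x)" by (rule bform_CS[OF bform_rf])
    also have "\<dots> \<le> (RR * zz (Suc k) * v) * (RR * zz (Suc k) * V (U k x))"
      unfolding v_def using bform_nonneg[OF bform_rf] bform_le[OF bform_rf] RR_nonneg zz_pos[of "Suc k"] V_nonneg
      by (intro mult_mono) (auto intro!: mult_nonneg_nonneg less_imp_le)
    also have "\<dots> \<le> (RR * zz k * v) * (RR * zz k * V (U k x))"
      using zz_mono[of k] RR_nonneg zz_pos[of "Suc k"] zz_pos[of k] v0 V_nonneg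
      by (intro mult_mono mult_nonneg_nonneg) (auto intro: less_imp_le)
    also have "\<dots> = (RR\<^sup>2 * (zz k)\<^sup>2 * v) * V (U k x)" by (simp add: power2_eq_square)
    finally have "?r\<^sup>2 \<le> (RR\<^sup>2 * (zz k)\<^sup>2 * v) * V (U k x)" .
    moreover have "4 * (P * Q) \<le> (P + Q)\<^sup>2" for P Q :: real
      using zero_le_power2[of "P - Q"] by (simp add: power2_eq_square algebra_simps)
    ultimately have "4 * ?r\<^sup>2 \<le> (RR\<^sup>2 * (zz k)\<^sup>2 * v + V (U k x))\<^sup>2"
      by (meson mult_left_mono order.trans zero_le_numeral)
    then have "\<bar>2 * ?r\<bar>\<^sup>2 \<le> (RR\<^sup>2 * (zz k)\<^sup>2 * v + V (U k x))\<^sup>2" by (simp add: power_mult_distrib)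
    then have "\<bar>2 * ?r\<bar> \<le> RR\<^sup>2 * (zz k)\<^sup>2 * v + V (U k x)"
      by (rule power2_le_imp_le) (use v0 V_nonneg in \<open>auto intro!: add_nonneg_nonneg mult_nonneg_nonneg\<close>)
    then show ?thesis using V_U_le[of k x] unfolding v_def by linarith
  qed
  have d4: "- q2 - s2 \<le> - (2 * a / real (Suc k)) * v + 2 * (om k / real (Suc k)) * v"
  proof -
    have "2 / real (Suc k) * ((a - om k) * v) \<le> 2 / real (Suc k) * (bb * ((\<Sum>s<p. qf (Suc (Suc k) + s) x x) / real p)
        + kap * real (Suc k) powr eps * ((\<Sum>l<n. sf l x x) / real n) / 2)"
      unfolding v_def by (intro mult_left_mono Qf[OF k]) auto
    also have "\<dots> = q2 + s2" unfolding q2_def s2_def zz_eq by (simp add: distrib_left del: of_nat_Suc)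
    finally show ?thesis by (simp add: left_diff_distrib right_diff_distrib diff_divide_distrib)
  qed
  have "DD k x = (rf k x x - rf (Suc k) x x) + 2 * ip x (U k x) - 2 * rf (Suc k) x (U k x)"
    by (simp add: DD_def phi_def)
  also have "\<dots> \<le> - (2 * a / real (Suc k)) * v + (2 * (om k / real (Suc k)) + RR * E1 + RR\<^sup>2 * (zz k)\<^sup>2 + KU * ku k) * v"
    using d1 d2 d3 d4 by (simp add: algebra_simps)
  also have "\<dots> \<le> - (2 * a / real (Suc k)) * phi k x x + ee k * phi k x x"
  \<comment> \<open>The contraction uses that \<open>phi\<close> is at most \<open>V\<close>, the
    errors that \<open>V\<close> is at most twice \<open>phi\<close>; hence the doubling before the
    comparison with \<open>ee\<close>.\<close>
  proof (rule add_mono)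
    show "- (2 * a / real (Suc k)) * v \<le> - (2 * a / real (Suc k)) * phi k x x"
      unfolding v_def using phi_bounds(2)[OF small, of x] a by (intro mult_left_mono_neg) auto
    have C: "4 \<le> 4 + 2 * RR + 8 * RR\<^sup>2 + 32 * KU" "2 * RR \<le> 4 + 2 * RR + 8 * RR\<^sup>2 + 32 * KU"
       "2 * RR\<^sup>2 \<le> 4 + 2 * RR + 8 * RR\<^sup>2 + 32 * KU" "2 * KU \<le> 4 + 2 * RR + 8 * RR\<^sup>2 + 32 * KU"
      using RR_nonneg KU_nonneg zero_le_power2[of RR] by linarith+
    have E0: "0 \<le> E1" unfolding E1_def using ee_parts[of k] by linarith
    have "2 * (2 * (om k / real (Suc k)) + RR * E1 + RR\<^sup>2 * (zz k)\<^sup>2 + KU * ku k)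
      = 4 * (om k / real (Suc k)) + (2 * RR) * E1 + (2 * RR\<^sup>2) * (zz k)\<^sup>2 + (2 * KU) * ku k" by simp
    also have "\<dots> \<le> (4 + 2 * RR + 8 * RR\<^sup>2 + 32 * KU) * (om k / real (Suc k)) + (4 + 2 * RR + 8 * RR\<^sup>2 + 32 * KU) * E1
        + (4 + 2 * RR + 8 * RR\<^sup>2 + 32 * KU) * (zz k)\<^sup>2 + (4 + 2 * RR + 8 * RR\<^sup>2 + 32 * KU) * ku k"
      by (intro add_mono mult_right_mono C E0 ee_parts)
    also have "\<dots> = ee k" unfolding ee_def E1_def by (simp only: distrib_left ac_simps)
    finally have "2 * (2 * (om k / real (Suc k)) + RR * E1 + RR\<^sup>2 * (zz k)\<^sup>2 + KU * ku k) \<le> ee k" .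
    then have "2 * (2 * (om k / real (Suc k)) + RR * E1 + RR\<^sup>2 * (zz k)\<^sup>2 + KU * ku k) * (v / 2) \<le> ee k * (v / 2)"
      by (rule mult_right_mono) (use v0 in simp)
    moreover have "2 * W * (v / 2) = W * v" for W :: real by simp
    ultimately have "(2 * (om k / real (Suc k)) + RR * E1 + RR\<^sup>2 * (zz k)\<^sup>2 + KU * ku k) * v \<le> ee k * (v / 2)" by metis
    also have "\<dots> \<le> ee k * phi k x x" unfolding v_def using phi_bounds(1)[OF small, of x] ee_nonneg by (intro mult_left_mono) auto
    finally show "(2 * (om k / real (Suc k)) + RR * E1 + RR\<^sup>2 * (zz k)\<^sup>2 + KU * ku k) * v \<le> ee k * phi k x x" .
  qed
  finally show ?thesis by (simp add: algebra_simps)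
qed

text \<open>Both parts of \<open>DD\<close> are of the order of one step size times
  \<open>V\<close>, and squared step sizes are summable.\<close>

lemma DD_sq:
  assumes small: "RR * zz k \<le> 1/2"
  shows "(DD k x)\<^sup>2 \<le> ee k * (phi k x x)\<^sup>2"
proof -
  define v where "v = V x"
  have v0: "0 \<le> v" by (simp add: v_def V_nonneg)
  have smallS: "RR * zz (Suc k) \<le> 1/2" using small zz_mono[of k] RR_nonneg by (meson mult_left_mono order.trans)
  define w where "w = RR * zz k * v"
  have "rf k x x \<le> w" "0 \<le> rf k x x" "0 \<le> rf (Suc k) x x"
    using bform_le[OF bform_rf] bform_nonneg[OF bform_rf] by (auto simp: w_def v_def)
  moreover have "rf (Suc k) x x \<le> w"
  proof -
    have "rf (Suc k) x x \<le> RR * zz (Suc k) * v" unfolding v_def by (rule bform_le[OF bform_rf])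
    also have "\<dots> \<le> w" unfolding w_def using zz_mono[of k] RR_nonneg v0 by (intro mult_right_mono mult_left_mono) auto
    finally show ?thesis .
  qed
  ultimately have "\<bar>phi (Suc k) x x - phi k x x\<bar> \<le> w" by (simp add: phi_def abs_le_iff)
  then have "\<bar>phi (Suc k) x x - phi k x x\<bar>\<^sup>2 \<le> w\<^sup>2" by (intro power_mono) auto
  then have s1: "(phi (Suc k) x x - phi k x x)\<^sup>2 \<le> RR\<^sup>2 * (zz k)\<^sup>2 * v\<^sup>2" by (simp add: w_def power_mult_distrib)
  have s2: "(2 * phi (Suc k) x (U k x))\<^sup>2 \<le> 4 * KU * ku k * v\<^sup>2"
  proof -
    have "(phi (Suc k) x (U k x))\<^sup>2 \<le> phi (Suc k) x x * phi (Suc k) (U k x) (U k x)" by (rule bform_CS[OF bform_phi[OF smallS]])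
    also have "\<dots> \<le> V x * V (U k x)"
      using phi_bounds[OF smallS] V_nonneg bform_nonneg[OF bform_phi[OF smallS]] by (intro mult_mono) auto
    also have "\<dots> \<le> v * (KU * ku k * v)" unfolding v_def by (intro mult_left_mono V_U_le V_nonneg)
    finally show ?thesis by (simp add: power_mult_distrib power2_eq_square mult_ac)
  qed
  have "(DD k x)\<^sup>2 \<le> 2 * (phi (Suc k) x x - phi k x x)\<^sup>2 + 2 * (2 * phi (Suc k) x (U k x))\<^sup>2"
    unfolding DD_def using zero_le_power2[of "(phi (Suc k) x x - phi k x x) - 2 * phi (Suc k) x (U k x)"]
    by (simp add: power2_eq_square algebra_simps)
  also have "\<dots> \<le> (2 * RR\<^sup>2 * (zz k)\<^sup>2 + 8 * KU * ku k) * v\<^sup>2" using s1 s2 by (simp add: algebra_simps)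
  also have "\<dots> \<le> (2 * RR\<^sup>2 * (zz k)\<^sup>2 + 8 * KU * ku k) * (4 * (phi k x x)\<^sup>2)"
  proof (rule mult_left_mono)
    have "v\<^sup>2 \<le> (2 * phi k x x)\<^sup>2" unfolding v_def using phi_bounds(1)[OF small, of x] V_nonneg by (intro power_mono) auto
    then show "v\<^sup>2 \<le> 4 * (phi k x x)\<^sup>2" by (simp add: power_mult_distrib)
    show "0 \<le> 2 * RR\<^sup>2 * (zz k)\<^sup>2 + 8 * KU * ku k" using KU_nonneg ee_parts(2)[of k] by auto
  qed
  also have "\<dots> = (8 * RR\<^sup>2 * (zz k)\<^sup>2 + 32 * KU * ku k) * (phi k x x)\<^sup>2" by (simp add: algebra_simps)
  also have "\<dots> \<le> ee k * (phi k x x)\<^sup>2"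
  proof (rule mult_right_mono)
    define C where "C = 4 + 2 * RR + 8 * RR\<^sup>2 + 32 * KU"
    have C: "8 * RR\<^sup>2 \<le> C" "32 * KU \<le> C" "0 \<le> C" using RR_nonneg KU_nonneg zero_le_power2[of RR] unfolding C_def by linarith+
    have "8 * RR\<^sup>2 * (zz k)\<^sup>2 + 32 * KU * ku k \<le> C * (zz k)\<^sup>2 + C * ku k"
      by (intro add_mono mult_right_mono C ee_parts)
    also have "\<dots> = C * ((zz k)\<^sup>2 + ku k)" by (simp only: distrib_left)
    also have "\<dots> \<le> ee k" unfolding ee_def C_def[symmetric] using ee_parts[of k] C by (intro mult_left_mono) auto
    finally show "8 * RR\<^sup>2 * (zz k)\<^sup>2 + 32 * KU * ku k \<le> ee k" .
  qed simp
  finally show ?thesis .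
qed

end

section \<open>The stochastic recursion\<close>

locale sc_network = sc_noise M N m w d \<rho> + sc_det N n m aw H \<theta> nu b alpha1 gamma beta1 Hbar \<delta> p
  for M :: "'w measure" and N n :: nat and m :: "nat \<Rightarrow> nat"
    and w :: "nat \<Rightarrow> nat \<Rightarrow> 'w \<Rightarrow> nat \<Rightarrow> real" and d :: "nat \<Rightarrow> nat \<Rightarrow> 'w \<Rightarrow> real" and \<rho> :: real
    and aw :: "nat \<Rightarrow> nat \<Rightarrow> real" and H :: "nat \<Rightarrow> nat \<Rightarrow> nat \<Rightarrow> nat \<Rightarrow> real" and \<theta> :: "nat \<Rightarrow> real"
    and nu b alpha1 gamma :: "nat \<Rightarrow> nat \<Rightarrow> real" and beta1 :: "nat \<Rightarrow> real" and Hbar \<delta> :: real and p :: nat +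
  fixes init :: "nat \<Rightarrow> nat \<Rightarrow> real"
begin

definition est :: "'w \<Rightarrow> nat \<Rightarrow> nat \<Rightarrow> nat \<Rightarrow> real" where
  "est \<omega> = sc_est N n m aw nu b (\<lambda>i j k. alpha1 i j / real k powr gamma i j) (\<lambda>i k. beta1 i / real k) H
     (\<lambda>i k r. matvec n (H i k) \<theta> r + w i k \<omega> r) (\<lambda>i k. d i k \<omega>) init"

definition X :: "nat \<Rightarrow> 'w \<Rightarrow> nat \<Rightarrow> nat \<Rightarrow> real" where "X k \<omega> i c = est \<omega> k i c - \<theta> c"

definition sh :: "nat \<Rightarrow> 'w \<Rightarrow> nat \<Rightarrow> nat \<Rightarrow> real" where
  "sh k \<omega> j i = (if \<bar>zc k (X k \<omega>) j + b j i * d j (Suc k) \<omega>\<bar> > thr j i k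
      then (if zc k (X k \<omega>) j + b j i * d j (Suc k) \<omega> > 0 then 1 else -1) else 0)"

text \<open>Received message minus its mean given the past. The order of the indices is receiver
  \<open>i\<close>, sender \<open>j\<close>, opposite to that of \<open>sh\<close>.\<close>

definition zeta :: "nat \<Rightarrow> 'w \<Rightarrow> nat \<Rightarrow> nat \<Rightarrow> real" where
  "zeta k \<omega> i j = sh k \<omega> j i - G i j k (zc k (X k \<omega>) j)"

definition xi :: "nat \<Rightarrow> 'w \<Rightarrow> nat \<Rightarrow> nat \<Rightarrow> real" where
  "xi k \<omega> i c = (if c = lc k then (\<Sum>j\<in>nbrs N aw i. al i j k * aw i j * zeta k \<omega> i j) else 0)
     + beta1 i / real (Suc k) * (\<Sum>r<m i. H i (Suc k) r c * w i (Suc k) \<omega> r)"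

lemma zc_X: "zc k (X k \<omega>) i = est \<omega> k i (lc k)" by (simp add: zc_def X_def)

lemma nbrs_E: "j \<in> nbrs N aw i \<longleftrightarrow> (i, j) \<in> E" by (simp add: nbrs_def)

lemma dG_nbrs: assumes "i < N"
  shows "dG k x i = (\<Sum>j\<in>nbrs N aw i. al i j k * aw i j * (G i j k (zc k x j) - G i j k (zc k x i)))"
proof -
  have "dG k x i = (\<Sum>j\<in>nbrs N aw i. aw i j * (al i j k * (G i j k (zc k x j) - G i j k (zc k x i))))"
    unfolding dG_def by (rule nbrs_sum[symmetric]) (use aw_nonneg assms in auto)
  then show ?thesis by (simp add: mult_ac)
qed

lemma est_Suc:
  "est \<omega> (Suc k) i c = est \<omega> k i c
     + (if c = lc k then (\<Sum>j\<in>nbrs N aw i. al i j k * aw i j * (sh k \<omega> j i - G i j k (est \<omega> k i (lc k)))) else 0)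
     + beta1 i / real (Suc k) * (\<Sum>r<m i. H i (Suc k) r c * (matvec n (H i (Suc k)) \<theta> r + w i (Suc k) \<omega> r - matvec n (H i (Suc k)) (est \<omega> k i) r))"
  unfolding est_def sc_est.simps Let_def
  unfolding est_def[symmetric] sh_def zc_X al_def G_def trG_def thr_def lc_def by simp

text \<open>Inserting the mean message at the sender's value separates the consensus increment
  \<open>dG\<close> from the noise \<open>zeta\<close>; the innovation is the observation noise
  minus the measured error.\<close>

lemma X_Suc: assumes i: "i < N" shows "X (Suc k) \<omega> i c = X k \<omega> i c + (U k (X k \<omega>) i c + xi k \<omega> i c)"
proof -
  let ?z = "zc k (X k \<omega>)"
  have 1: "(\<Sum>j\<in>nbrs N aw i. al i j k * aw i j * (sh k \<omega> j i - G i j k (?z i)))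
      = dG k (X k \<omega>) i + (\<Sum>j\<in>nbrs N aw i. al i j k * aw i j * zeta k \<omega> i j)"
    unfolding dG_nbrs[OF i] sum.distrib[symmetric] by (intro sum.cong refl) (simp add: zeta_def algebra_simps)
  have mv: "matvec n A \<theta> r - matvec n A (est \<omega> k i) r = - matvec n A (X k \<omega> i) r" for A r
    unfolding matvec_def X_def by (simp add: right_diff_distrib sum_subtractf)
  have 2: "(\<Sum>r<m i. H i (Suc k) r c * (matvec n (H i (Suc k)) \<theta> r + w i (Suc k) \<omega> r - matvec n (H i (Suc k)) (est \<omega> k i) r))
     = (\<Sum>r<m i. H i (Suc k) r c * w i (Suc k) \<omega> r) - (\<Sum>r<m i. H i (Suc k) r c * matvec n (H i (Suc k)) (X k \<omega> i) r)"
    unfolding sum_subtractf[symmetric]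
  proof (intro sum.cong refl)
    fix r
    have eq: "matvec n (H i (Suc k)) \<theta> r + w i (Suc k) \<omega> r - matvec n (H i (Suc k)) (est \<omega> k i) r = w i (Suc k) \<omega> r - matvec n (H i (Suc k)) (X k \<omega> i) r"
      using mv[of "H i (Suc k)" r] by simp
    show "H i (Suc k) r c * (matvec n (H i (Suc k)) \<theta> r + w i (Suc k) \<omega> r - matvec n (H i (Suc k)) (est \<omega> k i) r)
      = H i (Suc k) r c * w i (Suc k) \<omega> r - H i (Suc k) r c * matvec n (H i (Suc k)) (X k \<omega> i) r"
      unfolding eq right_diff_distrib ..
  qed
  have x: "X (Suc k) \<omega> i c = X k \<omega> i c + (est \<omega> (Suc k) i c - est \<omega> k i c)" by (simp add: X_def)
  show ?thesis
  proof (cases "c = lc k")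
    case True
    then show ?thesis unfolding x est_Suc 2 U_def xi_def dH_def using 1 by (simp add: zc_X algebra_simps)
  next
    case False
    then show ?thesis unfolding x est_Suc 2 U_def xi_def dH_def by (simp add: algebra_simps)
  qed
qed

section \<open>Measurability and conditional law of the messages\<close>

lemma F_lift: "f \<in> borel_measurable (F j) \<Longrightarrow> j \<le> k \<Longrightarrow> f \<in> borel_measurable (F k)" for f :: "'w \<Rightarrow> 'b::topological_space"
  using F_mono[of j k] by (auto simp: measurable_def space_F)

lemma borel_measurable_trG[measurable]: "trG C b' \<in> borel_measurable borel"
  unfolding trG_def[abs_def] by measurable

lemma borel_measurable_G: "f \<in> borel_measurable M' \<Longrightarrow> (\<lambda>\<omega>. G i j k (f \<omega>)) \<in> borel_measurable M'"
  unfolding G_def by (rule measurable_compose[OF _ borel_measurable_trG])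

lemma X_measF: "i < N \<Longrightarrow> (\<lambda>\<omega>. X k \<omega> i c) \<in> borel_measurable (F k)"
proof (induction k arbitrary: i c)
  case 0
  then show ?case by (simp add: X_def est_def)
next
  case (Suc k)
  have X: "(\<lambda>\<omega>. X k \<omega> i c) \<in> borel_measurable (F (Suc k))" if "i < N" for i c
    using Suc.IH[OF that] F_lift[of _ k "Suc k"] by auto
  have z[measurable]: "(\<lambda>\<omega>. zc k (X k \<omega>) j) \<in> borel_measurable (F (Suc k))" if "j < N" for j
    unfolding zc_def using X[OF that] by measurable
  have G: "(\<lambda>\<omega>. G i' j' k (zc k (X k \<omega>) j)) \<in> borel_measurable (F (Suc k))" if "j < N" for i' j' j
    by (rule borel_measurable_G[OF z[OF that]])
  have sh: "(\<lambda>\<omega>. sh k \<omega> j i) \<in> borel_measurable (F (Suc k))" if "j < N" for j i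
  proof -
    have [measurable]: "d j (Suc k) \<in> borel_measurable (F (Suc k))" by (rule d_measF) (use that in auto)
    note z[OF that, measurable]
    show ?thesis unfolding sh_def by measurable
  qed
  have nb: "j < N" if "j \<in> nbrs N aw i" for i j using that by (auto simp: nbrs_def edges_def)
  have U: "(\<lambda>\<omega>. U k (X k \<omega>) i c) \<in> borel_measurable (F (Suc k))"
    unfolding U_def dG_def dH_def matvec_def
    by (intro borel_measurable_diff borel_measurable_times borel_measurable_sum borel_measurable_const
        measurable_If G X) (use Suc.prems in auto)
  have xi: "(\<lambda>\<omega>. xi k \<omega> i c) \<in> borel_measurable (F (Suc k))"
    unfolding xi_def zeta_def
    by (intro borel_measurable_add borel_measurable_diff borel_measurable_times borel_measurable_sum borel_measurable_const
        measurable_If G sh w_measF) (use Suc.prems nb in auto)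
  show ?case unfolding X_Suc[OF Suc.prems]
    by (intro borel_measurable_add X U xi Suc.prems)
qed


text \<open>Probability, given the past, that a message is sent at value \<open>z\<close>; it is
  also the mean square of the message.\<close>

definition Pr :: "nat \<Rightarrow> nat \<Rightarrow> nat \<Rightarrow> real \<Rightarrow> real" where
  "Pr i j k z = lapF ((z - thr i j k) / b i j) + lapF ((- z - thr i j k) / b i j)"

lemma Pr_nonneg: "0 \<le> Pr i j k z"
  using lapF_pos[of "(z - thr i j k) / b i j"] lapF_pos[of "(- z - thr i j k) / b i j"] by (simp add: Pr_def)

lemma Pr_le: "Pr i j k z \<le> 2"
  using lapF_le_1[of "(z - thr i j k) / b i j"] lapF_le_1[of "(- z - thr i j k) / b i j"] by (simp add: Pr_def)

lemma G_abs: "\<bar>G i j k z\<bar> \<le> Pr i j k z" "\<bar>G i j k z\<bar> \<le> 1"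
  using lapF_pos[of "(z - thr i j k) / b i j"] lapF_pos[of "(- z - thr i j k) / b i j"]
    lapF_le_1[of "(z - thr i j k) / b i j"] lapF_le_1[of "(- z - thr i j k) / b i j"]
  by (auto simp: Pr_def G_def trG_def abs_le_iff)

text \<open>The threshold is \<open>nu i j * b i j\<close> times a logarithm, so exp (- thr / b) is
  the power -nu of k + 1. This rarity of messages lowers the noise variance and is the source of the
  term nu / 2 in \<open>h\<close>. The other factor is bounded only on bounded errors.\<close>

lemma Pr_exp: assumes e: "(i, j) \<in> E" shows "Pr i j k z \<le> exp (\<bar>z\<bar> / b i j) * real (Suc k) powr (- nu i j)"
proof -
  have b: "0 < b i j" using b_sym[OF e] by simp
  have t: "exp (- thr i j k / b i j) = real (Suc k) powr (- nu i j)"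
    using b by (simp add: thr_def powr_def)
  have 1: "lapF ((y - thr i j k) / b i j) \<le> exp (\<bar>z\<bar> / b i j) * real (Suc k) powr (- nu i j) / 2" if "y \<le> \<bar>z\<bar>" for y
  proof -
    have "lapF ((y - thr i j k) / b i j) \<le> exp ((y - thr i j k) / b i j) / 2" by (rule lapF_le_exp)
    also have "exp ((y - thr i j k) / b i j) \<le> exp (\<bar>z\<bar> / b i j + - thr i j k / b i j)"
      using that b by (simp add: diff_divide_distrib divide_right_mono)
    also have "\<dots> = exp (\<bar>z\<bar> / b i j) * real (Suc k) powr (- nu i j)" unfolding exp_add t ..
    finally show ?thesis by simp
  qed
  show ?thesis using 1[OF abs_ge_self] 1[OF abs_ge_minus_self] unfolding Pr_def by linarith
qed

lemma zc_measF: "j < N \<Longrightarrow> (\<lambda>\<omega>. zc k (X k \<omega>) j) \<in> borel_measurable (F k)"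
  unfolding zc_def using X_measF[of j k] by measurable

text \<open>A nonnegative threshold makes the two half-lines for the dither disjoint, so the message
  is the difference of their indicators and its square is their sum.\<close>

lemma sh_indicator:
  assumes e: "(i, j) \<in> E"
  shows "sh k \<omega> j i = indicator {(thr i j k - zc k (X k \<omega>) j) / b i j<..} (d j (Suc k) \<omega>)
      - indicator {..<(- thr i j k - zc k (X k \<omega>) j) / b i j} (d j (Suc k) \<omega>)"
    and "(sh k \<omega> j i)\<^sup>2 = indicator {(thr i j k - zc k (X k \<omega>) j) / b i j<..} (d j (Suc k) \<omega>)
      + indicator {..<(- thr i j k - zc k (X k \<omega>) j) / b i j} (d j (Suc k) \<omega>)"
proof -
  define C where "C = thr i j k"
  define B where "B = b i j"
  define z where "z = zc k (X k \<omega>) j"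
  define y where "y = d j (Suc k) \<omega>"
  have C: "0 \<le> C" using thr_nonneg[OF e] by (simp add: C_def)
  have B: "0 < B" using b_sym[OF e] by (simp add: B_def)
  have c: "thr j i k = C" "b j i = B" using edge_fun_sym[OF e, of k] b_sym[OF e] by (auto simp: C_def B_def)
  have s: "sh k \<omega> j i = (if \<bar>z + B * y\<bar> > C then (if z + B * y > 0 then 1 else -1) else 0)"
    unfolding sh_def c z_def y_def ..
  have 1: "(C - z) / B < y \<longleftrightarrow> z + B * y > C" using B by (auto simp: field_simps)
  have 2: "y < (- C - z) / B \<longleftrightarrow> z + B * y < - C" using B by (auto simp: field_simps)
  have i1: "indicator {(C - z) / B<..} y = (if z + B * y > C then 1 else (0::real))" using 1 by (simp add: indicator_def)
  have i2: "indicator {..<(- C - z) / B} y = (if z + B * y < - C then 1 else (0::real))" using 2 by (simp add: indicator_def)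
  show "sh k \<omega> j i = indicator {(thr i j k - zc k (X k \<omega>) j) / b i j<..} (d j (Suc k) \<omega>)
      - indicator {..<(- thr i j k - zc k (X k \<omega>) j) / b i j} (d j (Suc k) \<omega>)"
    unfolding s C_def[symmetric] B_def[symmetric] z_def[symmetric] y_def[symmetric] i1 i2
    using C by (auto simp: abs_if)
  show "(sh k \<omega> j i)\<^sup>2 = indicator {(thr i j k - zc k (X k \<omega>) j) / b i j<..} (d j (Suc k) \<omega>)
      + indicator {..<(- thr i j k - zc k (X k \<omega>) j) / b i j} (d j (Suc k) \<omega>)"
    unfolding s C_def[symmetric] B_def[symmetric] z_def[symmetric] y_def[symmetric] i1 i2
    using C by (auto simp: abs_if)
qed

lemma sh_abs: "\<bar>sh k \<omega> j i\<bar> \<le> 1" by (simp add: sh_def)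

lemma zeta_abs: "\<bar>zeta k \<omega> i j\<bar> \<le> 2"
  using sh_abs[of k \<omega> j i] G_abs(2)[of i j k "zc k (X k \<omega>) j"] unfolding zeta_def by linarith

lemma integrable_bounded_mult:
  fixes f g :: "'w \<Rightarrow> real"
  assumes "f \<in> borel_measurable M" "g \<in> borel_measurable M" "\<And>\<omega>. \<bar>f \<omega>\<bar> \<le> B" "\<And>\<omega>. \<bar>g \<omega>\<bar> \<le> C"
  shows "integrable M (\<lambda>\<omega>. f \<omega> * g \<omega>)"
proof (rule integrable_const_bound[where B = "B * C"])
  have "norm (f \<omega> * g \<omega>) \<le> B * C" for \<omega>
    unfolding real_norm_def abs_mult
    by (rule mult_mono) (use assms(3,4) order.trans[OF abs_ge_zero assms(3)] in auto)
  then show "AE \<omega> in M. norm (f \<omega> * g \<omega>) \<le> B * C" by simp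
  show "(\<lambda>\<omega>. f \<omega> * g \<omega>) \<in> borel_measurable M" using assms by measurable
qed

text \<open>\<open>independent_threshold\<close> is applied to the two half-lines of
  \<open>sh_indicator\<close>; the symmetry of \<open>lapF\<close> turns the tail probabilities into
  \<open>G\<close> and \<open>Pr\<close>.\<close>

lemma dither_expectations:
  assumes e: "(i, j) \<in> E" and Y: "Y \<in> borel_measurable (F k)" and YB: "\<And>\<omega>. \<bar>Y \<omega>\<bar> \<le> B"
  shows "(\<integral>\<omega>. Y \<omega> * sh k \<omega> j i \<partial>M) = (\<integral>\<omega>. Y \<omega> * G i j k (zc k (X k \<omega>) j) \<partial>M)"
    and "(\<integral>\<omega>. Y \<omega> * (sh k \<omega> j i)\<^sup>2 \<partial>M) = (\<integral>\<omega>. Y \<omega> * Pr i j k (zc k (X k \<omega>) j) \<partial>M)"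
    and "(\<lambda>\<omega>. sh k \<omega> j i) \<in> borel_measurable M"
    and "(\<lambda>\<omega>. G i j k (zc k (X k \<omega>) j)) \<in> borel_measurable (F k)"
    and "(\<lambda>\<omega>. Pr i j k (zc k (X k \<omega>) j)) \<in> borel_measurable (F k)"
proof -
  have j: "j < N" using edgeD[OF e] by simp
  define C where "C = thr i j k"
  define B' where "B' = b i j"
  define z where "z \<omega> = zc k (X k \<omega>) j" for \<omega>
  have zF[measurable]: "z \<in> borel_measurable (F k)" unfolding z_def[abs_def] by (rule zc_measF[OF j])
  define T1 where "T1 \<omega> = (C - z \<omega>) / B'" for \<omega>
  define T2 where "T2 \<omega> = (- C - z \<omega>) / B'" for \<omega>
  have T1[measurable]: "T1 \<in> borel_measurable (F k)" unfolding T1_def[abs_def] by measurable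
  have T2[measurable]: "T2 \<in> borel_measurable (F k)" unfolding T2_def[abs_def] by measurable
  note toM = measurable_from_subalg[OF subalg_F]
  have YM[measurable]: "Y \<in> borel_measurable M" by (rule toM[OF Y])
  have T1M[measurable]: "T1 \<in> borel_measurable M" by (rule toM[OF T1])
  have T2M[measurable]: "T2 \<in> borel_measurable M" by (rule toM[OF T2])
  have dM[measurable]: "d j (Suc k) \<in> borel_measurable M" using d_meas[OF j] by simp
  let ?i1 = "\<lambda>\<omega>. indicator {T1 \<omega><..} (d j (Suc k) \<omega>) :: real" and ?i2 = "\<lambda>\<omega>. indicator {..<T2 \<omega>} (d j (Suc k) \<omega>) :: real"
  have i1M[measurable]: "?i1 \<in> borel_measurable M"
  proof -
    have "?i1 = (\<lambda>\<omega>. if T1 \<omega> < d j (Suc k) \<omega> then 1 else 0)" by (auto simp: indicator_def)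
    then show ?thesis by simp
  qed
  have i2M[measurable]: "?i2 \<in> borel_measurable M"
  proof -
    have "?i2 = (\<lambda>\<omega>. if d j (Suc k) \<omega> < T2 \<omega> then 1 else 0)" by (auto simp: indicator_def)
    then show ?thesis by simp
  qed
  have sh1: "sh k \<omega> j i = ?i1 \<omega> - ?i2 \<omega>" for \<omega>
    unfolding sh_indicator(1)[OF e] T1_def T2_def C_def B'_def z_def ..
  have sh2: "(sh k \<omega> j i)\<^sup>2 = ?i1 \<omega> + ?i2 \<omega>" for \<omega>
    unfolding sh_indicator(2)[OF e] T1_def T2_def C_def B'_def z_def ..
  show "(\<lambda>\<omega>. sh k \<omega> j i) \<in> borel_measurable M" unfolding sh1 by measurable
  have dl: "distributed M lborel (d j (Suc k)) (\<lambda>x. ennreal (exp (- \<bar>x\<bar>) / 2))" by (rule d_lap[OF j]) simp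
  note th = independent_threshold[OF subalg_F ind_next[OF j] dl Y YB]
  have e1: "(\<integral>\<omega>. Y \<omega> * ?i1 \<omega> \<partial>M) = (\<integral>\<omega>. Y \<omega> * (1 - lapF (T1 \<omega>)) \<partial>M)" by (rule th(1)[OF T1])
  have e2: "(\<integral>\<omega>. Y \<omega> * ?i2 \<omega> \<partial>M) = (\<integral>\<omega>. Y \<omega> * lapF (T2 \<omega>) \<partial>M)" by (rule th(2)[OF T2])
  have l1: "1 - lapF (T1 \<omega>) = lapF ((z \<omega> - C) / B')" for \<omega>
    using lapF_uminus[of "T1 \<omega>"] by (simp add: T1_def minus_divide_left)
  have l2: "lapF (T2 \<omega>) = lapF ((- z \<omega> - C) / B')" for \<omega>
  proof -
    have "- C - z \<omega> = - z \<omega> - C" by simp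
    then show ?thesis unfolding T2_def by (simp only:)
  qed
  have Geq: "G i j k (zc k (X k \<omega>) j) = (1 - lapF (T1 \<omega>)) - lapF (T2 \<omega>)" for \<omega>
    unfolding l1 l2 by (simp add: G_def trG_def C_def B'_def z_def)
  have Peq: "Pr i j k (zc k (X k \<omega>) j) = (1 - lapF (T1 \<omega>)) + lapF (T2 \<omega>)" for \<omega>
    unfolding l1 l2 by (simp add: Pr_def C_def B'_def z_def)
  show "(\<lambda>\<omega>. G i j k (zc k (X k \<omega>) j)) \<in> borel_measurable (F k)" unfolding Geq by measurable
  show "(\<lambda>\<omega>. Pr i j k (zc k (X k \<omega>) j)) \<in> borel_measurable (F k)" unfolding Peq by measurable
  have lb: "\<bar>1 - lapF t\<bar> \<le> 1" "\<bar>lapF t\<bar> \<le> 1" for t using lapF_pos[of t] lapF_le_1[of t] by auto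
  have ib: "\<bar>?i1 \<omega>\<bar> \<le> 1" "\<bar>?i2 \<omega>\<bar> \<le> 1" for \<omega> by (auto simp: indicator_def)
  have lM1: "(\<lambda>\<omega>. 1 - lapF (T1 \<omega>)) \<in> borel_measurable M" by measurable
  have lM2: "(\<lambda>\<omega>. lapF (T2 \<omega>)) \<in> borel_measurable M" by measurable
  have int: "integrable M (\<lambda>\<omega>. Y \<omega> * ?i1 \<omega>)" "integrable M (\<lambda>\<omega>. Y \<omega> * ?i2 \<omega>)"
    "integrable M (\<lambda>\<omega>. Y \<omega> * (1 - lapF (T1 \<omega>)))" "integrable M (\<lambda>\<omega>. Y \<omega> * lapF (T2 \<omega>))"
    by (rule integrable_bounded_mult[OF YM i1M YB ib(1)] integrable_bounded_mult[OF YM i2M YB ib(2)]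
        integrable_bounded_mult[OF YM lM1 YB lb(1)] integrable_bounded_mult[OF YM lM2 YB lb(2)])+
  show "(\<integral>\<omega>. Y \<omega> * sh k \<omega> j i \<partial>M) = (\<integral>\<omega>. Y \<omega> * G i j k (zc k (X k \<omega>) j) \<partial>M)"
    unfolding sh1 Geq right_diff_distrib[of _ "indicator _ _"] right_diff_distrib[of _ "1 - lapF _"]
    using int e1 e2 by (subst (1 2) Bochner_Integration.integral_diff) auto
  show "(\<integral>\<omega>. Y \<omega> * (sh k \<omega> j i)\<^sup>2 \<partial>M) = (\<integral>\<omega>. Y \<omega> * Pr i j k (zc k (X k \<omega>) j) \<partial>M)"
    unfolding sh2 Peq distrib_left using int e1 e2 by (subst (1 2) Bochner_Integration.integral_add) auto
qed

lemma zeta_martingale: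
  assumes e: "(i, j) \<in> E" and Y: "Y \<in> borel_measurable (F k)" and YB: "\<And>\<omega>. \<bar>Y \<omega>\<bar> \<le> B"
  shows "integrable M (\<lambda>\<omega>. Y \<omega> * zeta k \<omega> i j)" "(\<integral>\<omega>. Y \<omega> * zeta k \<omega> i j \<partial>M) = 0"
proof -
  note de = dither_expectations[OF e Y YB]
  note toM = measurable_from_subalg[OF subalg_F]
  have YM: "Y \<in> borel_measurable M" by (rule toM[OF Y])
  have GM: "(\<lambda>\<omega>. G i j k (zc k (X k \<omega>) j)) \<in> borel_measurable M" by (rule toM[OF de(4)])
  have i1: "integrable M (\<lambda>\<omega>. Y \<omega> * sh k \<omega> j i)" by (rule integrable_bounded_mult[OF YM de(3) YB sh_abs])
  have i2: "integrable M (\<lambda>\<omega>. Y \<omega> * G i j k (zc k (X k \<omega>) j))" by (rule integrable_bounded_mult[OF YM GM YB G_abs(2)])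
  have eq: "Y \<omega> * zeta k \<omega> i j = Y \<omega> * sh k \<omega> j i - Y \<omega> * G i j k (zc k (X k \<omega>) j)" for \<omega>
    by (simp add: zeta_def right_diff_distrib)
  show "integrable M (\<lambda>\<omega>. Y \<omega> * zeta k \<omega> i j)" unfolding eq by (rule Bochner_Integration.integrable_diff[OF i1 i2])
  show "(\<integral>\<omega>. Y \<omega> * zeta k \<omega> i j \<partial>M) = 0" unfolding eq Bochner_Integration.integral_diff[OF i1 i2] de(1) by simp
qed

text \<open>A square (s - g)^2 is at most 2 s^2 + 2 g^2. The first square has conditional mean
  \<open>Pr\<close>, and g^2 is at most \<open>Pr\<close>, whence the factor 4.\<close>

lemma zeta_moment:
  assumes e: "(i, j) \<in> E" and Y: "Y \<in> borel_measurable (F k)" and Y0: "\<And>\<omega>. 0 \<le> Y \<omega>" and YB: "\<And>\<omega>. Y \<omega> \<le> B"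
  shows "integrable M (\<lambda>\<omega>. Y \<omega> * (zeta k \<omega> i j)\<^sup>2)"
    "(\<integral>\<omega>. Y \<omega> * (zeta k \<omega> i j)\<^sup>2 \<partial>M) \<le> 4 * (\<integral>\<omega>. Y \<omega> * Pr i j k (zc k (X k \<omega>) j) \<partial>M)"
    "integrable M (\<lambda>\<omega>. Y \<omega> * Pr i j k (zc k (X k \<omega>) j))"
    "(\<lambda>\<omega>. zeta k \<omega> i j) \<in> borel_measurable M"
proof -
  have YB': "\<bar>Y \<omega>\<bar> \<le> B" for \<omega> using Y0 YB by simp
  note de = dither_expectations[OF e Y YB']
  note toM = measurable_from_subalg[OF subalg_F]
  have YM[measurable]: "Y \<in> borel_measurable M" by (rule toM[OF Y])
  have GM[measurable]: "(\<lambda>\<omega>. G i j k (zc k (X k \<omega>) j)) \<in> borel_measurable M" by (rule toM[OF de(4)])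
  have PM[measurable]: "(\<lambda>\<omega>. Pr i j k (zc k (X k \<omega>) j)) \<in> borel_measurable M" by (rule toM[OF de(5)])
  have sM[measurable]: "(\<lambda>\<omega>. sh k \<omega> j i) \<in> borel_measurable M" by (rule de(3))
  show zM[measurable]: "(\<lambda>\<omega>. zeta k \<omega> i j) \<in> borel_measurable M" unfolding zeta_def by measurable
  have z4: "\<bar>(zeta k \<omega> i j)\<^sup>2\<bar> \<le> 4" for \<omega>
    using power_mono[OF zeta_abs[of k \<omega> i j], of 2] by simp
  show i1: "integrable M (\<lambda>\<omega>. Y \<omega> * (zeta k \<omega> i j)\<^sup>2)" by (rule integrable_bounded_mult[OF YM _ YB' z4]) measurable
  have P2: "\<bar>Pr i j k z\<bar> \<le> 2" for z using Pr_nonneg Pr_le by simp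
  show i2: "integrable M (\<lambda>\<omega>. Y \<omega> * Pr i j k (zc k (X k \<omega>) j))" by (rule integrable_bounded_mult[OF YM PM YB' P2])
  have s1: "\<bar>(sh k \<omega> j i)\<^sup>2\<bar> \<le> 1" for \<omega> using power_mono[OF sh_abs[of k \<omega> j i], of 2] by simp
  have i3: "integrable M (\<lambda>\<omega>. Y \<omega> * (sh k \<omega> j i)\<^sup>2)" by (rule integrable_bounded_mult[OF YM _ YB' s1]) measurable
  have "(\<integral>\<omega>. Y \<omega> * (zeta k \<omega> i j)\<^sup>2 \<partial>M) \<le> (\<integral>\<omega>. 2 * (Y \<omega> * (sh k \<omega> j i)\<^sup>2) + 2 * (Y \<omega> * Pr i j k (zc k (X k \<omega>) j)) \<partial>M)"
  proof (rule integral_mono[OF i1])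
    show "integrable M (\<lambda>\<omega>. 2 * (Y \<omega> * (sh k \<omega> j i)\<^sup>2) + 2 * (Y \<omega> * Pr i j k (zc k (X k \<omega>) j)))" using i2 i3 by simp
    fix \<omega>
    let ?g = "G i j k (zc k (X k \<omega>) j)" and ?P = "Pr i j k (zc k (X k \<omega>) j)"
    have "?g\<^sup>2 \<le> ?P"
    proof -
      have "\<bar>?g\<bar> * \<bar>?g\<bar> \<le> 1 * ?P" using G_abs[of i j k "zc k (X k \<omega>) j"] by (intro mult_mono) auto
      then show ?thesis by (simp add: power2_eq_square)
    qed
    then have "(zeta k \<omega> i j)\<^sup>2 \<le> 2 * (sh k \<omega> j i)\<^sup>2 + 2 * ?P"
      using diff_sq_le[of "sh k \<omega> j i" ?g] unfolding zeta_def by linarith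
    from mult_left_mono[OF this Y0[of \<omega>]]
    show "Y \<omega> * (zeta k \<omega> i j)\<^sup>2 \<le> 2 * (Y \<omega> * (sh k \<omega> j i)\<^sup>2) + 2 * (Y \<omega> * ?P)" by (simp add: algebra_simps)
  qed
  also have "\<dots> = 2 * (\<integral>\<omega>. Y \<omega> * (sh k \<omega> j i)\<^sup>2 \<partial>M) + 2 * (\<integral>\<omega>. Y \<omega> * Pr i j k (zc k (X k \<omega>) j) \<partial>M)"
    using i2 i3 by simp
  also have "\<dots> = 4 * (\<integral>\<omega>. Y \<omega> * Pr i j k (zc k (X k \<omega>) j) \<partial>M)" unfolding de(2) by simp
  finally show "(\<integral>\<omega>. Y \<omega> * (zeta k \<omega> i j)\<^sup>2 \<partial>M) \<le> 4 * (\<integral>\<omega>. Y \<omega> * Pr i j k (zc k (X k \<omega>) j) \<partial>M)" .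
qed

definition "AW = (\<Sum>i<N. \<Sum>j<N. (aw i j)\<^sup>2)"
definition "Kx = 2 * AW + 2 * real n * Hbar\<^sup>2 * (\<Sum>i<N. (beta1 i)\<^sup>2)"
definition "wsq i k \<omega> = (\<Sum>r<m i. (w i k \<omega> r)\<^sup>2)"
text \<open>A majorant of \<open>V (xi k \<omega>)\<close> without cross terms, so that moments can
  be taken edge by edge and sensor by sensor.\<close>

definition eta :: "nat \<Rightarrow> 'w \<Rightarrow> real" where
  "eta k \<omega> = Kx * ((\<Sum>(i, j)\<in>E. (al i j k)\<^sup>2 * (zeta k \<omega> i j)\<^sup>2) + (\<Sum>i<N. (1 / real (Suc k))\<^sup>2 * wsq i (Suc k) \<omega>))"

lemma Kx_nonneg: "0 \<le> Kx" unfolding Kx_def AW_def by (auto intro!: add_nonneg_nonneg mult_nonneg_nonneg sum_nonneg)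

lemma wsq_nonneg: "0 \<le> wsq i k \<omega>" unfolding wsq_def by (intro sum_nonneg) auto

lemma E_Sigma: "E = Sigma {..<N} (nbrs N aw)" by (auto simp: nbrs_def edges_def)

lemma V_xi_le: "V (xi k \<omega>) \<le> eta k \<omega>"
proof -
  define S where "S i = (\<Sum>j\<in>nbrs N aw i. al i j k * aw i j * zeta k \<omega> i j)" for i
  define h where "h i c = beta1 i / real (Suc k) * (\<Sum>r<m i. H i (Suc k) r c * w i (Suc k) \<omega> r)" for i c
  have fin: "finite (nbrs N aw i)" for i by (rule finite_subset[of _ "{..<N}"]) (auto simp: nbrs_def edges_def)
  have S2: "(S i)\<^sup>2 \<le> AW * (\<Sum>j\<in>nbrs N aw i. (al i j k)\<^sup>2 * (zeta k \<omega> i j)\<^sup>2)" if i: "i < N" for i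
  proof -
    have "(S i)\<^sup>2 = (\<Sum>j\<in>nbrs N aw i. aw i j * (al i j k * zeta k \<omega> i j))\<^sup>2" unfolding S_def by (simp add: mult_ac)
    also have "\<dots> \<le> (\<Sum>j\<in>nbrs N aw i. (aw i j)\<^sup>2) * (\<Sum>j\<in>nbrs N aw i. (al i j k * zeta k \<omega> i j)\<^sup>2)"
      by (rule Cauchy_Schwarz_ineq_sum)
    also have "\<dots> \<le> AW * (\<Sum>j\<in>nbrs N aw i. (al i j k * zeta k \<omega> i j)\<^sup>2)"
    proof (rule mult_right_mono)
      have "(\<Sum>j\<in>nbrs N aw i. (aw i j)\<^sup>2) \<le> (\<Sum>j<N. (aw i j)\<^sup>2)"
        by (rule sum_mono2) (auto simp: nbrs_def edges_def)
      also have "\<dots> \<le> AW" unfolding AW_def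
        by (rule member_le_sum[of i "{..<N}" "\<lambda>i. \<Sum>j<N. (aw i j)\<^sup>2"]) (use i in \<open>auto intro: sum_nonneg\<close>)
      finally show "(\<Sum>j\<in>nbrs N aw i. (aw i j)\<^sup>2) \<le> AW" .
    qed (auto intro: sum_nonneg)
    finally show ?thesis by (simp add: power_mult_distrib)
  qed
  have h2: "(h i c)\<^sup>2 \<le> Hbar\<^sup>2 * (\<Sum>i<N. (beta1 i)\<^sup>2) * ((1 / real (Suc k))\<^sup>2 * wsq i (Suc k) \<omega>)" if i: "i < N" and c: "c < n" for i c
  proof -
    have "(h i c)\<^sup>2 = (beta1 i)\<^sup>2 * ((1 / real (Suc k))\<^sup>2 * (\<Sum>r<m i. H i (Suc k) r c * w i (Suc k) \<omega> r)\<^sup>2)"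
      unfolding h_def by (simp add: power_mult_distrib power_divide)
    also have "\<dots> \<le> (\<Sum>i<N. (beta1 i)\<^sup>2) * ((1 / real (Suc k))\<^sup>2 * (Hbar\<^sup>2 * wsq i (Suc k) \<omega>))"
    proof (intro mult_mono mult_left_mono)
      show "(beta1 i)\<^sup>2 \<le> (\<Sum>i<N. (beta1 i)\<^sup>2)" using i by (intro member_le_sum) auto
      show "(\<Sum>r<m i. H i (Suc k) r c * w i (Suc k) \<omega> r)\<^sup>2 \<le> Hbar\<^sup>2 * wsq i (Suc k) \<omega>"
        unfolding wsq_def by (rule matvec_transpose_le[OF _ c]) (use Hbound[OF i, of "Suc k"] in auto)
    qed (auto intro: sum_nonneg)
    finally show ?thesis by (simp add: mult_ac)
  qed
  have "V (xi k \<omega>) \<le> (\<Sum>i<N. \<Sum>c<n. 2 * (if c = lc k then (S i)\<^sup>2 else 0) + 2 * (h i c)\<^sup>2)"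
    unfolding V_def
  proof (intro sum_mono)
    fix i c
    have "xi k \<omega> i c = (if c = lc k then S i else 0) + h i c" unfolding xi_def S_def h_def ..
    then show "(xi k \<omega> i c)\<^sup>2 \<le> 2 * (if c = lc k then (S i)\<^sup>2 else 0) + 2 * (h i c)\<^sup>2"
      using diff_sq_le[of "S i" "- h i c"] by auto
  qed
  also have "\<dots> = (\<Sum>i<N. 2 * (S i)\<^sup>2 + 2 * (\<Sum>c<n. (h i c)\<^sup>2))"
    using lc_less by (simp add: sum.distrib sum_distrib_left[symmetric])
  also have "\<dots> \<le> (\<Sum>i<N. 2 * (AW * (\<Sum>j\<in>nbrs N aw i. (al i j k)\<^sup>2 * (zeta k \<omega> i j)\<^sup>2))
      + 2 * (\<Sum>c<n. Hbar\<^sup>2 * (\<Sum>i<N. (beta1 i)\<^sup>2) * ((1 / real (Suc k))\<^sup>2 * wsq i (Suc k) \<omega>)))"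
    by (intro sum_mono add_mono mult_left_mono S2 h2) auto
  also have "\<dots> = 2 * AW * (\<Sum>i<N. \<Sum>j\<in>nbrs N aw i. (al i j k)\<^sup>2 * (zeta k \<omega> i j)\<^sup>2)
      + 2 * real n * Hbar\<^sup>2 * (\<Sum>i<N. (beta1 i)\<^sup>2) * (\<Sum>i<N. (1 / real (Suc k))\<^sup>2 * wsq i (Suc k) \<omega>)"
  proof -
    define BS where "BS = (\<Sum>i<N. (beta1 i)\<^sup>2)"
    have "(\<Sum>i<N. 2 * (\<Sum>c<n. Hbar\<^sup>2 * BS * ((1 / real (Suc k))\<^sup>2 * wsq i (Suc k) \<omega>)))
        = 2 * real n * Hbar\<^sup>2 * BS * (\<Sum>i<N. (1 / real (Suc k))\<^sup>2 * wsq i (Suc k) \<omega>)"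
      unfolding sum_distrib_left[of "2 * real n * Hbar\<^sup>2 * BS"] by (intro sum.cong refl) simp
    moreover have "(\<Sum>i<N. 2 * (AW * (\<Sum>j\<in>nbrs N aw i. (al i j k)\<^sup>2 * (zeta k \<omega> i j)\<^sup>2)))
        = 2 * AW * (\<Sum>i<N. \<Sum>j\<in>nbrs N aw i. (al i j k)\<^sup>2 * (zeta k \<omega> i j)\<^sup>2)"
      unfolding sum_distrib_left[of "2 * AW" _ "{..<N}"] by (intro sum.cong refl) simp
    ultimately show ?thesis unfolding sum.distrib BS_def by linarith
  qed
  also have "(\<Sum>i<N. \<Sum>j\<in>nbrs N aw i. (al i j k)\<^sup>2 * (zeta k \<omega> i j)\<^sup>2) = (\<Sum>(i, j)\<in>E. (al i j k)\<^sup>2 * (zeta k \<omega> i j)\<^sup>2)"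
    unfolding E_Sigma by (rule sum.Sigma) (use fin in auto)
  also have "2 * AW * (\<Sum>(i, j)\<in>E. (al i j k)\<^sup>2 * (zeta k \<omega> i j)\<^sup>2)
      + 2 * real n * Hbar\<^sup>2 * (\<Sum>i<N. (beta1 i)\<^sup>2) * (\<Sum>i<N. (1 / real (Suc k))\<^sup>2 * wsq i (Suc k) \<omega>)
      \<le> Kx * (\<Sum>(i, j)\<in>E. (al i j k)\<^sup>2 * (zeta k \<omega> i j)\<^sup>2) + Kx * (\<Sum>i<N. (1 / real (Suc k))\<^sup>2 * wsq i (Suc k) \<omega>)"
    by (intro add_mono mult_right_mono) (auto simp: Kx_def AW_def wsq_nonneg intro!: sum_nonneg mult_nonneg_nonneg)
  finally show ?thesis by (simp add: eta_def distrib_left)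
qed

end

lemma powr_sum_le:
  fixes f :: "'i \<Rightarrow> real"
  assumes A: "finite A" and f: "\<And>x. x \<in> A \<Longrightarrow> 0 \<le> f x" and q: "0 < q"
  shows "(\<Sum>x\<in>A. f x) powr q \<le> real (card A) powr q * (\<Sum>x\<in>A. f x powr q)"
proof (cases "A = {}")
  case False
  define mx where "mx = Max (f ` A)"
  have "mx \<in> f ` A" unfolding mx_def using A False by (intro Max_in) auto
  then obtain y where y: "y \<in> A" "mx = f y" by auto
  have "(\<Sum>x\<in>A. f x) \<le> (\<Sum>x\<in>A. mx)" using A by (intro sum_mono) (auto simp: mx_def)
  then have "(\<Sum>x\<in>A. f x) powr q \<le> (real (card A) * mx) powr q"
    using q f by (intro powr_mono2) (auto intro: sum_nonneg)
  also have "\<dots> = real (card A) powr q * mx powr q" using y f by (simp add: powr_mult)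
  also have "mx powr q \<le> (\<Sum>x\<in>A. f x powr q)" unfolding y using A y by (intro member_le_sum) auto
  finally show ?thesis by (simp add: mult_left_mono)
qed (use q in simp)

lemma powr_add_le:
  fixes x y q :: real
  assumes "0 \<le> x" "0 \<le> y" "0 < q"
  shows "(x + y) powr q \<le> 2 powr q * (x powr q + y powr q)"
proof -
  have "(x + y) powr q \<le> (2 * max x y) powr q" using assms by (intro powr_mono2) auto
  also have "\<dots> = 2 powr q * max x y powr q" using assms by (simp add: powr_mult)
  also have "max x y powr q \<le> x powr q + y powr q" by (simp add: max_def)
  finally show ?thesis by simp
qed

section \<open>Conditional moments of the squared noise\<close>

context sc_network
begin

definition "CS L = Kx * (4 * real (card E) + real N * (1 + L))"
definition "CQ q L = Kx powr q * (2 powr q * (16 * (real (card E) powr q * real (card E)) + real N powr q * (real N * (1 + L))))"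

text \<open>The q-th power of the squared norm is the norm to the power 2 q, within reach of the
  moment of order \<open>\<rho>\<close>; the summand 1 covers norms below 1.\<close>

lemma wsq_powr_le:
  assumes q: "1 \<le> q" "2 * q \<le> \<rho>"
  shows "wsq i k \<omega> powr q \<le> 1 + vnorm (m i) (w i k \<omega>) powr \<rho>"
proof -
  let ?v = "vnorm (m i) (w i k \<omega>)"
  have v0: "0 \<le> ?v" by (simp add: vnorm_def sum_nonneg)
  have "wsq i k \<omega> = ?v\<^sup>2" unfolding wsq_def vnorm_def by (simp add: sum_nonneg)
  also have "\<dots> = ?v powr 2" using v0 by simp
  finally have e: "wsq i k \<omega> powr q = ?v powr (2 * q)" by (simp add: powr_powr)
  show ?thesis
  proof (cases "?v \<le> 1")
    case True
    then have "?v powr (2 * q) \<le> 1" using v0 q by (intro powr_le1) auto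
    then show ?thesis unfolding e using powr_ge_zero[of ?v \<rho>] by linarith
  next
    case False
    then have "?v powr (2 * q) \<le> ?v powr \<rho>" using q by (intro powr_mono) auto
    then show ?thesis unfolding e by simp
  qed
qed

lemma wsq_measM: "i < N \<Longrightarrow> 1 \<le> k \<Longrightarrow> (\<lambda>\<omega>. wsq i k \<omega>) \<in> borel_measurable M"
proof -
  assume "i < N" "1 \<le> k"
  then have [measurable]: "r < m i \<Longrightarrow> (\<lambda>\<omega>. w i k \<omega> r) \<in> borel_measurable M" for r using w_meas by blast
  show ?thesis unfolding wsq_def by measurable
qed

lemma zeta_measM: "(i, j) \<in> E \<Longrightarrow> (\<lambda>\<omega>. zeta k \<omega> i j) \<in> borel_measurable M"
  using zeta_moment(4)[of i j "\<lambda>_. 0" k 0] by simp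

lemma eta_measM: "eta k \<in> borel_measurable M"
  unfolding eta_def[abs_def]
proof (intro borel_measurable_times borel_measurable_add borel_measurable_const borel_measurable_sum)
  show "(\<lambda>\<omega>. case x of (i, j) \<Rightarrow> (al i j k)\<^sup>2 * (zeta k \<omega> i j)\<^sup>2) \<in> borel_measurable M" if x: "x \<in> E" for x
  proof (cases x)
    case (Pair i j)
    have [measurable]: "(\<lambda>\<omega>. zeta k \<omega> i j) \<in> borel_measurable M" using zeta_measM x Pair by simp
    show ?thesis unfolding Pair by simp
  qed
  show "wsq i (Suc k) \<in> borel_measurable M" if "i \<in> {..<N}" for i using wsq_measM[of i "Suc k"] that by auto
qed

lemma eta_nonneg: "0 \<le> eta k \<omega>"
  using V_xi_le[of k \<omega>] V_nonneg[of "xi k \<omega>"] by linarith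

lemma w_part_moment:
  assumes i: "i < N" and Y: "Y \<in> borel_measurable (F k)" and Y0: "\<And>\<omega>. 0 \<le> Y \<omega>" and YB: "\<And>\<omega>. Y \<omega> \<le> B"
    and q: "1 \<le> q" "2 * q \<le> \<rho>" and L: "0 \<le> L" and supp: "\<And>\<omega>. Y \<omega> \<noteq> 0 \<Longrightarrow> Sw i (Suc k) \<omega> \<le> ennreal L"
  shows "integrable M (\<lambda>\<omega>. Y \<omega> * wsq i (Suc k) \<omega> powr q)"
    "(\<integral>\<omega>. Y \<omega> * wsq i (Suc k) \<omega> powr q \<partial>M) \<le> (1 + L) * (\<integral>\<omega>. Y \<omega> \<partial>M)"
proof -
  let ?W = "\<lambda>\<omega>. vnorm (m i) (w i (Suc k) \<omega>) powr \<rho>"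
  have YM[measurable]: "Y \<in> borel_measurable M" by (rule measurable_from_subalg[OF subalg_F Y])
  have [measurable]: "(\<lambda>\<omega>. wsq i (Suc k) \<omega>) \<in> borel_measurable M" using wsq_measM[OF i] by simp
  have iY: "integrable M Y" by (rule integrable_const_bound[where B = B]) (use Y0 YB in auto)
  note wm = w_moment[OF i Y Y0 YB L supp]
  have i2: "integrable M (\<lambda>\<omega>. Y \<omega> + Y \<omega> * ?W \<omega>)" using iY wm(1) by simp
  have le: "Y \<omega> * wsq i (Suc k) \<omega> powr q \<le> Y \<omega> + Y \<omega> * ?W \<omega>" for \<omega>
    using mult_left_mono[OF wsq_powr_le[OF q, of i "Suc k" \<omega>] Y0[of \<omega>]] by (simp add: distrib_left)
  show i1: "integrable M (\<lambda>\<omega>. Y \<omega> * wsq i (Suc k) \<omega> powr q)"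
  proof (rule Bochner_Integration.integrable_bound[OF i2])
    have "norm (Y \<omega> * wsq i (Suc k) \<omega> powr q) \<le> norm (Y \<omega> + Y \<omega> * ?W \<omega>)" for \<omega>
      using le[of \<omega>] Y0[of \<omega>] by (simp add: abs_mult)
    then show "AE \<omega> in M. norm (Y \<omega> * wsq i (Suc k) \<omega> powr q) \<le> norm (Y \<omega> + Y \<omega> * ?W \<omega>)" by simp
  qed measurable
  have "(\<integral>\<omega>. Y \<omega> * wsq i (Suc k) \<omega> powr q \<partial>M) \<le> (\<integral>\<omega>. Y \<omega> + Y \<omega> * ?W \<omega> \<partial>M)"
    by (rule integral_mono[OF i1 i2 le])
  also have "\<dots> = (\<integral>\<omega>. Y \<omega> \<partial>M) + (\<integral>\<omega>. Y \<omega> * ?W \<omega> \<partial>M)" using iY wm(1) by simp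
  also have "\<dots> \<le> (1 + L) * (\<integral>\<omega>. Y \<omega> \<partial>M)" using wm(2) by (simp add: algebra_simps)
  finally show "(\<integral>\<omega>. Y \<omega> * wsq i (Suc k) \<omega> powr q \<partial>M) \<le> (1 + L) * (\<integral>\<omega>. Y \<omega> \<partial>M)" .
qed

lemma zeta_part_moment:
  assumes e: "(i, j) \<in> E" and Y: "Y \<in> borel_measurable (F k)" and Y0: "\<And>\<omega>. 0 \<le> Y \<omega>" and YB: "\<And>\<omega>. Y \<omega> \<le> B"
    and c: "0 \<le> c" and supp: "\<And>\<omega>. Y \<omega> \<noteq> 0 \<Longrightarrow> c * Pr i j k (zc k (X k \<omega>) j) \<le> s"
  shows "integrable M (\<lambda>\<omega>. Y \<omega> * (c * (zeta k \<omega> i j)\<^sup>2))"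
    "(\<integral>\<omega>. Y \<omega> * (c * (zeta k \<omega> i j)\<^sup>2) \<partial>M) \<le> 4 * s * (\<integral>\<omega>. Y \<omega> \<partial>M)"
proof -
  note zm = zeta_moment[OF e Y Y0 YB]
  have YM[measurable]: "Y \<in> borel_measurable M" by (rule measurable_from_subalg[OF subalg_F Y])
  have iY: "integrable M Y" by (rule integrable_const_bound[where B = B]) (use Y0 YB in auto)
  have eq: "Y \<omega> * (c * (zeta k \<omega> i j)\<^sup>2) = c * (Y \<omega> * (zeta k \<omega> i j)\<^sup>2)" for \<omega> by simp
  show "integrable M (\<lambda>\<omega>. Y \<omega> * (c * (zeta k \<omega> i j)\<^sup>2))" unfolding eq using zm(1) by simp
  have "(\<integral>\<omega>. Y \<omega> * (c * (zeta k \<omega> i j)\<^sup>2) \<partial>M) = c * (\<integral>\<omega>. Y \<omega> * (zeta k \<omega> i j)\<^sup>2 \<partial>M)" unfolding eq by simp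
  also have "\<dots> \<le> c * (4 * (\<integral>\<omega>. Y \<omega> * Pr i j k (zc k (X k \<omega>) j) \<partial>M))" by (rule mult_left_mono[OF zm(2) c])
  also have "\<dots> = 4 * (\<integral>\<omega>. c * (Y \<omega> * Pr i j k (zc k (X k \<omega>) j)) \<partial>M)" by simp
  also have "\<dots> \<le> 4 * (\<integral>\<omega>. s * Y \<omega> \<partial>M)"
  proof (intro mult_left_mono integral_mono)
    show "integrable M (\<lambda>\<omega>. c * (Y \<omega> * Pr i j k (zc k (X k \<omega>) j)))" using zm(3) by simp
    show "integrable M (\<lambda>\<omega>. s * Y \<omega>)" using iY by simp
    fix \<omega>
    show "c * (Y \<omega> * Pr i j k (zc k (X k \<omega>) j)) \<le> s * Y \<omega>"
      using supp[of \<omega>] mult_left_mono[of "c * Pr i j k (zc k (X k \<omega>) j)" s "Y \<omega>"] Y0[of \<omega>]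
      by (cases "Y \<omega> = 0") (auto simp: mult_ac)
  qed simp
  also have "\<dots> = 4 * s * (\<integral>\<omega>. Y \<omega> \<partial>M)" by simp
  finally show "(\<integral>\<omega>. Y \<omega> * (c * (zeta k \<omega> i j)\<^sup>2) \<partial>M) \<le> 4 * s * (\<integral>\<omega>. Y \<omega> \<partial>M)" .
qed

text \<open>Because \<open>zeta\<close> is bounded, its higher powers are still governed by the
  first power of the sending probability. Hence \<open>suppt\<close> raises the step size to the
  power q but leaves \<open>Pr\<close> as it is.\<close>

lemma eta_moment:
  assumes Y: "Y \<in> borel_measurable (F k)" and Y0: "\<And>\<omega>. 0 \<le> Y \<omega>" and YB: "\<And>\<omega>. Y \<omega> \<le> B"
    and q: "1 \<le> q" "q \<le> 2" "2 * q \<le> \<rho>" and L: "0 \<le> L"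
    and supp: "\<And>\<omega> i. Y \<omega> \<noteq> 0 \<Longrightarrow> i < N \<Longrightarrow> Sw i (Suc k) \<omega> \<le> ennreal L"
    and st: "0 \<le> s" "0 \<le> t"
    and supps: "\<And>\<omega> i j. Y \<omega> \<noteq> 0 \<Longrightarrow> (i, j) \<in> E \<Longrightarrow> (al i j k)\<^sup>2 * Pr i j k (zc k (X k \<omega>) j) \<le> s"
    and suppt: "\<And>\<omega> i j. Y \<omega> \<noteq> 0 \<Longrightarrow> (i, j) \<in> E \<Longrightarrow> ((al i j k)\<^sup>2) powr q * Pr i j k (zc k (X k \<omega>) j) \<le> t"
  shows "integrable M (\<lambda>\<omega>. Y \<omega> * eta k \<omega>)"
    "(\<integral>\<omega>. Y \<omega> * eta k \<omega> \<partial>M) \<le> CS L * (s + (1 / real (Suc k))\<^sup>2) * (\<integral>\<omega>. Y \<omega> \<partial>M)"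
    "integrable M (\<lambda>\<omega>. Y \<omega> * eta k \<omega> powr q)"
    "(\<integral>\<omega>. Y \<omega> * eta k \<omega> powr q \<partial>M) \<le> CQ q L * (t + ((1 / real (Suc k))\<^sup>2) powr q) * (\<integral>\<omega>. Y \<omega> \<partial>M)"
proof -
  have YM[measurable]: "Y \<in> borel_measurable M" by (rule measurable_from_subalg[OF subalg_F Y])
  have iY: "integrable M Y" by (rule integrable_const_bound[where B = B]) (use Y0 YB in auto)
  define y where "y = (\<integral>\<omega>. Y \<omega> \<partial>M)"
  have y0: "0 \<le> y" unfolding y_def by (intro integral_nonneg_AE) (use Y0 in auto)
  define g where "g = (1 / real (Suc k))\<^sup>2"
  have g0: "0 \<le> g" by (simp add: g_def)
  have Z: "integrable M (\<lambda>\<omega>. Y \<omega> * ((al (fst x) (snd x) k)\<^sup>2 * (zeta k \<omega> (fst x) (snd x))\<^sup>2))"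
      "(\<integral>\<omega>. Y \<omega> * ((al (fst x) (snd x) k)\<^sup>2 * (zeta k \<omega> (fst x) (snd x))\<^sup>2) \<partial>M) \<le> 4 * s * y" if "x \<in> E" for x
  proof -
    have e: "(fst x, snd x) \<in> E" using that by simp
    note zz = zeta_part_moment[OF e Y Y0 YB zero_le_power2 supps[OF _ e]]
    show "integrable M (\<lambda>\<omega>. Y \<omega> * ((al (fst x) (snd x) k)\<^sup>2 * (zeta k \<omega> (fst x) (snd x))\<^sup>2))" by (rule zz(1))
    show "(\<integral>\<omega>. Y \<omega> * ((al (fst x) (snd x) k)\<^sup>2 * (zeta k \<omega> (fst x) (snd x))\<^sup>2) \<partial>M) \<le> 4 * s * y" unfolding y_def by (rule zz(2))
  qed
  have Zq: "integrable M (\<lambda>\<omega>. Y \<omega> * (4 * ((al (fst x) (snd x) k)\<^sup>2) powr q * (zeta k \<omega> (fst x) (snd x))\<^sup>2))"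
      "(\<integral>\<omega>. Y \<omega> * (4 * ((al (fst x) (snd x) k)\<^sup>2) powr q * (zeta k \<omega> (fst x) (snd x))\<^sup>2) \<partial>M) \<le> 4 * (4 * t) * y" if "x \<in> E" for x
  proof -
    have e: "(fst x, snd x) \<in> E" using that by simp
    have h: "4 * ((al (fst x) (snd x) k)\<^sup>2) powr q * Pr (fst x) (snd x) k (zc k (X k \<omega>) (snd x)) \<le> 4 * t" if "Y \<omega> \<noteq> 0" for \<omega>
      using suppt[OF that, of "fst x" "snd x"] \<open>x \<in> E\<close> by simp
    show "integrable M (\<lambda>\<omega>. Y \<omega> * (4 * ((al (fst x) (snd x) k)\<^sup>2) powr q * (zeta k \<omega> (fst x) (snd x))\<^sup>2))"
      "(\<integral>\<omega>. Y \<omega> * (4 * ((al (fst x) (snd x) k)\<^sup>2) powr q * (zeta k \<omega> (fst x) (snd x))\<^sup>2) \<partial>M) \<le> 4 * (4 * t) * y"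
      using zeta_part_moment[OF e Y Y0 YB _ h] unfolding y_def by simp_all
  qed
  have W: "integrable M (\<lambda>\<omega>. Y \<omega> * wsq i (Suc k) \<omega> powr r)"
      "(\<integral>\<omega>. Y \<omega> * wsq i (Suc k) \<omega> powr r \<partial>M) \<le> (1 + L) * y" if "i \<in> {..<N}" "1 \<le> r" "2 * r \<le> \<rho>" for i r
    using w_part_moment[OF _ Y Y0 YB that(2,3) L supp, of i] that(1) unfolding y_def by simp_all
  have wsq1: "wsq i k' \<omega> = wsq i k' \<omega> powr 1" for i k' \<omega> using wsq_nonneg[of i k' \<omega>] by simp
  define S1 where "S1 \<omega> = (\<Sum>x\<in>E. (al (fst x) (snd x) k)\<^sup>2 * (zeta k \<omega> (fst x) (snd x))\<^sup>2)" for \<omega>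
  define S2 where "S2 \<omega> = (\<Sum>i<N. g * wsq i (Suc k) \<omega>)" for \<omega>
  have eta: "eta k \<omega> = Kx * (S1 \<omega> + S2 \<omega>)" for \<omega>
    unfolding eta_def S1_def S2_def g_def by (simp add: case_prod_unfold)
  have S10: "0 \<le> S1 \<omega>" and S20: "0 \<le> S2 \<omega>" for \<omega> unfolding S1_def S2_def
    by (auto intro!: sum_nonneg mult_nonneg_nonneg wsq_nonneg g0)
  have e1: "Y \<omega> * eta k \<omega> = Kx * ((\<Sum>x\<in>E. Y \<omega> * ((al (fst x) (snd x) k)\<^sup>2 * (zeta k \<omega> (fst x) (snd x))\<^sup>2))
      + (\<Sum>i<N. g * (Y \<omega> * wsq i (Suc k) \<omega> powr 1)))" for \<omega>
    unfolding eta S1_def S2_def wsq1[symmetric] by (simp add: sum_distrib_left algebra_simps)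
  have r1: "2 * (1::real) \<le> \<rho>" using \<rho> by simp
  have iS1: "integrable M (\<lambda>\<omega>. \<Sum>x\<in>E. Y \<omega> * ((al (fst x) (snd x) k)\<^sup>2 * (zeta k \<omega> (fst x) (snd x))\<^sup>2))"
    by (rule Bochner_Integration.integrable_sum) (rule Z)
  have iS2: "integrable M (\<lambda>\<omega>. \<Sum>i<N. g * (Y \<omega> * wsq i (Suc k) \<omega> powr 1))"
    by (rule Bochner_Integration.integrable_sum, rule integrable_mult_right, rule W) (use r1 in auto)
  show "integrable M (\<lambda>\<omega>. Y \<omega> * eta k \<omega>)" unfolding e1 using iS1 iS2 by simp
  have "(\<integral>\<omega>. Y \<omega> * eta k \<omega> \<partial>M) = Kx * ((\<Sum>x\<in>E. \<integral>\<omega>. Y \<omega> * ((al (fst x) (snd x) k)\<^sup>2 * (zeta k \<omega> (fst x) (snd x))\<^sup>2) \<partial>M)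
      + (\<Sum>i<N. g * (\<integral>\<omega>. Y \<omega> * wsq i (Suc k) \<omega> powr 1 \<partial>M)))"
  proof -
    have "(\<integral>\<omega>. (\<Sum>x\<in>E. Y \<omega> * ((al (fst x) (snd x) k)\<^sup>2 * (zeta k \<omega> (fst x) (snd x))\<^sup>2)) \<partial>M)
        = (\<Sum>x\<in>E. \<integral>\<omega>. Y \<omega> * ((al (fst x) (snd x) k)\<^sup>2 * (zeta k \<omega> (fst x) (snd x))\<^sup>2) \<partial>M)"
      by (rule Bochner_Integration.integral_sum) (rule Z)
    moreover have "(\<integral>\<omega>. (\<Sum>i<N. g * (Y \<omega> * wsq i (Suc k) \<omega> powr 1)) \<partial>M) = (\<Sum>i<N. \<integral>\<omega>. g * (Y \<omega> * wsq i (Suc k) \<omega> powr 1) \<partial>M)"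
      by (rule Bochner_Integration.integral_sum, rule integrable_mult_right, rule W) (use r1 in auto)
    ultimately show ?thesis unfolding e1 using iS1 iS2 by simp
  qed
  also have "\<dots> \<le> Kx * ((\<Sum>x\<in>E. 4 * s * y) + (\<Sum>i<N. g * ((1 + L) * y)))"
    by (intro mult_left_mono add_mono sum_mono Kx_nonneg Z W) (use r1 g0 in auto)
  also have "\<dots> = Kx * (4 * real (card E) * s + real N * (1 + L) * g) * y" by (simp add: algebra_simps)
  also have "\<dots> \<le> CS L * (s + g) * y"
  proof (rule mult_right_mono[OF _ y0])
    have "4 * real (card E) * s + real N * (1 + L) * g \<le> (4 * real (card E) + real N * (1 + L)) * s + (4 * real (card E) + real N * (1 + L)) * g"
      using L st g0 by (intro add_mono mult_right_mono) auto
    then have "Kx * (4 * real (card E) * s + real N * (1 + L) * g) \<le> Kx * ((4 * real (card E) + real N * (1 + L)) * (s + g))"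
      by (intro mult_left_mono Kx_nonneg) (simp only: distrib_left)
    then show "Kx * (4 * real (card E) * s + real N * (1 + L) * g) \<le> CS L * (s + g)" unfolding CS_def by (simp only: mult.assoc)
  qed
  finally show "(\<integral>\<omega>. Y \<omega> * eta k \<omega> \<partial>M) \<le> CS L * (s + (1 / real (Suc k))\<^sup>2) * (\<integral>\<omega>. Y \<omega> \<partial>M)"
    unfolding y_def g_def .
  define cE where "cE = real (card E) powr q"
  define cN where "cN = real N powr q"
  let ?T1 = "\<lambda>\<omega>. \<Sum>x\<in>E. Y \<omega> * (4 * ((al (fst x) (snd x) k)\<^sup>2) powr q * (zeta k \<omega> (fst x) (snd x))\<^sup>2)"
  let ?T2 = "\<lambda>\<omega>. \<Sum>i<N. g powr q * (Y \<omega> * wsq i (Suc k) \<omega> powr q)"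
  let ?R = "\<lambda>\<omega>. Kx powr q * (2 powr q * (cE * ?T1 \<omega> + cN * ?T2 \<omega>))"
  have pw: "Y \<omega> * eta k \<omega> powr q \<le> ?R \<omega>" for \<omega>
  proof -
    have "eta k \<omega> powr q = Kx powr q * (S1 \<omega> + S2 \<omega>) powr q"
      unfolding eta using Kx_nonneg S10 S20 by (simp add: powr_mult)
    also have "\<dots> \<le> Kx powr q * (2 powr q * (S1 \<omega> powr q + S2 \<omega> powr q))"
      using q by (intro mult_left_mono powr_add_le S10 S20) auto
    also have "S1 \<omega> powr q \<le> cE * (\<Sum>x\<in>E. 4 * ((al (fst x) (snd x) k)\<^sup>2) powr q * (zeta k \<omega> (fst x) (snd x))\<^sup>2)"
    proof -
      have "S1 \<omega> powr q \<le> cE * (\<Sum>x\<in>E. ((al (fst x) (snd x) k)\<^sup>2 * (zeta k \<omega> (fst x) (snd x))\<^sup>2) powr q)"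
        unfolding S1_def cE_def by (rule powr_sum_le) (use finite_E q in auto)
      also have "\<dots> \<le> cE * (\<Sum>x\<in>E. 4 * ((al (fst x) (snd x) k)\<^sup>2) powr q * (zeta k \<omega> (fst x) (snd x))\<^sup>2)"
      proof (intro mult_left_mono sum_mono)
        fix x
        define u where "u = (zeta k \<omega> (fst x) (snd x))\<^sup>2"
        have u: "0 \<le> u" "u \<le> 4" using power_mono[OF zeta_abs[of k \<omega> "fst x" "snd x"], of 2] by (auto simp: u_def)
        \<comment> \<open>From u at most 4 and q at most 2. Together with the factor 4 of
          \<open>zeta_part_moment\<close> this produces the 16 in \<open>CQ\<close>.\<close>
        have "u powr q \<le> 4 * u"
        proof (cases "u = 0")
          case False
          have "u powr (q - 1) \<le> 4 powr (q - 1)" using u q by (intro powr_mono2) auto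
          also have "(4::real) powr (q - 1) \<le> 4 powr 1" using q by (intro powr_mono) auto
          finally have "u * u powr (q - 1) \<le> u * 4" using u by (intro mult_left_mono) auto
          then show ?thesis using False u powr_add[of u 1 "q - 1"] by simp
        qed (use q in simp)
        then have "((al (fst x) (snd x) k)\<^sup>2) powr q * u powr q \<le> ((al (fst x) (snd x) k)\<^sup>2) powr q * (4 * u)"
          by (rule mult_left_mono) simp
        then show "((al (fst x) (snd x) k)\<^sup>2 * (zeta k \<omega> (fst x) (snd x))\<^sup>2) powr q
           \<le> 4 * ((al (fst x) (snd x) k)\<^sup>2) powr q * (zeta k \<omega> (fst x) (snd x))\<^sup>2"
          unfolding u_def[symmetric] using u by (simp add: powr_mult mult_ac)
      qed (simp add: cE_def)
      finally show ?thesis .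
    qed
    also have "S2 \<omega> powr q \<le> cN * (\<Sum>i<N. g powr q * wsq i (Suc k) \<omega> powr q)"
    proof -
      have "S2 \<omega> powr q \<le> cN * (\<Sum>i<N. (g * wsq i (Suc k) \<omega>) powr q)"
        unfolding S2_def cN_def using powr_sum_le[of "{..<N}" "\<lambda>i. g * wsq i (Suc k) \<omega>" q] q g0 wsq_nonneg by simp
      then show ?thesis using g0 wsq_nonneg by (simp add: powr_mult)
    qed
    finally have "eta k \<omega> powr q \<le> Kx powr q * (2 powr q * (cE * (\<Sum>x\<in>E. 4 * ((al (fst x) (snd x) k)\<^sup>2) powr q * (zeta k \<omega> (fst x) (snd x))\<^sup>2)
        + cN * (\<Sum>i<N. g powr q * wsq i (Suc k) \<omega> powr q)))" by (simp add: mult_left_mono)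
    from mult_left_mono[OF this Y0[of \<omega>]]
    show ?thesis by (simp add: sum_distrib_left[symmetric] distrib_left mult_ac)
  qed
  have iT1: "integrable M ?T1" by (rule Bochner_Integration.integrable_sum) (rule Zq)
  have iT2: "integrable M ?T2" by (rule Bochner_Integration.integrable_sum, rule integrable_mult_right, rule W) (use q in auto)
  have iR: "integrable M ?R" using iT1 iT2 by simp
  have [measurable]: "eta k \<in> borel_measurable M" by (rule eta_measM)
  show iq: "integrable M (\<lambda>\<omega>. Y \<omega> * eta k \<omega> powr q)"
  proof (rule Bochner_Integration.integrable_bound[OF iR])
    have "norm (Y \<omega> * eta k \<omega> powr q) \<le> norm (?R \<omega>)" for \<omega>
      unfolding real_norm_def using pw[of \<omega>] Y0[of \<omega>] mult_nonneg_nonneg[OF Y0[of \<omega>] powr_ge_zero[of "eta k \<omega>" q]] by linarith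
    then show "AE \<omega> in M. norm (Y \<omega> * eta k \<omega> powr q) \<le> norm (?R \<omega>)" by simp
  qed measurable
  have "(\<integral>\<omega>. Y \<omega> * eta k \<omega> powr q \<partial>M) \<le> (\<integral>\<omega>. ?R \<omega> \<partial>M)" by (rule integral_mono[OF iq iR pw])
  also have "\<dots> = Kx powr q * (2 powr q * (cE * (\<Sum>x\<in>E. \<integral>\<omega>. Y \<omega> * (4 * ((al (fst x) (snd x) k)\<^sup>2) powr q * (zeta k \<omega> (fst x) (snd x))\<^sup>2) \<partial>M)
      + cN * (\<Sum>i<N. g powr q * (\<integral>\<omega>. Y \<omega> * wsq i (Suc k) \<omega> powr q \<partial>M))))"
  proof -
    have "(\<integral>\<omega>. ?T1 \<omega> \<partial>M) = (\<Sum>x\<in>E. \<integral>\<omega>. Y \<omega> * (4 * ((al (fst x) (snd x) k)\<^sup>2) powr q * (zeta k \<omega> (fst x) (snd x))\<^sup>2) \<partial>M)"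
      by (rule Bochner_Integration.integral_sum) (rule Zq)
    moreover have "(\<integral>\<omega>. ?T2 \<omega> \<partial>M) = (\<Sum>i<N. \<integral>\<omega>. g powr q * (Y \<omega> * wsq i (Suc k) \<omega> powr q) \<partial>M)"
      by (rule Bochner_Integration.integral_sum, rule integrable_mult_right, rule W) (use q in auto)
    ultimately show ?thesis using iT1 iT2 by simp
  qed
  also have "\<dots> \<le> Kx powr q * (2 powr q * (cE * (\<Sum>x\<in>E. 4 * (4 * t) * y) + cN * (\<Sum>i<N. g powr q * ((1 + L) * y))))"
    by (intro mult_left_mono add_mono sum_mono Zq W) (use q in \<open>auto simp: cE_def cN_def\<close>)
  also have "\<dots> = Kx powr q * (2 powr q * (16 * (cE * real (card E)) * t + cN * (real N * (1 + L)) * g powr q)) * y"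
    by (simp add: algebra_simps)
  also have "\<dots> \<le> CQ q L * (t + g powr q) * y"
  proof (rule mult_right_mono[OF _ y0])
    define Z where "Z = 16 * (cE * real (card E)) + cN * (real N * (1 + L))"
    have "16 * (cE * real (card E)) * t + cN * (real N * (1 + L)) * g powr q \<le> Z * t + Z * g powr q"
      unfolding Z_def using L st by (intro add_mono mult_right_mono) (auto simp: cE_def cN_def)
    then have "Kx powr q * (2 powr q * (16 * (cE * real (card E)) * t + cN * (real N * (1 + L)) * g powr q)) \<le> Kx powr q * (2 powr q * (Z * (t + g powr q)))"
      by (intro mult_left_mono) (auto simp: distrib_left)
    then show "Kx powr q * (2 powr q * (16 * (cE * real (card E)) * t + cN * (real N * (1 + L)) * g powr q)) \<le> CQ q L * (t + g powr q)"
      unfolding CQ_def Z_def cE_def cN_def by (simp only: mult.assoc)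
  qed
  finally show "(\<integral>\<omega>. Y \<omega> * eta k \<omega> powr q \<partial>M) \<le> CQ q L * (t + ((1 / real (Suc k))\<^sup>2) powr q) * (\<integral>\<omega>. Y \<omega> \<partial>M)"
    unfolding y_def g_def .
qed

lemma xi_martingale:
  assumes i: "i < N" and Y: "Y \<in> borel_measurable (F k)" and YB: "\<And>\<omega>. \<bar>Y \<omega>\<bar> \<le> B"
  shows "integrable M (\<lambda>\<omega>. Y \<omega> * xi k \<omega> i c)" "(\<integral>\<omega>. Y \<omega> * xi k \<omega> i c \<partial>M) = 0"
proof -
  let ?z = "\<lambda>\<omega>. \<Sum>j\<in>nbrs N aw i. (if c = lc k then al i j k * aw i j else 0) * (Y \<omega> * zeta k \<omega> i j)"
  let ?w = "\<lambda>\<omega>. \<Sum>r<m i. (beta1 i / real (Suc k) * H i (Suc k) r c) * (Y \<omega> * w i (Suc k) \<omega> r)"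
  have eq: "Y \<omega> * xi k \<omega> i c = ?z \<omega> + ?w \<omega>" for \<omega>
    unfolding xi_def by (simp add: sum_distrib_left distrib_left mult_ac)
  have z: "integrable M (\<lambda>\<omega>. Y \<omega> * zeta k \<omega> i j)" "(\<integral>\<omega>. Y \<omega> * zeta k \<omega> i j \<partial>M) = 0" if "j \<in> nbrs N aw i" for j
    using zeta_martingale[OF _ Y YB, of i j] that by (auto simp: nbrs_E)
  have ww: "integrable M (\<lambda>\<omega>. Y \<omega> * w i (Suc k) \<omega> r)" "(\<integral>\<omega>. Y \<omega> * w i (Suc k) \<omega> r \<partial>M) = 0" if "r \<in> {..<m i}" for r
    using w_martingale[OF i _ Y YB, of r] that by auto
  have iz: "integrable M ?z" by (rule Bochner_Integration.integrable_sum, rule integrable_mult_right, rule z)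
  have iw: "integrable M ?w" by (rule Bochner_Integration.integrable_sum, rule integrable_mult_right, rule ww)
  show "integrable M (\<lambda>\<omega>. Y \<omega> * xi k \<omega> i c)" unfolding eq by (rule Bochner_Integration.integrable_add[OF iz iw])
  have "(\<integral>\<omega>. ?z \<omega> \<partial>M) = (\<Sum>j\<in>nbrs N aw i. \<integral>\<omega>. (if c = lc k then al i j k * aw i j else 0) * (Y \<omega> * zeta k \<omega> i j) \<partial>M)"
    by (rule Bochner_Integration.integral_sum, rule integrable_mult_right, rule z)
  also have "\<dots> = 0" using z by simp
  finally have z0: "(\<integral>\<omega>. ?z \<omega> \<partial>M) = 0" .
  have "(\<integral>\<omega>. ?w \<omega> \<partial>M) = (\<Sum>r<m i. \<integral>\<omega>. (beta1 i / real (Suc k) * H i (Suc k) r c) * (Y \<omega> * w i (Suc k) \<omega> r) \<partial>M)"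
    by (rule Bochner_Integration.integral_sum, rule integrable_mult_right, rule ww)
  also have "\<dots> = 0" using ww by simp
  finally have w0: "(\<integral>\<omega>. ?w \<omega> \<partial>M) = 0" .
  show "(\<integral>\<omega>. Y \<omega> * xi k \<omega> i c \<partial>M) = 0" unfolding eq Bochner_Integration.integral_add[OF iz iw] z0 w0 by simp
qed


text \<open>\<open>Sw i (Suc k)\<close> conditions on noise up to time k, so the event is known at
  time k although it bounds a moment of the next noise.\<close>

definition J :: "real set \<Rightarrow> real \<Rightarrow> nat \<Rightarrow> 'w set" where
  "J loc L k = {\<omega> \<in> space M. V (X k \<omega>) \<in> loc \<and> (\<forall>i<N. Sw i (Suc k) \<omega> \<le> ennreal L)}"

lemma U_measF: "i < N \<Longrightarrow> (\<lambda>\<omega>. U k (X k \<omega>) i c) \<in> borel_measurable (F k)"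
  unfolding U_def dG_def dH_def matvec_def
  by (intro borel_measurable_diff borel_measurable_times borel_measurable_sum borel_measurable_const
      measurable_If borel_measurable_G zc_measF X_measF) auto

lemma xi_measM: "i < N \<Longrightarrow> (\<lambda>\<omega>. xi k \<omega> i c) \<in> borel_measurable M"
  unfolding xi_def
  by (intro borel_measurable_add borel_measurable_times borel_measurable_sum borel_measurable_const
      measurable_If zeta_measM w_meas) (auto simp: nbrs_E)

lemma V_measF: "(\<lambda>\<omega>. V (X k \<omega>)) \<in> borel_measurable (F k)"
  unfolding V_def by (intro borel_measurable_sum borel_measurable_power X_measF) auto

lemma bform_unit_measF: assumes f: "bform C f" shows "(\<lambda>\<omega>. f (unit i c) (X k \<omega>)) \<in> borel_measurable (F k)"
  unfolding bform_expand[OF f, of "unit i c"]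
  by (intro borel_measurable_sum borel_measurable_times borel_measurable_const X_measF) auto

lemma bform_measF:
  assumes f: "bform C f" and Y: "\<And>i c. i < N \<Longrightarrow> (\<lambda>\<omega>. Y \<omega> i c) \<in> borel_measurable (F k)"
  shows "(\<lambda>\<omega>. f (X k \<omega>) (Y \<omega>)) \<in> borel_measurable (F k)"
  unfolding bform_expand[OF f, of "X k _"]
  by (intro borel_measurable_sum borel_measurable_times bform_unit_measF[OF f] Y) auto

lemma bform_measM:
  assumes f: "bform C f" and Y: "\<And>i c. i < N \<Longrightarrow> (\<lambda>\<omega>. Y \<omega> i c) \<in> borel_measurable M"
  shows "(\<lambda>\<omega>. f (X k \<omega>) (Y \<omega>)) \<in> borel_measurable M"
  unfolding bform_expand[OF f, of "X k _"]
  by (intro borel_measurable_sum borel_measurable_times Y measurable_from_subalg[OF subalg_F bform_unit_measF[OF f]]) auto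

text \<open>\<open>X_Suc\<close> describes only the rows below \<open>N\<close>, and a form does not
  see the others.\<close>

lemma bform_cong:
  assumes f: "bform C f" and "\<And>i c. i < N \<Longrightarrow> x i c = x' i c"
  shows "f x x = f x' x'"
proof -
  have e: "f y x = f y x'" for y
    unfolding bform_expand[OF f, of y] using assms(2) by (intro sum.cong refl) simp
  show ?thesis using e[of x] e[of x'] bform_symD[OF f, of x x'] by simp
qed

lemma J_sets: assumes "loc \<in> sets borel" shows "J loc L k \<in> sets (F k)"
proof -
  have S: "Sw i (Suc k) \<in> borel_measurable (F k)" for i
    using Sw_measFw[of i "Suc k"] Fw_le_F[of k] by (auto simp: measurable_def space_F)
  have "J loc L k = ((\<lambda>\<omega>. V (X k \<omega>)) -` loc \<inter> space (F k)) \<inter> (\<Inter>i\<in>{..<N}. {\<omega> \<in> space (F k). Sw i (Suc k) \<omega> \<le> ennreal L})"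
    using Npos by (auto simp: J_def space_F)
  also have "\<dots> \<in> sets (F k)"
  proof (rule sets.Int[OF measurable_sets[OF V_measF assms] sets.finite_INT])
    show "{\<omega> \<in> space (F k). Sw i (Suc k) \<omega> \<le> ennreal L} \<in> sets (F k)" for i using S[of i] by measurable
    show "{..<N} \<noteq> {}" using Npos by (auto simp: lessThan_empty_iff)
  qed simp
  finally show ?thesis .
qed

lemma V_unit: "i < N \<Longrightarrow> c < n \<Longrightarrow> V (unit i c) = 1"
  using ip_unit[of i c "unit i c"] by (simp add: V_ip) (simp add: unit_def)

text \<open>\<open>A\<close> is the corrected form of the error, \<open>D\<close> its mean change
  \<open>DD\<close>, and \<open>mm\<close> the part linear in \<open>xi\<close>. The remainder is
  exactly \<open>phi\<close> of the whole increment, hence nonnegative and bounded by the squares of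
  \<open>U\<close> and \<open>xi\<close>. From \<open>K\<close> on the correction takes at most half
  of \<open>V\<close>.\<close>

lemma lyapunov:
  fixes bb kap eps a q L :: real and om sn tn :: "nat \<Rightarrow> real" and K0 :: nat and loc :: "real set"
  assumes form: "sc_form N n m aw H nu b alpha1 gamma beta1 Hbar \<delta> p bb kap eps a om K0"
    and q: "1 < q" "q \<le> 2" "2 * q \<le> \<rho>" and L: "0 \<le> L" and loc: "loc \<in> sets borel"
    and cs: "\<And>k x. K0 \<le> k \<Longrightarrow> V x \<in> loc \<Longrightarrow> kap * real (Suc k) powr (eps - 1) * sf (lc k) x x \<le> cons k x"
    and sn: "\<And>k. 0 \<le> sn k" and tn: "\<And>k. 0 \<le> tn k"
    and prs: "\<And>k x i j. K0 \<le> k \<Longrightarrow> V x \<in> loc \<Longrightarrow> (i, j) \<in> E \<Longrightarrow> (al i j k)\<^sup>2 * Pr i j k (zc k x j) \<le> sn k"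
    and prt: "\<And>k x i j. K0 \<le> k \<Longrightarrow> V x \<in> loc \<Longrightarrow> (i, j) \<in> E \<Longrightarrow> ((al i j k)\<^sup>2) powr q * Pr i j k (zc k x j) \<le> tn k"
  shows "\<exists>K A D mm e. K \<ge> K0 \<and> (\<forall>k\<ge>K. \<forall>\<omega>. V (X k \<omega>) \<le> 2 * A k \<omega>) \<and>
    lyapunov_process M F (J loc L) A D mm eta K q a e
      (\<lambda>k. CS L * (sn k + (1 / real (Suc k))\<^sup>2)) (\<lambda>k. CQ q L * (tn k + ((1 / real (Suc k))\<^sup>2) powr q))"
proof -
  interpret fm: sc_form N n m aw H \<theta> nu b alpha1 gamma beta1 Hbar \<delta> p bb kap eps a om K0 by (rule form)
  have zlim: "fm.zz \<longlonglongrightarrow> 0" unfolding fm.zz_def[abs_def] using fm.eps by (intro tendsto_Suc_powr_0) auto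
  have "(\<lambda>k. fm.RR * fm.zz k) \<longlonglongrightarrow> fm.RR * 0" by (intro tendsto_mult tendsto_const zlim)
  then have "eventually (\<lambda>k. fm.RR * fm.zz k < 1/2) sequentially" by (rule order_tendstoD) simp
  moreover have "eventually (\<lambda>k. fm.ee k < 1) sequentially"
    by (rule order_tendstoD(2)[OF summable_LIMSEQ_zero[OF fm.summable_ee]]) simp
  ultimately have "eventually (\<lambda>k. fm.RR * fm.zz k < 1/2 \<and> fm.ee k < 1) sequentially" by (rule eventually_conj)
  then obtain K1 where K1: "\<And>k. k \<ge> K1 \<Longrightarrow> fm.RR * fm.zz k < 1/2 \<and> fm.ee k < 1" unfolding eventually_sequentially by blast
  define K where "K = max K0 K1"
  have small: "fm.RR * fm.zz k \<le> 1/2" if "k \<ge> K" for k using K1[of k] that by (simp add: K_def less_imp_le)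
  define A where "A k \<omega> = fm.phi k (X k \<omega>) (X k \<omega>)" for k \<omega>
  define D where "D k \<omega> = fm.DD k (X k \<omega>)" for k \<omega>
  define mm where "mm k \<omega> = 2 * fm.phi (Suc k) (X k \<omega>) (xi k \<omega>)" for k \<omega>
  \<comment> \<open>Cut to 0 before \<open>K\<close>, so that the bound by 1 holds for every
    k.\<close>
  define e where "e k = (if k \<ge> K then fm.ee k else 0)" for k
  have AV: "V (X k \<omega>) \<le> 2 * A k \<omega>" "A k \<omega> \<le> V (X k \<omega>)" if "k \<ge> K" for k \<omega>
    using fm.phi_bounds[OF small[OF that], of "X k \<omega>"] by (auto simp: A_def)
  have bf: "bform 1 (fm.phi k)" if "k \<ge> K" for k by (rule fm.bform_phi[OF small[OF that]])
  have A0: "0 \<le> A k \<omega>" if "k \<ge> K" for k \<omega> unfolding A_def by (rule bform_nonneg[OF bf[OF that]])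
  have KU_ku: "4 * KU * ku k \<le> fm.ee k" for k
  proof -
    define C where "C = 4 + 2 * fm.RR + 8 * fm.RR\<^sup>2 + 32 * KU"
    have C: "4 * KU \<le> C" "0 \<le> C" using fm.RR_nonneg KU_nonneg zero_le_power2[of fm.RR] unfolding C_def by linarith+
    have "4 * KU * ku k \<le> C * ku k" by (intro mult_right_mono C fm.ee_parts)
    also have "\<dots> \<le> fm.ee k" unfolding fm.ee_def C_def[symmetric] using fm.ee_parts[of k] C by (intro mult_left_mono) auto
    finally show ?thesis .
  qed
  have lp: "lyapunov_process M F (J loc L) A D mm eta K q a e
      (\<lambda>k. CS L * (sn k + (1 / real (Suc k))\<^sup>2)) (\<lambda>k. CQ q L * (tn k + ((1 / real (Suc k))\<^sup>2) powr q))"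
  proof (intro lyapunov_process.intro prob_space_axioms lyapunov_process_axioms.intro)
    show "subalgebra M (F k)" for k by (rule subalg_F)
    show "sets (F j) \<subseteq> sets (F k)" if "j \<le> k" for j k by (rule F_mono[OF that])
    show "1 < q" "q \<le> 2" by (rule q)+
    show "0 \<le> a" by (rule fm.a)
    show "0 \<le> e k" for k using fm.ee_nonneg by (simp add: e_def)
    show "e k \<le> 1" for k using K1[of k] by (auto simp: e_def K_def less_imp_le)
    show "summable e"
    proof (rule summable_comparison_test'[OF fm.summable_ee])
      show "norm (e k) \<le> fm.ee k" for k using fm.ee_nonneg[of k] by (auto simp: e_def)
    qed
    show "0 \<le> CS L * (sn k + (1 / real (Suc k))\<^sup>2)" for k
      unfolding CS_def using Kx_nonneg L sn[of k] by (intro mult_nonneg_nonneg add_nonneg_nonneg) auto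
    show "0 \<le> CQ q L * (tn k + ((1 / real (Suc k))\<^sup>2) powr q)" for k
      unfolding CQ_def using L tn[of k] by (intro mult_nonneg_nonneg add_nonneg_nonneg) auto
  next
    fix k assume k: "K \<le> k"
    then have kS: "K \<le> Suc k" and k0: "K0 \<le> k" by (auto simp: K_def)
    have bfS: "bform 1 (fm.phi (Suc k))" by (rule bf[OF kS])
    show "A k \<in> borel_measurable (F k)" unfolding A_def[abs_def] by (rule bform_measF[OF bf[OF k] X_measF])
    show "D k \<in> borel_measurable (F k)" unfolding D_def[abs_def] fm.DD_def
      by (intro borel_measurable_add borel_measurable_diff borel_measurable_times borel_measurable_const
          bform_measF[OF bfS X_measF] bform_measF[OF bf[OF k] X_measF] bform_measF[OF bfS U_measF])
    show "mm k \<in> borel_measurable M" unfolding mm_def[abs_def]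
      by (intro borel_measurable_times borel_measurable_const bform_measM[OF bfS xi_measM])
    show "eta k \<in> borel_measurable M" by (rule eta_measM)
    show "0 \<le> A k \<omega>" for \<omega> by (rule A0[OF k])
    show "0 \<le> eta k \<omega>" for \<omega> by (rule eta_nonneg)
    show "J loc L k \<in> sets (F k)" by (rule J_sets[OF loc])
    show "(D k \<omega>)\<^sup>2 \<le> e k * (A k \<omega>)\<^sup>2" for \<omega>
      unfolding D_def A_def using fm.DD_sq[OF small[OF k], of "X k \<omega>"] k by (simp add: e_def)
    show "D k \<omega> \<le> (e k - 2 * a / real (Suc k)) * A k \<omega>" if w: "\<omega> \<in> J loc L k" for \<omega>
    proof -
      have "kap * fm.zz k * sf (lc k) (X k \<omega>) (X k \<omega>) \<le> cons k (X k \<omega>)"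
        unfolding fm.zz_def by (rule cs[OF k0]) (use w in \<open>simp add: J_def\<close>)
      from fm.drift[OF k0 small[OF k] this] show ?thesis unfolding D_def A_def using k by (simp add: e_def)
    qed
    show "(mm k \<omega>)\<^sup>2 \<le> 8 * A k \<omega> * eta k \<omega>" for \<omega>
    proof -
      have "(fm.phi (Suc k) (X k \<omega>) (xi k \<omega>))\<^sup>2 \<le> fm.phi (Suc k) (X k \<omega>) (X k \<omega>) * fm.phi (Suc k) (xi k \<omega>) (xi k \<omega>)"
        by (rule bform_CS[OF bfS])
      also have "\<dots> \<le> (2 * A k \<omega>) * eta k \<omega>"
      proof (rule mult_mono)
        show "fm.phi (Suc k) (X k \<omega>) (X k \<omega>) \<le> 2 * A k \<omega>"
          using bform_le[OF bfS, of "X k \<omega>"] AV(1)[OF k, of \<omega>] by linarith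
        show "fm.phi (Suc k) (xi k \<omega>) (xi k \<omega>) \<le> eta k \<omega>"
          using bform_le[OF bfS, of "xi k \<omega>"] V_xi_le[of k \<omega>] by linarith
      qed (use A0[OF k, of \<omega>] bform_nonneg[OF bfS] in auto)
      finally show ?thesis by (simp add: mm_def power_mult_distrib)
    qed
    define h where "h \<omega> = (\<lambda>i c. U k (X k \<omega>) i c + xi k \<omega> i c)" for \<omega>
    have ASuc: "A (Suc k) \<omega> - A k \<omega> - D k \<omega> - mm k \<omega> = fm.phi (Suc k) (h \<omega>) (h \<omega>)" for \<omega>
    proof -
      have "A (Suc k) \<omega> = fm.phi (Suc k) (\<lambda>i c. X k \<omega> i c + h \<omega> i c) (\<lambda>i c. X k \<omega> i c + h \<omega> i c)"
        unfolding A_def by (rule bform_cong[OF bfS]) (simp add: X_Suc h_def)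
      also have "\<dots> = fm.phi (Suc k) (X k \<omega>) (X k \<omega>) + 2 * fm.phi (Suc k) (X k \<omega>) (h \<omega>) + fm.phi (Suc k) (h \<omega>) (h \<omega>)"
        by (rule bform_square_add[OF bfS])
      also have "fm.phi (Suc k) (X k \<omega>) (h \<omega>) = fm.phi (Suc k) (X k \<omega>) (U k (X k \<omega>)) + fm.phi (Suc k) (X k \<omega>) (xi k \<omega>)"
        unfolding h_def by (rule bform_addD[OF bfS])
      finally show ?thesis by (simp add: A_def D_def fm.DD_def mm_def)
    qed
    show "0 \<le> A (Suc k) \<omega> - A k \<omega> - D k \<omega> - mm k \<omega>" for \<omega>
      unfolding ASuc by (rule bform_nonneg[OF bfS])
    show "A (Suc k) \<omega> - A k \<omega> - D k \<omega> - mm k \<omega> \<le> e k * A k \<omega> + 2 * eta k \<omega>" for \<omega>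
    proof -
      have "fm.phi (Suc k) (h \<omega>) (h \<omega>) \<le> V (h \<omega>)" using bform_le[OF bfS, of "h \<omega>"] by simp
      also have "\<dots> \<le> 2 * V (U k (X k \<omega>)) + 2 * V (xi k \<omega>)"
      proof -
        have "(x + y)\<^sup>2 \<le> 2 * x\<^sup>2 + 2 * y\<^sup>2" for x y :: real using diff_sq_le[of x "- y"] by simp
        then have "V (h \<omega>) \<le> (\<Sum>i<N. \<Sum>c<n. 2 * (U k (X k \<omega>) i c)\<^sup>2 + 2 * (xi k \<omega> i c)\<^sup>2)"
          unfolding V_def h_def by (intro sum_mono)
        then show ?thesis by (simp add: V_def sum.distrib sum_distrib_left)
      qed
      also have "\<dots> \<le> 2 * (KU * ku k * (2 * A k \<omega>)) + 2 * eta k \<omega>"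
      proof (intro add_mono mult_left_mono V_xi_le)
        show "V (U k (X k \<omega>)) \<le> KU * ku k * (2 * A k \<omega>)"
          using V_U_le[of k "X k \<omega>"] mult_left_mono[OF AV(1)[OF k, of \<omega>], of "KU * ku k"] KU_nonneg fm.ee_parts(2)[of k]
          by (meson mult_nonneg_nonneg order.trans)
      qed auto
      also have "\<dots> \<le> e k * A k \<omega> + 2 * eta k \<omega>"
        using mult_right_mono[OF KU_ku[of k] A0[OF k, of \<omega>]] k by (simp add: e_def mult_ac)
      finally show ?thesis unfolding ASuc .
    qed
    fix Y :: "'w \<Rightarrow> real" and B :: real
    assume Y: "Y \<in> borel_measurable (F k)"
    show "integrable M (\<lambda>\<omega>. Y \<omega> * mm k \<omega>) \<and> (\<integral>\<omega>. Y \<omega> * mm k \<omega> \<partial>M) = 0"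
      if YB: "\<And>\<omega>. \<bar>Y \<omega>\<bar> \<le> B" and supp: "\<And>\<omega>. Y \<omega> \<noteq> 0 \<Longrightarrow> \<omega> \<in> J loc L k \<and> A k \<omega> \<le> B"
    proof -
      \<comment> \<open>On the support of \<open>Y\<close> the process \<open>A k\<close> is at most
        \<open>B\<close>; Cauchy-Schwarz then bounds the coefficient of each noise coordinate, and
        \<open>xi_martingale\<close> applies coordinate by coordinate.\<close>
      define g where "g i c \<omega> = 2 * (Y \<omega> * fm.phi (Suc k) (unit i c) (X k \<omega>))" for i c \<omega>
      have eq: "Y \<omega> * mm k \<omega> = (\<Sum>i<N. \<Sum>c<n. g i c \<omega> * xi k \<omega> i c)" for \<omega>
        unfolding mm_def bform_expand[OF bfS, of "X k \<omega>"] g_def by (simp add: sum_distrib_left mult_ac)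
      have gF: "g i c \<in> borel_measurable (F k)" for i c unfolding g_def[abs_def]
        by (intro borel_measurable_times borel_measurable_const Y bform_unit_measF[OF bfS])
      have gB: "\<bar>g i c \<omega>\<bar> \<le> 2 * (B * (1 + 2 * B))" if ic: "i < N" "c < n" for i c \<omega>
      proof (cases "Y \<omega> = 0")
        case True
        have "0 \<le> B" using YB[of \<omega>] by simp
        then show ?thesis using True by (simp add: g_def)
      next
        case False
        have AB: "A k \<omega> \<le> B" using supp[OF False] by simp
        have B0: "0 \<le> B" using AB A0[OF k, of \<omega>] by linarith
        let ?f = "fm.phi (Suc k) (unit i c) (X k \<omega>)"
        have "?f\<^sup>2 \<le> fm.phi (Suc k) (unit i c) (unit i c) * fm.phi (Suc k) (X k \<omega>) (X k \<omega>)" by (rule bform_CS[OF bfS])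
        also have "\<dots> \<le> 1 * (2 * B)"
          using bform_le[OF bfS, of "unit i c"] V_unit[OF ic] bform_le[OF bfS, of "X k \<omega>"] AV(1)[OF k, of \<omega>] AB
            bform_nonneg[OF bfS] by (intro mult_mono) auto
        also have "\<dots> \<le> (1 + 2 * B)\<^sup>2" using B0 by (simp add: power2_eq_square algebra_simps)
        finally have "\<bar>?f\<bar>\<^sup>2 \<le> (1 + 2 * B)\<^sup>2" by simp
        then have "\<bar>?f\<bar> \<le> 1 + 2 * B" by (rule power2_le_imp_le) (use B0 in simp)
        then have "\<bar>Y \<omega>\<bar> * \<bar>?f\<bar> \<le> B * (1 + 2 * B)" using YB[of \<omega>] B0 by (intro mult_mono) auto
        then show ?thesis by (simp add: g_def abs_mult)
      qed
      have x: "integrable M (\<lambda>\<omega>. g i c \<omega> * xi k \<omega> i c)" "(\<integral>\<omega>. g i c \<omega> * xi k \<omega> i c \<partial>M) = 0" if "i < N" "c < n" for i c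
        using xi_martingale[OF that(1) gF[of i c] gB[OF that], of c] by blast+
      have i: "integrable M (\<lambda>\<omega>. \<Sum>c<n. g i c \<omega> * xi k \<omega> i c)" if "i < N" for i
        by (rule Bochner_Integration.integrable_sum) (use x that in auto)
      have i0: "(\<integral>\<omega>. (\<Sum>c<n. g i c \<omega> * xi k \<omega> i c) \<partial>M) = 0" if "i < N" for i
        using x that by (subst Bochner_Integration.integral_sum) auto
      show ?thesis unfolding eq
      proof
        show "integrable M (\<lambda>\<omega>. \<Sum>i<N. \<Sum>c<n. g i c \<omega> * xi k \<omega> i c)"
          by (rule Bochner_Integration.integrable_sum) (use i in auto)
        show "(\<integral>\<omega>. (\<Sum>i<N. \<Sum>c<n. g i c \<omega> * xi k \<omega> i c) \<partial>M) = 0"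
          using i i0 by (subst Bochner_Integration.integral_sum) auto
      qed
    qed
    show "integrable M (\<lambda>\<omega>. Y \<omega> * eta k \<omega>) \<and> (\<integral>\<omega>. Y \<omega> * eta k \<omega> \<partial>M) \<le> CS L * (sn k + (1 / real (Suc k))\<^sup>2) * (\<integral>\<omega>. Y \<omega> \<partial>M) \<and>
        integrable M (\<lambda>\<omega>. Y \<omega> * eta k \<omega> powr q) \<and>
        (\<integral>\<omega>. Y \<omega> * eta k \<omega> powr q \<partial>M) \<le> CQ q L * (tn k + ((1 / real (Suc k))\<^sup>2) powr q) * (\<integral>\<omega>. Y \<omega> \<partial>M)"
      if Y0: "\<And>\<omega>. 0 \<le> Y \<omega>" and YB: "\<And>\<omega>. Y \<omega> \<le> B" and supp: "\<And>\<omega>. Y \<omega> \<noteq> 0 \<Longrightarrow> \<omega> \<in> J loc L k"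
    proof -
      have q': "1 \<le> q" using q by simp
      have s1: "Sw i (Suc k) \<omega> \<le> ennreal L" if "Y \<omega> \<noteq> 0" "i < N" for \<omega> i using supp[OF that(1)] that(2) by (simp add: J_def)
      have s2: "(al i j k)\<^sup>2 * Pr i j k (zc k (X k \<omega>) j) \<le> sn k" if "Y \<omega> \<noteq> 0" "(i, j) \<in> E" for \<omega> i j
        by (rule prs[OF k0 _ that(2)]) (use supp[OF that(1)] in \<open>simp add: J_def\<close>)
      have s3: "((al i j k)\<^sup>2) powr q * Pr i j k (zc k (X k \<omega>) j) \<le> tn k" if "Y \<omega> \<noteq> 0" "(i, j) \<in> E" for \<omega> i j
        by (rule prt[OF k0 _ that(2)]) (use supp[OF that(1)] in \<open>simp add: J_def\<close>)
      note em = eta_moment[OF Y Y0 YB q' q(2,3) L s1 sn tn s2 s3]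
      show ?thesis by (intro conjI em)
    qed
  qed
  show ?thesis
    by (rule exI[of _ K], rule exI[of _ A], rule exI[of _ D], rule exI[of _ mm], rule exI[of _ e])
      (use lp AV(1) in \<open>auto simp: K_def\<close>)
qed

end

lemma extend_finite_bound:
  fixes f g :: "nat \<Rightarrow> real"
  assumes "\<And>k. k \<ge> K \<Longrightarrow> f k \<le> B * g k" and g: "\<And>k. 0 < g k"
  shows "\<exists>B. \<forall>k. f k \<le> B * g k"
proof -
  define B' where "B' = \<bar>B\<bar> + (\<Sum>j<K. \<bar>f j / g j\<bar>)"
  have "f k \<le> B' * g k" for k
  proof (cases "k \<ge> K")
    case True
    have "B \<le> B'" unfolding B'_def using sum_nonneg[of "{..<K}" "\<lambda>j. \<bar>f j / g j\<bar>"] by simp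
    then have "B * g k \<le> B' * g k" using g[of k] by (intro mult_right_mono) auto
    then show ?thesis using assms(1)[OF True] by linarith
  next
    case False
    then have "\<bar>f k / g k\<bar> \<le> (\<Sum>j<K. \<bar>f j / g j\<bar>)" by (intro member_le_sum) auto
    then have "f k / g k \<le> B'" unfolding B'_def by linarith
    then show ?thesis using g[of k] by (simp add: divide_le_eq)
  qed
  then show ?thesis by blast
qed

section \<open>Localised rates and boundedness of the errors\<close>

context sc_network
begin

lemma form_mono:
  assumes "sc_form N n m aw H nu b alpha1 gamma beta1 Hbar \<delta> p bb kap eps a om K0" "K0 \<le> K1"
  shows "sc_form N n m aw H nu b alpha1 gamma beta1 Hbar \<delta> p bb kap eps a om K1"
proof -
  interpret fm: sc_form N n m aw H \<theta> nu b alpha1 gamma beta1 Hbar \<delta> p bb kap eps a om K0 by (rule assms)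
  show ?thesis
    by unfold_locales (use fm.bb fm.kap fm.eps fm.a fm.om fm.Qf assms(2) order.trans in blast)+
qed

text \<open>The time \<open>T\<close> after which the path stays in \<open>loc\<close> and the
  moment bound \<open>L\<close> depend on the outcome; each pair of naturals is treated separately
  and the countably many null sets are joined. The alternatives for \<open>g\<close> come from
  \<open>rate_summable\<close> with \<open>l\<close> equal to 1 and to a squared logarithm, and from
  \<open>rate_log\<close> with exponent 2 h - 1.\<close>

lemma rate:
  fixes bb kap eps a q S h :: real and om :: "nat \<Rightarrow> real" and K0 :: nat and loc :: "real set"
  assumes form: "sc_form N n m aw H nu b alpha1 gamma beta1 Hbar \<delta> p bb kap eps a om K0"
    and q: "1 < q" "q \<le> 2" "2 * q \<le> \<rho>" and loc: "loc \<in> sets borel"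
    and cs: "\<And>k x. K0 \<le> k \<Longrightarrow> V x \<in> loc \<Longrightarrow> kap * real (Suc k) powr (eps - 1) * sf (lc k) x x \<le> cons k x"
    and h: "1/2 < h" "h \<le> 1" and S: "0 \<le> S"
    and prs: "\<And>k x i j. K0 \<le> k \<Longrightarrow> V x \<in> loc \<Longrightarrow> (i, j) \<in> E \<Longrightarrow>
        (al i j k)\<^sup>2 * Pr i j k (zc k x j) \<le> S * real (Suc k) powr (- 2 * h)"
    and prt: "\<And>k x i j. K0 \<le> k \<Longrightarrow> V x \<in> loc \<Longrightarrow> (i, j) \<in> E \<Longrightarrow>
        ((al i j k)\<^sup>2) powr q * Pr i j k (zc k x j) \<le> S * real (Suc k) powr (- q * (2 * h - 1) - 1)"
    and g: "(2 * h - 2 * a > 1 \<and> g = (\<lambda>k. real (Suc k) powr (- 2 * a)))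
      \<or> (2 * h - 2 * a = 1 \<and> g = (\<lambda>k. ln (real (k + 2)) powr 2 * real (Suc k) powr (- 2 * a)))
      \<or> (2 * h - 2 * a < 1 \<and> g = (\<lambda>k. ln (real (k + 2)) * real (Suc k) powr (- (2 * h - 1))))"
  shows "AE \<omega> in M. (\<exists>T. \<forall>k\<ge>T. V (X k \<omega>) \<in> loc) \<longrightarrow> (\<exists>B. \<forall>k. V (X k \<omega>) \<le> B * g k)"
proof -
  have gpos: "0 < g k" for k
  proof -
    have "0 < ln (real (k + 2))" by simp
    then show ?thesis using g by (elim disjE conjE) auto
  qed
  have main: "AE \<omega> in M. (\<forall>k\<ge>T. V (X k \<omega>) \<in> loc) \<and> (\<forall>i<N. \<forall>k. Sw i (Suc k) \<omega> \<le> ennreal (real L))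
      \<longrightarrow> (\<exists>B. \<forall>k. V (X k \<omega>) \<le> B * g k)" for T L :: nat
  proof -
    define K1 where "K1 = max K0 T"
    have K1: "K0 \<le> K1" "T \<le> K1" by (auto simp: K1_def)
    have kk: "K1 \<le> k \<Longrightarrow> K0 \<le> k" for k using K1 by simp
    define sn where "sn k = S * real (Suc k) powr (- 2 * h)" for k
    define tn where "tn k = S * real (Suc k) powr (- q * (2 * h - 1) - 1)" for k
    define \<sigma> where "\<sigma> k = CS (real L) * (sn k + (1 / real (Suc k))\<^sup>2)" for k
    define \<tau> where "\<tau> k = CQ q (real L) * (tn k + ((1 / real (Suc k))\<^sup>2) powr q)" for k
    have "\<exists>K A D mm e. K \<ge> K1 \<and> (\<forall>k\<ge>K. \<forall>\<omega>. V (X k \<omega>) \<le> 2 * A k \<omega>) \<and>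
        lyapunov_process M F (J loc (real L)) A D mm eta K q a e
          (\<lambda>k. CS (real L) * (sn k + (1 / real (Suc k))\<^sup>2)) (\<lambda>k. CQ q (real L) * (tn k + ((1 / real (Suc k))\<^sup>2) powr q))"
      by (rule lyapunov[OF form_mono[OF form K1(1)] q _ loc cs[OF kk] _ _ prs[OF kk, folded sn_def] prt[OF kk, folded tn_def]])
        (use S in \<open>auto simp: sn_def tn_def\<close>)
    then obtain K A D mm e where K: "K \<ge> K1" and AV: "\<And>k \<omega>. k \<ge> K \<Longrightarrow> V (X k \<omega>) \<le> 2 * A k \<omega>"
      and lp: "lyapunov_process M F (J loc (real L)) A D mm eta K q a e \<sigma> \<tau>"
      unfolding \<sigma>_def[abs_def] \<tau>_def[abs_def] by blast
    interpret lp: lyapunov_process M F "J loc (real L)" A D mm eta K q a e \<sigma> \<tau> by (rule lp)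
    define C where "C = (CS (real L) + CQ q (real L)) * (S + 1)"
    have CS0: "0 \<le> CS (real L)" unfolding CS_def using Kx_nonneg by simp
    have CQ0: "0 \<le> CQ q (real L)" unfolding CQ_def by simp
    have C0: "0 \<le> C" unfolding C_def using CS0 CQ0 S by simp
    have i2: "(1 / real (Suc k))\<^sup>2 = real (Suc k) powr (- 2)" for k
      by (simp add: powr_minus power_divide divide_inverse power_inverse del: of_nat_Suc)
    have \<sigma>: "\<sigma> k \<le> C * real (Suc k) powr (- 2 * h)" for k
    proof -
      have "(1 / real (Suc k))\<^sup>2 \<le> real (Suc k) powr (- 2 * h)" unfolding i2 using h by (intro powr_mono) auto
      then have "\<sigma> k \<le> CS (real L) * ((S + 1) * real (Suc k) powr (- 2 * h))"
        unfolding \<sigma>_def sn_def using CS0 by (intro mult_left_mono) (auto simp: algebra_simps)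
      also have "\<dots> \<le> (CS (real L) + CQ q (real L)) * ((S + 1) * real (Suc k) powr (- 2 * h))"
        using CQ0 S by (intro mult_right_mono) auto
      finally show ?thesis by (simp add: C_def mult.assoc)
    qed
    have \<tau>: "\<tau> k \<le> C * real (Suc k) powr (- q * (2 * h - 1) - 1)" for k
    proof -
      have "((1 / real (Suc k))\<^sup>2) powr q = real (Suc k) powr (- 2 * q)" unfolding i2 by (simp add: powr_powr)
      also have "\<dots> \<le> real (Suc k) powr (- q * (2 * h - 1) - 1)"
      proof (intro powr_mono)
        have "q * (2 * h - 1) \<le> q * 1" using h q by (intro mult_left_mono) auto
        moreover have "- q * (2 * h - 1) = - (q * (2 * h - 1))" by simp
        ultimately show "- 2 * q \<le> - q * (2 * h - 1) - 1" using q by linarith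
      qed auto
      finally have "\<tau> k \<le> CQ q (real L) * ((S + 1) * real (Suc k) powr (- q * (2 * h - 1) - 1))"
        unfolding \<tau>_def tn_def using CQ0 by (intro mult_left_mono) (auto simp: algebra_simps)
      also have "\<dots> \<le> (CS (real L) + CQ q (real L)) * ((S + 1) * real (Suc k) powr (- q * (2 * h - 1) - 1))"
        using CS0 S by (intro mult_right_mono) auto
      finally show ?thesis by (simp add: C_def mult.assoc)
    qed
    have fin: ?thesis if \<psi>: "AE \<omega> in M. (\<forall>k\<ge>K. \<omega> \<in> J loc (real L) k) \<longrightarrow> (\<exists>B. \<forall>k\<ge>K. \<psi> k * A k \<omega> \<le> B)"
        and \<psi>g: "\<And>k. \<psi> k * g k = 1" for \<psi>
      using \<psi>
    proof (rule AE_mp, intro AE_I2 impI)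
      fix \<omega> assume sp: "\<omega> \<in> space M" and imp: "(\<forall>k\<ge>K. \<omega> \<in> J loc (real L) k) \<longrightarrow> (\<exists>B. \<forall>k\<ge>K. \<psi> k * A k \<omega> \<le> B)"
        and w: "(\<forall>k\<ge>T. V (X k \<omega>) \<in> loc) \<and> (\<forall>i<N. \<forall>k. Sw i (Suc k) \<omega> \<le> ennreal (real L))"
      have "\<omega> \<in> J loc (real L) k" if "k \<ge> K" for k using w sp that K K1 by (simp add: J_def)
      then obtain B where B: "\<And>k. k \<ge> K \<Longrightarrow> \<psi> k * A k \<omega> \<le> B" using imp by blast
      have "V (X k \<omega>) \<le> (2 * B) * g k" if "k \<ge> K" for k
      proof -
        have "A k \<omega> = (\<psi> k * g k) * A k \<omega>" by (simp add: \<psi>g)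
        also have "\<dots> = (\<psi> k * A k \<omega>) * g k" by (simp only: mult_ac)
        also have "\<dots> \<le> B * g k" using B[OF that] gpos[of k] by (intro mult_right_mono) auto
        finally show ?thesis using AV[OF that, of \<omega>] by simp
      qed
      then show "\<exists>B. \<forall>k. V (X k \<omega>) \<le> B * g k" by (rule extend_finite_bound[OF _ gpos])
    qed
    consider (1) "2 * h - 2 * a > 1" "g = (\<lambda>k. real (Suc k) powr (- 2 * a))"
      | (2) "2 * h - 2 * a = 1" "g = (\<lambda>k. ln (real (k + 2)) powr 2 * real (Suc k) powr (- 2 * a))"
      | (3) "2 * h - 2 * a < 1" "g = (\<lambda>k. ln (real (k + 2)) * real (Suc k) powr (- (2 * h - 1)))" using g by blast
    then show ?thesis
    proof cases
      case 1
      have pos1: "0 < (1::real)" "(1::real) \<le> 1" by auto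
      have "AE \<omega> in M. (\<forall>k\<ge>K. \<omega> \<in> J loc (real L) k) \<longrightarrow> (\<exists>B. \<forall>k\<ge>K. real (Suc k) powr (2 * a) / (\<lambda>_. 1) k * A k \<omega> \<le> B)"
      proof (rule lp.rate_summable)
        show "summable (\<lambda>k. real (Suc k) powr (2 * a) / 1 * \<sigma> k)"
        proof (rule summable_comparison_test')
          show "summable (\<lambda>k. C * real (Suc k) powr (2 * a - 2 * h))" using 1 by (intro summable_mult summable_Suc_powr) auto
          fix k
          have "real (Suc k) powr (2 * a) * \<sigma> k \<le> real (Suc k) powr (2 * a) * (C * real (Suc k) powr (- 2 * h))" by (intro mult_left_mono \<sigma>) auto
          also have "\<dots> = C * real (Suc k) powr (2 * a - 2 * h)" by (simp add: powr_add[symmetric] mult.left_commute)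
          finally show "norm (real (Suc k) powr (2 * a) / 1 * \<sigma> k) \<le> C * real (Suc k) powr (2 * a - 2 * h)"
            using lp.\<sigma>_nn[of k] by (simp add: abs_mult)
        qed
        show "summable (\<lambda>k. (real (Suc k) powr (2 * a) / 1) powr q * \<tau> k)"
        proof (rule summable_comparison_test')
          have "q * (2 * a - 2 * h + 1) < 0" using 1 q by (intro mult_pos_neg) auto
          then have ex: "q * (2 * a) + (- q * (2 * h - 1) - 1) < -1" by (simp add: algebra_simps)
          then show "summable (\<lambda>k. C * real (Suc k) powr (q * (2 * a) + (- q * (2 * h - 1) - 1)))" by (intro summable_mult summable_Suc_powr)
          fix k
          have "real (Suc k) powr (q * (2 * a)) * \<tau> k \<le> real (Suc k) powr (q * (2 * a)) * (C * real (Suc k) powr (- q * (2 * h - 1) - 1))" by (intro mult_left_mono \<tau>) auto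
          also have "\<dots> = C * real (Suc k) powr (q * (2 * a) + (- q * (2 * h - 1) - 1))" by (simp only: powr_add mult_ac)
          finally show "norm ((real (Suc k) powr (2 * a) / 1) powr q * \<tau> k) \<le> C * real (Suc k) powr (q * (2 * a) + (- q * (2 * h - 1) - 1))"
            using lp.\<tau>_nn[of k] by (simp add: abs_mult powr_powr mult_ac)
        qed
      qed auto
      then show ?thesis by (rule fin) (simp add: 1(2) powr_add[symmetric])
    next
      \<comment> \<open>At equality the weight k powr (2 a) turns the noise into terms of order 1 /
        k. Division by the squared logarithm makes them summable, and a square root later yields the
        factor ln k.\<close>
      case 2
      let ?l = "\<lambda>k. ln (real (k + 2)) powr 2"
      have lpos: "0 < ln (real (k + 2))" for k :: nat by simp
      have "AE \<omega> in M. (\<forall>k\<ge>K. \<omega> \<in> J loc (real L) k) \<longrightarrow> (\<exists>B. \<forall>k\<ge>K. real (Suc k) powr (2 * a) / ?l k * A k \<omega> \<le> B)"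
      proof (rule lp.rate_summable)
        show "0 < ?l k" for k using lpos[of k] by simp
        show "?l k \<le> ?l (Suc k)" for k by (intro powr_mono2) auto
        show "summable (\<lambda>k. real (Suc k) powr (2 * a) / ?l k * \<sigma> k)"
        proof (rule summable_comparison_test')
          show "summable (\<lambda>k. C * (1 / (real (k + 1) * ?l k)))" by (intro summable_mult summable_inverse_mult_ln_powr) auto
          fix k
          have "real (Suc k) powr (2 * a) * \<sigma> k \<le> real (Suc k) powr (2 * a) * (C * real (Suc k) powr (- 2 * h))" by (intro mult_left_mono \<sigma>) auto
          also have "\<dots> = C * real (Suc k) powr (2 * a - 2 * h)" by (simp add: powr_add[symmetric] mult.left_commute)
          also have "2 * a - 2 * h = - 1" using 2 by simp
          finally have "real (Suc k) powr (2 * a) * \<sigma> k / ?l k \<le> C * real (Suc k) powr (- 1) / ?l k" by (intro divide_right_mono) auto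
          then show "norm (real (Suc k) powr (2 * a) / ?l k * \<sigma> k) \<le> C * (1 / (real (k + 1) * ?l k))"
            using lp.\<sigma>_nn[of k] by (simp add: abs_mult powr_minus divide_inverse mult_ac)
        qed
        show "summable (\<lambda>k. (real (Suc k) powr (2 * a) / ?l k) powr q * \<tau> k)"
        proof (rule summable_comparison_test')
          show "summable (\<lambda>k. C * (1 / (real (k + 1) * ln (real (k + 2)) powr (2 * q))))"
            using q by (intro summable_mult summable_inverse_mult_ln_powr) auto
          fix k
          have "real (Suc k) powr (q * (2 * a)) * \<tau> k \<le> real (Suc k) powr (q * (2 * a)) * (C * real (Suc k) powr (- q * (2 * h - 1) - 1))" by (intro mult_left_mono \<tau>) auto
          also have "\<dots> = C * real (Suc k) powr (q * (2 * a) + (- q * (2 * h - 1) - 1))" by (simp only: powr_add mult_ac)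
          also have "q * (2 * a) + (- q * (2 * h - 1) - 1) = - 1"
          proof -
            have "2 * a = 2 * h - 1" using 2 by simp
            then show ?thesis by simp
          qed
          finally have *: "real (Suc k) powr (q * (2 * a)) * \<tau> k / ln (real (k + 2)) powr (2 * q) \<le> C * real (Suc k) powr (- 1) / ln (real (k + 2)) powr (2 * q)"
            by (intro divide_right_mono) auto
          have "(real (Suc k) powr (2 * a) / ?l k) powr q = (real (Suc k) powr (2 * a)) powr q / (?l k) powr q"
            by (rule powr_divide)
          also have "\<dots> = real (Suc k) powr (q * (2 * a)) / ln (real (k + 2)) powr (2 * q)"
            by (simp only: powr_powr mult_ac)
          finally show "norm ((real (Suc k) powr (2 * a) / ?l k) powr q * \<tau> k) \<le> C * (1 / (real (k + 1) * ln (real (k + 2)) powr (2 * q)))"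
            using * lp.\<tau>_nn[of k] by (simp add: abs_mult powr_minus divide_inverse mult_ac del: powr_numeral)
        qed
      qed
      then show ?thesis
      proof (rule fin)
        show "real (Suc k) powr (2 * a) / ?l k * g k = 1" for k using lpos[of k] by (simp add: 2(2) powr_add[symmetric])
      qed
    next
      case 3
      have lpos: "0 < ln (real (k + 2))" for k :: nat by simp
      have "AE \<omega> in M. (\<forall>k\<ge>K. \<omega> \<in> J loc (real L) k) \<longrightarrow> (\<exists>B. \<forall>k\<ge>K. real (Suc k) powr (2 * h - 1) / ln (real (k + 2)) * A k \<omega> \<le> B)"
      proof (rule lp.rate_log[of "2 * h - 1" C])
        show "\<sigma> k \<le> C * real (Suc k) powr (- (2 * h - 1) - 1)" for k using \<sigma>[of k] by simp
        show "\<tau> k \<le> C * real (Suc k) powr (- q * (2 * h - 1) - 1)" for k by (rule \<tau>)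
      qed (use h C0 3 in auto)
      then show ?thesis
      proof (rule fin)
        show "real (Suc k) powr (2 * h - 1) / ln (real (k + 2)) * g k = 1" for k
          using lpos[of k] powr_add[of "real (Suc k)" "2 * h - 1" "- (2 * h - 1)"] by (simp add: 3(2))
      qed
    qed
  qed
  have "AE \<omega> in M. \<forall>T L::nat. (\<forall>k\<ge>T. V (X k \<omega>) \<in> loc) \<and> (\<forall>i<N. \<forall>k. Sw i (Suc k) \<omega> \<le> ennreal (real L))
      \<longrightarrow> (\<exists>B. \<forall>k. V (X k \<omega>) \<le> B * g k)"
    unfolding AE_all_countable using main by blast
  then show ?thesis using moment_bound_AE
  proof eventually_elim
    case (elim \<omega>)
    then show ?case by blast
  qed
qed

lemma edge_const_bound:
  fixes f :: "nat \<Rightarrow> nat \<Rightarrow> real"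
  assumes "\<And>i j. (i, j) \<in> E \<Longrightarrow> 0 \<le> f i j" "(i, j) \<in> E"
  shows "f i j \<le> (\<Sum>(i, j)\<in>E. f i j)"
  using member_le_sum[of "(i, j)" E "\<lambda>(i, j). f i j"] assms finite_E by auto

text \<open>The dissipation is discarded: with coefficients 0 for both forms and rate 0,
  monotonicity of the quantiser mean gives \<open>cs\<close>. Since \<open>Pr\<close> is at most 2
  and gmin exceeds 1/2, the noise is summable whatever the size of the errors, so \<open>loc\<close>
  is \<open>UNIV\<close>.\<close>

lemma bounded_AE:
  assumes q: "1 < q" "q \<le> 2" "2 * q \<le> \<rho>"
  shows "AE \<omega> in M. \<exists>B. \<forall>k. V (X k \<omega>) \<le> B"
proof -
  define f where "f i j = 2 * (alpha1 i j)\<^sup>2 + 2 * ((alpha1 i j)\<^sup>2) powr q" for i j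
  define S where "S = (\<Sum>(i, j)\<in>E. f i j)"
  have f0: "0 \<le> f i j" for i j by (simp add: f_def)
  have fS: "(i, j) \<in> E \<Longrightarrow> f i j \<le> S" for i j unfolding S_def by (rule edge_const_bound) (use f0 in auto)
  have al2: "(al i j k)\<^sup>2 \<le> (alpha1 i j)\<^sup>2 * real (Suc k) powr (- 2 * gmin)" if e: "(i, j) \<in> E" for i j k
  proof -
    have "(al i j k)\<^sup>2 \<le> (alpha1 i j * real (Suc k) powr (- gmin))\<^sup>2"
      using al_le[OF e, of k] al_pos[OF e, of k] by (intro power_mono) auto
    moreover have "(real (Suc k) powr (- gmin))\<^sup>2 = real (Suc k) powr (- 2 * gmin)"
      by (simp add: power2_eq_square powr_add[symmetric])
    ultimately show ?thesis unfolding power_mult_distrib by (simp only:)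
  qed
  have "AE \<omega> in M. (\<exists>T. \<forall>k\<ge>T. V (X k \<omega>) \<in> UNIV) \<longrightarrow> (\<exists>B. \<forall>k. V (X k \<omega>) \<le> B * (\<lambda>k. real (Suc k) powr (- 2 * 0)) k)"
  proof (rule rate[where bb = 0 and kap = 0 and eps = 0 and om = "\<lambda>_. 0" and ?K0.0 = 0 and h = gmin and S = S and q = q and a = 0])
    show "sc_form N n m aw H nu b alpha1 gamma beta1 Hbar \<delta> p 0 0 0 0 (\<lambda>_. 0) 0"
      by unfold_locales (use beta_pos in \<open>auto intro: less_imp_le\<close>)
    show "0 * real (Suc k) powr (0 - 1) * sf (lc k) x x \<le> cons k x" for k x using cons_nonneg by simp
    show "1/2 < gmin" "gmin \<le> 1" by (rule gmin)+
    show "0 \<le> S" unfolding S_def using f0 by (intro sum_nonneg) auto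
    fix k x i j assume e: "(i, j) \<in> E"
    have P: "0 \<le> Pr i j k (zc k x j)" "Pr i j k (zc k x j) \<le> 2" using Pr_nonneg Pr_le by auto
    have "(al i j k)\<^sup>2 * Pr i j k (zc k x j) \<le> ((alpha1 i j)\<^sup>2 * real (Suc k) powr (- 2 * gmin)) * 2"
      using al2[OF e, of k] P by (intro mult_mono) auto
    also have "\<dots> = (2 * (alpha1 i j)\<^sup>2) * real (Suc k) powr (- 2 * gmin)" by simp
    also have "\<dots> \<le> S * real (Suc k) powr (- 2 * gmin)" using fS[OF e] by (intro mult_right_mono) (auto simp: f_def intro: order.trans[rotated])
    finally show "(al i j k)\<^sup>2 * Pr i j k (zc k x j) \<le> S * real (Suc k) powr (- 2 * gmin)" .
    have "((al i j k)\<^sup>2) powr q \<le> ((alpha1 i j)\<^sup>2 * real (Suc k) powr (- 2 * gmin)) powr q"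
      using al2[OF e, of k] q by (intro powr_mono2) auto
    also have "\<dots> = ((alpha1 i j)\<^sup>2) powr q * real (Suc k) powr (q * (- 2 * gmin))" by (simp add: powr_mult powr_powr mult.commute)
    also have "\<dots> \<le> ((alpha1 i j)\<^sup>2) powr q * real (Suc k) powr (- q * (2 * gmin - 1) - 1)"
      using q by (intro mult_left_mono powr_mono) (auto simp: algebra_simps)
    finally have "((al i j k)\<^sup>2) powr q * Pr i j k (zc k x j) \<le> (((alpha1 i j)\<^sup>2) powr q * real (Suc k) powr (- q * (2 * gmin - 1) - 1)) * 2"
      using P by (intro mult_mono) auto
    also have "\<dots> = (2 * ((alpha1 i j)\<^sup>2) powr q) * real (Suc k) powr (- q * (2 * gmin - 1) - 1)" by simp
    also have "\<dots> \<le> S * real (Suc k) powr (- q * (2 * gmin - 1) - 1)"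
      using fS[OF e] by (intro mult_right_mono) (auto simp: f_def intro: order.trans[rotated])
    finally show "((al i j k)\<^sup>2) powr q * Pr i j k (zc k x j) \<le> S * real (Suc k) powr (- q * (2 * gmin - 1) - 1)" .
  qed (use q gmin in auto)
  then show ?thesis by simp
qed


section \<open>The rate constant\<close>

text \<open>Pythagoras for the network mean and the deviations from it, whose sum over the sensors
  vanishes in each coordinate.\<close>

lemma V_split:
  defines "mb \<equiv> \<lambda>x c. (\<Sum>i<N. x i c) / real N"
  shows "V x = real N * (\<Sum>c<n. (mb x c)\<^sup>2) + (\<Sum>i<N. \<Sum>c<n. (x i c - mb x c)\<^sup>2)"
proof -
  have N: "real N \<noteq> 0" using Npos by simp
  have s0: "(\<Sum>i<N. x i c - mb x c) = 0" for c using N by (simp add: sum_subtractf mb_def)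
  have c: "(\<Sum>i<N. (x i c)\<^sup>2) = real N * (mb x c)\<^sup>2 + (\<Sum>i<N. (x i c - mb x c)\<^sup>2)" for c
  proof -
    have "(\<Sum>i<N. (x i c)\<^sup>2) = (\<Sum>i<N. (mb x c)\<^sup>2 + 2 * mb x c * (x i c - mb x c) + (x i c - mb x c)\<^sup>2)"
      by (intro sum.cong refl) (simp add: power2_eq_square algebra_simps)
    also have "\<dots> = real N * (mb x c)\<^sup>2 + 2 * mb x c * (\<Sum>i<N. x i c - mb x c) + (\<Sum>i<N. (x i c - mb x c)\<^sup>2)"
      by (simp only: sum.distrib sum_distrib_left[symmetric] sum_constant card_lessThan)
    finally show ?thesis using s0 by simp
  qed
  have "V x = (\<Sum>c<n. \<Sum>i<N. (x i c)\<^sup>2)" unfolding V_def by (rule sum.swap)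
  also have "\<dots> = real N * (\<Sum>c<n. (mb x c)\<^sup>2) + (\<Sum>c<n. \<Sum>i<N. (x i c - mb x c)\<^sup>2)"
    unfolding c by (simp add: sum.distrib sum_distrib_left)
  also have "(\<Sum>c<n. \<Sum>i<N. (x i c - mb x c)\<^sup>2) = (\<Sum>i<N. \<Sum>c<n. (x i c - mb x c)\<^sup>2)" by (rule sum.swap)
  finally show ?thesis .
qed

text \<open>Excitation acts on the network mean, the consensus form on the deviations. Young's
  inequality with parameter \<open>\<eta>\<close> divides the cross term of the measurement form:
  \<open>c1\<close> is the budget of the mean and \<open>c2\<close> that of the deviations.\<close>

lemma averaged_forms_ge:
  assumes gap: "\<And>x. (\<Sum>i<N. \<Sum>j<N. aw i j * (x i - x j)\<^sup>2) \<ge> 2 * \<mu> * (\<Sum>i<N. (x i - (\<Sum>j<N. x j) / N)\<^sup>2)"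
    and \<eta>: "0 < \<eta>" "\<eta> \<le> 1" and bb: "0 \<le> bb" and kp: "0 \<le> kp" and t: "1 \<le> t"
    and c1: "a' * real N \<le> bb * (1 - \<eta>) * \<delta>" and c2: "a' \<le> kp * \<mu> / real n - bb * (1 / \<eta> - 1) * Hbar\<^sup>2"
  shows "a' * V x \<le> bb * ((\<Sum>s<p. qf (t + s) x x) / real p) + kp * ((\<Sum>l<n. sf l x x) / real n) / 2"
proof -
  define mb where "mb c = (\<Sum>i<N. x i c) / real N" for c
  define ev where "ev i c = x i c - mb c" for i c
  define Es where "Es = (\<Sum>i<N. \<Sum>c<n. (ev i c)\<^sup>2)"
  define Ms where "Ms = (\<Sum>c<n. (mb c)\<^sup>2)"
  have Es0: "0 \<le> Es" unfolding Es_def by (intro sum_nonneg) auto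
  have Ms0: "0 \<le> Ms" unfolding Ms_def by (intro sum_nonneg) auto
  have Vx: "V x = real N * Ms + Es" using V_split[of x] by (simp add: Ms_def Es_def mb_def ev_def)
  have sfl: "2 * \<mu> * (\<Sum>i<N. (ev i l)\<^sup>2) \<le> sf l x x" for l
    using gap[of "\<lambda>i. x i l"] by (simp add: sf_def ev_def mb_def power2_eq_square mult.assoc)
  have sfs: "2 * \<mu> * Es \<le> (\<Sum>l<n. sf l x x)"
  proof -
    have "2 * \<mu> * Es = (\<Sum>l<n. 2 * \<mu> * (\<Sum>i<N. (ev i l)\<^sup>2))"
      unfolding Es_def by (subst sum.swap) (simp add: sum_distrib_left)
    also have "\<dots> \<le> (\<Sum>l<n. sf l x x)" by (intro sum_mono sfl)
    finally show ?thesis .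
  qed
  define Q where "Q s = (\<Sum>i<N. \<Sum>r<m i. (matvec n (H i s) mb r)\<^sup>2)" for s
  have qs: "(1 - \<eta>) * Q s - (1 / \<eta> - 1) * (Hbar\<^sup>2 * Es) \<le> qf s x x" if s: "1 \<le> s" for s
  proof -
    \<comment> \<open>Young's inequality, obtained by expanding the nonnegative quantity
      (\<open>\<eta>\<close> u + v)^2 / \<open>\<eta>\<close>.\<close>
    have pt: "(1 - \<eta>) * u\<^sup>2 - (1 / \<eta> - 1) * v\<^sup>2 \<le> (u + v)\<^sup>2" for u v :: real
    proof -
      have "0 \<le> (\<eta> * u + v)\<^sup>2 / \<eta>" using \<eta> by simp
      also have "\<dots> = \<eta> * u\<^sup>2 + 2 * u * v + v\<^sup>2 / \<eta>" using \<eta> by (simp add: power2_eq_square field_simps)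
      finally show ?thesis by (simp add: power2_eq_square algebra_simps)
    qed
    have mv: "matvec n A (x i) r = matvec n A mb r + matvec n A (ev i) r" for A i r
      by (simp add: matvec_def ev_def sum.distrib[symmetric] algebra_simps)
    have "(\<Sum>i<N. \<Sum>r<m i. (matvec n (H i s) (ev i) r)\<^sup>2) \<le> (\<Sum>i<N. Hbar\<^sup>2 * (\<Sum>c<n. (ev i c)\<^sup>2))"
      by (intro sum_mono Hbound s) auto
    also have "\<dots> = Hbar\<^sup>2 * Es" by (simp add: Es_def sum_distrib_left)
    finally have ee: "(\<Sum>i<N. \<Sum>r<m i. (matvec n (H i s) (ev i) r)\<^sup>2) \<le> Hbar\<^sup>2 * Es" .
    have e0: "0 \<le> 1 / \<eta> - 1" using \<eta> by simp
    have "(1 - \<eta>) * Q s - (1 / \<eta> - 1) * (Hbar\<^sup>2 * Es) \<le> (1 - \<eta>) * Q s - (1 / \<eta> - 1) * (\<Sum>i<N. \<Sum>r<m i. (matvec n (H i s) (ev i) r)\<^sup>2)"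
      by (rule diff_left_mono[OF mult_left_mono[OF ee e0]])
    also have "\<dots> = (\<Sum>i<N. \<Sum>r<m i. (1 - \<eta>) * (matvec n (H i s) mb r)\<^sup>2 - (1 / \<eta> - 1) * (matvec n (H i s) (ev i) r)\<^sup>2)"
      unfolding Q_def by (simp only: sum_subtractf sum_distrib_left)
    also have "\<dots> \<le> qf s x x" unfolding qf_def mv power2_eq_square[symmetric] by (intro sum_mono pt)
    finally show ?thesis .
  qed
  have avg: "(1 - \<eta>) * (\<delta> * Ms) - (1 / \<eta> - 1) * (Hbar\<^sup>2 * Es) \<le> (\<Sum>s<p. qf (t + s) x x) / real p"
  proof -
    have im: "(\<Sum>s\<in>{t..t + p - 1}. f s) = (\<Sum>s<p. f (t + s))" for f :: "nat \<Rightarrow> real"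
    proof -
      have "{t..t + p - 1} = {t..<t + p}" using pe(1) by auto
      then show ?thesis using sum.shift_bounds_nat_ivl[of f 0 t p] by (simp add: lessThan_atLeast0 add.commute)
    qed
    have vs: "(vnorm k y)\<^sup>2 = (\<Sum>c<k. (y c)\<^sup>2)" for k y unfolding vnorm_def by (simp add: sum_nonneg)
    have "\<delta> * Ms \<le> (1 / real p) * (\<Sum>s<p. Q (t + s))"
      using pe(3)[OF t, of mb] unfolding im vs Ms_def Q_def .
    then have "(1 - \<eta>) * (\<delta> * Ms) \<le> (1 - \<eta>) * ((1 / real p) * (\<Sum>s<p. Q (t + s)))" using \<eta> by (intro mult_left_mono) auto
    also have "\<dots> = (\<Sum>s<p. (1 - \<eta>) * Q (t + s)) / real p" unfolding sum_distrib_left[symmetric] by simp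
    finally have 1: "(1 - \<eta>) * (\<delta> * Ms) \<le> (\<Sum>s<p. (1 - \<eta>) * Q (t + s)) / real p" .
    have 2: "(\<Sum>s<p. (1 - \<eta>) * Q (t + s) - (1 / \<eta> - 1) * (Hbar\<^sup>2 * Es)) / real p
      = (\<Sum>s<p. (1 - \<eta>) * Q (t + s)) / real p - (1 / \<eta> - 1) * (Hbar\<^sup>2 * Es)"
      unfolding sum_subtractf diff_divide_distrib using pe(1) by simp
    have "(1 - \<eta>) * (\<delta> * Ms) - (1 / \<eta> - 1) * (Hbar\<^sup>2 * Es) \<le> (\<Sum>s<p. (1 - \<eta>) * Q (t + s) - (1 / \<eta> - 1) * (Hbar\<^sup>2 * Es)) / real p"
      unfolding 2 using 1 by (rule diff_right_mono)
    also have "\<dots> \<le> (\<Sum>s<p. qf (t + s) x x) / real p"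
      using t by (intro divide_right_mono sum_mono qs) auto
    finally show ?thesis .
  qed
  have "a' * V x = (a' * real N) * Ms + a' * Es" unfolding Vx by (simp add: algebra_simps)
  also have "\<dots> \<le> (bb * (1 - \<eta>) * \<delta>) * Ms + (kp * \<mu> / real n - bb * (1 / \<eta> - 1) * Hbar\<^sup>2) * Es"
    by (intro add_mono mult_right_mono c1 c2 Ms0 Es0)
  also have "\<dots> = bb * ((1 - \<eta>) * (\<delta> * Ms) - (1 / \<eta> - 1) * (Hbar\<^sup>2 * Es)) + kp * ((2 * \<mu> * Es) / real n) / 2"
  proof -
    have "(bb * (1 - \<eta>) * \<delta>) * Ms = bb * ((1 - \<eta>) * (\<delta> * Ms))" by (simp only: mult.assoc)
    moreover have "bb * (1 / \<eta> - 1) * Hbar\<^sup>2 * Es = bb * ((1 / \<eta> - 1) * (Hbar\<^sup>2 * Es))" by (simp only: mult.assoc)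
    moreover have "kp * \<mu> / real n * Es = kp * ((2 * \<mu> * Es) / real n) / 2" by simp
    ultimately show ?thesis unfolding left_diff_distrib[of "kp * \<mu> / real n"] right_diff_distrib[of bb] by linarith
  qed
  also have "\<dots> \<le> bb * ((\<Sum>s<p. qf (t + s) x x) / real p) + kp * ((\<Sum>l<n. sf l x x) / real n) / 2"
  proof (rule add_mono)
    show "bb * ((1 - \<eta>) * (\<delta> * Ms) - (1 / \<eta> - 1) * (Hbar\<^sup>2 * Es)) \<le> bb * ((\<Sum>s<p. qf (t + s) x x) / real p)"
      by (rule mult_left_mono[OF avg bb])
    have "2 * \<mu> * Es / real n \<le> (\<Sum>l<n. sf l x x) / real n" by (rule divide_right_mono[OF sfs]) simp
    from mult_left_mono[OF this kp] show "kp * (2 * \<mu> * Es / real n) / 2 \<le> kp * ((\<Sum>l<n. sf l x x) / real n) / 2" by (rule divide_right_mono) simp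
  qed
  finally show ?thesis .
qed

text \<open>A single unit vector tested in the excitation condition and against the bound on
  \<open>H\<close>. The inequality supplies the slack in the deviation budget of the critical
  case.\<close>

lemma delta_le_Hbar: "\<delta> \<le> real N * Hbar\<^sup>2"
proof -
  let ?u = "\<lambda>c. if c = 0 then 1 else 0 :: real"
  have u1: "(\<Sum>c<n. (?u c)\<^sup>2) = 1"
  proof -
    have "(\<Sum>c<n. (?u c)\<^sup>2) = (\<Sum>c<n. ?u c)" by (intro sum.cong) auto
    then show ?thesis using npos by simp
  qed
  have vs: "(vnorm k y)\<^sup>2 = (\<Sum>c<k. (y c)\<^sup>2)" for k y unfolding vnorm_def by (simp add: sum_nonneg)
  have "\<delta> * (vnorm n ?u)\<^sup>2 \<le> (1 / real p) * (\<Sum>t\<in>{1..1 + p - 1}. \<Sum>i<N. (vnorm (m i) (matvec n (H i t) ?u))\<^sup>2)"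
    by (rule pe(3)) simp
  also have "\<dots> \<le> (1 / real p) * (\<Sum>t\<in>{1..1 + p - 1}. \<Sum>i<N. Hbar\<^sup>2)"
  proof (intro mult_left_mono sum_mono)
    fix t i assume "t \<in> {1..1 + p - 1}" "i \<in> {..<N}"
    then show "(vnorm (m i) (matvec n (H i t) ?u))\<^sup>2 \<le> Hbar\<^sup>2" unfolding vs using Hbound[of i t ?u] u1 by simp
  qed simp
  also have "\<dots> = real N * Hbar\<^sup>2" using pe(1) by simp
  finally show ?thesis unfolding vs u1 by simp
qed

text \<open>A coordinate of \<open>\<theta>\<close> is bounded by the 1-norm whichever coordinate is
  being transmitted; this is how \<open>l1norm\<close> enters the rate constant.\<close>

lemma zc_bound: assumes "V x \<le> R" "j < N" shows "\<bar>zc k x j\<bar> \<le> l1norm n \<theta> + sqrt R"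
proof -
  have "\<bar>\<theta> (lc k)\<bar> \<le> l1norm n \<theta>" unfolding l1norm_def using lc_less by (intro member_le_sum) auto
  moreover have "\<bar>x j (lc k)\<bar> \<le> sqrt R"
    using sq_le_V[OF assms(2) lc_less, of x k] assms(1) by (intro real_le_rsqrt) (simp add: order.trans)
  ultimately show ?thesis unfolding zc_def by linarith
qed

text \<open>Step size times lower slope is the consensus gain of an edge, of order k powr -(nu +
  gamma). For a critical edge it is of order 1 / k, like the measurement gain; for every other edge
  it decays more slowly.\<close>

lemma al_exp:
  assumes e: "(i, j) \<in> E"
  shows "al i j k * (exp (- (Z + thr i j k) / b i j) / b i j) = alpha1 i j * exp (- Z / b i j) / b i j * real (Suc k) powr (- (nu i j + gamma i j))"
proof -
  have b: "0 < b i j" using b_sym[OF e] by simp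
  have eq: "- (Z + thr i j k) / b i j = - Z / b i j + - nu i j * ln (real (Suc k))"
    using b by (simp add: thr_def field_simps)
  have "exp (- (Z + thr i j k) / b i j) = exp (- Z / b i j) * real (Suc k) powr (- nu i j)"
    unfolding eq exp_add powr_def by simp
  moreover have "al i j k = alpha1 i j * real (Suc k) powr (- gamma i j)" by (simp add: al_def powr_minus divide_inverse)
  moreover have "real (Suc k) powr (- (nu i j + gamma i j)) = real (Suc k) powr (- nu i j) * real (Suc k) powr (- gamma i j)"
    by (simp add: powr_add[symmetric])
  ultimately show ?thesis by simp
qed

lemma cons_ge:
  assumes z: "\<And>j. j < N \<Longrightarrow> \<bar>zc k x j\<bar> \<le> Z"
    and c: "\<And>i j. (i, j) \<in> E \<Longrightarrow> c \<le> al i j k * (exp (- (Z + thr i j k) / b i j) / b i j)"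
  shows "c * sf (lc k) x x \<le> cons k x"
proof -
  have "c * sf (lc k) x x = (\<Sum>i<N. \<Sum>j<N. c * (aw i j * (x i (lc k) - x j (lc k)) * (x i (lc k) - x j (lc k))))"
    unfolding sf_def by (simp add: sum_distrib_left)
  also have "\<dots> \<le> cons k x" unfolding cons_def
  proof (intro sum_mono)
    fix i j assume ij: "i \<in> {..<N}" "j \<in> {..<N}"
    show "c * (aw i j * (x i (lc k) - x j (lc k)) * (x i (lc k) - x j (lc k)))
      \<le> aw i j * al i j k * (zc k x i - zc k x j) * (G i j k (zc k x i) - G i j k (zc k x j))"
    proof (cases "aw i j = 0")
      case False
      then have e: "(i, j) \<in> E" using edgeI ij by auto
      define D where "D = zc k x i - zc k x j"
      have D: "x i (lc k) - x j (lc k) = D" by (simp add: D_def zc_def)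
      have sm: "exp (- (Z + thr i j k) / b i j) / b i j * D\<^sup>2 \<le> D * (G i j k (zc k x i) - G i j k (zc k x j))"
        unfolding D_def G_def using b_sym[OF e] thr_nonneg[OF e] ij by (intro trG_strongly_monotone z) auto
      have "c * D\<^sup>2 \<le> al i j k * (exp (- (Z + thr i j k) / b i j) / b i j) * D\<^sup>2" using c[OF e] by (intro mult_right_mono) auto
      also have "\<dots> = al i j k * (exp (- (Z + thr i j k) / b i j) / b i j * D\<^sup>2)" by (simp only: mult.assoc)
      also have "\<dots> \<le> al i j k * (D * (G i j k (zc k x i) - G i j k (zc k x j)))"
        using sm al_pos[OF e, of k] by (intro mult_left_mono) auto
      finally have "aw i j * (c * D\<^sup>2) \<le> aw i j * (al i j k * (D * (G i j k (zc k x i) - G i j k (zc k x j))))"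
        using edgeD[OF e] by (intro mult_left_mono) auto
      then show ?thesis unfolding D D_def[symmetric] by (simp add: power2_eq_square mult_ac)
    qed simp
  qed
  finally show ?thesis .
qed

text \<open>On bounded errors the step size contributes the exponent gamma twice and
  \<open>Pr_exp\<close> the exponent nu; both rates then follow from 2 gamma + nu being at least 2
  h.\<close>

lemma quantisation_noise_bounds:
  assumes q: "1 < q" "q \<le> 2" and h: "\<And>i j. (i, j) \<in> E \<Longrightarrow> h \<le> nu i j / 2 + gamma i j"
  shows "\<exists>S\<ge>0. \<forall>k x i j. V x \<le> R \<longrightarrow> (i, j) \<in> E \<longrightarrow>
      (al i j k)\<^sup>2 * Pr i j k (zc k x j) \<le> S * real (Suc k) powr (- 2 * h) \<and>
      ((al i j k)\<^sup>2) powr q * Pr i j k (zc k x j) \<le> S * real (Suc k) powr (- q * (2 * h - 1) - 1)"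
proof -
  define Z where "Z = l1norm n \<theta> + sqrt R"
  define f where "f i j = ((alpha1 i j)\<^sup>2 + ((alpha1 i j)\<^sup>2) powr q) * exp (Z / b i j)" for i j
  define S where "S = (\<Sum>(i, j)\<in>E. f i j)"
  have f0: "0 \<le> f i j" for i j by (simp add: f_def)
  have fS: "(i, j) \<in> E \<Longrightarrow> f i j \<le> S" for i j unfolding S_def by (rule edge_const_bound) (use f0 in auto)
  have S0: "0 \<le> S" unfolding S_def using f0 by (intro sum_nonneg) auto
  have main: "(al i j k)\<^sup>2 * Pr i j k (zc k x j) \<le> S * real (Suc k) powr (- 2 * h) \<and>
      ((al i j k)\<^sup>2) powr q * Pr i j k (zc k x j) \<le> S * real (Suc k) powr (- q * (2 * h - 1) - 1)"
    if V: "V x \<le> R" and e: "(i, j) \<in> E" for k x i j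
  proof
    let ?K = "real (Suc k)"
    have j: "j < N" using edgeD[OF e] by simp
    have b: "0 < b i j" using b_sym[OF e] by simp
    have P: "Pr i j k (zc k x j) \<le> exp (Z / b i j) * ?K powr (- nu i j)"
    proof -
      have "exp (\<bar>zc k x j\<bar> / b i j) \<le> exp (Z / b i j)"
        using zc_bound[OF V j, of k] b unfolding Z_def by (simp add: divide_right_mono)
      then have "exp (\<bar>zc k x j\<bar> / b i j) * ?K powr (- nu i j) \<le> exp (Z / b i j) * ?K powr (- nu i j)" by (intro mult_right_mono) auto
      then show ?thesis using Pr_exp[OF e, of k "zc k x j"] by linarith
    qed
    have "al i j k = alpha1 i j * ?K powr (- gamma i j)" by (simp add: al_def powr_minus divide_inverse)
    then have a2: "(al i j k)\<^sup>2 = (alpha1 i j)\<^sup>2 * ?K powr (- 2 * gamma i j)"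
      by (simp add: power2_eq_square powr_add[symmetric] mult_ac)
    have "(al i j k)\<^sup>2 * Pr i j k (zc k x j) \<le> ((alpha1 i j)\<^sup>2 * ?K powr (- 2 * gamma i j)) * (exp (Z / b i j) * ?K powr (- nu i j))"
      unfolding a2 by (intro mult_left_mono P) auto
    also have "\<dots> = ((alpha1 i j)\<^sup>2 * exp (Z / b i j)) * (?K powr (- 2 * gamma i j) * ?K powr (- nu i j))" by (simp only: mult_ac)
    also have "?K powr (- 2 * gamma i j) * ?K powr (- nu i j) = ?K powr (- 2 * gamma i j - nu i j)" by (simp add: powr_add[symmetric])
    also have "((alpha1 i j)\<^sup>2 * exp (Z / b i j)) * ?K powr (- 2 * gamma i j - nu i j) \<le> S * ?K powr (- 2 * h)"
    proof (intro mult_mono powr_mono)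
      have "(alpha1 i j)\<^sup>2 * exp (Z / b i j) \<le> f i j" unfolding f_def by (intro mult_right_mono) auto
      then show "(alpha1 i j)\<^sup>2 * exp (Z / b i j) \<le> S" using fS[OF e] by linarith
      show "- 2 * gamma i j - nu i j \<le> - 2 * h" using h[OF e] by simp
    qed (use S0 in auto)
    finally show "(al i j k)\<^sup>2 * Pr i j k (zc k x j) \<le> S * ?K powr (- 2 * h)" .
    have aq: "((al i j k)\<^sup>2) powr q = ((alpha1 i j)\<^sup>2) powr q * ?K powr (q * (- 2 * gamma i j))"
      unfolding a2 by (simp add: powr_mult powr_powr mult.commute)
    have "((al i j k)\<^sup>2) powr q * Pr i j k (zc k x j) \<le> (((alpha1 i j)\<^sup>2) powr q * ?K powr (q * (- 2 * gamma i j))) * (exp (Z / b i j) * ?K powr (- nu i j))"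
      unfolding aq by (intro mult_left_mono P) auto
    also have "\<dots> = (((alpha1 i j)\<^sup>2) powr q * exp (Z / b i j)) * (?K powr (q * (- 2 * gamma i j)) * ?K powr (- nu i j))" by (simp only: mult_ac)
    also have "?K powr (q * (- 2 * gamma i j)) * ?K powr (- nu i j) = ?K powr (q * (- 2 * gamma i j) - nu i j)" by (simp add: powr_add[symmetric])
    also have "(((alpha1 i j)\<^sup>2) powr q * exp (Z / b i j)) * ?K powr (q * (- 2 * gamma i j) - nu i j) \<le> S * ?K powr (- q * (2 * h - 1) - 1)"
    proof (intro mult_mono powr_mono)
      have "((alpha1 i j)\<^sup>2) powr q * exp (Z / b i j) \<le> f i j" unfolding f_def by (intro mult_right_mono) auto
      then show "((alpha1 i j)\<^sup>2) powr q * exp (Z / b i j) \<le> S" using fS[OF e] by linarith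
      \<comment> \<open>The exponent 2 q gamma + nu equals q (2 gamma + nu) - (q - 1) nu, which is
        at least 2 q h - (q - 1) because nu is at most 1.\<close>
      have nu1: "nu i j \<le> 1" using gamma_cond[OF e] by auto
      have "q * (2 * h) \<le> q * (nu i j + 2 * gamma i j)" using h[OF e] q by (intro mult_left_mono) auto
      moreover have "0 \<le> (q - 1) * (1 - nu i j)" using q nu1 by simp
      ultimately show "q * (- 2 * gamma i j) - nu i j \<le> - q * (2 * h - 1) - 1" by (simp add: algebra_simps)
    qed (use S0 in auto)
    finally show "((al i j k)\<^sup>2) powr q * Pr i j k (zc k x j) \<le> S * ?K powr (- q * (2 * h - 1) - 1)" .
  qed
  show ?thesis using S0 main by blast
qed

end

lemma eventually_powr_le:
  fixes c e :: real
  assumes "0 < c" "e < f"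
  shows "eventually (\<lambda>k. K * real (Suc k) powr e \<le> c * real (Suc k) powr f) sequentially"
proof -
  have "(\<lambda>k. K * real (Suc k) powr (e - f)) \<longlonglongrightarrow> K * 0"
    by (rule tendsto_mult[OF tendsto_const tendsto_Suc_powr_0]) (use assms in simp)
  then have "eventually (\<lambda>k. K * real (Suc k) powr (e - f) < c) sequentially"
    by (rule order_tendstoD(2)) (use assms in simp)
  then show ?thesis
  proof (eventually_elim)
    case (elim k)
    have "K * real (Suc k) powr e = K * real (Suc k) powr (e - f) * real (Suc k) powr f"
      by (simp add: powr_add[symmetric])
    also have "\<dots> \<le> c * real (Suc k) powr f" using elim by (intro mult_right_mono) auto
    finally show ?case .
  qed
qed

section \<open>Choice of the constants with and without critical edges\<close>

context sc_network
begin

lemma gap_and_edges: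
  obtains \<mu> where "\<mu> > 0" "0 \<le> lambda2 (laplacian N aw)" "lambda2 (laplacian N aw) \<le> \<mu>"
    "\<And>x. (\<Sum>i<N. \<Sum>j<N. aw i j * (x i - x j)\<^sup>2) \<ge> 2 * \<mu> * (\<Sum>i<N. (x i - (\<Sum>j<N. x j) / N)\<^sup>2)"
    "E \<noteq> {}"
proof (rule laplacian_spectral_gap[OF Npos aw_sym aw_nonneg conn])
  fix \<mu> assume \<mu>: "\<mu> > 0" "0 \<le> lambda2 (laplacian N aw)" "lambda2 (laplacian N aw) \<le> \<mu>"
    "\<And>x. (\<Sum>i<N. \<Sum>j<N. aw i j * (x i - x j)\<^sup>2) \<ge> 2 * \<mu> * (\<Sum>i<N. (x i - (\<Sum>j<N. x j) / N)\<^sup>2)"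
  have "E \<noteq> {}"
  proof
    assume "E = {}"
    then have "aw i j = 0" if "i < N" "j < N" for i j using edgeI[OF that] by blast
    then have z: "(\<Sum>i<N. \<Sum>j<N. aw i j * (x i - x j)\<^sup>2) = 0" for x by simp
    \<comment> \<open>Without edges the Dirichlet form of the indicator of sensor 0 vanishes,
      although this vector is not constant; that contradicts the positive gap.\<close>
    let ?x = "\<lambda>i::nat. if i = 0 then 1 else 0 :: real"
    have s: "(\<Sum>j<N. ?x j) = 1" using Npos by simp
    have "0 < (1 - 1 / real N)\<^sup>2" using Npos by simp
    also have "(1 - 1 / real N)\<^sup>2 = (?x 0 - (\<Sum>j<N. ?x j) / N)\<^sup>2" unfolding s by simp
    also have "\<dots> \<le> (\<Sum>i<N. (?x i - (\<Sum>j<N. ?x j) / N)\<^sup>2)"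
      by (rule member_le_sum[of 0 "{..<N}" "\<lambda>i. (?x i - (\<Sum>j<N. ?x j) / N)\<^sup>2"]) (use Npos in auto)
    finally have "0 < 2 * \<mu> * (\<Sum>i<N. (?x i - (\<Sum>j<N. ?x j) / N)\<^sup>2)" using \<mu>(1) by simp
    then show False using \<mu>(4)[of ?x] z[of ?x] by linarith
  qed
  then show ?thesis using \<mu> that by blast
qed

definition "bl = Min (beta1 ` {..<N})"

lemma bl: "0 < bl" "i < N \<Longrightarrow> bl \<le> beta1 i"
proof -
  have ne: "beta1 ` {..<N} \<noteq> {}" using Npos by (auto simp: lessThan_empty_iff)
  show "0 < bl" unfolding bl_def using ne beta_pos by (subst Min_gr_iff) auto
  show "i < N \<Longrightarrow> bl \<le> beta1 i" unfolding bl_def by (intro Min_le) auto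
qed

definition "hh = Min ((\<lambda>(i, j). nu i j / 2 + gamma i j) ` E)"

lemma hh: "(i, j) \<in> E \<Longrightarrow> hh \<le> nu i j / 2 + gamma i j" "E \<noteq> {} \<Longrightarrow> 1/2 < hh" "E \<noteq> {} \<Longrightarrow> hh \<le> 1"
proof -
  have fin: "finite ((\<lambda>(i, j). nu i j / 2 + gamma i j) ` E)" using finite_E by simp
  show le: "(i, j) \<in> E \<Longrightarrow> hh \<le> nu i j / 2 + gamma i j" for i j unfolding hh_def by (intro Min_le[OF fin]) (auto intro: rev_image_eqI)
  show "1/2 < hh" if "E \<noteq> {}"
  proof -
    have "\<forall>y\<in>(\<lambda>(i, j). nu i j / 2 + gamma i j) ` E. 1/2 < y"
    proof clarify
      fix i j assume e: "(i, j) \<in> E"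
      show "1/2 < nu i j / 2 + gamma i j" using gamma_cond[OF e] nu_sym[OF e] by linarith
    qed
    then show ?thesis unfolding hh_def using that fin by (subst Min_gr_iff) auto
  qed
  show "hh \<le> 1" if ne: "E \<noteq> {}"
  proof -
    obtain i j where e: "(i, j) \<in> E" using ne by auto
    have "nu i j / 2 + gamma i j \<le> 1" using gamma_cond[OF e] nu_sym[OF e] by linarith
    then show ?thesis using le[OF e] by linarith
  qed
qed

text \<open>\<open>averaged_forms_ge\<close> with a Young parameter that may depend on time; letting
  it tend to 0 recovers the whole excitation constant when no edge is critical.\<close>

lemma sc_form_intro:
  assumes "0 < \<mu>" and gap: "\<And>x. (\<Sum>i<N. \<Sum>j<N. aw i j * (x i - x j)\<^sup>2) \<ge> 2 * \<mu> * (\<Sum>i<N. (x i - (\<Sum>j<N. x j) / N)\<^sup>2)"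
    and kap: "0 \<le> kap" and eps: "0 \<le> eps" "eps \<le> 1/4" and a: "0 \<le> a" and om: "\<And>k. 0 \<le> om k" "summable (\<lambda>k. om k / real (Suc k))"
    and \<eta>: "\<And>k. K0 \<le> k \<Longrightarrow> 0 < \<eta> k \<and> \<eta> k \<le> 1 \<and> (a - om k) * real N \<le> bl * (1 - \<eta> k) * \<delta>
       \<and> a - om k \<le> kap * real (Suc k) powr eps * \<mu> / real n - bl * (1 / \<eta> k - 1) * Hbar\<^sup>2"
  shows "sc_form N n m aw H nu b alpha1 gamma beta1 Hbar \<delta> p bl kap eps a om K0"
proof unfold_locales
  show "0 \<le> bl" using bl(1) by simp
  show "bl \<le> beta1 i" if "i < N" for i by (rule bl(2)[OF that])
  fix k x assume k: "K0 \<le> k"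
  show "(a - om k) * V x \<le> bl * ((\<Sum>s<p. qf (Suc (Suc k) + s) x x) / real p)
        + kap * real (Suc k) powr eps * ((\<Sum>l<n. sf l x x) / real n) / 2"
    using \<eta>[OF k] kap bl(1) by (intro averaged_forms_ge[OF gap, where \<eta> = "\<eta> k"]) auto
qed (use assms in auto)

text \<open>Coefficient of the gain in \<open>al_exp\<close>. At Z equal to
  \<open>l1norm n \<theta>\<close> its minimum over the critical edges is \<open>mprime\<close> of
  the theorem.\<close>

definition "c1 Z i j = alpha1 i j * exp (- Z / b i j) / b i j"

lemma c1_pos: "(i, j) \<in> E \<Longrightarrow> 0 < c1 Z i j" unfolding c1_def using alpha_sym[of i j] b_sym[of i j] by simp

lemma consensus_form_le:
  assumes edge: "\<And>i j. (i, j) \<in> E \<Longrightarrow> kap * real (Suc k) powr (eps - 1) \<le> c1 (l1norm n \<theta> + sqrt R) i j * real (Suc k) powr (- (nu i j + gamma i j))"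
    and V: "V x \<in> {..R}"
  shows "kap * real (Suc k) powr (eps - 1) * sf (lc k) x x \<le> cons k x"
proof (rule cons_ge)
  show "\<bar>zc k x j\<bar> \<le> l1norm n \<theta> + sqrt R" if "j < N" for j by (rule zc_bound) (use V that in auto)
  show "kap * real (Suc k) powr (eps - 1) \<le> al i j k * (exp (- (l1norm n \<theta> + sqrt R + thr i j k) / b i j) / b i j)" if "(i, j) \<in> E" for i j
    using edge[OF that] unfolding al_exp[OF that] c1_def .
qed

lemma edge_const_lower_bound:
  assumes "E \<noteq> {}"
  obtains kap where "0 < kap" "\<And>i j. (i, j) \<in> E \<Longrightarrow> kap \<le> c1 Z i j"
proof -
  let ?S = "(\<lambda>(i, j). c1 Z i j) ` E"
  have fin: "finite ?S" using finite_E by simp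
  have "0 < Min ?S" using assms fin c1_pos by (subst Min_gr_iff) auto
  moreover have "Min ?S \<le> c1 Z i j" if "(i, j) \<in> E" for i j using that by (intro Min_le[OF fin]) (auto intro: rev_image_eqI)
  ultimately show ?thesis by (rule that)
qed

text \<open>On bounded errors the quantiser slopes are bounded below, so some positive rate is
  available, and any positive rate forces convergence. The bound from \<open>bounded_AE\<close> is
  random, hence the passage through all natural \<open>R\<close>.\<close>

lemma V_tendsto_0_AE:
  assumes q: "1 < q" "q \<le> 2" "2 * q \<le> \<rho>"
  shows "AE \<omega> in M. (\<lambda>k. V (X k \<omega>)) \<longlonglongrightarrow> 0"
proof -
  obtain \<mu> where \<mu>: "\<mu> > 0" and gap: "\<And>x. (\<Sum>i<N. \<Sum>j<N. aw i j * (x i - x j)\<^sup>2) \<ge> 2 * \<mu> * (\<Sum>i<N. (x i - (\<Sum>j<N. x j) / N)\<^sup>2)"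
    and ne: "E \<noteq> {}" by (rule gap_and_edges) blast
  have R: "AE \<omega> in M. (\<exists>T. \<forall>k\<ge>T. V (X k \<omega>) \<in> {..real R}) \<longrightarrow> (\<lambda>k. V (X k \<omega>)) \<longlonglongrightarrow> 0" for R :: nat
  proof -
    obtain kap where kap: "0 < kap" "\<And>i j. (i, j) \<in> E \<Longrightarrow> kap \<le> c1 (l1norm n \<theta> + sqrt (real R)) i j" by (rule edge_const_lower_bound[OF ne]) blast
    \<comment> \<open>The value of 1 / \<open>\<eta>\<close> - 1 for which the Young loss takes
      exactly half of the consensus budget.\<close>
    define x0 where "x0 = kap * \<mu> / (2 * real n * bl * Hbar\<^sup>2)"
    have x0: "0 < x0" using kap \<mu> npos bl Hbar by (simp add: x0_def)
    define \<eta> where "\<eta> = 1 / (1 + x0)"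
    have \<eta>: "0 < \<eta>" "\<eta> < 1" using x0 by (auto simp: \<eta>_def)
    have e1: "1 / \<eta> - 1 = x0" by (simp add: \<eta>_def)
    have e2: "bl * x0 * Hbar\<^sup>2 = kap * \<mu> / (2 * real n)" using bl Hbar npos by (simp add: x0_def field_simps)
    \<comment> \<open>The last entry keeps 2 hh - 2 a above 1, so that the purely polynomial
      alternative of \<open>rate\<close> applies.\<close>
    define a where "a = min (min (bl * (1 - \<eta>) * \<delta> / real N) (kap * \<mu> / (2 * real n))) ((2 * hh - 1) / 4)"
    have a0: "0 < a" using bl \<eta> pe(2) Npos kap \<mu> npos hh(2)[OF ne] by (simp add: a_def)
    have aN: "a * real N \<le> bl * (1 - \<eta>) * \<delta>"
    proof -
      have "a \<le> bl * (1 - \<eta>) * \<delta> / real N" by (simp add: a_def)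
      then show ?thesis using Npos by (simp add: field_simps)
    qed
    have ak: "a \<le> kap * \<mu> / (2 * real n)" unfolding a_def by (rule min.coboundedI1[OF min.cobounded2])
    have ah: "a \<le> (2 * hh - 1) / 4" unfolding a_def by (rule min.cobounded2)
    have half: "kap * \<mu> / real n - kap * \<mu> / (2 * real n) = kap * \<mu> / (2 * real n)" by (simp add: field_simps)
    have form: "sc_form N n m aw H nu b alpha1 gamma beta1 Hbar \<delta> p bl kap 0 a (\<lambda>_. 0) 0"
    proof (rule sc_form_intro[OF \<mu> gap, where \<eta> = "\<lambda>_. \<eta>"])
      show "0 < \<eta> \<and> \<eta> \<le> 1 \<and> (a - 0) * real N \<le> bl * (1 - \<eta>) * \<delta> \<and>
          a - 0 \<le> kap * real (Suc k) powr 0 * \<mu> / real n - bl * (1 / \<eta> - 1) * Hbar\<^sup>2" for k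
      proof -
        have k0: "kap * real (Suc k) powr 0 * \<mu> / real n = kap * \<mu> / real n" by simp
        have "a - 0 \<le> kap * real (Suc k) powr 0 * \<mu> / real n - bl * (1 / \<eta> - 1) * Hbar\<^sup>2"
          unfolding e1 e2 k0 using ak half by linarith
        then show ?thesis using \<eta> aN by (intro conjI) simp_all
      qed
    qed (use kap a0 in auto)
    obtain S where S: "0 \<le> S" "\<And>k x i j. V x \<le> real R \<Longrightarrow> (i, j) \<in> E \<Longrightarrow> (al i j k)\<^sup>2 * Pr i j k (zc k x j) \<le> S * real (Suc k) powr (- 2 * hh)"
      "\<And>k x i j. V x \<le> real R \<Longrightarrow> (i, j) \<in> E \<Longrightarrow> ((al i j k)\<^sup>2) powr q * Pr i j k (zc k x j) \<le> S * real (Suc k) powr (- q * (2 * hh - 1) - 1)"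
      using quantisation_noise_bounds[OF q(1,2) hh(1), of "real R"] by blast
    have "AE \<omega> in M. (\<exists>T. \<forall>k\<ge>T. V (X k \<omega>) \<in> {..real R}) \<longrightarrow> (\<exists>B. \<forall>k. V (X k \<omega>) \<le> B * (\<lambda>k. real (Suc k) powr (- 2 * a)) k)"
    proof (rule rate[OF form q])
      show "kap * real (Suc k) powr (0 - 1) * sf (lc k) x x \<le> cons k x" if "V x \<in> {..real R}" for k x
      proof (rule consensus_form_le[OF _ that])
        fix i j assume e: "(i, j) \<in> E"
        show "kap * real (Suc k) powr (0 - 1) \<le> c1 (l1norm n \<theta> + sqrt (real R)) i j * real (Suc k) powr (- (nu i j + gamma i j))"
          using kap(2)[OF e] c1_pos[OF e] gamma_cond[OF e] by (intro mult_mono powr_mono) (auto intro: less_imp_le)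
      qed
      show "1/2 < hh" "hh \<le> 1" using hh(2,3)[OF ne] by auto
      show "0 \<le> S" by (rule S)
      have "4 * a \<le> 2 * hh - 1" using ah by simp
      then have "2 * hh - 2 * a > 1" using hh(2)[OF ne] by simp
      then show "(2 * hh - 2 * a > 1 \<and> (\<lambda>k. real (Suc k) powr (- 2 * a)) = (\<lambda>k. real (Suc k) powr (- 2 * a)))
        \<or> (2 * hh - 2 * a = 1 \<and> (\<lambda>k. real (Suc k) powr (- 2 * a)) = (\<lambda>k. ln (real (k + 2)) powr 2 * real (Suc k) powr (- 2 * a)))
        \<or> (2 * hh - 2 * a < 1 \<and> (\<lambda>k. real (Suc k) powr (- 2 * a)) = (\<lambda>k. ln (real (k + 2)) * real (Suc k) powr (- (2 * hh - 1))))"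
        by (intro disjI1 conjI refl)
      show "(al i j k)\<^sup>2 * Pr i j k (zc k x j) \<le> S * real (Suc k) powr (- 2 * hh)" if "V x \<in> {..real R}" "(i, j) \<in> E" for k x i j
        by (rule S(2)) (use that in auto)
      show "((al i j k)\<^sup>2) powr q * Pr i j k (zc k x j) \<le> S * real (Suc k) powr (- q * (2 * hh - 1) - 1)" if "V x \<in> {..real R}" "(i, j) \<in> E" for k x i j
        by (rule S(3)) (use that in auto)
    qed simp
    then show ?thesis
    proof (eventually_elim, intro impI)
      fix \<omega> assume "(\<exists>T. \<forall>k\<ge>T. V (X k \<omega>) \<in> {..real R}) \<longrightarrow> (\<exists>B. \<forall>k. V (X k \<omega>) \<le> B * real (Suc k) powr (- 2 * a))"
        "\<exists>T. \<forall>k\<ge>T. V (X k \<omega>) \<in> {..real R}"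
      then obtain B where B: "\<And>k. V (X k \<omega>) \<le> B * real (Suc k) powr (- 2 * a)" by blast
      have "(\<lambda>k. B * real (Suc k) powr (- 2 * a)) \<longlonglongrightarrow> B * 0"
        by (rule tendsto_mult[OF tendsto_const tendsto_Suc_powr_0]) (use a0 in simp)
      then have lim: "(\<lambda>k. B * real (Suc k) powr (- 2 * a)) \<longlonglongrightarrow> 0" by simp
      show "(\<lambda>k. V (X k \<omega>)) \<longlonglongrightarrow> 0"
        by (rule tendsto_sandwich[OF always_eventually always_eventually tendsto_const lim]) (use B V_nonneg in blast)+
    qed
  qed
  have "AE \<omega> in M. \<forall>R::nat. (\<exists>T. \<forall>k\<ge>T. V (X k \<omega>) \<in> {..real R}) \<longrightarrow> (\<lambda>k. V (X k \<omega>)) \<longlonglongrightarrow> 0"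
    unfolding AE_all_countable using R by blast
  then show ?thesis using bounded_AE[OF q]
  proof eventually_elim
    case (elim \<omega>)
    obtain B where B: "\<And>k. V (X k \<omega>) \<le> B" using elim(2) by blast
    obtain R :: nat where R: "B \<le> real R" using real_arch_simple by blast
    have "V (X k \<omega>) \<in> {..real R}" for k using order.trans[OF B[of k] R] by simp
    then have "\<exists>T. \<forall>k\<ge>T. V (X k \<omega>) \<in> {..real R}" by blast
    then show ?case using elim(1) by (elim allE[of _ R] impE)
  qed
qed

text \<open>Since the errors tend to zero, almost every path ends up in {..R} for any R > 0. The
  gains are therefore required only for values of size at most
  \<open>l1norm n \<theta> + sqrt R\<close>, with R as small as desired.\<close>

lemma weighted_bound_AE:
  assumes q: "1 < q" "q \<le> 2" "2 * q \<le> \<rho>" and ne: "E \<noteq> {}" and R: "0 < R"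
    and form: "sc_form N n m aw H nu b alpha1 gamma beta1 Hbar \<delta> p bl kap eps a om K0"
    and edge: "\<And>k i j. K0 \<le> k \<Longrightarrow> (i, j) \<in> E \<Longrightarrow>
      kap * real (Suc k) powr (eps - 1) \<le> c1 (l1norm n \<theta> + sqrt R) i j * real (Suc k) powr (- (nu i j + gamma i j))"
    and g: "(2 * hh - 2 * a > 1 \<and> g = (\<lambda>k. real (Suc k) powr (- 2 * a)))
      \<or> (2 * hh - 2 * a = 1 \<and> g = (\<lambda>k. ln (real (k + 2)) powr 2 * real (Suc k) powr (- 2 * a)))
      \<or> (2 * hh - 2 * a < 1 \<and> g = (\<lambda>k. ln (real (k + 2)) * real (Suc k) powr (- (2 * hh - 1))))"
  shows "AE \<omega> in M. \<exists>B. \<forall>k. V (X k \<omega>) \<le> B * g k"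
proof -
  obtain S where S: "0 \<le> S" "\<And>k x i j. V x \<le> R \<Longrightarrow> (i, j) \<in> E \<Longrightarrow> (al i j k)\<^sup>2 * Pr i j k (zc k x j) \<le> S * real (Suc k) powr (- 2 * hh)"
    "\<And>k x i j. V x \<le> R \<Longrightarrow> (i, j) \<in> E \<Longrightarrow> ((al i j k)\<^sup>2) powr q * Pr i j k (zc k x j) \<le> S * real (Suc k) powr (- q * (2 * hh - 1) - 1)"
    using quantisation_noise_bounds[OF q(1,2) hh(1), of R] by blast
  have "AE \<omega> in M. (\<exists>T. \<forall>k\<ge>T. V (X k \<omega>) \<in> {..R}) \<longrightarrow> (\<exists>B. \<forall>k. V (X k \<omega>) \<le> B * g k)"
  proof (rule rate[OF form q])
    show "kap * real (Suc k) powr (eps - 1) * sf (lc k) x x \<le> cons k x" if "K0 \<le> k" "V x \<in> {..R}" for k x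
      by (rule consensus_form_le[OF edge[OF that(1)] that(2)])
    show "1/2 < hh" "hh \<le> 1" using hh(2,3)[OF ne] by auto
  qed (use S g in auto)
  then show ?thesis using V_tendsto_0_AE[OF q]
  proof eventually_elim
    case (elim \<omega>)
    have "eventually (\<lambda>k. V (X k \<omega>) < R) sequentially" by (rule order_tendstoD(2)[OF elim(2) R])
    then have "\<exists>T. \<forall>k\<ge>T. V (X k \<omega>) \<in> {..R}" unfolding eventually_sequentially by (auto intro: less_imp_le)
    then show ?case using elim(1) by blast
  qed
qed


text \<open>Every gain decays more slowly than 1 / k, so the relative weight of consensus grows like
  k powr eps. The Young parameter may then tend to 0 at that rate: the mean budget approaches its
  full value with a loss \<open>a * \<eta> k\<close> that is summable against 1 / k.\<close>

lemma weighted_bound_no_critical_edges: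
  assumes q: "1 < q" "q \<le> 2" "2 * q \<le> \<rho>"
    and E': "\<And>i j. (i, j) \<in> E \<Longrightarrow> nu i j + gamma i j \<noteq> 1"
    and a: "a = \<delta> * bl / real N"
    and g: "(2 * hh - 2 * a > 1 \<and> g = (\<lambda>k. real (Suc k) powr (- 2 * a)))
      \<or> (2 * hh - 2 * a = 1 \<and> g = (\<lambda>k. ln (real (k + 2)) powr 2 * real (Suc k) powr (- 2 * a)))
      \<or> (2 * hh - 2 * a < 1 \<and> g = (\<lambda>k. ln (real (k + 2)) * real (Suc k) powr (- (2 * hh - 1))))"
  shows "AE \<omega> in M. \<exists>B. \<forall>k. V (X k \<omega>) \<le> B * g k"
proof -
  obtain \<mu> where \<mu>: "\<mu> > 0" and gap: "\<And>x. (\<Sum>i<N. \<Sum>j<N. aw i j * (x i - x j)\<^sup>2) \<ge> 2 * \<mu> * (\<Sum>i<N. (x i - (\<Sum>j<N. x j) / N)\<^sup>2)"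
    and ne: "E \<noteq> {}" by (rule gap_and_edges) blast
  obtain kap where kap: "0 < kap" "\<And>i j. (i, j) \<in> E \<Longrightarrow> kap \<le> c1 (l1norm n \<theta> + sqrt 1) i j" by (rule edge_const_lower_bound[OF ne]) blast
  \<comment> \<open>Smallest distance of nu + gamma from 1, capped at 1/4 so that \<open>zz\<close>
    stays square summable.\<close>
  define eps where "eps = Min (insert (1/4) ((\<lambda>(i, j). 1 - (nu i j + gamma i j)) ` E))"
  have fin: "finite (insert (1/4) ((\<lambda>(i, j). 1 - (nu i j + gamma i j)) ` E))" using finite_E by simp
  have eps4: "eps \<le> 1/4" unfolding eps_def by (rule Min_le[OF fin]) simp
  have epsE: "eps \<le> 1 - (nu i j + gamma i j)" if "(i, j) \<in> E" for i j
    unfolding eps_def by (rule Min_le[OF fin]) (use that in \<open>auto intro: rev_image_eqI\<close>)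
  have eps0: "0 < eps" unfolding eps_def
  proof (subst Min_gr_iff[OF fin])
    show "\<forall>y\<in>insert (1/4) ((\<lambda>(i, j). 1 - (nu i j + gamma i j)) ` E). 0 < y"
    proof (intro ballI)
      fix y assume "y \<in> insert (1/4) ((\<lambda>(i, j). 1 - (nu i j + gamma i j)) ` E)"
      then consider "y = 1/4" | i j where "(i, j) \<in> E" "y = 1 - (nu i j + gamma i j)" by auto
      then show "0 < y"
      proof cases
        case (2 i j)
        then show ?thesis using gamma_cond[OF 2(1)] E'[OF 2(1)] by linarith
      qed simp
    qed
  qed simp
  have a0: "0 < a" using pe(2) bl(1) Npos by (simp add: a)
  \<comment> \<open>Makes the consensus budget equal to (\<open>bl * Hbar\<^sup>2 + a\<close>) /
    \<open>\<eta> k\<close>, which covers the Young loss and still leaves \<open>a\<close>.\<close>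
  define T where "T = (bl * Hbar\<^sup>2 + a) * real n / (kap * \<mu>)"
  have T0: "0 < T" unfolding T_def using bl(1) Hbar(1) a0 npos kap(1) \<mu> by (intro divide_pos_pos mult_pos_pos add_pos_pos) auto
  define \<eta> where "\<eta> k = T * real (Suc k) powr (- eps)" for k
  have "\<eta> \<longlonglongrightarrow> T * 0" unfolding \<eta>_def[abs_def] by (rule tendsto_mult[OF tendsto_const tendsto_Suc_powr_0]) (use eps0 in simp)
  then have "eventually (\<lambda>k. \<eta> k < 1) sequentially" by (rule order_tendstoD(2)) simp
  then obtain K0 where K0: "\<And>k. K0 \<le> k \<Longrightarrow> \<eta> k < 1" unfolding eventually_sequentially by blast
  have form: "sc_form N n m aw H nu b alpha1 gamma beta1 Hbar \<delta> p bl kap eps a (\<lambda>k. a * \<eta> k) K0"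
  proof (rule sc_form_intro[OF \<mu> gap, where \<eta> = \<eta>])
    show "0 \<le> a * \<eta> k" for k using a0 T0 by (simp add: \<eta>_def)
    have "a * \<eta> k / real (Suc k) = a * T * real (Suc k) powr (- eps - 1)" for k
      by (simp add: \<eta>_def powr_diff)
    then show "summable (\<lambda>k. a * \<eta> k / real (Suc k))" using summable_mult[OF summable_Suc_powr[of "- eps - 1"], of "a * T"] eps0 by simp
    fix k assume k: "K0 \<le> k"
    have e0: "0 < \<eta> k" using T0 by (simp add: \<eta>_def)
    have kT: "kap * T * \<mu> / real n = bl * Hbar\<^sup>2 + a" unfolding T_def using kap(1) \<mu> npos by simp
    have "kap * real (Suc k) powr eps * \<mu> / real n = (bl * Hbar\<^sup>2 + a) / \<eta> k"
    proof -
      have "\<eta> k * real (Suc k) powr eps = T" unfolding \<eta>_def mult.assoc powr_add[symmetric] by simp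
      then have "real (Suc k) powr eps = T / \<eta> k" using e0 by (simp add: eq_divide_eq mult.commute)
      then show ?thesis unfolding kT[symmetric] by simp
    qed
    moreover have "a \<le> a / \<eta> k" using K0[OF k] e0 a0 by (simp add: le_divide_eq)
    moreover have "0 \<le> bl * Hbar\<^sup>2" "0 \<le> a * \<eta> k" using bl(1) a0 e0 by auto
    moreover have "bl * (1 / \<eta> k - 1) * Hbar\<^sup>2 = bl * Hbar\<^sup>2 / \<eta> k - bl * Hbar\<^sup>2" by (simp add: algebra_simps)
    ultimately have "a - a * \<eta> k \<le> kap * real (Suc k) powr eps * \<mu> / real n - bl * (1 / \<eta> k - 1) * Hbar\<^sup>2"
      by (simp add: add_divide_distrib)
    moreover have "(a - a * \<eta> k) * real N = bl * (1 - \<eta> k) * \<delta>"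
    proof -
      have "(a - a * \<eta> k) * real N = (a * real N) * (1 - \<eta> k)" by (simp add: algebra_simps)
      also have "a * real N = \<delta> * bl" using Npos by (simp add: a)
      finally show ?thesis by (simp only: mult_ac)
    qed
    ultimately show "0 < \<eta> k \<and> \<eta> k \<le> 1 \<and> (a - a * \<eta> k) * real N \<le> bl * (1 - \<eta> k) * \<delta>
       \<and> a - a * \<eta> k \<le> kap * real (Suc k) powr eps * \<mu> / real n - bl * (1 / \<eta> k - 1) * Hbar\<^sup>2"
      using e0 K0[OF k] by simp
  qed (use kap eps0 eps4 a0 in auto)
  show ?thesis
  proof (rule weighted_bound_AE[OF q ne _ form _ g, of 1])
    show "kap * real (Suc k) powr (eps - 1) \<le> c1 (l1norm n \<theta> + sqrt 1) i j * real (Suc k) powr (- (nu i j + gamma i j))"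
      if e: "(i, j) \<in> E" for k i j
      using kap(2)[OF e] c1_pos[OF e] epsE[OF e] by (intro mult_mono powr_mono) (auto intro: less_imp_le)
  qed simp
qed

text \<open>The Young parameter is the one for which the mean budget equals \<open>a\<close>
  exactly; its loss takes half of the nominal deviation budget P / n. By
  \<open>delta_le_Hbar\<close> the other half exceeds \<open>a\<close> when P > 0, so the slopes may
  shrink by a factor s < 1, which buys a small neighbourhood of \<open>\<theta>\<close> in place of
  \<open>\<theta>\<close> itself.\<close>

lemma weighted_bound_critical_edges:
  assumes q: "1 < q" "q \<le> 2" "2 * q \<le> \<rho>"
    and E'_def: "E' = {(i, j) \<in> E. nu i j + gamma i j = 1}" and E': "E' \<noteq> {}"
    and mp_def: "mp = Min ((\<lambda>(i, j). alpha1 i j * exp (- l1norm n \<theta> / b i j) / b i j) ` E')"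
    and a: "a = \<delta> * lambda2 (laplacian N aw) * bl * mp /
          (2 * real N * real n * Hbar\<^sup>2 * bl + real N * lambda2 (laplacian N aw) * mp)"
    and g: "(2 * hh - 2 * a > 1 \<and> g = (\<lambda>k. real (Suc k) powr (- 2 * a)))
      \<or> (2 * hh - 2 * a = 1 \<and> g = (\<lambda>k. ln (real (k + 2)) powr 2 * real (Suc k) powr (- 2 * a)))
      \<or> (2 * hh - 2 * a < 1 \<and> g = (\<lambda>k. ln (real (k + 2)) * real (Suc k) powr (- (2 * hh - 1))))"
  shows "AE \<omega> in M. \<exists>B. \<forall>k. V (X k \<omega>) \<le> B * g k"
proof -
  obtain \<mu> where \<mu>: "\<mu> > 0" and l0: "0 \<le> lambda2 (laplacian N aw)" and l\<mu>: "lambda2 (laplacian N aw) \<le> \<mu>"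
    and gap: "\<And>x. (\<Sum>i<N. \<Sum>j<N. aw i j * (x i - x j)\<^sup>2) \<ge> 2 * \<mu> * (\<Sum>i<N. (x i - (\<Sum>j<N. x j) / N)\<^sup>2)"
    and ne: "E \<noteq> {}" by (rule gap_and_edges) blast
  have finE': "finite E'" unfolding E'_def by (rule finite_subset[OF _ finite_E]) auto
  have fin: "finite ((\<lambda>(i, j). c1 (l1norm n \<theta>) i j) ` E')" using finE' by simp
  have mp': "mp = Min ((\<lambda>(i, j). c1 (l1norm n \<theta>) i j) ` E')" unfolding mp_def c1_def ..
  have mp0: "0 < mp" unfolding mp' using E' fin c1_pos by (subst Min_gr_iff) (auto simp: E'_def)
  have mpE: "mp \<le> c1 (l1norm n \<theta>) i j" if "(i, j) \<in> E'" for i j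
    unfolding mp' by (rule Min_le[OF fin]) (use that in \<open>auto intro: rev_image_eqI\<close>)
  define P where "P = lambda2 (laplacian N aw) * mp"
  define W where "W = 2 * real n * Hbar\<^sup>2 * bl"
  have P0: "0 \<le> P" using l0 mp0 by (simp add: P_def)
  have W0: "0 < W" using npos Hbar(1) bl(1) by (simp add: W_def)
  \<comment> \<open>Solves 1 - \<open>\<eta>\<close> = P / (W + P), the fraction of the mean budget
    that appears in \<open>a\<close>; then 1 / \<open>\<eta>\<close> - 1 is P / W.\<close>
  define \<eta> where "\<eta> = W / (W + P)"
  have \<eta>: "0 < \<eta>" "\<eta> \<le> 1" using W0 P0 by (auto simp: \<eta>_def)
  have a': "a = \<delta> * bl / real N * (P / (W + P))"
  proof -
    have "2 * real N * real n * Hbar\<^sup>2 * bl + real N * lambda2 (laplacian N aw) * mp = real N * (W + P)"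
      by (simp add: W_def P_def algebra_simps)
    then have "a = \<delta> * bl * P / (real N * (W + P))" unfolding a by (simp add: P_def mult_ac)
    then show ?thesis by simp
  qed
  have a0: "0 \<le> a" unfolding a' using pe(2) bl(1) P0 W0 by simp
  have e1: "1 - \<eta> = P / (W + P)" using W0 P0 by (simp add: \<eta>_def field_simps)
  have e2: "bl * (1 / \<eta> - 1) * Hbar\<^sup>2 = P / (2 * real n)"
  proof -
    have "1 / \<eta> - 1 = P / W" using W0 P0 by (simp add: \<eta>_def field_simps)
    then show ?thesis using npos Hbar(1) bl(1) by (simp add: W_def)
  qed
  have aN: "a * real N = bl * (1 - \<eta>) * \<delta>" unfolding a' e1 using Npos by simp
  have a_le: "a \<le> P * \<eta> / (2 * real n)"
  proof -
    have "\<delta> * bl / real N \<le> Hbar\<^sup>2 * bl"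
      using delta_le_Hbar Npos bl(1) by (simp add: divide_le_eq mult_ac)
    then have "a \<le> Hbar\<^sup>2 * bl * (P / (W + P))" unfolding a' using P0 W0 by (intro mult_right_mono) auto
    also have "\<dots> = P * \<eta> / (2 * real n)" using npos by (simp add: \<eta>_def W_def)
    finally show ?thesis .
  qed
  \<comment> \<open>For P > 0, s = (1 + \<open>\<eta>\<close>) / 2 leaves exactly the amount P
    \<open>\<eta>\<close> / (2 n) that bounds \<open>a\<close>. P = 0 is not excluded, as
    \<open>lambda2\<close> is only known to be nonnegative; then \<open>a\<close> is 0 and any s in
    (0, 1) will do.\<close>
  define s where "s = (if P = 0 then 1/2 else (1 + \<eta>) / 2)"
  have s0: "0 < s" using \<eta> by (simp add: s_def)
  have s1: "s < 1"
  proof (cases "P = 0")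
    case False
    then have "\<eta> < 1" using P0 W0 by (simp add: \<eta>_def)
    then show ?thesis by (simp add: s_def)
  qed (simp add: s_def)
  have a_s: "a \<le> s * mp * \<mu> / real n - P / (2 * real n)"
  proof (cases "P = 0")
    case True
    then have "a = 0" by (simp add: a')
    then show ?thesis using True s0 mp0 \<mu> by simp
  next
    case False
    have "P \<le> mp * \<mu>" unfolding P_def using l\<mu> mp0 by (simp add: mult.commute)
    then have "s * P / real n \<le> s * mp * \<mu> / real n"
      using s0 mult_left_mono[of P "mp * \<mu>" s] by (intro divide_right_mono) (auto simp: mult.assoc)
    moreover have "s * P / real n - P / (2 * real n) = P * \<eta> / (2 * real n)"
      using False npos by (simp add: s_def field_simps)
    ultimately show ?thesis using a_le by linarith
  qed
  have form: "sc_form N n m aw H nu b alpha1 gamma beta1 Hbar \<delta> p bl (s * mp) 0 a (\<lambda>_. 0) K0" for K0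
  proof (rule sc_form_intro[OF \<mu> gap, where \<eta> = "\<lambda>_. \<eta>"])
    show "0 < \<eta> \<and> \<eta> \<le> 1 \<and> (a - 0) * real N \<le> bl * (1 - \<eta>) * \<delta> \<and>
        a - 0 \<le> s * mp * real (Suc k) powr 0 * \<mu> / real n - bl * (1 / \<eta> - 1) * Hbar\<^sup>2" for k
      unfolding e2 using \<eta> aN a_s by simp
  qed (use s0 mp0 a0 in auto)
  define bm where "bm = Min ((\<lambda>(i, j). b i j) ` E)"
  have finb: "finite ((\<lambda>(i, j). b i j) ` E)" using finite_E by simp
  have bm0: "0 < bm" unfolding bm_def using ne finb b_sym by (subst Min_gr_iff) auto
  have bmE: "bm \<le> b i j" if "(i, j) \<in> E" for i j
    unfolding bm_def by (rule Min_le[OF finb]) (use that in \<open>auto intro: rev_image_eqI\<close>)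
  \<comment> \<open>Radius within which every edge keeps at least the fraction \<open>s\<close> of
    its slope; the smallest dither scale \<open>bm\<close> decides.\<close>
  define r0 where "r0 = bm * ln (1 / s)"
  have lns: "0 < ln (1 / s)" using s0 s1 by simp
  have r00: "0 < r0" using bm0 lns by (simp add: r0_def)
  have rs: "s \<le> exp (- r0 / b i j)" if e: "(i, j) \<in> E" for i j
  proof -
    have bpos: "0 < b i j" using b_sym[OF e] by simp
    have "r0 / b i j \<le> ln (1 / s)"
      using mult_right_mono[OF bmE[OF e], of "ln (1 / s)"] lns bpos by (simp add: r0_def divide_le_eq mult.commute)
    then have "exp (- ln (1 / s)) \<le> exp (- r0 / b i j)" by simp
    then show ?thesis using s0 by (simp add: ln_div exp_minus)
  qed
  have cs: "s * c1 (l1norm n \<theta>) i j \<le> c1 (l1norm n \<theta> + sqrt (r0\<^sup>2)) i j" if e: "(i, j) \<in> E" for i j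
  proof -
    have bpos: "0 < b i j" using b_sym[OF e] by simp
    have "c1 (l1norm n \<theta> + sqrt (r0\<^sup>2)) i j = exp (- r0 / b i j) * c1 (l1norm n \<theta>) i j"
    proof -
      have "- (l1norm n \<theta> + r0) / b i j = - l1norm n \<theta> / b i j + - r0 / b i j" by (simp add: add_divide_distrib diff_divide_distrib)
      then have "exp (- (l1norm n \<theta> + r0) / b i j) = exp (- l1norm n \<theta> / b i j) * exp (- r0 / b i j)" by (simp only: exp_add)
      then show ?thesis using r00 unfolding c1_def by simp
    qed
    then show ?thesis using mult_right_mono[OF rs[OF e], of "c1 (l1norm n \<theta>) i j"] c1_pos[OF e, of "l1norm n \<theta>"] by simp
  qed
  have ev: "eventually (\<lambda>k. s * mp * real (Suc k) powr (0 - 1) \<le> c1 (l1norm n \<theta> + sqrt (r0\<^sup>2)) (fst x) (snd x) * real (Suc k) powr (- (nu (fst x) (snd x) + gamma (fst x) (snd x)))) sequentially"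
    if x: "x \<in> E" for x
  proof -
    obtain i j where xij: "x = (i, j)" by (cases x)
    have e: "(i, j) \<in> E" using x xij by simp
    show ?thesis
    proof (cases "nu i j + gamma i j = 1")
      case True
      then have "(i, j) \<in> E'" using e by (simp add: E'_def)
      then have "s * mp \<le> s * c1 (l1norm n \<theta>) i j" using mpE s0 by (intro mult_left_mono) auto
      then have "s * mp \<le> c1 (l1norm n \<theta> + sqrt (r0\<^sup>2)) i j" using cs[OF e] by linarith
      then have "s * mp * real (Suc k) powr (0 - 1) \<le> c1 (l1norm n \<theta> + sqrt (r0\<^sup>2)) i j * real (Suc k) powr (- (nu i j + gamma i j))" for k
        unfolding True by (intro mult_mono) (use c1_pos[OF e] in \<open>auto intro: less_imp_le\<close>)
      then show ?thesis unfolding xij fst_conv snd_conv by (intro always_eventually allI)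
    next
      case False
      \<comment> \<open>A noncritical gain decays more slowly than 1 / k and eventually exceeds the
        required one whatever its constant. This is why only critical edges enter
        \<open>mp\<close>.\<close>
      then have "0 - 1 < - (nu i j + gamma i j)" using gamma_cond[OF e] by linarith
      then show ?thesis unfolding xij fst_conv snd_conv by (intro eventually_powr_le c1_pos[OF e])
    qed
  qed
  have "eventually (\<lambda>k. \<forall>x\<in>E. s * mp * real (Suc k) powr (0 - 1) \<le> c1 (l1norm n \<theta> + sqrt (r0\<^sup>2)) (fst x) (snd x) * real (Suc k) powr (- (nu (fst x) (snd x) + gamma (fst x) (snd x)))) sequentially"
    by (rule eventually_ball_finite[OF finite_E]) (use ev in blast)
  then obtain K0 where K0: "\<And>k x. K0 \<le> k \<Longrightarrow> x \<in> E \<Longrightarrow> s * mp * real (Suc k) powr (0 - 1) \<le> c1 (l1norm n \<theta> + sqrt (r0\<^sup>2)) (fst x) (snd x) * real (Suc k) powr (- (nu (fst x) (snd x) + gamma (fst x) (snd x)))"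
    unfolding eventually_sequentially by blast
  show ?thesis
  proof (rule weighted_bound_AE[OF q ne _ form _ g, of "r0\<^sup>2" K0])
    show "0 < r0\<^sup>2" using r00 by simp
    show "s * mp * real (Suc k) powr (0 - 1) \<le> c1 (l1norm n \<theta> + sqrt (r0\<^sup>2)) i j * real (Suc k) powr (- (nu i j + gamma i j))"
      if "K0 \<le> k" "(i, j) \<in> E" for k i j using K0[OF that] by simp
  qed
qed

section \<open>From \<open>V\<close> to the norm of each sensor's error\<close>

lemma vnorm_X: "i < N \<Longrightarrow> vnorm n (\<lambda>c. est \<omega> k i c - \<theta> c) \<le> sqrt (V (X k \<omega>))"
  unfolding vnorm_def using sum_sq_le_V[of i "X k \<omega>"] by (simp add: X_def)

text \<open>Square root of the bound on \<open>V\<close>; the factor 4 absorbs the shifts from k + 1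
  and k + 2 to k. Starting at k = 2 avoids the zero of ln k at 1.\<close>

lemma rate_vnorm:
  assumes i: "i < N" and AE: "AE \<omega> in M. \<exists>B. \<forall>k. V (X k \<omega>) \<le> B * g k"
    and gf: "\<And>k. k \<ge> 2 \<Longrightarrow> 0 \<le> g k \<and> 0 \<le> f k \<and> g k \<le> 4 * (f k)\<^sup>2"
  shows "AE \<omega> in M. \<exists>B. \<forall>k\<ge>2. vnorm n (\<lambda>c. est \<omega> k i c - \<theta> c) \<le> B * f k"
  using AE
proof (rule AE_mp, intro AE_I2 impI)
  fix \<omega> assume "\<exists>B. \<forall>k. V (X k \<omega>) \<le> B * g k"
  then obtain B where B: "\<And>k. V (X k \<omega>) \<le> B * g k" by blast
  have "vnorm n (\<lambda>c. est \<omega> k i c - \<theta> c) \<le> (2 * sqrt \<bar>B\<bar>) * f k" if k: "k \<ge> 2" for k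
  proof -
    have "V (X k \<omega>) \<le> \<bar>B\<bar> * g k" using B[of k] gf[OF k] mult_right_mono[OF abs_ge_self[of B], of "g k"] by linarith
    also have "\<dots> \<le> \<bar>B\<bar> * (4 * (f k)\<^sup>2)" using gf[OF k] by (intro mult_left_mono) auto
    also have "\<dots> = (2 * sqrt \<bar>B\<bar> * f k)\<^sup>2" by (simp add: power_mult_distrib)
    finally have "sqrt (V (X k \<omega>)) \<le> 2 * sqrt \<bar>B\<bar> * f k" using gf[OF k] by (intro real_le_lsqrt) (auto simp: V_nonneg)
    then show ?thesis using vnorm_X[OF i, of \<omega> k] by linarith
  qed
  then show "\<exists>B. \<forall>k\<ge>2. vnorm n (\<lambda>c. est \<omega> k i c - \<theta> c) \<le> B * f k" by blast
qed

text \<open>From k = 2 on, k + 2 is at most k^2.\<close>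

lemma ln_shift_le: "2 \<le> k \<Longrightarrow> ln (real (k + 2)) \<le> 2 * ln (real k)"
proof -
  assume k: "2 \<le> k"
  have "k + 2 \<le> k * k" using mult_le_mono1[OF k, of k] k by linarith
  then have "real (k + 2) \<le> real k ^ 2" unfolding power2_eq_square by (metis of_nat_le_iff of_nat_mult)
  then have "ln (real (k + 2)) \<le> ln (real k ^ 2)" using k by (subst ln_le_cancel_iff) auto
  then show ?thesis using k by (simp add: ln_realpow)
qed

lemma error_rates:
  fixes a :: real
  assumes i: "i < N"
    and main: "\<And>g. (2 * hh - 2 * a > 1 \<and> g = (\<lambda>k. real (Suc k) powr (- 2 * a)))
      \<or> (2 * hh - 2 * a = 1 \<and> g = (\<lambda>k. ln (real (k + 2)) powr 2 * real (Suc k) powr (- 2 * a)))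
      \<or> (2 * hh - 2 * a < 1 \<and> g = (\<lambda>k. ln (real (k + 2)) * real (Suc k) powr (- (2 * hh - 1)))) \<Longrightarrow>
      AE \<omega> in M. \<exists>B. \<forall>k. V (X k \<omega>) \<le> B * g k"
    and a0: "0 \<le> a"
  shows "(2 * hh - 2 * a > 1 \<longrightarrow> (AE \<omega> in M. \<exists>B. \<forall>k\<ge>2.
              vnorm n (\<lambda>c. est \<omega> k i c - \<theta> c) \<le> B * real k powr (- a)))
       \<and> (2 * hh - 2 * a = 1 \<longrightarrow> (AE \<omega> in M. \<exists>B. \<forall>k\<ge>2.
              vnorm n (\<lambda>c. est \<omega> k i c - \<theta> c) \<le> B * (ln (real k) / real k powr (hh - 1/2))))
       \<and> (2 * hh - 2 * a < 1 \<longrightarrow> (AE \<omega> in M. \<exists>B. \<forall>k\<ge>2.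
              vnorm n (\<lambda>c. est \<omega> k i c - \<theta> c) \<le> B * (sqrt (ln (real k)) / real k powr (hh - 1/2))))"
proof (intro conjI impI)
  have ne: "E \<noteq> {}" by (rule gap_and_edges) blast
  have hp: "1/2 < hh" by (rule hh(2)[OF ne])
  have sq: "(real k powr (- c))\<^sup>2 = real k powr (- 2 * c)" for k :: nat and c :: real
    by (simp add: power2_eq_square powr_add[symmetric])
  have aux: "(sqrt L / P)\<^sup>2 = L * (inverse P)\<^sup>2" if "0 \<le> L" for L P :: real
    unfolding power_divide real_sqrt_pow2[OF that] power_inverse by (rule divide_inverse)
  have mono: "real (Suc k) powr (- 2 * c) \<le> real k powr (- 2 * c)" if "2 \<le> k" "0 \<le> c" for k c
    using that by (intro powr_mono2') auto
  {
    assume c: "2 * hh - 2 * a > 1"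
    show "AE \<omega> in M. \<exists>B. \<forall>k\<ge>2. vnorm n (\<lambda>c. est \<omega> k i c - \<theta> c) \<le> B * real k powr (- a)"
    proof (rule rate_vnorm[OF i main])
      show "(2 * hh - 2 * a > 1 \<and> (\<lambda>k. real (Suc k) powr (- 2 * a)) = (\<lambda>k. real (Suc k) powr (- 2 * a)))
        \<or> (2 * hh - 2 * a = 1 \<and> (\<lambda>k. real (Suc k) powr (- 2 * a)) = (\<lambda>k. ln (real (k + 2)) powr 2 * real (Suc k) powr (- 2 * a)))
        \<or> (2 * hh - 2 * a < 1 \<and> (\<lambda>k. real (Suc k) powr (- 2 * a)) = (\<lambda>k. ln (real (k + 2)) * real (Suc k) powr (- (2 * hh - 1))))"
        using c by blast
      show "0 \<le> real (Suc k) powr (- 2 * a) \<and> 0 \<le> real k powr (- a) \<and> real (Suc k) powr (- 2 * a) \<le> 4 * (real k powr (- a))\<^sup>2" if "2 \<le> k" for k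
      proof -
        have "real (Suc k) powr (- 2 * a) \<le> 4 * real k powr (- 2 * a)"
          using mono[OF that a0] powr_ge_zero[of "real k" "- 2 * a"] by linarith
        then show ?thesis unfolding sq by (intro conjI powr_ge_zero)
      qed
    qed
  next
    assume c: "2 * hh - 2 * a = 1"
    then have ah: "hh - 1/2 = a" by simp
    show "AE \<omega> in M. \<exists>B. \<forall>k\<ge>2. vnorm n (\<lambda>c. est \<omega> k i c - \<theta> c) \<le> B * (ln (real k) / real k powr (hh - 1/2))"
    proof (rule rate_vnorm[OF i main])
      show "(2 * hh - 2 * a > 1 \<and> (\<lambda>k. ln (real (k + 2)) powr 2 * real (Suc k) powr (- 2 * a)) = (\<lambda>k. real (Suc k) powr (- 2 * a)))
        \<or> (2 * hh - 2 * a = 1 \<and> (\<lambda>k. ln (real (k + 2)) powr 2 * real (Suc k) powr (- 2 * a)) = (\<lambda>k. ln (real (k + 2)) powr 2 * real (Suc k) powr (- 2 * a)))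
        \<or> (2 * hh - 2 * a < 1 \<and> (\<lambda>k. ln (real (k + 2)) powr 2 * real (Suc k) powr (- 2 * a)) = (\<lambda>k. ln (real (k + 2)) * real (Suc k) powr (- (2 * hh - 1))))"
        using c by blast
      show "0 \<le> ln (real (k + 2)) powr 2 * real (Suc k) powr (- 2 * a) \<and> 0 \<le> ln (real k) / real k powr (hh - 1/2)
          \<and> ln (real (k + 2)) powr 2 * real (Suc k) powr (- 2 * a) \<le> 4 * (ln (real k) / real k powr (hh - 1/2))\<^sup>2" if k: "2 \<le> k" for k
      proof -
        have l0: "0 \<le> ln (real k)" "0 < ln (real (k + 2))" using k by auto
        have "ln (real (k + 2)) powr 2 = (ln (real (k + 2)))\<^sup>2" using l0 by simp
        also have "\<dots> \<le> (2 * ln (real k))\<^sup>2" using ln_shift_le[OF k] l0 by (intro power_mono) auto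
        finally have "ln (real (k + 2)) powr 2 * real (Suc k) powr (- 2 * a) \<le> (2 * ln (real k))\<^sup>2 * real k powr (- 2 * a)"
          using mono[OF k a0] by (intro mult_mono) auto
        also have "\<dots> = 4 * (ln (real k) / real k powr (hh - 1/2))\<^sup>2"
          unfolding ah sq[symmetric] by (simp add: powr_minus power_mult_distrib power_divide divide_inverse power_inverse)
        finally show ?thesis using l0 by simp
      qed
    qed
  next
    assume c: "2 * hh - 2 * a < 1"
    show "AE \<omega> in M. \<exists>B. \<forall>k\<ge>2. vnorm n (\<lambda>c. est \<omega> k i c - \<theta> c) \<le> B * (sqrt (ln (real k)) / real k powr (hh - 1/2))"
    proof (rule rate_vnorm[OF i main])
      show "(2 * hh - 2 * a > 1 \<and> (\<lambda>k. ln (real (k + 2)) * real (Suc k) powr (- (2 * hh - 1))) = (\<lambda>k. real (Suc k) powr (- 2 * a)))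
        \<or> (2 * hh - 2 * a = 1 \<and> (\<lambda>k. ln (real (k + 2)) * real (Suc k) powr (- (2 * hh - 1))) = (\<lambda>k. ln (real (k + 2)) powr 2 * real (Suc k) powr (- 2 * a)))
        \<or> (2 * hh - 2 * a < 1 \<and> (\<lambda>k. ln (real (k + 2)) * real (Suc k) powr (- (2 * hh - 1))) = (\<lambda>k. ln (real (k + 2)) * real (Suc k) powr (- (2 * hh - 1))))"
        using c by blast
      show "0 \<le> ln (real (k + 2)) * real (Suc k) powr (- (2 * hh - 1)) \<and> 0 \<le> sqrt (ln (real k)) / real k powr (hh - 1/2)
          \<and> ln (real (k + 2)) * real (Suc k) powr (- (2 * hh - 1)) \<le> 4 * (sqrt (ln (real k)) / real k powr (hh - 1/2))\<^sup>2" if k: "2 \<le> k" for k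
      proof -
        have l0: "0 \<le> ln (real k)" "0 < ln (real (k + 2))" using k by auto
        have ex: "- (2 * hh - 1) = - 2 * (hh - 1/2)" by simp
        have pm: "real (Suc k) powr (- (2 * hh - 1)) \<le> real k powr (- (2 * hh - 1))"
          unfolding ex by (rule mono[OF k]) (use hp in simp)
        have "ln (real (k + 2)) * real (Suc k) powr (- (2 * hh - 1)) \<le> (2 * ln (real k)) * real k powr (- (2 * hh - 1))"
          by (rule mult_mono[OF ln_shift_le[OF k] pm]) (use l0 in simp_all)
        also have "\<dots> \<le> 4 * (ln (real k) * real k powr (- (2 * hh - 1)))"
          using mult_nonneg_nonneg[OF l0(1) powr_ge_zero[of "real k" "- (2 * hh - 1)"]] by linarith
        also have "ln (real k) * real k powr (- (2 * hh - 1)) = (sqrt (ln (real k)) / real k powr (hh - 1/2))\<^sup>2"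
          unfolding ex sq[symmetric] aux[OF l0(1)] powr_minus ..
        finally have "ln (real (k + 2)) * real (Suc k) powr (- (2 * hh - 1)) \<le> 4 * (sqrt (ln (real k)) / real k powr (hh - 1/2))\<^sup>2" .
        moreover have "0 \<le> ln (real (k + 2)) * real (Suc k) powr (- (2 * hh - 1))" "0 \<le> sqrt (ln (real k)) / real k powr (hh - 1/2)"
          using l0 by simp_all
        ultimately show ?thesis by (intro conjI)
      qed
    qed
  }
qed

end

theorem theorem4p3:
  fixes M :: "'w measure"
    and N n :: nat and m :: "nat \<Rightarrow> nat"
    and aw :: "nat \<Rightarrow> nat \<Rightarrow> real"
    and H :: "nat \<Rightarrow> nat \<Rightarrow> nat \<Rightarrow> nat \<Rightarrow> real"
    and \<theta> :: "nat \<Rightarrow> real"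
    and w :: "nat \<Rightarrow> nat \<Rightarrow> 'w \<Rightarrow> nat \<Rightarrow> real"
    and d :: "nat \<Rightarrow> nat \<Rightarrow> 'w \<Rightarrow> real"
    and init :: "nat \<Rightarrow> nat \<Rightarrow> real"
    and nu b alpha1 gamma :: "nat \<Rightarrow> nat \<Rightarrow> real"
    and beta1 :: "nat \<Rightarrow> real"
    and Hbar \<delta> :: real and p :: nat
    and h a mprime betalow :: real
  defines "E \<equiv> edges N aw"
    and "E' \<equiv> {(i, j) \<in> edges N aw. nu i j + gamma i j = 1}"
    and "\<L> \<equiv> laplacian N aw"
    and "est \<equiv> (\<lambda>\<omega>. sc_est N n m aw nu b
              (\<lambda>i j k. alpha1 i j / real k powr gamma i j) (\<lambda>i k. beta1 i / real k) H
              (\<lambda>i k r. matvec n (H i k) \<theta> r + w i k \<omega> r) (\<lambda>i k. d i k \<omega>) init)"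
  assumes M: "prob_space M"
    and Npos: "2 \<le> N" and npos: "0 < n"
    \<comment> \<open>network\<close>
    and aw_sym: "\<And>i j. i < N \<Longrightarrow> j < N \<Longrightarrow> aw i j = aw j i"
    and aw_nonneg: "\<And>i j. i < N \<Longrightarrow> j < N \<Longrightarrow> aw i j \<ge> 0"
    and aw_noloop: "\<And>i. i < N \<Longrightarrow> aw i i = 0"
    \<comment> \<open>(A1)\<close>
    and Hbar: "Hbar > 0" "\<And>i k. i < N \<Longrightarrow> 1 \<le> k \<Longrightarrow> opnorm (m i) n (H i k) \<le> Hbar"
    and pe: "p > 0" "\<delta> > 0"
        "\<And>k x. 1 \<le> k \<Longrightarrow>
            (1 / real p) * (\<Sum>t\<in>{k..k+p-1}. \<Sum>i<N. (vnorm (m i) (matvec n (H i t) x))\<^sup>2)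
              \<ge> \<delta> * (vnorm n x)\<^sup>2"
    \<comment> \<open>(A2)\<close>
    and w_adapted: "\<And>i k r. i < N \<Longrightarrow> 1 \<le> k \<Longrightarrow> r < m i \<Longrightarrow>
        (\<lambda>\<omega>. w i k \<omega> r) \<in> borel_measurable (filt_wd M N m w d k)"
    and w_int: "\<And>i k r. i < N \<Longrightarrow> 1 \<le> k \<Longrightarrow> r < m i \<Longrightarrow> integrable M (\<lambda>\<omega>. w i k \<omega> r)"
    and w_mds: "\<And>i k r. i < N \<Longrightarrow> 1 \<le> k \<Longrightarrow> r < m i \<Longrightarrow>
        AE \<omega> in M. real_cond_exp M (filt_wd M N m w d (k - 1)) (\<lambda>\<omega>. w i k \<omega> r) \<omega> = 0"
    and w_mom: "\<exists>\<rho>>2. AE \<omega> in M.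
        (\<Squnion>i\<in>{..<N}. \<Squnion>k\<in>{1..}. nn_cond_exp M (filt_w M N m w (k - 1))
           (\<lambda>\<omega>. ennreal (vnorm (m i) (w i k \<omega>) powr \<rho>)) \<omega>) < \<infinity>"
    \<comment> \<open>(A3)\<close>
    and conn: "mat_rank \<L> = N - 1"
    \<comment> \<open>(A4)\<close>
    and d_lap: "\<And>i k. i < N \<Longrightarrow> 1 \<le> k \<Longrightarrow>
        distributed M lborel (d i k) (\<lambda>x. ennreal (exp (- \<bar>x\<bar>) / 2))"
    and d_indep: "prob_space.indep_vars M (\<lambda>_. borel) (\<lambda>(i, k). d i k) ({..<N} \<times> {1..})"
    and dw_indep: "prob_space.indep_set M (events_d M N d) (events_w M N m w)"
    \<comment> \<open>algorithm parameters\<close>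
    and nu_sym: "\<And>i j. (i, j) \<in> E \<Longrightarrow> nu i j = nu j i \<and> nu i j \<ge> 0"
    and b_sym: "\<And>i j. (i, j) \<in> E \<Longrightarrow> b i j = b j i \<and> b i j > 0"
    and alpha_sym: "\<And>i j. (i, j) \<in> E \<Longrightarrow> alpha1 i j = alpha1 j i \<and> alpha1 i j > 0"
    and beta_pos: "\<And>i. i < N \<Longrightarrow> beta1 i > 0"
    and gamma_cond: "\<And>i j. (i, j) \<in> E \<Longrightarrow>
        gamma i j = gamma j i \<and> 1/2 < gamma i j \<and> gamma i j \<le> 1 \<and> nu i j + gamma i j \<le> 1"
    \<comment> \<open>constants of the theorem\<close>
    and h_def: "h = Min ((\<lambda>(i, j). nu i j / 2 + gamma i j) ` E)"
    and betalow_def: "betalow = Min (beta1 ` {..<N})"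
    and mprime_def: "mprime = Min ((\<lambda>(i, j). alpha1 i j * exp (- l1norm n \<theta> / b i j) / b i j) ` E')"
    and a_def: "a = (if E' = {} then \<delta> * betalow / real N
        else \<delta> * lambda2 \<L> * betalow * mprime /
          (2 * real N * real n * Hbar\<^sup>2 * betalow + real N * lambda2 \<L> * mprime))"
    and i: "i < N"
  shows "(2 * h - 2 * a > 1 \<longrightarrow> (AE \<omega> in M. \<exists>B. \<forall>k\<ge>2.
              vnorm n (\<lambda>c. est \<omega> k i c - \<theta> c) \<le> B * real k powr (- a)))
       \<and> (2 * h - 2 * a = 1 \<longrightarrow> (AE \<omega> in M. \<exists>B. \<forall>k\<ge>2.
              vnorm n (\<lambda>c. est \<omega> k i c - \<theta> c) \<le> B * (ln (real k) / real k powr (h - 1/2))))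
       \<and> (2 * h - 2 * a < 1 \<longrightarrow> (AE \<omega> in M. \<exists>B. \<forall>k\<ge>2.
              vnorm n (\<lambda>c. est \<omega> k i c - \<theta> c) \<le> B * (sqrt (ln (real k)) / real k powr (h - 1/2))))"
proof -
  obtain \<rho> where \<rho>: "\<rho> > 2" and mom: "AE \<omega> in M.
        (\<Squnion>i\<in>{..<N}. \<Squnion>k\<in>{1..}. nn_cond_exp M (filt_w M N m w (k - 1))
           (\<lambda>\<omega>. ennreal (vnorm (m i) (w i k \<omega>) powr \<rho>)) \<omega>) < \<infinity>"
    using w_mom by blast
  have noise: "sc_noise M N m w d \<rho>"
    by (rule sc_noise.intro[OF M sc_noise_axioms.intro[OF w_int w_mds \<rho> mom d_lap d_indep dw_indep]])
  have det: "sc_det N n m aw H nu b alpha1 gamma beta1 Hbar \<delta> p"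
    by (rule sc_det.intro[OF Npos npos aw_sym aw_nonneg Hbar pe conn[unfolded \<L>_def]
        nu_sym[unfolded E_def] b_sym[unfolded E_def] alpha_sym[unfolded E_def] beta_pos gamma_cond[unfolded E_def]])
  interpret net: sc_network M N n m w d \<rho> aw H \<theta> nu b alpha1 gamma beta1 Hbar \<delta> p init
    by (rule sc_network.intro[OF noise det])
  have est: "est \<omega> = net.est \<omega>" for \<omega> unfolding est_def net.est_def ..
  have h: "h = net.hh" unfolding h_def net.hh_def E_def ..
  have bl: "betalow = net.bl" unfolding betalow_def net.bl_def ..
  \<comment> \<open>Above 1 because \<open>\<rho>\<close> exceeds 2, as the logarithmic case
    demands; at most 2 for \<open>power_step\<close>; and 2 q stays within the available
    moments.\<close>
  define q where "q = min (\<rho> / 2) 2"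
  have q: "1 < q" "q \<le> 2" "2 * q \<le> \<rho>" using \<rho> by (auto simp: q_def)
  show ?thesis unfolding est h
  proof (cases "E' = {}")
    case True
    have a: "a = \<delta> * net.bl / real N" unfolding a_def bl using True by simp
    show "(2 * net.hh - 2 * a > 1 \<longrightarrow> (AE \<omega> in M. \<exists>B. \<forall>k\<ge>2.
              vnorm n (\<lambda>c. net.est \<omega> k i c - \<theta> c) \<le> B * real k powr (- a)))
       \<and> (2 * net.hh - 2 * a = 1 \<longrightarrow> (AE \<omega> in M. \<exists>B. \<forall>k\<ge>2.
              vnorm n (\<lambda>c. net.est \<omega> k i c - \<theta> c) \<le> B * (ln (real k) / real k powr (net.hh - 1/2))))
       \<and> (2 * net.hh - 2 * a < 1 \<longrightarrow> (AE \<omega> in M. \<exists>B. \<forall>k\<ge>2.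
              vnorm n (\<lambda>c. net.est \<omega> k i c - \<theta> c) \<le> B * (sqrt (ln (real k)) / real k powr (net.hh - 1/2))))"
    proof (rule net.error_rates[OF i net.weighted_bound_no_critical_edges[OF q _ a]])
      show "nu i j + gamma i j \<noteq> 1" if "(i, j) \<in> edges N aw" for i j using True that unfolding E'_def by blast
      show "0 \<le> a" unfolding a using pe(2) net.bl(1) by simp
    qed
  next
    case False
    have fin: "finite E'" unfolding E'_def by (rule finite_subset[OF _ net.finite_E]) auto
    have mp: "0 < mprime"
    proof -
      have "\<forall>y\<in>(\<lambda>(i, j). alpha1 i j * exp (- l1norm n \<theta> / b i j) / b i j) ` E'. 0 < y"
        using net.alpha_sym net.b_sym unfolding E'_def by fastforce
      then show ?thesis unfolding mprime_def using False fin by (subst Min_gr_iff) auto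
    qed
    have l0: "0 \<le> lambda2 (laplacian N aw)" by (rule net.gap_and_edges)
    have a: "a = \<delta> * lambda2 (laplacian N aw) * net.bl * mprime /
          (2 * real N * real n * Hbar\<^sup>2 * net.bl + real N * lambda2 (laplacian N aw) * mprime)"
      unfolding a_def bl \<L>_def using False by simp
    have E': "E' = {(i, j) \<in> edges N aw. nu i j + gamma i j = 1}" by (simp add: E'_def)
    show "(2 * net.hh - 2 * a > 1 \<longrightarrow> (AE \<omega> in M. \<exists>B. \<forall>k\<ge>2.
              vnorm n (\<lambda>c. net.est \<omega> k i c - \<theta> c) \<le> B * real k powr (- a)))
       \<and> (2 * net.hh - 2 * a = 1 \<longrightarrow> (AE \<omega> in M. \<exists>B. \<forall>k\<ge>2.
              vnorm n (\<lambda>c. net.est \<omega> k i c - \<theta> c) \<le> B * (ln (real k) / real k powr (net.hh - 1/2))))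
       \<and> (2 * net.hh - 2 * a < 1 \<longrightarrow> (AE \<omega> in M. \<exists>B. \<forall>k\<ge>2.
              vnorm n (\<lambda>c. net.est \<omega> k i c - \<theta> c) \<le> B * (sqrt (ln (real k)) / real k powr (net.hh - 1/2))))"
    proof (rule net.error_rates[OF i net.weighted_bound_critical_edges[OF q E' False mprime_def a]])
      show "0 \<le> a" unfolding a using pe(2) net.bl(1) mp l0
        by (intro divide_nonneg_nonneg mult_nonneg_nonneg add_nonneg_nonneg) auto
    qed
  qed
qed

end
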